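(* Let $(X,T^*_{X,-})$ be a model and suppose its first obstruction cohomology vanishes, ${\bf H}^1_\partial(X,\mathcal A_{T^*_{X,-}})=(0)$. Then a homogeneous element $\theta\in H^1(X,\mathcal A_{T^*_{X,-}})$ is the obstruction to splitting some supermanifold atlas modelled on $(X,T^*_{X,-})$ if and only if $\partial\theta=0$.
   Context: A model $(X,T^*_{X,-})$ is a complex manifold $X$ with a holomorphic vector bundle $T^*_{X,-}$ (identified with its locally free sheaf of sections). Let $J=\bigoplus_{j>0}\wedge^jT^*_{X,-}\subset\wedge^\bullet T^*_{X,-}$ and $J^k=\bigoplus_{j\ge k}\wedge^jT^*_{X,-}$. For $k\ge2$ let $\mathrm G_k=\mathrm G_{T^*_{X,-},k}$ be the sheaf of groups of automorphisms $\alpha$ of $\wedge^\bullet T^*_{X,-}$ (as a sheaf of $\mathbb C$-algebras, preserving the $\mathbb Z_2$-grading) with $\alpha(u)-u\in J^k$ for all $u$. Then $\mathrm G_2\supseteq\mathrm G_3\supseteq\cdots$ is a descending series of sheaves of normal subgroups of $\mathrm G_2$, trivial for $k>\operatorname{rank}T^*_{X,-}$, and the quotients $\mathrm G_j/\mathrm G_{j+1},\dots,\mathrm G_j/\mathrm G_{j+4}$ are abelian. The obstruction sheaf is the $\mathbb Z$-graded abelian sheaf $\mathcal A_{T^*_{X,-}}=\bigoplus_j\mathcal A_j$, with $\mathcal A_j=\mathrm G_j/\mathrm G_{j+1}$ for $j\ge2$ and $\mathcal A_j=0$ for $j<2$; the obstruction space is $H^1(X,\mathcal A_{T^*_{X,-}})=\bigoplus_jH^1(X,\mathcal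 A_j)$. Obstruction complex: $\partial:H^n(X,\mathcal A_j)\to H^{n+1}(X,\mathcal A_{j+1})$ is the connecting map of $0\to\mathcal A_{j+1}\to\mathrm G_j/\mathrm G_{j+2}\to\mathcal A_j\to0$ (zero for $j<2$); $\partial\circ\partial=0$. The first obstruction cohomology is ${\bf H}^1_\partial=\bigoplus_j\ker\{\partial:H^1(X,\mathcal A_j)\to H^2(X,\mathcal A_{j+1})\}/\operatorname{im}\{\partial:H^0(X,\mathcal A_{j-1})\to H^1(X,\mathcal A_j)\}$. A $j$-th order supermanifold atlas ($j\ge2$) modelled on $(X,T^*_{X,-})$ is a representative of an element of the non-abelian Čech cohomology set $\check H^1(X,\mathrm G_j)$; a supermanifold atlas is one of some order $j$. Its obstruction to splitting is its image under $\omega_{j*}:\check H^1(X,\mathrm G_j)\to H^1(X,\mathcal A_j)$ induced by $\mathrm G_j\to\mathcal A_j$. *)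

theory Defs
  imports
    "HOL-Analysis.Analysis"
    "HOL-Library.Poly_Mapping"
    "HOL-Algebra.Algebra"
begin

section \<open>The exterior algebra of a complex vector space\<close>

text \<open>
  Words with concatenation as (additively written) monoid operation, so that the type
  of finitely supported functions \<open>'v gen_word \<Rightarrow>\<^sub>0 complex\<close> with the convolution
  product of \<^theory>\<open>HOL-Library.Poly_Mapping\<close> is the free associative unital
  \<open>\<complex>\<close>-algebra on the set \<open>'v\<close>.
\<close>

datatype 'v gen_word = Word (letters: "'v list")

instantiation gen_word :: (type) monoid_add
begin

definition "0 = Word []"
definition "v + w = Word (letters v @ letters w)"

instance
  by standard (simp_all add: zero_gen_word_def plus_gen_word_def)

end

definition cfield :: "complex ring"
  where "cfield = \<lparr>carrier = UNIV, monoid.mult = (*), one = 1, ring.zero = 0, add = (+)\<rparr>"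

abbreviation gen :: "'v \<Rightarrow> 'v gen_word \<Rightarrow>\<^sub>0 complex"
  where "gen v \<equiv> Poly_Mapping.single (Word [v]) 1"

abbreviation scalar :: "complex \<Rightarrow> 'v gen_word \<Rightarrow>\<^sub>0 complex"
  where "scalar c \<equiv> Poly_Mapping.single 0 c"

definition free_alg :: "(complex, 'v) module \<Rightarrow> ('v gen_word \<Rightarrow>\<^sub>0 complex) ring"
  where "free_alg V =
    \<lparr>carrier = {t. \<forall>w\<in>Poly_Mapping.keys t. set (letters w) \<subseteq> carrier V},
     monoid.mult = (*), one = 1, ring.zero = 0, add = (+)\<rparr>"

text \<open>
  The relations make the generators additive and \<open>\<complex>\<close>-homogeneous (which turns the free
  algebra into the tensor algebra of \<open>V\<close>) and square-zero.
\<close>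

definition ext_rels :: "(complex, 'v) module \<Rightarrow> ('v gen_word \<Rightarrow>\<^sub>0 complex) set"
  where "ext_rels V =
      {gen (u \<oplus>\<^bsub>V\<^esub> v) - gen u - gen v | u v. u \<in> carrier V \<and> v \<in> carrier V}
    \<union> {gen (c \<odot>\<^bsub>V\<^esub> v) - scalar c * gen v | c v. v \<in> carrier V}
    \<union> {gen v * gen v | v. v \<in> carrier V}"

definition ext_ideal :: "(complex, 'v) module \<Rightarrow> ('v gen_word \<Rightarrow>\<^sub>0 complex) set"
  where "ext_ideal V = Idl\<^bsub>free_alg V\<^esub> (ext_rels V)"

definition ext_class ::
    "(complex, 'v) module \<Rightarrow> ('v gen_word \<Rightarrow>\<^sub>0 complex) \<Rightarrow> ('v gen_word \<Rightarrow>\<^sub>0 complex) set"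
  where "ext_class V t = ext_ideal V +>\<^bsub>free_alg V\<^esub> t"

definition ext_alg :: "(complex, 'v) module \<Rightarrow> ('v gen_word \<Rightarrow>\<^sub>0 complex) set ring"
  where "ext_alg V = free_alg V Quot ext_ideal V"

text \<open>\<open>ext_part V D\<close> is the sum of the \<open>\<And>\<^sup>j V\<close> over all degrees \<open>j \<in> D\<close>.\<close>

definition ext_part ::
    "(complex, 'v) module \<Rightarrow> nat set \<Rightarrow> ('v gen_word \<Rightarrow>\<^sub>0 complex) set set"
  where "ext_part V D =
    {ext_class V t | t. t \<in> carrier (free_alg V) \<and>
       (\<forall>w\<in>Poly_Mapping.keys t. length (letters w) \<in> D)}"


section \<open>Complex manifolds and holomorphic vector bundles\<close>

text \<open>
  \<open>\<complex>\<^sup>n\<close> is the space of extensional functions on \<open>{..<n}\<close>. A function on an open subset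
  is holomorphic if it is continuous and holomorphic in each variable separately.
\<close>

definition Cn :: "nat \<Rightarrow> (nat \<Rightarrow> complex) topology"
  where "Cn n = product_topology (\<lambda>_. euclidean) {..<n}"

definition holomorphic_Cn :: "nat \<Rightarrow> (nat \<Rightarrow> complex) set \<Rightarrow> ((nat \<Rightarrow> complex) \<Rightarrow> complex) \<Rightarrow> bool"
  where "holomorphic_Cn n D f \<longleftrightarrow>
    openin (Cn n) D \<and> continuous_map (subtopology (Cn n) D) euclidean f \<and>
    (\<forall>z\<in>D. \<forall>i<n. (\<lambda>w. f (z(i := w))) field_differentiable (at (z i)))"

text \<open>
  A bundle is given by its fibres together with a collection of local holomorphic frames
  \<open>(U, e)\<close>, where \<open>e i x\<close> for \<open>i < rank\<close> is the \<open>i\<close>-th frame vector at \<open>x \<in> U\<close>.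
\<close>

record ('x, 'v) model_data =
  space :: "'x topology"
  cdim :: nat
  charts :: "('x set \<times> ('x \<Rightarrow> nat \<Rightarrow> complex)) set"
  fibre :: "'x \<Rightarrow> (complex, 'v) module"
  rank :: nat
  frames :: "('x set \<times> (nat \<Rightarrow> 'x \<Rightarrow> 'v)) set"

definition complex_manifold :: "('x, 'v) model_data \<Rightarrow> bool"
  where "complex_manifold M \<longleftrightarrow>
    Hausdorff_space (space M) \<and> second_countable (space M) \<and>
    (\<Union>(U, \<phi>)\<in>charts M. U) = topspace (space M) \<and>
    (\<forall>(U, \<phi>)\<in>charts M. openin (space M) U \<and> openin (Cn (cdim M)) (\<phi> ` U) \<and>
       homeomorphic_map (subtopology (space M) U) (subtopology (Cn (cdim M)) (\<phi> ` U)) \<phi>) \<and>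
    (\<forall>(U, \<phi>)\<in>charts M. \<forall>(V, \<psi>)\<in>charts M. \<forall>i<cdim M.
       holomorphic_Cn (cdim M) (\<phi> ` (U \<inter> V)) (\<lambda>z. \<psi> (inv_into U \<phi> z) i))"

definition holomorphic_fun :: "('x, 'v) model_data \<Rightarrow> 'x set \<Rightarrow> ('x \<Rightarrow> complex) \<Rightarrow> bool"
  where "holomorphic_fun M W f \<longleftrightarrow>
    openin (space M) W \<and>
    (\<forall>(U, \<phi>)\<in>charts M. holomorphic_Cn (cdim M) (\<phi> ` (U \<inter> W)) (\<lambda>z. f (inv_into U \<phi> z)))"

definition holomorphic_bundle :: "('x, 'v) model_data \<Rightarrow> bool"
  where "holomorphic_bundle M \<longleftrightarrow>
    (\<forall>x\<in>topspace (space M). module cfield (fibre M x)) \<and>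
    (\<Union>(U, e)\<in>frames M. U) = topspace (space M) \<and>
    (\<forall>(U, e)\<in>frames M. openin (space M) U \<and>
       (\<forall>x\<in>U. (\<forall>i<rank M. e i x \<in> carrier (fibre M x)) \<and>
          (\<forall>v\<in>carrier (fibre M x). \<exists>!c. c \<in> {..<rank M} \<rightarrow>\<^sub>E UNIV \<and>
             v = (\<Oplus>\<^bsub>fibre M x\<^esub>i\<in>{..<rank M}. c i \<odot>\<^bsub>fibre M x\<^esub> e i x)))) \<and>
    (\<forall>(U, e)\<in>frames M. \<forall>(V, e')\<in>frames M. \<exists>g.
       (\<forall>k<rank M. \<forall>i<rank M. holomorphic_fun M (U \<inter> V) (g k i)) \<and>
       (\<forall>x\<in>U \<inter> V. \<forall>i<rank M.
          e' i x = (\<Oplus>\<^bsub>fibre M x\<^esub>k\<in>{..<rank M}. g k i x \<odot>\<^bsub>fibre M x\<^esub> e k x)))"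

definition model :: "('x, 'v) model_data \<Rightarrow> bool"
  where "model M \<longleftrightarrow> complex_manifold M \<and> holomorphic_bundle M"


section \<open>The sheaf of exterior algebras and its automorphisms\<close>

text \<open>
  A local section of the exterior algebra bundle is, in each frame \<open>e\<close>, a combination of
  the products \<open>e i\<^sub>1 \<and> \<dots> \<and> e i\<^sub>k\<close>, \<open>I = {i\<^sub>1 < \<dots> < i\<^sub>k}\<close>, with holomorphic coefficients \<open>f I\<close>.
\<close>

type_synonym ('x, 'v) ext_section = "'x \<Rightarrow> ('v gen_word \<Rightarrow>\<^sub>0 complex) set"

definition ext_sheaf :: "('x, 'v) model_data \<Rightarrow> 'x set \<Rightarrow> ('x, 'v) ext_section ring"
  where "ext_sheaf M U =
    \<lparr>carrier = {s \<in> extensional U. \<forall>(V, e)\<in>frames M. \<exists>f.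
        (\<forall>I\<in>Pow {..<rank M}. holomorphic_fun M (U \<inter> V) (f I)) \<and>
        (\<forall>x\<in>U \<inter> V. s x = ext_class (fibre M x)
           (\<Sum>I\<in>Pow {..<rank M}.
              Poly_Mapping.single (Word (map (\<lambda>i. e i x) (sorted_list_of_set I))) (f I x)))},
     monoid.mult = (\<lambda>s t. \<lambda>x\<in>U. s x \<otimes>\<^bsub>ext_alg (fibre M x)\<^esub> t x),
     one = (\<lambda>x\<in>U. \<one>\<^bsub>ext_alg (fibre M x)\<^esub>),
     ring.zero = (\<lambda>x\<in>U. \<zero>\<^bsub>ext_alg (fibre M x)\<^esub>),
     add = (\<lambda>s t. \<lambda>x\<in>U. s x \<oplus>\<^bsub>ext_alg (fibre M x)\<^esub> t x)\<rparr>"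

definition const_section :: "('x, 'v) model_data \<Rightarrow> 'x set \<Rightarrow> complex \<Rightarrow> ('x, 'v) ext_section"
  where "const_section M U c = (\<lambda>x\<in>U. ext_class (fibre M x) (scalar c))"

definition ext_sheaf_part :: "('x, 'v) model_data \<Rightarrow> nat set \<Rightarrow> 'x set \<Rightarrow> ('x, 'v) ext_section set"
  where "ext_sheaf_part M D U =
    {s \<in> carrier (ext_sheaf M U). \<forall>x\<in>U. s x \<in> ext_part (fibre M x) D}"

definition J_sheaf :: "('x, 'v) model_data \<Rightarrow> nat \<Rightarrow> 'x set \<Rightarrow> ('x, 'v) ext_section set"
  where "J_sheaf M k = ext_sheaf_part M {k..}"

text \<open>
  For a sheaf of groups \<open>F\<close>, \<open>sec F U\<close> is the group of sections over \<open>U\<close>, and \<open>rest F V\<close>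
  restricts sections over any open set containing \<open>V\<close> to \<open>V\<close>.
\<close>

record ('x, 's) group_sheaf =
  sec :: "'x set \<Rightarrow> 's monoid"
  rest :: "'x set \<Rightarrow> 's \<Rightarrow> 's"

definition opens_in :: "'x topology \<Rightarrow> 'x set \<Rightarrow> 'x set set"
  where "opens_in T U = {W. openin T W \<and> W \<subseteq> U}"

text \<open>
  A section over \<open>U\<close> is an automorphism of the restriction of the sheaf to \<open>U\<close>, that is a
  family of automorphisms, one for each open \<open>W \<subseteq> U\<close>, compatible with restriction.
  \<open>\<complex>\<close>-linearity of a ring homomorphism is expressed as compatibility with the
  structure maps from \<open>\<complex>\<close>.
\<close>

type_synonym ('x, 'v) ext_aut = "'x set \<Rightarrow> ('x, 'v) ext_section \<Rightarrow> ('x, 'v) ext_section"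

definition aut_sheaf :: "('x, 'v) model_data \<Rightarrow> ('x, ('x, 'v) ext_aut) group_sheaf"
  where "aut_sheaf M =
    \<lparr>sec = (\<lambda>U.
       \<lparr>carrier = {\<alpha> \<in> extensional (opens_in (space M) U).
          (\<forall>W\<in>opens_in (space M) U.
             \<alpha> W \<in> extensional (carrier (ext_sheaf M W)) \<and>
             \<alpha> W \<in> ring_iso (ext_sheaf M W) (ext_sheaf M W) \<and>
             (\<forall>c. \<alpha> W (const_section M W c) = const_section M W c) \<and>
             \<alpha> W ` ext_sheaf_part M {j. even j} W \<subseteq> ext_sheaf_part M {j. even j} W \<and>
             \<alpha> W ` ext_sheaf_part M {j. odd j} W \<subseteq> ext_sheaf_part M {j. odd j} W) \<and>
          (\<forall>W\<in>opens_in (space M) U. \<forall>W'\<in>opens_in (space M) W.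
             \<forall>s\<in>carrier (ext_sheaf M W). \<alpha> W' (restrict s W') = restrict (\<alpha> W s) W')},
        monoid.mult = (\<lambda>\<alpha> \<beta>. \<lambda>W\<in>opens_in (space M) U. compose (carrier (ext_sheaf M W)) (\<alpha> W) (\<beta> W)),
        one = (\<lambda>W\<in>opens_in (space M) U. \<lambda>s\<in>carrier (ext_sheaf M W). s)\<rparr>),
     rest = (\<lambda>V \<alpha>. restrict \<alpha> (opens_in (space M) V))\<rparr>"

definition G_sheaf :: "('x, 'v) model_data \<Rightarrow> nat \<Rightarrow> ('x, ('x, 'v) ext_aut) group_sheaf"
  where "G_sheaf M k =
    \<lparr>sec = (\<lambda>U. (sec (aut_sheaf M) U)
       \<lparr>carrier := {\<alpha> \<in> carrier (sec (aut_sheaf M) U).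
          \<forall>W\<in>opens_in (space M) U. \<forall>u\<in>carrier (ext_sheaf M W).
            \<alpha> W u \<ominus>\<^bsub>ext_sheaf M W\<^esub> u \<in> J_sheaf M k W}\<rparr>),
     rest = rest (aut_sheaf M)\<rparr>"


section \<open>Quotients of sheaves of groups\<close>

definition germ :: "'x topology \<Rightarrow> ('x, 's) group_sheaf \<Rightarrow> 'x \<Rightarrow> 'x set \<Rightarrow> 's \<Rightarrow> ('x set \<times> 's) set"
  where "germ T F x U a =
    {(V, b). openin T V \<and> x \<in> V \<and> b \<in> carrier (sec F V) \<and>
       (\<exists>W. openin T W \<and> x \<in> W \<and> W \<subseteq> U \<inter> V \<and> rest F W a = rest F W b)}"

definition stalk :: "'x topology \<Rightarrow> ('x, 's) group_sheaf \<Rightarrow> 'x \<Rightarrow> ('x set \<times> 's) set monoid"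
  where "stalk T F x =
    \<lparr>carrier = {germ T F x U a | U a. openin T U \<and> x \<in> U \<and> a \<in> carrier (sec F U)},
     monoid.mult = (\<lambda>p q. \<Union>(U, a)\<in>p. \<Union>(V, b)\<in>q.
        germ T F x (U \<inter> V) (rest F (U \<inter> V) a \<otimes>\<^bsub>sec F (U \<inter> V)\<^esub> rest F (U \<inter> V) b)),
     one = germ T F x (topspace T) \<one>\<^bsub>sec F (topspace T)\<^esub>\<rparr>"

text \<open>
  For subsheaves \<open>N \<subseteq> G \<subseteq> F\<close> with \<open>N\<close> normal, all stalks are formed inside the stalks of \<open>F\<close>.
  A section of \<open>G/N\<close> is a function assigning to each point \<open>x\<close> an element of \<open>G\<^sub>x/N\<^sub>x\<close>
  and locally coming from sections of \<open>G\<close>; this is the sheafification of the presheaf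
  of quotient groups. With \<open>F\<close> fixed, \<open>G'/N\<close> is literally a subsheaf of \<open>G/N\<close> for
  \<open>N \<subseteq> G' \<subseteq> G\<close>.
\<close>

definition substalk ::
    "'x topology \<Rightarrow> ('x, 's) group_sheaf \<Rightarrow> ('x, 's) group_sheaf \<Rightarrow> 'x \<Rightarrow> ('x set \<times> 's) set set"
  where "substalk T F N x = {germ T F x U a | U a. openin T U \<and> x \<in> U \<and> a \<in> carrier (sec N U)}"

definition quot_map ::
    "'x topology \<Rightarrow> ('x, 's) group_sheaf \<Rightarrow> ('x, 's) group_sheaf \<Rightarrow> 'x set \<Rightarrow> 's
       \<Rightarrow> 'x \<Rightarrow> ('x set \<times> 's) set set"
  where "quot_map T F N U a = (\<lambda>x\<in>U. substalk T F N x #>\<^bsub>stalk T F x\<^esub> germ T F x U a)"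

definition quot_sheaf ::
    "'x topology \<Rightarrow> ('x, 's) group_sheaf \<Rightarrow> ('x, 's) group_sheaf \<Rightarrow> ('x, 's) group_sheaf
       \<Rightarrow> ('x, 'x \<Rightarrow> ('x set \<times> 's) set set) group_sheaf"
  where "quot_sheaf T F G N =
    \<lparr>sec = (\<lambda>U.
       \<lparr>carrier = {s \<in> extensional U. \<forall>x\<in>U. \<exists>V a. openin T V \<and> x \<in> V \<and> V \<subseteq> U \<and>
           a \<in> carrier (sec G V) \<and> (\<forall>y\<in>V. s y = quot_map T F N V a y)},
        monoid.mult = (\<lambda>s t. \<lambda>x\<in>U. s x <#>\<^bsub>stalk T F x\<^esub> t x),
        one = (\<lambda>x\<in>U. substalk T F N x)\<rparr>),
     rest = (\<lambda>V s. restrict s V)\<rparr>"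


section \<open>Cech cohomology in low degrees\<close>

text \<open>
  Covers are sets of open sets, indexed by themselves; cohomology classes are the
  equivalence classes of cocycles on arbitrary covers, two cocycles being identified if they become
  cohomologous on a common refinement (the colimit over all covers). Degree 1
  makes sense for sheaves of non-abelian groups; the group structures and degree 2 are meant for
  sheaves of abelian groups.
\<close>

definition open_cover :: "'x topology \<Rightarrow> 'x set set \<Rightarrow> bool"
  where "open_cover T C \<longleftrightarrow> (\<forall>U\<in>C. openin T U) \<and> \<Union>C = topspace T"

definition refines :: "('x set \<Rightarrow> 'x set) \<Rightarrow> 'x set set \<Rightarrow> 'x set set \<Rightarrow> bool"
  where "refines \<tau> B C \<longleftrightarrow> (\<forall>U\<in>B. \<tau> U \<in> C \<and> U \<subseteq> \<tau> U)"

type_synonym ('x, 's) cochain1 = "'x set set \<times> ('x set \<Rightarrow> 'x set \<Rightarrow> 's)"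
type_synonym ('x, 's) cochain2 = "'x set set \<times> ('x set \<Rightarrow> 'x set \<Rightarrow> 'x set \<Rightarrow> 's)"

definition Z1 :: "'x topology \<Rightarrow> ('x, 's) group_sheaf \<Rightarrow> ('x, 's) cochain1 set"
  where "Z1 T F = {(C, g). open_cover T C \<and>
    (\<forall>U\<in>C. \<forall>V\<in>C. g U V \<in> carrier (sec F (U \<inter> V))) \<and>
    (\<forall>U\<in>C. \<forall>V\<in>C. \<forall>W\<in>C. let Q = U \<inter> V \<inter> W in
       rest F Q (g U V) \<otimes>\<^bsub>sec F Q\<^esub> rest F Q (g V W) = rest F Q (g U W))}"

definition cohomologous1 ::
    "'x topology \<Rightarrow> ('x, 's) group_sheaf \<Rightarrow> ('x, 's) cochain1 \<Rightarrow> ('x, 's) cochain1 \<Rightarrow> bool"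
  where "cohomologous1 T F = (\<lambda>(C, g) (D, h). \<exists>B \<sigma> \<tau> k.
    open_cover T B \<and> refines \<sigma> B C \<and> refines \<tau> B D \<and> (\<forall>U\<in>B. k U \<in> carrier (sec F U)) \<and>
    (\<forall>U\<in>B. \<forall>V\<in>B. let Q = U \<inter> V in
       rest F Q (h (\<tau> U) (\<tau> V)) =
         inv\<^bsub>sec F Q\<^esub> (rest F Q (k U)) \<otimes>\<^bsub>sec F Q\<^esub> rest F Q (g (\<sigma> U) (\<sigma> V)) \<otimes>\<^bsub>sec F Q\<^esub> rest F Q (k V)))"

definition class1 ::
    "'x topology \<Rightarrow> ('x, 's) group_sheaf \<Rightarrow> ('x, 's) cochain1 \<Rightarrow> ('x, 's) cochain1 set"
  where "class1 T F z = {z' \<in> Z1 T F. cohomologous1 T F z z'}"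

definition H0 :: "'x topology \<Rightarrow> ('x, 's) group_sheaf \<Rightarrow> 's monoid"
  where "H0 T F = sec F (topspace T)"

definition H1_set :: "'x topology \<Rightarrow> ('x, 's) group_sheaf \<Rightarrow> ('x, 's) cochain1 set set"
  where "H1_set T F = class1 T F ` Z1 T F"

definition H1 :: "'x topology \<Rightarrow> ('x, 's) group_sheaf \<Rightarrow> ('x, 's) cochain1 set monoid"
  where "H1 T F =
    \<lparr>carrier = H1_set T F,
     monoid.mult = (\<lambda>p q. \<Union>{class1 T F (C, \<lambda>U V. g U V \<otimes>\<^bsub>sec F (U \<inter> V)\<^esub> h U V) | C g h.
                        (C, g) \<in> p \<and> (C, h) \<in> q}),
     one = class1 T F ({topspace T}, \<lambda>U V. \<one>\<^bsub>sec F (U \<inter> V)\<^esub>)\<rparr>"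

definition Z2 :: "'x topology \<Rightarrow> ('x, 's) group_sheaf \<Rightarrow> ('x, 's) cochain2 set"
  where "Z2 T F = {(C, c). open_cover T C \<and>
    (\<forall>U\<in>C. \<forall>V\<in>C. \<forall>W\<in>C. c U V W \<in> carrier (sec F (U \<inter> V \<inter> W))) \<and>
    (\<forall>U\<in>C. \<forall>V\<in>C. \<forall>W\<in>C. \<forall>Z\<in>C. let Q = U \<inter> V \<inter> W \<inter> Z in
       rest F Q (c V W Z) \<otimes>\<^bsub>sec F Q\<^esub> rest F Q (c U V Z) =
       rest F Q (c U W Z) \<otimes>\<^bsub>sec F Q\<^esub> rest F Q (c U V W))}"

definition coboundary1 ::
    "('x, 's) group_sheaf \<Rightarrow> ('x set \<Rightarrow> 'x set \<Rightarrow> 's) \<Rightarrow> 'x set \<Rightarrow> 'x set \<Rightarrow> 'x set \<Rightarrow> 's"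
  where "coboundary1 F b U V W = (let Q = U \<inter> V \<inter> W in
    rest F Q (b V W) \<otimes>\<^bsub>sec F Q\<^esub> inv\<^bsub>sec F Q\<^esub> (rest F Q (b U W)) \<otimes>\<^bsub>sec F Q\<^esub> rest F Q (b U V))"

definition cohomologous2 ::
    "'x topology \<Rightarrow> ('x, 's) group_sheaf \<Rightarrow> ('x, 's) cochain2 \<Rightarrow> ('x, 's) cochain2 \<Rightarrow> bool"
  where "cohomologous2 T F = (\<lambda>(C, c) (D, d). \<exists>B \<sigma> \<tau> k.
    open_cover T B \<and> refines \<sigma> B C \<and> refines \<tau> B D \<and>
    (\<forall>U\<in>B. \<forall>V\<in>B. k U V \<in> carrier (sec F (U \<inter> V))) \<and>
    (\<forall>U\<in>B. \<forall>V\<in>B. \<forall>W\<in>B. let Q = U \<inter> V \<inter> W in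
       rest F Q (d (\<tau> U) (\<tau> V) (\<tau> W)) =
         rest F Q (c (\<sigma> U) (\<sigma> V) (\<sigma> W)) \<otimes>\<^bsub>sec F Q\<^esub> coboundary1 F k U V W))"

definition class2 ::
    "'x topology \<Rightarrow> ('x, 's) group_sheaf \<Rightarrow> ('x, 's) cochain2 \<Rightarrow> ('x, 's) cochain2 set"
  where "class2 T F z = {z' \<in> Z2 T F. cohomologous2 T F z z'}"

definition H2 :: "'x topology \<Rightarrow> ('x, 's) group_sheaf \<Rightarrow> ('x, 's) cochain2 set monoid"
  where "H2 T F =
    \<lparr>carrier = class2 T F ` Z2 T F,
     monoid.mult = (\<lambda>p q. \<Union>{class2 T F (C, \<lambda>U V W. c U V W \<otimes>\<^bsub>sec F (U \<inter> V \<inter> W)\<^esub> d U V W) | C c d.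
                        (C, c) \<in> p \<and> (C, d) \<in> q}),
     one = class2 T F ({topspace T}, \<lambda>U V W. \<one>\<^bsub>sec F (U \<inter> V \<inter> W)\<^esub>)\<rparr>"

text \<open>The map on degree 1 cohomology induced by a morphism \<open>\<omega> U\<close> from \<open>F\<close> to \<open>F'\<close>.\<close>

definition H1_map ::
    "'x topology \<Rightarrow> ('x, 't) group_sheaf \<Rightarrow> ('x set \<Rightarrow> 's \<Rightarrow> 't)
       \<Rightarrow> ('x, 's) cochain1 set \<Rightarrow> ('x, 't) cochain1 set"
  where "H1_map T F' \<omega> p = (\<Union>(C, g)\<in>p. class1 T F' (C, \<lambda>U V. \<omega> (U \<inter> V) (g U V)))"

text \<open>
  The connecting maps of a short exact sequence \<open>A \<rightarrow> B \<rightarrow> Q\<close>, where \<open>A\<close> is literally a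
  subsheaf of \<open>B\<close>, and \<open>p U\<close> is the projection over \<open>U\<close>: lift the given
  section or cocycle locally along \<open>p\<close> and take the coboundary of the lift.
\<close>

definition connecting0 ::
    "'x topology \<Rightarrow> ('x, 's) group_sheaf \<Rightarrow> ('x, 's) group_sheaf \<Rightarrow> ('x, 't) group_sheaf
       \<Rightarrow> ('x set \<Rightarrow> 's \<Rightarrow> 't) \<Rightarrow> 't \<Rightarrow> ('x, 's) cochain1 set"
  where "connecting0 T A B Q p s = (THE h. \<exists>C b.
    open_cover T C \<and>
    (\<forall>U\<in>C. b U \<in> carrier (sec B U) \<and> p U (b U) = rest Q U s) \<and>
    h = class1 T A (C, \<lambda>U V. inv\<^bsub>sec B (U \<inter> V)\<^esub> (rest B (U \<inter> V) (b U))
                              \<otimes>\<^bsub>sec B (U \<inter> V)\<^esub> rest B (U \<inter> V) (b V)))"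

definition connecting1 ::
    "'x topology \<Rightarrow> ('x, 's) group_sheaf \<Rightarrow> ('x, 's) group_sheaf
       \<Rightarrow> ('x set \<Rightarrow> 's \<Rightarrow> 't) \<Rightarrow> ('x, 't) cochain1 set \<Rightarrow> ('x, 's) cochain2 set"
  where "connecting1 T A B p \<theta> = (THE h. \<exists>C g b.
    (C, g) \<in> \<theta> \<and>
    (\<forall>U\<in>C. \<forall>V\<in>C. b U V \<in> carrier (sec B (U \<inter> V)) \<and> p (U \<inter> V) (b U V) = g U V) \<and>
    h = class2 T A (C, coboundary1 B b))"


section \<open>The obstruction sheaf and the obstruction complex\<close>

type_synonym ('x, 'v) quot_section = "'x \<Rightarrow> ('x set \<times> ('x, 'v) ext_aut) set set"

definition G_quot :: "('x, 'v) model_data \<Rightarrow> nat \<Rightarrow> nat \<Rightarrow> ('x, ('x, 'v) quot_section) group_sheaf"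
  where "G_quot M j k = quot_sheaf (space M) (G_sheaf M 2) (G_sheaf M j) (G_sheaf M k)"

text \<open>For \<open>j < 2\<close> this is the zero sheaf, realised as the quotient of \<open>G_sheaf M 2\<close> by itself.\<close>

definition obs_sheaf :: "('x, 'v) model_data \<Rightarrow> int \<Rightarrow> ('x, ('x, 'v) quot_section) group_sheaf"
  where "obs_sheaf M j = (if 2 \<le> j then G_quot M (nat j) (nat j + 1) else G_quot M 2 2)"

definition G_proj ::
    "('x, 'v) model_data \<Rightarrow> nat \<Rightarrow> 'x set \<Rightarrow> ('x, 'v) quot_section \<Rightarrow> ('x, 'v) quot_section"
  where "G_proj M k U s =
    (\<lambda>x\<in>U. substalk (space M) (G_sheaf M 2) (G_sheaf M k) x
             <#>\<^bsub>stalk (space M) (G_sheaf M 2) x\<^esub> s x)"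

abbreviation obs_H0 where "obs_H0 M j \<equiv> H0 (space M) (obs_sheaf M j)"
abbreviation obs_H1 where "obs_H1 M j \<equiv> H1 (space M) (obs_sheaf M j)"
abbreviation obs_H2 where "obs_H2 M j \<equiv> H2 (space M) (obs_sheaf M j)"

definition bd0 ::
    "('x, 'v) model_data \<Rightarrow> int \<Rightarrow> ('x, 'v) quot_section \<Rightarrow> ('x, ('x, 'v) quot_section) cochain1 set"
  where "bd0 M j s =
    (if 2 \<le> j
     then connecting0 (space M) (obs_sheaf M (j + 1)) (G_quot M (nat j) (nat j + 2)) (obs_sheaf M j)
            (G_proj M (nat j + 1)) s
     else \<one>\<^bsub>obs_H1 M (j + 1)\<^esub>)"

definition bd1 ::
    "('x, 'v) model_data \<Rightarrow> int \<Rightarrow> ('x, ('x, 'v) quot_section) cochain1 set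
       \<Rightarrow> ('x, ('x, 'v) quot_section) cochain2 set"
  where "bd1 M j \<theta> =
    (if 2 \<le> j
     then connecting1 (space M) (obs_sheaf M (j + 1)) (G_quot M (nat j) (nat j + 2))
            (G_proj M (nat j + 1)) \<theta>
     else \<one>\<^bsub>obs_H2 M (j + 1)\<^esub>)"

definition obs_cohomology1 ::
    "('x, 'v) model_data \<Rightarrow> (int \<Rightarrow> ('x, ('x, 'v) quot_section) cochain1 set set) monoid"
  where "obs_cohomology1 M = sum_group UNIV (\<lambda>j.
    (obs_H1 M j)\<lparr>carrier := kernel (obs_H1 M j) (obs_H2 M (j + 1)) (bd1 M j)\<rparr>
      Mod (bd0 M (j - 1) ` carrier (obs_H0 M (j - 1))))"

definition obs_space ::
    "('x, 'v) model_data \<Rightarrow> (int \<Rightarrow> ('x, ('x, 'v) quot_section) cochain1 set) monoid"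
  where "obs_space M = sum_group UNIV (obs_H1 M)"

definition obs_space2 ::
    "('x, 'v) model_data \<Rightarrow> (int \<Rightarrow> ('x, ('x, 'v) quot_section) cochain2 set) monoid"
  where "obs_space2 M = sum_group UNIV (obs_H2 M)"

definition boundary ::
    "('x, 'v) model_data \<Rightarrow> (int \<Rightarrow> ('x, ('x, 'v) quot_section) cochain1 set)
       \<Rightarrow> int \<Rightarrow> ('x, ('x, 'v) quot_section) cochain2 set"
  where "boundary M \<theta> = (\<lambda>j. bd1 M (j - 1) (\<theta> (j - 1)))"

definition homogeneous ::
    "('x, 'v) model_data \<Rightarrow> (int \<Rightarrow> ('x, ('x, 'v) quot_section) cochain1 set) \<Rightarrow> bool"
  where "homogeneous M \<theta> \<longleftrightarrow> (\<exists>j. \<forall>i. i \<noteq> j \<longrightarrow> \<theta> i = \<one>\<^bsub>obs_H1 M i\<^esub>)"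


section \<open>Supermanifold atlases\<close>

definition supermanifold_atlas ::
    "('x, 'v) model_data \<Rightarrow> nat \<Rightarrow> ('x, ('x, 'v) ext_aut) cochain1 \<Rightarrow> bool"
  where "supermanifold_atlas M j z \<longleftrightarrow> 2 \<le> j \<and> z \<in> Z1 (space M) (G_sheaf M j)"

text \<open>
  The obstruction of a \<open>j\<close>-th order atlas is the image of its class in the degree \<open>j\<close> summand,
  regarded as an element of the whole obstruction space.
\<close>

definition obstruction ::
    "('x, 'v) model_data \<Rightarrow> nat \<Rightarrow> ('x, ('x, 'v) ext_aut) cochain1
       \<Rightarrow> int \<Rightarrow> ('x, ('x, 'v) quot_section) cochain1 set"
  where "obstruction M j z = (\<lambda>i. if i = int j
    then H1_map (space M) (obs_sheaf M i)
           (quot_map (space M) (G_sheaf M 2) (G_sheaf M (j + 1)))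
           (class1 (space M) (G_sheaf M j) z)
    else \<one>\<^bsub>obs_H1 M i\<^esub>)"

end

theory Submission imports Defs begin

text \<open>
  One implication is a general fact on central extensions. The obstruction of an atlas is the class of a
  cocycle with values in \<open>G\<^sub>j/G\<^bsub>j+1\<^esub>\<close> that lifts to a cocycle with values in \<open>G\<^sub>j\<close>, hence to one in
  \<open>G\<^sub>j/G\<^bsub>j+2\<^esub>\<close>; the connecting map measures the failure of such a lift, so it kills the obstruction
  (\<open>connecting1_trivial\<close>).

  For the converse, vanishing of the cohomology gives \<open>\<theta> = \<partial>s\<close> with a global section \<open>s\<close> of
  \<open>G\<^bsub>j-1\<^esub>/G\<^sub>j\<close> (\<open>exact\<close>). Over a fine cover \<open>s\<close> is represented by sections \<open>a\<^sub>U\<close> of \<open>G\<^bsub>j-1\<^esub>\<close>, not only of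
  \<open>G\<^bsub>j-1\<^esub>/G\<^bsub>j+1\<^esub>\<close>. The differences \<open>a\<^sub>U\<inverse> a\<^sub>V\<close> satisfy the cocycle condition and lie in \<open>G\<^sub>j\<close>, so they are an atlas of
  order \<open>j\<close>, and by construction its obstruction is \<open>\<partial>s = \<theta>\<close> (\<open>connecting0_cocycle\<close>). For \<open>j \<le> 2\<close> the
  map into degree \<open>j\<close> is zero, and \<open>\<theta>\<close> is the obstruction of the trivial atlas.

  Both arguments need that the connecting maps have a value that does not depend on the covers,
  representatives and lifts that are chosen. Here it matters that \<open>G\<^bsub>j+1\<^esub>/G\<^bsub>j+2\<^esub>\<close> is central in \<open>G\<^sub>j/G\<^bsub>j+2\<^esub>\<close>:
  two lifts of a cocycle differ by a central cochain, which changes the coboundary of the lift by the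
  coboundary of that cochain only (\<open>lift_coboundary\<close>).

  The geometry enters through \<open>obstruction_tower_G\<close>: the \<open>G\<^sub>k\<close> are subsheaves of normal subgroups with
  \<open>[G\<^sub>j, G\<^sub>k] \<subseteq> G\<^bsub>j+k-1\<^esub>\<close>. This rests on the estimate that an automorphism in \<open>G\<^sub>j\<close> moves elements of \<open>J\<^sup>k\<close> by
  elements of \<open>J\<^bsup>j+k-1\<^esup>\<close> (\<open>G_J\<close>), which is checked on products of frame vectors; it requires the grading of
  the exterior algebra, and the fact that the sections with holomorphic coefficients form a ring that is preserved
  by the projections to sets of degrees.
\<close>

section \<open>Cech cohomology of presheaves of groups\<close>

lemma (in group) l_inv_cancel:
  "x \<in> carrier G \<Longrightarrow> y \<in> carrier G \<Longrightarrow> inv x \<otimes> (x \<otimes> y) = y"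
  by (simp add: m_assoc[symmetric])

lemma (in group) r_inv_cancel:
  "x \<in> carrier G \<Longrightarrow> y \<in> carrier G \<Longrightarrow> x \<otimes> (inv x \<otimes> y) = y"
  by (simp add: m_assoc[symmetric])

locale presheaf =
  fixes T :: "'x topology" and F :: "('x, 's) group_sheaf"
  assumes group_sec: "openin T U \<Longrightarrow> group (sec F U)"
    and rest_hom: "openin T U \<Longrightarrow> openin T V \<Longrightarrow> V \<subseteq> U \<Longrightarrow> rest F V \<in> hom (sec F U) (sec F V)"
    and rest_rest: "a \<in> carrier (sec F U) \<Longrightarrow> openin T U \<Longrightarrow> openin T V \<Longrightarrow> openin T W \<Longrightarrow>
      W \<subseteq> V \<Longrightarrow> V \<subseteq> U \<Longrightarrow> rest F W (rest F V a) = rest F W a"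
    and rest_id: "openin T U \<Longrightarrow> a \<in> carrier (sec F U) \<Longrightarrow> rest F U a = a"
begin

lemma rest_closed:
  "a \<in> carrier (sec F U) \<Longrightarrow> openin T U \<Longrightarrow> openin T V \<Longrightarrow> V \<subseteq> U \<Longrightarrow> rest F V a \<in> carrier (sec F V)"
  using rest_hom unfolding hom_def by blast

lemma rest_mult:
  "a \<in> carrier (sec F U) \<Longrightarrow> b \<in> carrier (sec F U) \<Longrightarrow> openin T U \<Longrightarrow> openin T V \<Longrightarrow> V \<subseteq> U \<Longrightarrow>
    rest F V (a \<otimes>\<^bsub>sec F U\<^esub> b) = rest F V a \<otimes>\<^bsub>sec F V\<^esub> rest F V b"
  using rest_hom unfolding hom_def by blast

lemma rest_group_hom:
  "openin T U \<Longrightarrow> openin T V \<Longrightarrow> V \<subseteq> U \<Longrightarrow> group_hom (sec F U) (sec F V) (rest F V)"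
  using group_sec rest_hom by (simp add: group_hom_def group_hom_axioms_def)

lemma rest_one:
  "openin T U \<Longrightarrow> openin T V \<Longrightarrow> V \<subseteq> U \<Longrightarrow> rest F V \<one>\<^bsub>sec F U\<^esub> = \<one>\<^bsub>sec F V\<^esub>"
  using group_hom.hom_one[OF rest_group_hom] .

lemma rest_inv:
  "a \<in> carrier (sec F U) \<Longrightarrow> openin T U \<Longrightarrow> openin T V \<Longrightarrow> V \<subseteq> U \<Longrightarrow>
    rest F V (inv\<^bsub>sec F U\<^esub> a) = inv\<^bsub>sec F V\<^esub> (rest F V a)"
  using group_hom.hom_inv[OF rest_group_hom] .

end

subsection \<open>Covers and refinements\<close>

lemma open_coverD: "open_cover T C \<Longrightarrow> U \<in> C \<Longrightarrow> openin T U"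
  by (simp add: open_cover_def)

lemma open_cover_space: "open_cover T {topspace T}"
  by (simp add: open_cover_def)

lemma refinesD: "refines \<sigma> B C \<Longrightarrow> U \<in> B \<Longrightarrow> \<sigma> U \<in> C" "refines \<sigma> B C \<Longrightarrow> U \<in> B \<Longrightarrow> U \<subseteq> \<sigma> U"
  by (auto simp: refines_def)

lemma refines_comp:
  "refines \<sigma> B C \<Longrightarrow> refines \<rho> A B \<Longrightarrow> refines (\<lambda>U. \<sigma> (\<rho> U)) A C"
  unfolding refines_def by blast

lemma refines_space: "open_cover T C \<Longrightarrow> refines (\<lambda>_. topspace T) C {topspace T}"
  by (auto simp: refines_def open_cover_def)

lemma refines_id: "refines (\<lambda>U. U) C C"
  by (simp add: refines_def)

lemma refinement_by_property:
  assumes B: "open_cover T B"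
    and loc: "\<And>U x. U \<in> B \<Longrightarrow> x \<in> U \<Longrightarrow> \<exists>V. openin T V \<and> x \<in> V \<and> V \<subseteq> U \<and> P U V"
  obtains D \<upsilon> where "open_cover T D" "refines \<upsilon> D B" "\<And>V. V \<in> D \<Longrightarrow> P (\<upsilon> V) V"
proof -
  define D where "D = {V. openin T V \<and> (\<exists>U\<in>B. V \<subseteq> U \<and> P U V)}"
  define \<upsilon> where "\<upsilon> V = (SOME U. U \<in> B \<and> V \<subseteq> U \<and> P U V)" for V
  have \<upsilon>: "\<upsilon> V \<in> B \<and> V \<subseteq> \<upsilon> V \<and> P (\<upsilon> V) V" if "V \<in> D" for V
  proof -
    have "\<exists>U. U \<in> B \<and> V \<subseteq> U \<and> P U V" using that unfolding D_def by blast
    from someI_ex[OF this] show ?thesis unfolding \<upsilon>_def .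
  qed
  have "x \<in> \<Union>D" if "x \<in> topspace T" for x
  proof -
    have "x \<in> \<Union>B" using B that by (simp add: open_cover_def)
    then obtain U where "U \<in> B" "x \<in> U" by blast
    with loc obtain V where "openin T V" "x \<in> V" "V \<subseteq> U" "P U V" by blast
    with \<open>U \<in> B\<close> show ?thesis unfolding D_def by blast
  qed
  hence "open_cover T D"
    unfolding open_cover_def D_def using openin_subset by blast
  with \<upsilon> that[of D \<upsilon>] show ?thesis by (auto simp: refines_def)
qed

lemma common_refinement:
  assumes "open_cover T B" "open_cover T C"
  obtains D \<sigma> \<tau> where "open_cover T D" "refines \<sigma> D B" "refines \<tau> D C"
proof -
  have "\<exists>V. openin T V \<and> x \<in> V \<and> V \<subseteq> U \<and> (\<exists>W\<in>C. V \<subseteq> W)" if "U \<in> B" "x \<in> U" for U x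
  proof -
    have "x \<in> topspace T" using that assms(1) unfolding open_cover_def by blast
    then obtain W where W: "W \<in> C" "x \<in> W" using assms(2) unfolding open_cover_def by blast
    have "openin T (U \<inter> W)" using that W assms unfolding open_cover_def by auto
    thus ?thesis using that W by (intro exI[of _ "U \<inter> W"]) auto
  qed
  with assms(1) obtain D \<sigma> where D: "open_cover T D" "refines \<sigma> D B"
    and P: "\<And>V. V \<in> D \<Longrightarrow> \<exists>W\<in>C. V \<subseteq> W"
    by (rule refinement_by_property[where P = "\<lambda>U V. \<exists>W\<in>C. V \<subseteq> W"]) blast+
  from P obtain \<tau> where "\<And>V. V \<in> D \<Longrightarrow> \<tau> V \<in> C \<and> V \<subseteq> \<tau> V" by metis
  hence "refines \<tau> D C" by (simp add: refines_def)
  with D that show ?thesis by blast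
qed

subsection \<open>Non-abelian cohomology in degree one\<close>

lemma Z1_iff:
  "(C, g) \<in> Z1 T F \<longleftrightarrow> open_cover T C \<and>
    (\<forall>U\<in>C. \<forall>V\<in>C. g U V \<in> carrier (sec F (U \<inter> V))) \<and>
    (\<forall>U\<in>C. \<forall>V\<in>C. \<forall>W\<in>C. rest F (U \<inter> V \<inter> W) (g U V) \<otimes>\<^bsub>sec F (U \<inter> V \<inter> W)\<^esub> rest F (U \<inter> V \<inter> W) (g V W)
       = rest F (U \<inter> V \<inter> W) (g U W))"
  by (simp add: Z1_def Let_def)

lemma cohomologous1_iff:
  "cohomologous1 T F (C, g) (D, h) \<longleftrightarrow> (\<exists>B \<sigma> \<tau> k.
    open_cover T B \<and> refines \<sigma> B C \<and> refines \<tau> B D \<and> (\<forall>U\<in>B. k U \<in> carrier (sec F U)) \<and>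
    (\<forall>U\<in>B. \<forall>V\<in>B. rest F (U \<inter> V) (h (\<tau> U) (\<tau> V)) =
         inv\<^bsub>sec F (U \<inter> V)\<^esub> (rest F (U \<inter> V) (k U)) \<otimes>\<^bsub>sec F (U \<inter> V)\<^esub> rest F (U \<inter> V) (g (\<sigma> U) (\<sigma> V))
           \<otimes>\<^bsub>sec F (U \<inter> V)\<^esub> rest F (U \<inter> V) (k V)))"
  by (simp add: cohomologous1_def Let_def)

context presheaf
begin

lemma Z1_cover: "(C, g) \<in> Z1 T F \<Longrightarrow> open_cover T C"
  by (simp add: Z1_iff)

lemma Z1_closed:
  assumes "(C, g) \<in> Z1 T F" "U \<in> C" "V \<in> C" "openin T Q" "Q \<subseteq> U \<inter> V"
  shows "rest F Q (g U V) \<in> carrier (sec F Q)"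
  using assms rest_closed[of "g U V" "U \<inter> V" Q] by (auto simp: Z1_iff open_cover_def)

lemma Z1_cocycle:
  assumes z: "(C, g) \<in> Z1 T F" and C: "U \<in> C" "V \<in> C" "W \<in> C"
    and Q: "openin T Q" "Q \<subseteq> U \<inter> V \<inter> W"
  shows "rest F Q (g U V) \<otimes>\<^bsub>sec F Q\<^esub> rest F Q (g V W) = rest F Q (g U W)"
proof -
  let ?R = "U \<inter> V \<inter> W"
  have op: "openin T U" "openin T V" "openin T W" using z C by (auto simp: Z1_iff open_cover_def)
  hence R: "openin T ?R" by auto
  have *: "rest F Q (rest F ?R (g Z Y)) = rest F Q (g Z Y)"
    if "Z \<in> C" "Y \<in> C" "?R \<subseteq> Z \<inter> Y" for Z Y
    using that z op Q R by (intro rest_rest[of _ "Z \<inter> Y"]) (auto simp: Z1_iff open_cover_def)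
  have "rest F Q (rest F ?R (g U V) \<otimes>\<^bsub>sec F ?R\<^esub> rest F ?R (g V W)) = rest F Q (rest F ?R (g U W))"
    using z C by (simp add: Z1_iff)
  moreover have "rest F Q (rest F ?R (g U V) \<otimes>\<^bsub>sec F ?R\<^esub> rest F ?R (g V W))
      = rest F Q (rest F ?R (g U V)) \<otimes>\<^bsub>sec F Q\<^esub> rest F Q (rest F ?R (g V W))"
    using z C Q R by (intro rest_mult Z1_closed[OF z]) auto
  moreover have "?R \<subseteq> U \<inter> V" "?R \<subseteq> V \<inter> W" "?R \<subseteq> U \<inter> W" by auto
  ultimately show ?thesis using * C by simp
qed

lemma Z1_inv:
  assumes z: "(C, g) \<in> Z1 T F" and C: "U \<in> C" "V \<in> C" and Q: "openin T Q" "Q \<subseteq> U \<inter> V"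
  shows "inv\<^bsub>sec F Q\<^esub> (rest F Q (g U V)) = rest F Q (g V U)"
proof -
  interpret Q: group "sec F Q" using group_sec Q by simp
  have cl: "rest F Q (g Z Y) \<in> carrier (sec F Q)" if "Z \<in> {U,V}" "Y \<in> {U,V}" for Z Y
    using that C Q by (intro Z1_closed[OF z]) auto
  have "rest F Q (g U U) \<otimes>\<^bsub>sec F Q\<^esub> rest F Q (g U U) = rest F Q (g U U)"
    "rest F Q (g V U) \<otimes>\<^bsub>sec F Q\<^esub> rest F Q (g U V) = rest F Q (g V V)"
    "rest F Q (g V V) \<otimes>\<^bsub>sec F Q\<^esub> rest F Q (g V V) = rest F Q (g V V)"
    using z C Q by (intro Z1_cocycle; force)+
  hence "rest F Q (g V U) \<otimes>\<^bsub>sec F Q\<^esub> rest F Q (g U V) = \<one>\<^bsub>sec F Q\<^esub>"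
    using cl Q.r_cancel_one by auto
  thus ?thesis using cl by (intro Q.inv_equality) auto
qed

text \<open>The equation of cohomologous cocycles is required over all open subsets of the intersections, as this is
  the form in which it passes to refinements and to composites of gauge transformations.\<close>

definition gauge :: "'x set set \<Rightarrow> ('x set \<Rightarrow> 's) \<Rightarrow> ('x set \<Rightarrow> 'x set \<Rightarrow> 's) \<Rightarrow> ('x set \<Rightarrow> 'x set \<Rightarrow> 's) \<Rightarrow> bool"
  where "gauge A k g h \<longleftrightarrow> (\<forall>U\<in>A. k U \<in> carrier (sec F U)) \<and>
    (\<forall>U\<in>A. \<forall>V\<in>A. \<forall>Q. openin T Q \<longrightarrow> Q \<subseteq> U \<inter> V \<longrightarrow> rest F Q (h U V) =
       inv\<^bsub>sec F Q\<^esub> (rest F Q (k U)) \<otimes>\<^bsub>sec F Q\<^esub> rest F Q (g U V) \<otimes>\<^bsub>sec F Q\<^esub> rest F Q (k V))"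

lemma gauge_closed: "gauge A k g h \<Longrightarrow> U \<in> A \<Longrightarrow> k U \<in> carrier (sec F U)"
  by (simp add: gauge_def)

lemma gauge_eq:
  "gauge A k g h \<Longrightarrow> U \<in> A \<Longrightarrow> V \<in> A \<Longrightarrow> openin T Q \<Longrightarrow> Q \<subseteq> U \<inter> V \<Longrightarrow> rest F Q (h U V) =
    inv\<^bsub>sec F Q\<^esub> (rest F Q (k U)) \<otimes>\<^bsub>sec F Q\<^esub> rest F Q (g U V) \<otimes>\<^bsub>sec F Q\<^esub> rest F Q (k V)"
  by (simp add: gauge_def)

lemma gauge_cohomologous1:
  assumes "open_cover T A" "refines \<sigma> A C" "refines \<tau> A D"
    and "gauge A k (\<lambda>U V. g (\<sigma> U) (\<sigma> V)) (\<lambda>U V. h (\<tau> U) (\<tau> V))"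
  shows "cohomologous1 T F (C, g) (D, h)"
  unfolding cohomologous1_iff
proof (intro exI conjI ballI)
  show "open_cover T A" "refines \<sigma> A C" "refines \<tau> A D" by fact+
  fix U assume U: "U \<in> A"
  show "k U \<in> carrier (sec F U)" using gauge_closed[OF assms(4) U] .
  fix V assume V: "V \<in> A"
  have "openin T (U \<inter> V)" using U V assms(1) by (simp add: open_cover_def openin_Int)
  from gauge_eq[OF assms(4) U V this]
  show "rest F (U \<inter> V) (h (\<tau> U) (\<tau> V)) =
         inv\<^bsub>sec F (U \<inter> V)\<^esub> (rest F (U \<inter> V) (k U)) \<otimes>\<^bsub>sec F (U \<inter> V)\<^esub> rest F (U \<inter> V) (g (\<sigma> U) (\<sigma> V))
           \<otimes>\<^bsub>sec F (U \<inter> V)\<^esub> rest F (U \<inter> V) (k V)" by simp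
qed

lemma Z1_rest_rest:
  assumes z: "(C, g) \<in> Z1 T F" and C: "U \<in> C" "V \<in> C"
    and Q: "openin T R" "openin T Q" "Q \<subseteq> R" "R \<subseteq> U \<inter> V"
  shows "rest F Q (rest F R (g U V)) = rest F Q (g U V)"
  using z C Q by (intro rest_rest[of _ "U \<inter> V"]) (auto simp: Z1_iff open_cover_def)

lemma cohomologous1_gauge:
  assumes z: "(C, g) \<in> Z1 T F" "(D, h) \<in> Z1 T F" and coh: "cohomologous1 T F (C, g) (D, h)"
  obtains A \<sigma> \<tau> k where "open_cover T A" "refines \<sigma> A C" "refines \<tau> A D"
    "gauge A k (\<lambda>U V. g (\<sigma> U) (\<sigma> V)) (\<lambda>U V. h (\<tau> U) (\<tau> V))"
proof -
  obtain A \<sigma> \<tau> k where A: "open_cover T A" "refines \<sigma> A C" "refines \<tau> A D"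
    and k: "\<And>U. U \<in> A \<Longrightarrow> k U \<in> carrier (sec F U)"
    and eq: "\<And>U V. U \<in> A \<Longrightarrow> V \<in> A \<Longrightarrow> rest F (U \<inter> V) (h (\<tau> U) (\<tau> V)) =
       inv\<^bsub>sec F (U \<inter> V)\<^esub> (rest F (U \<inter> V) (k U)) \<otimes>\<^bsub>sec F (U \<inter> V)\<^esub> rest F (U \<inter> V) (g (\<sigma> U) (\<sigma> V))
         \<otimes>\<^bsub>sec F (U \<inter> V)\<^esub> rest F (U \<inter> V) (k V)"
    using coh unfolding cohomologous1_iff by blast
  have "gauge A k (\<lambda>U V. g (\<sigma> U) (\<sigma> V)) (\<lambda>U V. h (\<tau> U) (\<tau> V))"
    unfolding gauge_def
  proof (intro conjI ballI allI impI)
    fix U assume U: "U \<in> A"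
    show "k U \<in> carrier (sec F U)" using k U .
    fix V Q assume V: "V \<in> A" and Q: "openin T Q" "Q \<subseteq> U \<inter> V"
    have op: "openin T U" "openin T V" "openin T (U \<inter> V)"
      using open_coverD[OF A(1)] U V by (auto intro: openin_Int)
    interpret R: group "sec F (U \<inter> V)" using group_sec op(3) .
    note s = refinesD[OF A(2) U] refinesD[OF A(2) V] and t = refinesD[OF A(3) U] refinesD[OF A(3) V]
    have sub: "U \<inter> V \<subseteq> \<sigma> U \<inter> \<sigma> V" "U \<inter> V \<subseteq> \<tau> U \<inter> \<tau> V" using s t by auto
    have hh: "rest F Q (rest F (U \<inter> V) (h (\<tau> U) (\<tau> V))) = rest F Q (h (\<tau> U) (\<tau> V))"
      using Z1_rest_rest[OF z(2) t(1,3) op(3) Q sub(2)] .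
    have gg: "rest F Q (rest F (U \<inter> V) (g (\<sigma> U) (\<sigma> V))) = rest F Q (g (\<sigma> U) (\<sigma> V))"
      using Z1_rest_rest[OF z(1) s(1,3) op(3) Q sub(1)] .
    have kk: "rest F Q (rest F (U \<inter> V) (k U)) = rest F Q (k U)" "rest F Q (rest F (U \<inter> V) (k V)) = rest F Q (k V)"
      using rest_rest[OF k[OF U] op(1,3) Q] rest_rest[OF k[OF V] op(2,3) Q] by auto
    have cl: "rest F (U \<inter> V) (k U) \<in> carrier (sec F (U \<inter> V))" "rest F (U \<inter> V) (k V) \<in> carrier (sec F (U \<inter> V))"
      using rest_closed[OF k[OF U] op(1,3)] rest_closed[OF k[OF V] op(2,3)] by auto
    have clg: "rest F (U \<inter> V) (g (\<sigma> U) (\<sigma> V)) \<in> carrier (sec F (U \<inter> V))"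
      using Z1_closed[OF z(1) s(1,3) op(3) sub(1)] .
    have "rest F Q (h (\<tau> U) (\<tau> V)) = rest F Q (
       inv\<^bsub>sec F (U \<inter> V)\<^esub> (rest F (U \<inter> V) (k U)) \<otimes>\<^bsub>sec F (U \<inter> V)\<^esub> rest F (U \<inter> V) (g (\<sigma> U) (\<sigma> V))
         \<otimes>\<^bsub>sec F (U \<inter> V)\<^esub> rest F (U \<inter> V) (k V))" using eq[OF U V] hh by simp
    also have "\<dots> = inv\<^bsub>sec F Q\<^esub> (rest F Q (rest F (U \<inter> V) (k U))) \<otimes>\<^bsub>sec F Q\<^esub>
        rest F Q (rest F (U \<inter> V) (g (\<sigma> U) (\<sigma> V))) \<otimes>\<^bsub>sec F Q\<^esub> rest F Q (rest F (U \<inter> V) (k V))"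
      using cl clg op(3) Q by (simp add: rest_mult rest_inv)
    finally show "rest F Q (h (\<tau> U) (\<tau> V)) = inv\<^bsub>sec F Q\<^esub> (rest F Q (k U)) \<otimes>\<^bsub>sec F Q\<^esub>
        rest F Q (g (\<sigma> U) (\<sigma> V)) \<otimes>\<^bsub>sec F Q\<^esub> rest F Q (k V)" unfolding gg kk .
  qed
  with A that show ?thesis by blast
qed

text \<open>Cohomologous cocycles are related over every common cover, whatever the refinement maps are. If \<open>\<sigma>\<close> and
  \<open>\<sigma>'\<close> are two refinement maps into the cover of \<open>g\<close>, then by the cocycle condition the sections
  \<open>g (\<sigma> U) (\<sigma>' U)\<close> are a gauge transformation from \<open>g\<close> pulled back by \<open>\<sigma>\<close> to \<open>g\<close> pulled back by \<open>\<sigma>'\<close>.\<close>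

lemma coh1_refined:
  assumes z: "(C, g) \<in> Z1 T F" "(D, h) \<in> Z1 T F" and coh: "cohomologous1 T F (C, g) (D, h)"
    and B: "open_cover T B" "refines \<sigma> B C" "refines \<tau> B D"
  obtains A \<rho> k where "open_cover T A" "refines \<rho> A B"
    "gauge A k (\<lambda>U V. g (\<sigma> (\<rho> U)) (\<sigma> (\<rho> V))) (\<lambda>U V. h (\<tau> (\<rho> U)) (\<tau> (\<rho> V)))"
proof -
  obtain B' \<sigma>' \<tau>' k' where B': "open_cover T B'" "refines \<sigma>' B' C" "refines \<tau>' B' D"
    and k': "gauge B' k' (\<lambda>U V. g (\<sigma>' U) (\<sigma>' V)) (\<lambda>U V. h (\<tau>' U) (\<tau>' V))"
    by (rule cohomologous1_gauge[OF z coh])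
  obtain A \<rho> \<rho>' where A: "open_cover T A" "refines \<rho> A B" "refines \<rho>' A B'"
    by (rule common_refinement[OF B(1) B'(1)])
  \<comment> \<open>The factors \<open>n\<close> and \<open>m\<close> pass from the prescribed refinement maps to those of the given witness and back.\<close>
  define n where "n U = g (\<sigma> (\<rho> U)) (\<sigma>' (\<rho>' U))" for U
  define m where "m U = h (\<tau>' (\<rho>' U)) (\<tau> (\<rho> U))" for U
  define k where "k U = rest F U (n U) \<otimes>\<^bsub>sec F U\<^esub> rest F U (k' (\<rho>' U)) \<otimes>\<^bsub>sec F U\<^esub> rest F U (m U)" for U
  note k'c = gauge_closed[OF k']
  have r: "\<rho>' U \<in> B'" "\<sigma> (\<rho> U) \<in> C" "\<sigma>' (\<rho>' U) \<in> C" "\<tau> (\<rho> U) \<in> D" "\<tau>' (\<rho>' U) \<in> D"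
    "U \<subseteq> \<rho>' U" "U \<subseteq> \<sigma> (\<rho> U)" "U \<subseteq> \<sigma>' (\<rho>' U)" "U \<subseteq> \<tau> (\<rho> U)" "U \<subseteq> \<tau>' (\<rho>' U)"
    "openin T U" "openin T (\<rho>' U)"
    if "U \<in> A" for U
    using refinesD[OF A(2) that] refinesD[OF A(3) that]
      refinesD[OF refines_comp[OF B(2) A(2)] that] refinesD[OF refines_comp[OF B'(2) A(3)] that]
      refinesD[OF refines_comp[OF B(3) A(2)] that] refinesD[OF refines_comp[OF B'(3) A(3)] that]
      open_coverD[OF A(1) that] open_coverD[OF B'(1)] by simp_all
  have cl: "rest F Q (n W) \<in> carrier (sec F Q)" "rest F Q (m W) \<in> carrier (sec F Q)"
      "rest F Q (k' (\<rho>' W)) \<in> carrier (sec F Q)"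
      "rest F Q (k W) = rest F Q (n W) \<otimes>\<^bsub>sec F Q\<^esub> rest F Q (k' (\<rho>' W)) \<otimes>\<^bsub>sec F Q\<^esub> rest F Q (m W)"
    if "W \<in> A" "openin T Q" "Q \<subseteq> W" for Q W
  proof -
    note rW = r[OF that(1)]
    have c: "rest F P (n W) \<in> carrier (sec F P)" "rest F P (m W) \<in> carrier (sec F P)"
      "rest F P (k' (\<rho>' W)) \<in> carrier (sec F P)" if "openin T P" "P \<subseteq> W" for P
      unfolding n_def m_def using that rW
      by (intro Z1_closed[OF z(1)] Z1_closed[OF z(2)] rest_closed[OF k'c]; blast)+
    show "rest F Q (n W) \<in> carrier (sec F Q)" "rest F Q (m W) \<in> carrier (sec F Q)"
      "rest F Q (k' (\<rho>' W)) \<in> carrier (sec F Q)" using c that by auto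
    interpret W: group "sec F W" using group_sec rW by simp
    have "rest F Q (rest F W (n W)) = rest F Q (n W)" "rest F Q (rest F W (m W)) = rest F Q (m W)"
      unfolding n_def m_def using rW that by (intro Z1_rest_rest[OF z(1)] Z1_rest_rest[OF z(2)]; blast)+
    moreover have "rest F Q (rest F W (k' (\<rho>' W))) = rest F Q (k' (\<rho>' W))"
      using rW that by (intro rest_rest[OF k'c]; blast)
    ultimately show "rest F Q (k W) = rest F Q (n W) \<otimes>\<^bsub>sec F Q\<^esub> rest F Q (k' (\<rho>' W)) \<otimes>\<^bsub>sec F Q\<^esub> rest F Q (m W)"
      unfolding k_def using c[OF rW(11) order_refl] rW(11) that(2,3) by (simp add: rest_mult)
  qed
  have "gauge A k (\<lambda>U V. g (\<sigma> (\<rho> U)) (\<sigma> (\<rho> V))) (\<lambda>U V. h (\<tau> (\<rho> U)) (\<tau> (\<rho> V)))"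
    unfolding gauge_def
  proof (intro conjI ballI allI impI)
    fix U assume U: "U \<in> A"
    note rU = r[OF U]
    interpret U: group "sec F U" using group_sec rU by simp
    show "k U \<in> carrier (sec F U)"
      unfolding k_def using cl(1-3)[OF U rU(11) order_refl] by simp
    fix V Q assume V: "V \<in> A" and Q: "openin T Q" "Q \<subseteq> U \<inter> V"
    note rV = r[OF V]
    interpret Q: group "sec F Q" using group_sec Q by simp
    have QU: "Q \<subseteq> U" and QV: "Q \<subseteq> V" using Q by auto
    note cU = cl[OF U Q(1) QU] and cV = cl[OF V Q(1) QV]
    have sub: "Q \<subseteq> \<sigma> (\<rho> U)" "Q \<subseteq> \<sigma> (\<rho> V)" "Q \<subseteq> \<sigma>' (\<rho>' U)" "Q \<subseteq> \<sigma>' (\<rho>' V)"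
      "Q \<subseteq> \<tau> (\<rho> U)" "Q \<subseteq> \<tau> (\<rho> V)" "Q \<subseteq> \<tau>' (\<rho>' U)" "Q \<subseteq> \<tau>' (\<rho>' V)" "Q \<subseteq> \<rho>' U \<inter> \<rho>' V"
      using order_trans[OF QU rU(7)] order_trans[OF QV rV(7)] order_trans[OF QU rU(8)] order_trans[OF QV rV(8)]
        order_trans[OF QU rU(9)] order_trans[OF QV rV(9)] order_trans[OF QU rU(10)] order_trans[OF QV rV(10)]
        order_trans[OF QU rU(6)] order_trans[OF QV rV(6)] by auto
    have gchain: "rest F Q (g (\<sigma>' (\<rho>' U)) (\<sigma>' (\<rho>' V))) =
        inv\<^bsub>sec F Q\<^esub> rest F Q (n U) \<otimes>\<^bsub>sec F Q\<^esub> rest F Q (g (\<sigma> (\<rho> U)) (\<sigma> (\<rho> V))) \<otimes>\<^bsub>sec F Q\<^esub> rest F Q (n V)"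
      unfolding n_def using rU(2,3) rV(2,3) Q(1) sub by (simp add: Z1_inv[OF z(1)] Z1_cocycle[OF z(1)])
    have hchain: "rest F Q (h (\<tau> (\<rho> U)) (\<tau> (\<rho> V))) =
        inv\<^bsub>sec F Q\<^esub> rest F Q (m U) \<otimes>\<^bsub>sec F Q\<^esub> rest F Q (h (\<tau>' (\<rho>' U)) (\<tau>' (\<rho>' V))) \<otimes>\<^bsub>sec F Q\<^esub> rest F Q (m V)"
      unfolding m_def using rU(4,5) rV(4,5) Q(1) sub by (simp add: Z1_inv[OF z(2)] Z1_cocycle[OF z(2)])
    have "rest F Q (g (\<sigma> (\<rho> U)) (\<sigma> (\<rho> V))) \<in> carrier (sec F Q)"
      using Z1_closed[OF z(1) rU(2) rV(2) Q(1)] sub by simp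
    thus "rest F Q (h (\<tau> (\<rho> U)) (\<tau> (\<rho> V))) = inv\<^bsub>sec F Q\<^esub> rest F Q (k U) \<otimes>\<^bsub>sec F Q\<^esub>
        rest F Q (g (\<sigma> (\<rho> U)) (\<sigma> (\<rho> V))) \<otimes>\<^bsub>sec F Q\<^esub> rest F Q (k V)"
      unfolding hchain gauge_eq[OF k' rU(1) rV(1) Q(1) sub(9)] gchain cU(4) cV(4)
      using cU cV by (simp add: Q.inv_mult_group Q.m_assoc)
  qed
  with A that show ?thesis by blast
qed

text \<open>Witnesses of cohomology live on different covers; composing them means restricting the coarser one.\<close>

lemma gauge_comp:
  assumes z: "(C, g) \<in> Z1 T F" "refines \<sigma> A C" and A: "open_cover T A" "open_cover T A'" "refines \<rho> A' A"
    and k: "gauge A k (\<lambda>U V. g (\<sigma> U) (\<sigma> V)) h" and k': "gauge A' k' (\<lambda>U V. h (\<rho> U) (\<rho> V)) l"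
  shows "gauge A' (\<lambda>U. rest F U (k (\<rho> U)) \<otimes>\<^bsub>sec F U\<^esub> k' U) (\<lambda>U V. g (\<sigma> (\<rho> U)) (\<sigma> (\<rho> V))) l"
  unfolding gauge_def
proof (intro conjI ballI allI impI)
  note kc = gauge_closed[OF k] and k'c = gauge_closed[OF k']
  have r: "\<rho> U \<in> A" "U \<subseteq> \<rho> U" "openin T U" "openin T (\<rho> U)" "\<sigma> (\<rho> U) \<in> C" "U \<subseteq> \<sigma> (\<rho> U)" if "U \<in> A'" for U
    using refinesD[OF A(3) that] refinesD[OF refines_comp[OF z(2) A(3)] that] open_coverD[OF A(1)] open_coverD[OF A(2) that]
    by auto
  have c: "rest F Q (k (\<rho> W)) \<in> carrier (sec F Q)" "rest F Q (k' W) \<in> carrier (sec F Q)"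
    "rest F Q (rest F W (k (\<rho> W)) \<otimes>\<^bsub>sec F W\<^esub> k' W) = rest F Q (k (\<rho> W)) \<otimes>\<^bsub>sec F Q\<^esub> rest F Q (k' W)"
    if "W \<in> A'" "openin T Q" "Q \<subseteq> W" for W Q
  proof -
    note rW = r[OF that(1)]
    show "rest F Q (k (\<rho> W)) \<in> carrier (sec F Q)" "rest F Q (k' W) \<in> carrier (sec F Q)"
      using rW that by (intro rest_closed[OF kc] rest_closed[OF k'c]; blast)+
    have "rest F Q (rest F W (k (\<rho> W))) = rest F Q (k (\<rho> W))"
      using rW that by (intro rest_rest[OF kc]; blast)
    moreover have "rest F W (k (\<rho> W)) \<in> carrier (sec F W)"
      using rW by (intro rest_closed[OF kc]; blast)
    ultimately show "rest F Q (rest F W (k (\<rho> W)) \<otimes>\<^bsub>sec F W\<^esub> k' W) = rest F Q (k (\<rho> W)) \<otimes>\<^bsub>sec F Q\<^esub> rest F Q (k' W)"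
      using rW(3) that k'c by (simp add: rest_mult)
  qed
  fix U assume U: "U \<in> A'"
  note rU = r[OF U]
  interpret U: group "sec F U" using group_sec rU(3) .
  have "rest F U (k (\<rho> U)) \<in> carrier (sec F U)"
    using rU by (intro rest_closed[OF kc]; blast)
  thus "rest F U (k (\<rho> U)) \<otimes>\<^bsub>sec F U\<^esub> k' U \<in> carrier (sec F U)"
    using k'c[OF U] by simp
  fix V Q assume V: "V \<in> A'" and Q: "openin T Q" "Q \<subseteq> U \<inter> V"
  note rV = r[OF V]
  interpret Q: group "sec F Q" using group_sec Q(1) .
  have QU: "Q \<subseteq> U" and QV: "Q \<subseteq> V" using Q by auto
  have sub: "Q \<subseteq> \<sigma> (\<rho> U) \<inter> \<sigma> (\<rho> V)" "Q \<subseteq> \<rho> U \<inter> \<rho> V" using QU QV rU rV by blast+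
  note cU = c[OF U Q(1) QU] and cV = c[OF V Q(1) QV]
  have "rest F Q (g (\<sigma> (\<rho> U)) (\<sigma> (\<rho> V))) \<in> carrier (sec F Q)"
    using Z1_closed[OF z(1) rU(5) rV(5) Q(1) sub(1)] .
  thus "rest F Q (l U V) = inv\<^bsub>sec F Q\<^esub> rest F Q (rest F U (k (\<rho> U)) \<otimes>\<^bsub>sec F U\<^esub> k' U) \<otimes>\<^bsub>sec F Q\<^esub>
      rest F Q (g (\<sigma> (\<rho> U)) (\<sigma> (\<rho> V))) \<otimes>\<^bsub>sec F Q\<^esub> rest F Q (rest F V (k (\<rho> V)) \<otimes>\<^bsub>sec F V\<^esub> k' V)"
    unfolding gauge_eq[OF k' U V Q] gauge_eq[OF k rU(1) rV(1) Q(1) sub(2)] cU(3) cV(3)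
    using cU(1,2) cV(1,2) by (simp add: Q.inv_mult_group Q.m_assoc)
qed

text \<open>Restricting a cocycle to a finer cover does not change its class; the witness is the trivial gauge
  transformation.\<close>

lemma coh1_refl_refine:
  assumes z: "(C, g) \<in> Z1 T F" and B: "open_cover T B" "refines \<sigma> B C"
  shows "(B, \<lambda>U V. rest F (U \<inter> V) (g (\<sigma> U) (\<sigma> V))) \<in> Z1 T F" (is "(B, ?h) \<in> _")
    and "cohomologous1 T F (C, g) (B, \<lambda>U V. rest F (U \<inter> V) (g (\<sigma> U) (\<sigma> V)))"
proof -
  have r: "\<sigma> U \<in> C" "U \<subseteq> \<sigma> U" "openin T U" if "U \<in> B" for U
    using that B by (auto simp: refines_def open_cover_def)
  have opC: "openin T V" if "V \<in> C" for V using that z by (simp add: Z1_iff open_cover_def)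
  have gc: "g U V \<in> carrier (sec F (U \<inter> V))" if "U \<in> C" "V \<in> C" for U V
    using z that by (simp add: Z1_iff)
  have rr: "rest F Q (?h U V) = rest F Q (g (\<sigma> U) (\<sigma> V))"
    if "U \<in> B" "V \<in> B" "openin T Q" "Q \<subseteq> U \<inter> V" for Q U V
    using that r[of U] r[of V] gc opC by (intro rest_rest[of _ "\<sigma> U \<inter> \<sigma> V"]) auto
  show "(B, ?h) \<in> Z1 T F"
    unfolding Z1_iff
  proof (intro conjI ballI)
    show "open_cover T B" by fact
    fix U V assume UV: "U \<in> B" "V \<in> B"
    note rUV = r[OF UV(1)] r[OF UV(2)]
    show "?h U V \<in> carrier (sec F (U \<inter> V))"
      using rUV by (intro Z1_closed[OF z]) auto
    fix W assume W: "W \<in> B"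
    have "rest F (U \<inter> V \<inter> W) (g (\<sigma> U) (\<sigma> V)) \<otimes>\<^bsub>sec F (U \<inter> V \<inter> W)\<^esub> rest F (U \<inter> V \<inter> W) (g (\<sigma> V) (\<sigma> W))
       = rest F (U \<inter> V \<inter> W) (g (\<sigma> U) (\<sigma> W))"
      using rUV r[OF W] by (intro Z1_cocycle[OF z]) auto
    moreover have "openin T (U \<inter> V \<inter> W)" "U \<inter> V \<inter> W \<subseteq> U \<inter> V" "U \<inter> V \<inter> W \<subseteq> U \<inter> W" "U \<inter> V \<inter> W \<subseteq> V \<inter> W"
      using rUV r[OF W] by auto
    ultimately show "rest F (U \<inter> V \<inter> W) (?h U V) \<otimes>\<^bsub>sec F (U \<inter> V \<inter> W)\<^esub> rest F (U \<inter> V \<inter> W) (?h V W)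
      = rest F (U \<inter> V \<inter> W) (?h U W)"
      using rr[OF UV] rr[OF UV(1) W] rr[OF UV(2) W] by simp
  qed
  show "cohomologous1 T F (C, g) (B, ?h)"
    unfolding cohomologous1_iff
  proof (intro exI conjI ballI)
    show "open_cover T B" "refines \<sigma> B C" "refines (\<lambda>U. U) B B" using B by (auto intro: refines_id)
    fix U assume U: "U \<in> B"
    show "\<one>\<^bsub>sec F U\<^esub> \<in> carrier (sec F U)"
      using r[OF U] group_sec group.is_monoid monoid.one_closed by blast
    fix V assume V: "V \<in> B"
    interpret Q: group "sec F (U \<inter> V)" using group_sec r[OF U] r[OF V] by auto
    have "rest F (U \<inter> V) (g (\<sigma> U) (\<sigma> V)) \<in> carrier (sec F (U \<inter> V))"
      using r[OF U] r[OF V] by (intro Z1_closed[OF z]) auto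
    moreover have "rest F (U \<inter> V) \<one>\<^bsub>sec F U\<^esub> = \<one>\<^bsub>sec F (U \<inter> V)\<^esub>" "rest F (U \<inter> V) \<one>\<^bsub>sec F V\<^esub> = \<one>\<^bsub>sec F (U \<inter> V)\<^esub>"
      using r[OF U] r[OF V] by (auto intro!: rest_one)
    ultimately show "rest F (U \<inter> V) (?h U V) = inv\<^bsub>sec F (U \<inter> V)\<^esub> (rest F (U \<inter> V) \<one>\<^bsub>sec F U\<^esub>)
      \<otimes>\<^bsub>sec F (U \<inter> V)\<^esub> rest F (U \<inter> V) (g (\<sigma> U) (\<sigma> V)) \<otimes>\<^bsub>sec F (U \<inter> V)\<^esub> rest F (U \<inter> V) \<one>\<^bsub>sec F V\<^esub>"
      using rr[OF U V, of "U \<inter> V"] r[OF U] r[OF V] by (simp add: openin_Int)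
  qed
qed

lemma coh1_refl: "z \<in> Z1 T F \<Longrightarrow> cohomologous1 T F z z"
proof -
  assume z: "z \<in> Z1 T F"
  obtain C g where zz: "z = (C, g)" by (cases z)
  have C: "open_cover T C" using z zz Z1_cover by auto
  have "cohomologous1 T F (C, g) (C, \<lambda>U V. rest F (U \<inter> V) (g U V))"
    using coh1_refl_refine(2)[OF z[unfolded zz] C refines_id] .
  moreover have "rest F (U \<inter> V) (rest F (U \<inter> V) (g U V)) = rest F (U \<inter> V) (g U V)" if "U \<in> C" "V \<in> C" for U V
    using z zz that C by (intro rest_id Z1_closed) (auto simp: open_cover_def)
  moreover have "rest F (U \<inter> V) (g U V) = g U V" if "U \<in> C" "V \<in> C" for U V
    using z zz that C by (intro rest_id) (auto simp: open_cover_def Z1_iff)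
  ultimately show ?thesis unfolding zz cohomologous1_iff refines_def
    by (smt (verit, best))
qed

lemma coh1_sym:
  assumes "z \<in> Z1 T F" "w \<in> Z1 T F" "cohomologous1 T F z w" shows "cohomologous1 T F w z"
proof -
  obtain C g where zz: "z = (C, g)" by (cases z)
  obtain D h where ww: "w = (D, h)" by (cases w)
  obtain B \<sigma> \<tau> k where B: "open_cover T B" "refines \<sigma> B C" "refines \<tau> B D"
    and k: "\<And>U. U \<in> B \<Longrightarrow> k U \<in> carrier (sec F U)"
    and eq: "\<And>U V. U \<in> B \<Longrightarrow> V \<in> B \<Longrightarrow> rest F (U \<inter> V) (h (\<tau> U) (\<tau> V)) =
       inv\<^bsub>sec F (U \<inter> V)\<^esub> (rest F (U \<inter> V) (k U)) \<otimes>\<^bsub>sec F (U \<inter> V)\<^esub> rest F (U \<inter> V) (g (\<sigma> U) (\<sigma> V))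
         \<otimes>\<^bsub>sec F (U \<inter> V)\<^esub> rest F (U \<inter> V) (k V)"
    using assms(3) unfolding zz ww cohomologous1_iff by blast
  show ?thesis unfolding zz ww cohomologous1_iff
  proof (intro exI conjI ballI)
    show "open_cover T B" "refines \<sigma> B C" "refines \<tau> B D" by fact+
    fix U assume U: "U \<in> B"
    have oU: "openin T U" using B U by (simp add: open_cover_def)
    show kU: "inv\<^bsub>sec F U\<^esub> (k U) \<in> carrier (sec F U)"
      using k[OF U] group.inv_closed[OF group_sec[OF oU]] by blast
    fix V assume V: "V \<in> B"
    have oV: "openin T V" using B V by (simp add: open_cover_def)
    let ?Q = "U \<inter> V"
    have oQ: "openin T ?Q" using oU oV by auto
    interpret Q: group "sec F ?Q" using group_sec oQ .
    have r: "rest F ?Q (inv\<^bsub>sec F U\<^esub> (k U)) = inv\<^bsub>sec F ?Q\<^esub> rest F ?Q (k U)"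
      "rest F ?Q (inv\<^bsub>sec F V\<^esub> (k V)) = inv\<^bsub>sec F ?Q\<^esub> rest F ?Q (k V)"
      using k[OF U] k[OF V] oU oV oQ by (auto intro!: rest_inv)
    have c: "rest F ?Q (k U) \<in> carrier (sec F ?Q)" "rest F ?Q (k V) \<in> carrier (sec F ?Q)"
      using k[OF U] k[OF V] oU oV oQ by (auto intro!: rest_closed)
    have "rest F ?Q (g (\<sigma> U) (\<sigma> V)) \<in> carrier (sec F ?Q)"
      using assms(1) B U V oQ unfolding zz by (intro Z1_closed) (auto simp: refines_def)
    with c show "rest F ?Q (g (\<sigma> U) (\<sigma> V)) = inv\<^bsub>sec F ?Q\<^esub> (rest F ?Q (inv\<^bsub>sec F U\<^esub> (k U)))
      \<otimes>\<^bsub>sec F ?Q\<^esub> rest F ?Q (h (\<tau> U) (\<tau> V)) \<otimes>\<^bsub>sec F ?Q\<^esub> rest F ?Q (inv\<^bsub>sec F V\<^esub> (k V))"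
      unfolding eq[OF U V] r by (simp add: Q.m_assoc Q.r_inv_cancel)
  qed
qed

text \<open>Transitivity is obtained by refining the two witnesses to a common cover of the three cocycles.\<close>

lemma coh1_trans:
  assumes z: "z \<in> Z1 T F" "w \<in> Z1 T F" "v \<in> Z1 T F" and zw: "cohomologous1 T F z w" and wv: "cohomologous1 T F w v"
  shows "cohomologous1 T F z v"
proof -
  obtain C g where zz: "z = (C, g)" by (cases z)
  obtain D h where ww: "w = (D, h)" by (cases w)
  obtain E l where vv: "v = (E, l)" by (cases v)
  note z = z[unfolded zz ww vv] and zw = zw[unfolded zz ww] and wv = wv[unfolded ww vv]
  obtain A \<alpha> \<beta> k where A: "open_cover T A" "refines \<alpha> A C" "refines \<beta> A D"
    and k: "gauge A k (\<lambda>U V. g (\<alpha> U) (\<alpha> V)) (\<lambda>U V. h (\<beta> U) (\<beta> V))"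
    by (rule cohomologous1_gauge[OF z(1,2) zw])
  obtain B \<gamma> \<delta> where B: "open_cover T B" "refines \<gamma> B A" "refines \<delta> B E"
    by (rule common_refinement[OF A(1) Z1_cover[OF z(3)]])
  obtain A' \<rho> k' where A': "open_cover T A'" "refines \<rho> A' B"
    and k': "gauge A' k' (\<lambda>U V. h (\<beta> (\<gamma> (\<rho> U))) (\<beta> (\<gamma> (\<rho> V)))) (\<lambda>U V. l (\<delta> (\<rho> U)) (\<delta> (\<rho> V)))"
    by (rule coh1_refined[OF z(2,3) wv B(1) refines_comp[OF A(3) B(2)] B(3)])
  note g = gauge_comp[OF z(1) A(2,1) A'(1) refines_comp[OF B(2) A'(2)] k k']
  show ?thesis unfolding zz vv
    using refines_comp[OF A(2) refines_comp[OF B(2) A'(2)]] refines_comp[OF B(3) A'(2)] g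
    by (intro gauge_cohomologous1[OF A'(1)])
qed

lemma class1_self: "z \<in> Z1 T F \<Longrightarrow> z \<in> class1 T F z"
  by (simp add: class1_def coh1_refl)

lemma class1_eq_iff:
  assumes "z \<in> Z1 T F" "w \<in> Z1 T F"
  shows "class1 T F z = class1 T F w \<longleftrightarrow> cohomologous1 T F z w"
  using assms coh1_refl coh1_sym coh1_trans unfolding class1_def by blast

text \<open>A cochain is a function on all pairs of sets, but its class only sees the members of its cover.\<close>

lemma class1_cong:
  assumes "(C, g) \<in> Z1 T F" "\<And>U V. U \<in> C \<Longrightarrow> V \<in> C \<Longrightarrow> h U V = g U V"
  shows "(C, h) \<in> Z1 T F" "class1 T F (C, h) = class1 T F (C, g)"
proof -
  show h: "(C, h) \<in> Z1 T F" using assms unfolding Z1_iff by simp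
  have "cohomologous1 T F (C, g) (C, g)" using assms(1) by (rule coh1_refl)
  then obtain B \<sigma> \<tau> k where *: "open_cover T B" "refines \<sigma> B C" "refines \<tau> B C" "\<forall>U\<in>B. k U \<in> carrier (sec F U)"
    "\<forall>U\<in>B. \<forall>V\<in>B. rest F (U \<inter> V) (g (\<tau> U) (\<tau> V)) =
         inv\<^bsub>sec F (U \<inter> V)\<^esub> (rest F (U \<inter> V) (k U)) \<otimes>\<^bsub>sec F (U \<inter> V)\<^esub> rest F (U \<inter> V) (g (\<sigma> U) (\<sigma> V))
           \<otimes>\<^bsub>sec F (U \<inter> V)\<^esub> rest F (U \<inter> V) (k V)"
    unfolding cohomologous1_iff by blast
  have "h (\<sigma> U) (\<sigma> V) = g (\<sigma> U) (\<sigma> V)" if "U \<in> B" "V \<in> B" for U V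
    using assms(2) refinesD(1)[OF *(2)] that by blast
  with * have "cohomologous1 T F (C, h) (C, g)"
    unfolding cohomologous1_iff by (intro exI[of _ B] exI[of _ \<sigma>] exI[of _ \<tau>] exI[of _ k]) simp
  thus "class1 T F (C, h) = class1 T F (C, g)" using class1_eq_iff[OF h assms(1)] by simp
qed

lemma class1_refine:
  assumes "(C, g) \<in> Z1 T F" "open_cover T B" "refines \<sigma> B C"
  shows "class1 T F (B, \<lambda>U V. rest F (U \<inter> V) (g (\<sigma> U) (\<sigma> V))) = class1 T F (C, g)"
  using class1_eq_iff[OF assms(1) coh1_refl_refine(1)[OF assms]] coh1_refl_refine(2)[OF assms] by simp

text \<open>A class can be represented over every cover that is fine enough, so finitely many classes can be
  represented over one cover.\<close>

lemma H1_set_refine: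
  assumes "p \<in> H1_set T F"
  obtains C where "open_cover T C"
    "\<And>B \<sigma>. open_cover T B \<Longrightarrow> refines \<sigma> B C \<Longrightarrow> \<exists>g. (B, g) \<in> Z1 T F \<and> p = class1 T F (B, g)"
proof -
  obtain C g where g: "(C, g) \<in> Z1 T F" "p = class1 T F (C, g)" using assms unfolding H1_set_def by auto
  show ?thesis
  proof (rule that[OF Z1_cover[OF g(1)]])
    fix B \<sigma> assume "open_cover T B" "refines \<sigma> B C"
    thus "\<exists>g. (B, g) \<in> Z1 T F \<and> p = class1 T F (B, g)"
      using class1_refine[OF g(1), of B \<sigma>] coh1_refl_refine(1)[OF g(1), of B \<sigma>] g(2) by auto
  qed
qed

lemma Z1_one: "open_cover T C \<Longrightarrow> (C, \<lambda>U V. \<one>\<^bsub>sec F (U \<inter> V)\<^esub>) \<in> Z1 T F"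
  unfolding Z1_iff
proof (intro conjI ballI)
  assume C: "open_cover T C"
  fix U V assume UV: "U \<in> C" "V \<in> C"
  hence op: "openin T (U \<inter> V)" using C by (simp add: open_cover_def openin_Int)
  show "\<one>\<^bsub>sec F (U \<inter> V)\<^esub> \<in> carrier (sec F (U \<inter> V))"
    using group.is_monoid[OF group_sec[OF op]] by (rule monoid.one_closed)
  fix W assume W: "W \<in> C"
  let ?Q = "U \<inter> V \<inter> W"
  have opW: "openin T ?Q" "openin T (V \<inter> W)" "openin T (U \<inter> W)" using op C UV W by (auto simp: open_cover_def openin_Int)
  interpret Q: group "sec F ?Q" using group_sec opW(1) .
  have "rest F ?Q \<one>\<^bsub>sec F (U \<inter> V)\<^esub> = \<one>\<^bsub>sec F ?Q\<^esub>" "rest F ?Q \<one>\<^bsub>sec F (V \<inter> W)\<^esub> = \<one>\<^bsub>sec F ?Q\<^esub>"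
    "rest F ?Q \<one>\<^bsub>sec F (U \<inter> W)\<^esub> = \<one>\<^bsub>sec F ?Q\<^esub>" using op opW by (intro rest_one; blast)+
  thus "rest F ?Q \<one>\<^bsub>sec F (U \<inter> V)\<^esub> \<otimes>\<^bsub>sec F ?Q\<^esub> rest F ?Q \<one>\<^bsub>sec F (V \<inter> W)\<^esub> = rest F ?Q \<one>\<^bsub>sec F (U \<inter> W)\<^esub>"
    by simp
qed

lemma class1_one:
  assumes C: "open_cover T C"
  shows "class1 T F (C, \<lambda>U V. \<one>\<^bsub>sec F (U \<inter> V)\<^esub>) = \<one>\<^bsub>H1 T F\<^esub>"
proof -
  note X = Z1_one[OF open_cover_space]
  have "class1 T F (C, \<lambda>U V. \<one>\<^bsub>sec F (U \<inter> V)\<^esub>) =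
      class1 T F (C, \<lambda>U V. rest F (U \<inter> V) \<one>\<^bsub>sec F (topspace T \<inter> topspace T)\<^esub>)"
  proof (rule class1_cong(2)[OF coh1_refl_refine(1)[OF X C refines_space[OF C]]])
    fix U V assume "U \<in> C" "V \<in> C"
    hence "openin T (U \<inter> V)" using C by (simp add: open_cover_def openin_Int)
    thus "\<one>\<^bsub>sec F (U \<inter> V)\<^esub> = rest F (U \<inter> V) \<one>\<^bsub>sec F (topspace T \<inter> topspace T)\<^esub>"
      using openin_subset by (subst rest_one) auto
  qed
  also have "\<dots> = class1 T F ({topspace T}, \<lambda>U V. \<one>\<^bsub>sec F (U \<inter> V)\<^esub>)"
    using class1_refine[OF X C refines_space[OF C]] .
  finally show ?thesis by (simp add: H1_def)
qed

end

subsection \<open>Abelian coefficients\<close>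

locale abelian_presheaf = presheaf +
  assumes comm_sec: "openin T U \<Longrightarrow> comm_group (sec F U)"
begin

lemma Z1_mult:
  assumes g: "(C, g) \<in> Z1 T F" and h: "(C, h) \<in> Z1 T F"
  shows "(C, \<lambda>U V. g U V \<otimes>\<^bsub>sec F (U \<inter> V)\<^esub> h U V) \<in> Z1 T F"
  unfolding Z1_iff
proof (intro conjI ballI)
  show C: "open_cover T C" using Z1_cover[OF g] .
  have gc: "g U V \<in> carrier (sec F (U \<inter> V))" "h U V \<in> carrier (sec F (U \<inter> V))" "openin T (U \<inter> V)"
    if "U \<in> C" "V \<in> C" for U V
    using g h that by (auto simp: Z1_iff open_cover_def openin_Int)
  fix U V assume UV: "U \<in> C" "V \<in> C"
  interpret UV: comm_group "sec F (U \<inter> V)" using comm_sec gc(3)[OF UV] .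
  show "g U V \<otimes>\<^bsub>sec F (U \<inter> V)\<^esub> h U V \<in> carrier (sec F (U \<inter> V))" using gc[OF UV] by simp
  fix W assume W: "W \<in> C"
  let ?Q = "U \<inter> V \<inter> W"
  have Q: "openin T ?Q" using gc(3)[OF UV] gc(3)[OF W W] by (auto intro: openin_Int)
  interpret Q: comm_group "sec F ?Q" using comm_sec Q .
  have m: "rest F ?Q (g Z Y \<otimes>\<^bsub>sec F (Z \<inter> Y)\<^esub> h Z Y) = rest F ?Q (g Z Y) \<otimes>\<^bsub>sec F ?Q\<^esub> rest F ?Q (h Z Y)"
    "rest F ?Q (g Z Y) \<in> carrier (sec F ?Q)" "rest F ?Q (h Z Y) \<in> carrier (sec F ?Q)"
    if "Z \<in> C" "Y \<in> C" "?Q \<subseteq> Z \<inter> Y" for Z Y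
    using rest_mult[OF gc(1,2)[OF that(1,2)] gc(3)[OF that(1,2)] Q that(3)]
      Z1_closed[OF g that(1,2) Q that(3)] Z1_closed[OF h that(1,2) Q that(3)] by simp_all
  have sub: "?Q \<subseteq> U \<inter> V" "?Q \<subseteq> V \<inter> W" "?Q \<subseteq> U \<inter> W" by auto
  show "rest F ?Q (g U V \<otimes>\<^bsub>sec F (U \<inter> V)\<^esub> h U V) \<otimes>\<^bsub>sec F ?Q\<^esub> rest F ?Q (g V W \<otimes>\<^bsub>sec F (V \<inter> W)\<^esub> h V W) =
     rest F ?Q (g U W \<otimes>\<^bsub>sec F (U \<inter> W)\<^esub> h U W)"
    unfolding m(1)[OF UV sub(1)] m(1)[OF UV(2) W sub(2)] m(1)[OF UV(1) W sub(3)]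
      Z1_cocycle[OF g UV W Q order_refl, symmetric] Z1_cocycle[OF h UV W Q order_refl, symmetric]
    using m(2,3)[OF UV sub(1)] m(2,3)[OF UV(2) W sub(2)] by (simp add: Q.m_ac)
qed

lemma Z1_inverse:
  assumes g: "(C, g) \<in> Z1 T F"
  shows "(C, \<lambda>U V. inv\<^bsub>sec F (U \<inter> V)\<^esub> g U V) \<in> Z1 T F"
  unfolding Z1_iff
proof (intro conjI ballI)
  show C: "open_cover T C" using Z1_cover[OF g] .
  have gc: "g U V \<in> carrier (sec F (U \<inter> V))" "openin T (U \<inter> V)" if "U \<in> C" "V \<in> C" for U V
    using g that by (auto simp: Z1_iff open_cover_def openin_Int)
  fix U V assume UV: "U \<in> C" "V \<in> C"
  interpret UV: comm_group "sec F (U \<inter> V)" using comm_sec gc(2)[OF UV] .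
  show "inv\<^bsub>sec F (U \<inter> V)\<^esub> g U V \<in> carrier (sec F (U \<inter> V))" using gc[OF UV] by simp
  fix W assume W: "W \<in> C"
  let ?Q = "U \<inter> V \<inter> W"
  have Q: "openin T ?Q" using gc(2)[OF UV] gc(2)[OF W W] by (auto intro: openin_Int)
  interpret Q: comm_group "sec F ?Q" using comm_sec Q .
  have m: "rest F ?Q (inv\<^bsub>sec F (Z \<inter> Y)\<^esub> g Z Y) = inv\<^bsub>sec F ?Q\<^esub> rest F ?Q (g Z Y)"
    "rest F ?Q (g Z Y) \<in> carrier (sec F ?Q)"
    if "Z \<in> C" "Y \<in> C" "?Q \<subseteq> Z \<inter> Y" for Z Y
    using rest_inv[OF gc(1)[OF that(1,2)] gc(2)[OF that(1,2)] Q that(3)]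
      Z1_closed[OF g that(1,2) Q that(3)] by simp_all
  have sub: "?Q \<subseteq> U \<inter> V" "?Q \<subseteq> V \<inter> W" "?Q \<subseteq> U \<inter> W" by auto
  show "rest F ?Q (inv\<^bsub>sec F (U \<inter> V)\<^esub> g U V) \<otimes>\<^bsub>sec F ?Q\<^esub> rest F ?Q (inv\<^bsub>sec F (V \<inter> W)\<^esub> g V W) =
     rest F ?Q (inv\<^bsub>sec F (U \<inter> W)\<^esub> g U W)"
    unfolding m(1)[OF UV sub(1)] m(1)[OF UV(2) W sub(2)] m(1)[OF UV(1) W sub(3)]
      Z1_cocycle[OF g UV W Q order_refl, symmetric]
    using m(2)[OF UV sub(1)] m(2)[OF UV(2) W sub(2)] by (simp add: Q.inv_mult)
qed

text \<open>With abelian coefficients the product of two gauge transformations is one for the product of the cocycles,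
  once \<open>coh1_refined\<close> has moved the second one to the cover and the refinement maps of the first.\<close>

lemma coh1_mult:
  assumes g: "(C, g) \<in> Z1 T F" "(D, g') \<in> Z1 T F" "cohomologous1 T F (C, g) (D, g')"
    and h: "(C, h) \<in> Z1 T F" "(D, h') \<in> Z1 T F" "cohomologous1 T F (C, h) (D, h')"
  shows "cohomologous1 T F (C, \<lambda>U V. g U V \<otimes>\<^bsub>sec F (U \<inter> V)\<^esub> h U V) (D, \<lambda>U V. g' U V \<otimes>\<^bsub>sec F (U \<inter> V)\<^esub> h' U V)"
proof -
  obtain A \<alpha> \<beta> k where A: "open_cover T A" "refines \<alpha> A C" "refines \<beta> A D"
    and k: "gauge A k (\<lambda>U V. g (\<alpha> U) (\<alpha> V)) (\<lambda>U V. g' (\<beta> U) (\<beta> V))"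
    by (rule cohomologous1_gauge[OF g])
  obtain A' \<rho> k' where A': "open_cover T A'" "refines \<rho> A' A"
    and k': "gauge A' k' (\<lambda>U V. h (\<alpha> (\<rho> U)) (\<alpha> (\<rho> V))) (\<lambda>U V. h' (\<beta> (\<rho> U)) (\<beta> (\<rho> V)))"
    by (rule coh1_refined[OF h A])
  note kc = gauge_closed[OF k] and k'c = gauge_closed[OF k']
  have r: "\<rho> U \<in> A" "U \<subseteq> \<rho> U" "openin T U" "openin T (\<rho> U)" "\<alpha> (\<rho> U) \<in> C" "U \<subseteq> \<alpha> (\<rho> U)"
     "\<beta> (\<rho> U) \<in> D" "U \<subseteq> \<beta> (\<rho> U)" if "U \<in> A'" for U
    using refinesD[OF A'(2) that] refinesD[OF refines_comp[OF A(2) A'(2)] that]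
      refinesD[OF refines_comp[OF A(3) A'(2)] that] open_coverD[OF A(1)] open_coverD[OF A'(1) that]
    by auto
  have c: "rest F Q (k (\<rho> W)) \<in> carrier (sec F Q)" "rest F Q (k' W) \<in> carrier (sec F Q)"
    "rest F Q (rest F W (k (\<rho> W)) \<otimes>\<^bsub>sec F W\<^esub> k' W) = rest F Q (k (\<rho> W)) \<otimes>\<^bsub>sec F Q\<^esub> rest F Q (k' W)"
    if "W \<in> A'" "openin T Q" "Q \<subseteq> W" for W Q
  proof -
    note rW = r[OF that(1)]
    show "rest F Q (k (\<rho> W)) \<in> carrier (sec F Q)" "rest F Q (k' W) \<in> carrier (sec F Q)"
      using rW that by (intro rest_closed[OF kc] rest_closed[OF k'c]; blast)+
    have "rest F Q (rest F W (k (\<rho> W))) = rest F Q (k (\<rho> W))"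
      using rW that by (intro rest_rest[OF kc]; blast)
    moreover have "rest F W (k (\<rho> W)) \<in> carrier (sec F W)"
      using rW by (intro rest_closed[OF kc]; blast)
    ultimately show "rest F Q (rest F W (k (\<rho> W)) \<otimes>\<^bsub>sec F W\<^esub> k' W) = rest F Q (k (\<rho> W)) \<otimes>\<^bsub>sec F Q\<^esub> rest F Q (k' W)"
      using rW(3) that k'c by (simp add: rest_mult)
  qed
  have m: "rest F Q (a Z Y \<otimes>\<^bsub>sec F (Z \<inter> Y)\<^esub> b Z Y) = rest F Q (a Z Y) \<otimes>\<^bsub>sec F Q\<^esub> rest F Q (b Z Y)"
    "rest F Q (a Z Y) \<in> carrier (sec F Q)" "rest F Q (b Z Y) \<in> carrier (sec F Q)"
    if "(E, a) \<in> Z1 T F" "(E, b) \<in> Z1 T F" "Z \<in> E" "Y \<in> E" "openin T Q" "Q \<subseteq> Z \<inter> Y" for E a b Z Y Q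
  proof -
    have "a Z Y \<in> carrier (sec F (Z \<inter> Y))" "b Z Y \<in> carrier (sec F (Z \<inter> Y))" "openin T (Z \<inter> Y)"
      using that by (auto simp: Z1_iff open_cover_def openin_Int)
    with that show "rest F Q (a Z Y \<otimes>\<^bsub>sec F (Z \<inter> Y)\<^esub> b Z Y) = rest F Q (a Z Y) \<otimes>\<^bsub>sec F Q\<^esub> rest F Q (b Z Y)"
      by (intro rest_mult)
    show "rest F Q (a Z Y) \<in> carrier (sec F Q)" "rest F Q (b Z Y) \<in> carrier (sec F Q)"
      using Z1_closed that by auto
  qed
  have "gauge A' (\<lambda>U. rest F U (k (\<rho> U)) \<otimes>\<^bsub>sec F U\<^esub> k' U)
     (\<lambda>U V. g (\<alpha> (\<rho> U)) (\<alpha> (\<rho> V)) \<otimes>\<^bsub>sec F (\<alpha> (\<rho> U) \<inter> \<alpha> (\<rho> V))\<^esub> h (\<alpha> (\<rho> U)) (\<alpha> (\<rho> V)))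
     (\<lambda>U V. g' (\<beta> (\<rho> U)) (\<beta> (\<rho> V)) \<otimes>\<^bsub>sec F (\<beta> (\<rho> U) \<inter> \<beta> (\<rho> V))\<^esub> h' (\<beta> (\<rho> U)) (\<beta> (\<rho> V)))"
    unfolding gauge_def
  proof (intro conjI ballI allI impI)
    fix U assume U: "U \<in> A'"
    note rU = r[OF U]
    interpret U: group "sec F U" using group_sec rU(3) .
    have "rest F U (k (\<rho> U)) \<in> carrier (sec F U)"
      using rU by (intro rest_closed[OF kc]; blast)
    thus "rest F U (k (\<rho> U)) \<otimes>\<^bsub>sec F U\<^esub> k' U \<in> carrier (sec F U)"
      using k'c[OF U] by simp
    fix V Q assume V: "V \<in> A'" and Q: "openin T Q" "Q \<subseteq> U \<inter> V"
    note rV = r[OF V]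
    interpret Q: comm_group "sec F Q" using comm_sec Q(1) .
    have QU: "Q \<subseteq> U" and QV: "Q \<subseteq> V" using Q by auto
    have sub: "Q \<subseteq> \<alpha> (\<rho> U) \<inter> \<alpha> (\<rho> V)" "Q \<subseteq> \<beta> (\<rho> U) \<inter> \<beta> (\<rho> V)" "Q \<subseteq> \<rho> U \<inter> \<rho> V" using QU QV rU rV by blast+
    note cU = c[OF U Q(1) QU] and cV = c[OF V Q(1) QV]
    note m1 = m[OF g(1) h(1) rU(5) rV(5) Q(1) sub(1)] and m2 = m[OF g(2) h(2) rU(7) rV(7) Q(1) sub(2)]
    show "rest F Q (g' (\<beta> (\<rho> U)) (\<beta> (\<rho> V)) \<otimes>\<^bsub>sec F (\<beta> (\<rho> U) \<inter> \<beta> (\<rho> V))\<^esub> h' (\<beta> (\<rho> U)) (\<beta> (\<rho> V))) =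
      inv\<^bsub>sec F Q\<^esub> rest F Q (rest F U (k (\<rho> U)) \<otimes>\<^bsub>sec F U\<^esub> k' U) \<otimes>\<^bsub>sec F Q\<^esub>
      rest F Q (g (\<alpha> (\<rho> U)) (\<alpha> (\<rho> V)) \<otimes>\<^bsub>sec F (\<alpha> (\<rho> U) \<inter> \<alpha> (\<rho> V))\<^esub> h (\<alpha> (\<rho> U)) (\<alpha> (\<rho> V)))
       \<otimes>\<^bsub>sec F Q\<^esub> rest F Q (rest F V (k (\<rho> V)) \<otimes>\<^bsub>sec F V\<^esub> k' V)"
      unfolding m1(1) m2(1) gauge_eq[OF k' U V Q] gauge_eq[OF k rU(1) rV(1) Q(1) sub(3)] cU(3) cV(3)
      using cU(1,2) cV(1,2) m1(2,3) by (simp add: Q.inv_mult Q.m_ac)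
  qed
  thus ?thesis
    by (intro gauge_cohomologous1[OF A'(1) refines_comp[OF A(2) A'(2)] refines_comp[OF A(3) A'(2)]])
qed

lemma H1_mult_class1:
  assumes g: "(C, g) \<in> Z1 T F" and h: "(C, h) \<in> Z1 T F"
  shows "class1 T F (C, g) \<otimes>\<^bsub>H1 T F\<^esub> class1 T F (C, h) = class1 T F (C, \<lambda>U V. g U V \<otimes>\<^bsub>sec F (U \<inter> V)\<^esub> h U V)"
proof -
  have "class1 T F (D, \<lambda>U V. g' U V \<otimes>\<^bsub>sec F (U \<inter> V)\<^esub> h' U V) = class1 T F (C, \<lambda>U V. g U V \<otimes>\<^bsub>sec F (U \<inter> V)\<^esub> h U V)"
    if "(D, g') \<in> class1 T F (C, g)" "(D, h') \<in> class1 T F (C, h)" for D g' h'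
  proof -
    have "(D, g') \<in> Z1 T F" "cohomologous1 T F (C, g) (D, g')" "(D, h') \<in> Z1 T F" "cohomologous1 T F (C, h) (D, h')"
      using that by (auto simp: class1_def)
    with coh1_mult[OF g this(1,2) h this(3,4)] class1_eq_iff[OF Z1_mult[OF g h] Z1_mult[OF this(1,3)]]
    show ?thesis by simp
  qed
  hence "{class1 T F (D, \<lambda>U V. g' U V \<otimes>\<^bsub>sec F (U \<inter> V)\<^esub> h' U V) | D g' h'.
      (D, g') \<in> class1 T F (C, g) \<and> (D, h') \<in> class1 T F (C, h)} =
    {class1 T F (C, \<lambda>U V. g U V \<otimes>\<^bsub>sec F (U \<inter> V)\<^esub> h U V)}"
    using class1_self[OF g] class1_self[OF h] by blast
  thus ?thesis by (simp add: H1_def)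
qed

text \<open>Over a common cover of the classes involved, the group axioms are those of the groups of sections.\<close>

theorem group_H1: "group (H1 T F)"
proof (rule groupI)
  have car: "carrier (H1 T F) = H1_set T F" by (simp add: H1_def)
  have cl: "class1 T F z \<in> carrier (H1 T F)" if "z \<in> Z1 T F" for z
    using that by (simp add: car H1_set_def)
  show one: "\<one>\<^bsub>H1 T F\<^esub> \<in> carrier (H1 T F)"
    using cl[OF Z1_one[OF open_cover_space]] class1_one[OF open_cover_space] by simp
  fix p assume p: "p \<in> carrier (H1 T F)"
  obtain C1 where C1: "open_cover T C1"
    "\<And>B \<sigma>. open_cover T B \<Longrightarrow> refines \<sigma> B C1 \<Longrightarrow> \<exists>g. (B, g) \<in> Z1 T F \<and> p = class1 T F (B, g)"
    using H1_set_refine p car by metis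
  obtain g0 where g0: "(C1, g0) \<in> Z1 T F" "p = class1 T F (C1, g0)"
    using C1(2)[OF C1(1) refines_id] by blast
  have gc: "g0 U V \<in> carrier (sec F (U \<inter> V))" "openin T (U \<inter> V)" if "U \<in> C1" "V \<in> C1" for U V
    using g0 that by (auto simp: Z1_iff open_cover_def openin_Int)
  note one = Z1_one[OF C1(1)] class1_one[OF C1(1)] and inv = Z1_inverse[OF g0(1)]
  have "class1 T F (C1, \<lambda>U V. \<one>\<^bsub>sec F (U \<inter> V)\<^esub> \<otimes>\<^bsub>sec F (U \<inter> V)\<^esub> g0 U V) = class1 T F (C1, g0)"
  proof (rule class1_cong(2)[OF g0(1)])
    fix U V assume UV: "U \<in> C1" "V \<in> C1"
    interpret Q: group "sec F (U \<inter> V)" using group_sec gc(2)[OF UV] .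
    show "\<one>\<^bsub>sec F (U \<inter> V)\<^esub> \<otimes>\<^bsub>sec F (U \<inter> V)\<^esub> g0 U V = g0 U V" using gc(1)[OF UV] by simp
  qed
  thus "\<one>\<^bsub>H1 T F\<^esub> \<otimes>\<^bsub>H1 T F\<^esub> p = p"
    using H1_mult_class1[OF one(1) g0(1)] one(2) g0(2) by simp
  have "class1 T F (C1, \<lambda>U V. inv\<^bsub>sec F (U \<inter> V)\<^esub> g0 U V \<otimes>\<^bsub>sec F (U \<inter> V)\<^esub> g0 U V) =
     class1 T F (C1, \<lambda>U V. \<one>\<^bsub>sec F (U \<inter> V)\<^esub>)"
  proof (rule class1_cong(2)[OF one(1)])
    fix U V assume UV: "U \<in> C1" "V \<in> C1"
    interpret Q: group "sec F (U \<inter> V)" using group_sec gc(2)[OF UV] .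
    show "inv\<^bsub>sec F (U \<inter> V)\<^esub> g0 U V \<otimes>\<^bsub>sec F (U \<inter> V)\<^esub> g0 U V = \<one>\<^bsub>sec F (U \<inter> V)\<^esub>" using gc(1)[OF UV] by simp
  qed
  hence "class1 T F (C1, \<lambda>U V. inv\<^bsub>sec F (U \<inter> V)\<^esub> g0 U V) \<otimes>\<^bsub>H1 T F\<^esub> p = \<one>\<^bsub>H1 T F\<^esub>"
    using H1_mult_class1[OF inv g0(1)] one(2) g0(2) by simp
  thus "\<exists>q\<in>carrier (H1 T F). q \<otimes>\<^bsub>H1 T F\<^esub> p = \<one>\<^bsub>H1 T F\<^esub>"
    using cl[OF inv] by blast
  fix q assume q: "q \<in> carrier (H1 T F)"
  obtain C2 where C2: "open_cover T C2"
    "\<And>B \<sigma>. open_cover T B \<Longrightarrow> refines \<sigma> B C2 \<Longrightarrow> \<exists>g. (B, g) \<in> Z1 T F \<and> q = class1 T F (B, g)"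
    using H1_set_refine q car by metis
  obtain B \<sigma> \<tau> where B: "open_cover T B" "refines \<sigma> B C1" "refines \<tau> B C2"
    by (rule common_refinement[OF C1(1) C2(1)])
  obtain g h where "(B, g) \<in> Z1 T F" "p = class1 T F (B, g)" "(B, h) \<in> Z1 T F" "q = class1 T F (B, h)"
    using C1(2)[OF B(1,2)] C2(2)[OF B(1,3)] by blast
  thus "p \<otimes>\<^bsub>H1 T F\<^esub> q \<in> carrier (H1 T F)"
    using H1_mult_class1 cl[OF Z1_mult] by simp
  fix r assume r: "r \<in> carrier (H1 T F)"
  obtain C3 where C3: "open_cover T C3"
    "\<And>B \<sigma>. open_cover T B \<Longrightarrow> refines \<sigma> B C3 \<Longrightarrow> \<exists>g. (B, g) \<in> Z1 T F \<and> r = class1 T F (B, g)"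
    using H1_set_refine r car by metis
  obtain A \<rho> \<upsilon> where A: "open_cover T A" "refines \<rho> A B" "refines \<upsilon> A C3"
    by (rule common_refinement[OF B(1) C3(1)])
  obtain a b c where a: "(A, a) \<in> Z1 T F" "p = class1 T F (A, a)" and b: "(A, b) \<in> Z1 T F" "q = class1 T F (A, b)"
    and c: "(A, c) \<in> Z1 T F" "r = class1 T F (A, c)"
    using C1(2)[OF A(1) refines_comp[OF B(2) A(2)]] C2(2)[OF A(1) refines_comp[OF B(3) A(2)]] C3(2)[OF A(1,3)] by blast
  have "class1 T F (A, \<lambda>U V. (a U V \<otimes>\<^bsub>sec F (U \<inter> V)\<^esub> b U V) \<otimes>\<^bsub>sec F (U \<inter> V)\<^esub> c U V) =
     class1 T F (A, \<lambda>U V. a U V \<otimes>\<^bsub>sec F (U \<inter> V)\<^esub> (b U V \<otimes>\<^bsub>sec F (U \<inter> V)\<^esub> c U V))"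
  proof (rule class1_cong(2)[OF Z1_mult[OF a(1) Z1_mult[OF b(1) c(1)]]])
    fix U V assume "U \<in> A" "V \<in> A"
    hence "openin T (U \<inter> V)" "a U V \<in> carrier (sec F (U \<inter> V))" "b U V \<in> carrier (sec F (U \<inter> V))"
      "c U V \<in> carrier (sec F (U \<inter> V))" using a b c by (auto simp: Z1_iff open_cover_def openin_Int)
    thus "(a U V \<otimes>\<^bsub>sec F (U \<inter> V)\<^esub> b U V) \<otimes>\<^bsub>sec F (U \<inter> V)\<^esub> c U V = a U V \<otimes>\<^bsub>sec F (U \<inter> V)\<^esub> (b U V \<otimes>\<^bsub>sec F (U \<inter> V)\<^esub> c U V)"
      using group.is_monoid[OF group_sec] monoid.m_assoc by metis
  qed
  thus "p \<otimes>\<^bsub>H1 T F\<^esub> q \<otimes>\<^bsub>H1 T F\<^esub> r = p \<otimes>\<^bsub>H1 T F\<^esub> (q \<otimes>\<^bsub>H1 T F\<^esub> r)"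
    unfolding a(2) b(2) c(2)
    using H1_mult_class1[OF a(1) b(1)] H1_mult_class1[OF b(1) c(1)] H1_mult_class1[OF Z1_mult[OF a(1) b(1)] c(1)]
      H1_mult_class1[OF a(1) Z1_mult[OF b(1) c(1)]] by simp
qed

end

subsection \<open>Functoriality\<close>

locale presheaf_morphism = dom: presheaf T F + cod: presheaf T F'
  for T :: "'x topology" and F :: "('x, 's) group_sheaf" and F' :: "('x, 't) group_sheaf" +
  fixes \<omega> :: "'x set \<Rightarrow> 's \<Rightarrow> 't"
  assumes mor_hom: "openin T U \<Longrightarrow> \<omega> U \<in> hom (sec F U) (sec F' U)"
    and mor_rest: "a \<in> carrier (sec F U) \<Longrightarrow> openin T U \<Longrightarrow> openin T V \<Longrightarrow> V \<subseteq> U \<Longrightarrow>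
      rest F' V (\<omega> U a) = \<omega> V (rest F V a)"
begin

lemma mor_closed: "a \<in> carrier (sec F U) \<Longrightarrow> openin T U \<Longrightarrow> \<omega> U a \<in> carrier (sec F' U)"
  using mor_hom unfolding hom_def by blast

lemma mor_mult:
  "a \<in> carrier (sec F U) \<Longrightarrow> b \<in> carrier (sec F U) \<Longrightarrow> openin T U \<Longrightarrow>
    \<omega> U (a \<otimes>\<^bsub>sec F U\<^esub> b) = \<omega> U a \<otimes>\<^bsub>sec F' U\<^esub> \<omega> U b"
  using mor_hom unfolding hom_def by blast

lemma mor_group_hom: "openin T U \<Longrightarrow> group_hom (sec F U) (sec F' U) (\<omega> U)"
  using dom.group_sec cod.group_sec mor_hom by (simp add: group_hom_def group_hom_axioms_def)

lemma mor_one: "openin T U \<Longrightarrow> \<omega> U \<one>\<^bsub>sec F U\<^esub> = \<one>\<^bsub>sec F' U\<^esub>"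
  using group_hom.hom_one[OF mor_group_hom] .

lemma mor_inv:
  "a \<in> carrier (sec F U) \<Longrightarrow> openin T U \<Longrightarrow> \<omega> U (inv\<^bsub>sec F U\<^esub> a) = inv\<^bsub>sec F' U\<^esub> (\<omega> U a)"
  using group_hom.hom_inv[OF mor_group_hom] .

lemma mor_Z1:
  assumes g: "(C, g) \<in> Z1 T F"
  shows "(C, \<lambda>U V. \<omega> (U \<inter> V) (g U V)) \<in> Z1 T F'"
  unfolding Z1_iff
proof (intro conjI ballI)
  show C: "open_cover T C" using dom.Z1_cover[OF g] .
  have gc: "g U V \<in> carrier (sec F (U \<inter> V))" "openin T (U \<inter> V)" if "U \<in> C" "V \<in> C" for U V
    using g that by (auto simp: Z1_iff open_cover_def openin_Int)
  fix U V assume UV: "U \<in> C" "V \<in> C"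
  show "\<omega> (U \<inter> V) (g U V) \<in> carrier (sec F' (U \<inter> V))" using mor_closed gc[OF UV] by blast
  fix W assume W: "W \<in> C"
  let ?Q = "U \<inter> V \<inter> W"
  have Q: "openin T ?Q" using gc(2)[OF UV] gc(2)[OF W W] by (auto intro: openin_Int)
  have m: "rest F' ?Q (\<omega> (Z \<inter> Y) (g Z Y)) = \<omega> ?Q (rest F ?Q (g Z Y))"
    if "Z \<in> C" "Y \<in> C" "?Q \<subseteq> Z \<inter> Y" for Z Y
    using mor_rest[OF gc[OF that(1,2)] Q that(3)] .
  have sub: "?Q \<subseteq> U \<inter> V" "?Q \<subseteq> V \<inter> W" "?Q \<subseteq> U \<inter> W" by auto
  show "rest F' ?Q (\<omega> (U \<inter> V) (g U V)) \<otimes>\<^bsub>sec F' ?Q\<^esub> rest F' ?Q (\<omega> (V \<inter> W) (g V W)) = rest F' ?Q (\<omega> (U \<inter> W) (g U W))"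
    unfolding m[OF UV sub(1)] m[OF UV(2) W sub(2)] m[OF UV(1) W sub(3)]
      dom.Z1_cocycle[OF g UV W Q order_refl, symmetric]
    by (rule mor_mult[OF dom.Z1_closed[OF g UV Q sub(1)] dom.Z1_closed[OF g UV(2) W Q sub(2)] Q, symmetric])
qed

lemma mor_cohomologous1:
  assumes g: "(C, g) \<in> Z1 T F" and h: "(D, h) \<in> Z1 T F" and coh: "cohomologous1 T F (C, g) (D, h)"
  shows "cohomologous1 T F' (C, \<lambda>U V. \<omega> (U \<inter> V) (g U V)) (D, \<lambda>U V. \<omega> (U \<inter> V) (h U V))"
proof -
  obtain A \<alpha> \<beta> k where A: "open_cover T A" "refines \<alpha> A C" "refines \<beta> A D"
    and k: "dom.gauge A k (\<lambda>U V. g (\<alpha> U) (\<alpha> V)) (\<lambda>U V. h (\<beta> U) (\<beta> V))"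
    by (rule dom.cohomologous1_gauge[OF g h coh])
  note kc = dom.gauge_closed[OF k]
  have "cod.gauge A (\<lambda>U. \<omega> U (k U)) (\<lambda>U V. \<omega> (\<alpha> U \<inter> \<alpha> V) (g (\<alpha> U) (\<alpha> V))) (\<lambda>U V. \<omega> (\<beta> U \<inter> \<beta> V) (h (\<beta> U) (\<beta> V)))"
    unfolding cod.gauge_def
  proof (intro conjI ballI allI impI)
    fix U assume U: "U \<in> A"
    note rU = open_coverD[OF A(1) U] refinesD[OF A(2) U] refinesD[OF A(3) U]
    show "\<omega> U (k U) \<in> carrier (sec F' U)" using mor_closed[OF kc[OF U] rU(1)] .
    fix V Q assume V: "V \<in> A" and Q: "openin T Q" "Q \<subseteq> U \<inter> V"
    note rV = open_coverD[OF A(1) V] refinesD[OF A(2) V] refinesD[OF A(3) V]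
    interpret Q: group "sec F Q" using dom.group_sec Q(1) .
    have QU: "Q \<subseteq> U" and QV: "Q \<subseteq> V" using Q by auto
    have sub: "Q \<subseteq> \<alpha> U \<inter> \<alpha> V" "Q \<subseteq> \<beta> U \<inter> \<beta> V" using QU QV rU rV by blast+
    have r: "rest F' Q (\<omega> (Z \<inter> Y) (a Z Y)) = \<omega> Q (rest F Q (a Z Y))"
      if "(E, a) \<in> Z1 T F" "Z \<in> E" "Y \<in> E" "Q \<subseteq> Z \<inter> Y" for E a Z Y
      using that Q by (intro mor_rest) (auto simp: Z1_iff open_cover_def openin_Int)
    have c: "rest F Q (k U) \<in> carrier (sec F Q)" "rest F Q (k V) \<in> carrier (sec F Q)"
      "rest F Q (g (\<alpha> U) (\<alpha> V)) \<in> carrier (sec F Q)"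
      using dom.rest_closed[OF kc[OF U] rU(1) Q(1) QU] dom.rest_closed[OF kc[OF V] rV(1) Q(1) QV]
        dom.Z1_closed[OF g rU(2) rV(2) Q(1) sub(1)] by auto
    show "rest F' Q (\<omega> (\<beta> U \<inter> \<beta> V) (h (\<beta> U) (\<beta> V))) = inv\<^bsub>sec F' Q\<^esub> rest F' Q (\<omega> U (k U)) \<otimes>\<^bsub>sec F' Q\<^esub>
       rest F' Q (\<omega> (\<alpha> U \<inter> \<alpha> V) (g (\<alpha> U) (\<alpha> V))) \<otimes>\<^bsub>sec F' Q\<^esub> rest F' Q (\<omega> V (k V))"
      unfolding r[OF h rU(4) rV(4) sub(2)] r[OF g rU(2) rV(2) sub(1)] mor_rest[OF kc[OF U] rU(1) Q(1) QU]
        mor_rest[OF kc[OF V] rV(1) Q(1) QV] dom.gauge_eq[OF k U V Q]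
      using c Q(1) by (simp add: mor_mult mor_inv)
  qed
  thus ?thesis by (intro cod.gauge_cohomologous1[OF A])
qed

lemma H1_map_class1:
  assumes g: "(C, g) \<in> Z1 T F"
  shows "H1_map T F' \<omega> (class1 T F (C, g)) = class1 T F' (C, \<lambda>U V. \<omega> (U \<inter> V) (g U V))"
proof -
  have "class1 T F' (D, \<lambda>U V. \<omega> (U \<inter> V) (h U V)) = class1 T F' (C, \<lambda>U V. \<omega> (U \<inter> V) (g U V))"
    if "(D, h) \<in> class1 T F (C, g)" for D h
  proof -
    have h: "(D, h) \<in> Z1 T F" "cohomologous1 T F (C, g) (D, h)" using that by (auto simp: class1_def)
    show ?thesis using mor_cohomologous1[OF g h] cod.class1_eq_iff[OF mor_Z1[OF g] mor_Z1[OF h(1)]] by simp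
  qed
  moreover have "(C, g) \<in> class1 T F (C, g)" using dom.class1_self[OF g] .
  ultimately show ?thesis unfolding H1_map_def by blast
qed

end

section \<open>Quotients of sheaves of groups\<close>

subsection \<open>Stalks\<close>

context presheaf
begin

lemma germ_eq_iff:
  assumes a: "openin T U" "x \<in> U" "a \<in> carrier (sec F U)"
    and b: "openin T V" "x \<in> V" "b \<in> carrier (sec F V)"
  shows "germ T F x U a = germ T F x V b \<longleftrightarrow>
    (\<exists>W. openin T W \<and> x \<in> W \<and> W \<subseteq> U \<inter> V \<and> rest F W a = rest F W b)"
proof
  assume "germ T F x U a = germ T F x V b"
  moreover have "(V, b) \<in> germ T F x V b" using b unfolding germ_def by auto
  ultimately have "(V, b) \<in> germ T F x U a" by simp
  thus "\<exists>W. openin T W \<and> x \<in> W \<and> W \<subseteq> U \<inter> V \<and> rest F W a = rest F W b"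
    unfolding germ_def by auto
next
  have sub: "germ T F x U' a' \<subseteq> germ T F x V' b'"
    if W: "openin T W" "x \<in> W" "W \<subseteq> U' \<inter> V'" "rest F W a' = rest F W b'"
      and a': "openin T U'" "a' \<in> carrier (sec F U')" and b': "openin T V'" "b' \<in> carrier (sec F V')"
    for U' V' W a' b'
  proof
    fix p assume "p \<in> germ T F x U' a'"
    then obtain C c W' where p: "p = (C, c)" "openin T C" "x \<in> C" "c \<in> carrier (sec F C)"
      and W': "openin T W'" "x \<in> W'" "W' \<subseteq> U' \<inter> C" "rest F W' a' = rest F W' c"
      unfolding germ_def by blast
    let ?P = "W \<inter> W'"
    have op: "openin T ?P" using W W' by auto
    have "rest F ?P a' = rest F ?P b'"
      using rest_rest[OF a'(2,1) W(1) op] rest_rest[OF b'(2,1) W(1) op] W by auto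
    moreover have "rest F ?P a' = rest F ?P c"
      using rest_rest[OF a'(2,1) W'(1) op] rest_rest[OF p(4,2) W'(1) op] W' by auto
    ultimately have "rest F ?P b' = rest F ?P c" by simp
    moreover have "x \<in> ?P" "?P \<subseteq> V' \<inter> C" using W W' by auto
    ultimately show "p \<in> germ T F x V' b'" unfolding germ_def p(1) using op p by blast
  qed
  assume "\<exists>W. openin T W \<and> x \<in> W \<and> W \<subseteq> U \<inter> V \<and> rest F W a = rest F W b"
  then obtain W where W: "openin T W" "x \<in> W" "W \<subseteq> U \<inter> V" "rest F W a = rest F W b" by blast
  hence W': "W \<subseteq> V \<inter> U" "rest F W b = rest F W a" by auto
  show "germ T F x U a = germ T F x V b"
    using sub[OF W a(1,3) b(1,3)] sub[OF W(1,2) W' b(1,3) a(1,3)] by blast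
qed

lemma germ_rest:
  assumes "openin T U" "a \<in> carrier (sec F U)" "openin T V" "x \<in> V" "V \<subseteq> U"
  shows "germ T F x V (rest F V a) = germ T F x U a"
proof -
  have "rest F V (rest F V a) = rest F V a" using rest_rest[OF assms(2,1,3,3)] assms by simp
  thus ?thesis using assms rest_closed[OF assms(2,1,3,5)]
    by (subst germ_eq_iff) auto
qed

lemma stalk_carrierI:
  "openin T U \<Longrightarrow> x \<in> U \<Longrightarrow> a \<in> carrier (sec F U) \<Longrightarrow> germ T F x U a \<in> carrier (stalk T F x)"
  unfolding stalk_def by auto

lemma stalk_carrierE:
  assumes "p \<in> carrier (stalk T F x)"
  obtains U a where "openin T U" "x \<in> U" "a \<in> carrier (sec F U)" "p = germ T F x U a"
  using assms unfolding stalk_def by auto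

text \<open>The product in the stalk is a union over all pairs of representatives; it is a germ because all of them
  give the same one.\<close>

lemma stalk_mult:
  assumes a: "openin T U" "x \<in> U" "a \<in> carrier (sec F U)" and b: "b \<in> carrier (sec F U)"
  shows "germ T F x U a \<otimes>\<^bsub>stalk T F x\<^esub> germ T F x U b = germ T F x U (a \<otimes>\<^bsub>sec F U\<^esub> b)"
proof -
  interpret U: group "sec F U" using group_sec a(1) .
  have "germ T F x (V \<inter> V') (rest F (V \<inter> V') c \<otimes>\<^bsub>sec F (V \<inter> V')\<^esub> rest F (V \<inter> V') c') = germ T F x U (a \<otimes>\<^bsub>sec F U\<^esub> b)"
    if c: "(V, c) \<in> germ T F x U a" and c': "(V', c') \<in> germ T F x U b" for V V' c c'
  proof -
    obtain W where V: "openin T V" "x \<in> V" "c \<in> carrier (sec F V)"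
      and W: "openin T W" "x \<in> W" "W \<subseteq> U \<inter> V" "rest F W a = rest F W c"
      using c unfolding germ_def by blast
    obtain W' where V': "openin T V'" "x \<in> V'" "c' \<in> carrier (sec F V')"
      and W': "openin T W'" "x \<in> W'" "W' \<subseteq> U \<inter> V'" "rest F W' b = rest F W' c'"
      using c' unfolding germ_def by blast
    let ?P = "W \<inter> W'" and ?V = "V \<inter> V'"
    have op: "openin T ?P" "openin T ?V" using W W' V V' by auto
    interpret V: group "sec F ?V" using group_sec op(2) .
    have cc: "rest F ?V c \<in> carrier (sec F ?V)" "rest F ?V c' \<in> carrier (sec F ?V)"
      using rest_closed[OF V(3,1) op(2)] rest_closed[OF V'(3,1) op(2)] by auto
    have sub: "?P \<subseteq> W" "W \<subseteq> U" "W \<subseteq> V" "?P \<subseteq> W'" "W' \<subseteq> U" "W' \<subseteq> V'" "?P \<subseteq> ?V" "?V \<subseteq> V" "?V \<subseteq> V'" "?P \<subseteq> U"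
      using W W' by auto
    have e1: "rest F ?P a = rest F ?P (rest F ?V c)"
      using rest_rest[OF a(3,1) W(1) op(1) sub(1,2)] rest_rest[OF V(3,1) W(1) op(1) sub(1,3)]
        rest_rest[OF V(3,1) op(2,1) sub(7,8)] W(4) by simp
    have e2: "rest F ?P b = rest F ?P (rest F ?V c')"
      using rest_rest[OF b a(1) W'(1) op(1) sub(4,5)] rest_rest[OF V'(3,1) W'(1) op(1) sub(4,6)]
        rest_rest[OF V'(3,1) op(2,1) sub(7,9)] W'(4) by simp
    have "rest F ?P (rest F ?V c \<otimes>\<^bsub>sec F ?V\<^esub> rest F ?V c') = rest F ?P (a \<otimes>\<^bsub>sec F U\<^esub> b)"
      unfolding rest_mult[OF cc op(2,1) sub(7)] rest_mult[OF a(3) b a(1) op(1) sub(10)] e1 e2 ..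
    moreover have "?P \<subseteq> ?V \<inter> U" "x \<in> ?P" using W W' by auto
    ultimately show ?thesis
      using op a b cc V(2) V'(2) by (subst germ_eq_iff) auto
  qed
  moreover have "(U, a) \<in> germ T F x U a" "(U, b) \<in> germ T F x U b" using a b unfolding germ_def by auto
  moreover have "germ T F x U a \<otimes>\<^bsub>stalk T F x\<^esub> germ T F x U b = (\<Union>(V, c)\<in>germ T F x U a. \<Union>(V', c')\<in>germ T F x U b.
     germ T F x (V \<inter> V') (rest F (V \<inter> V') c \<otimes>\<^bsub>sec F (V \<inter> V')\<^esub> rest F (V \<inter> V') c'))"
    by (simp add: stalk_def)
  ultimately show ?thesis by (auto simp: split_beta)
qed

lemma common_nbhd:
  assumes "p \<in> carrier (stalk T F x)" "q \<in> carrier (stalk T F x)"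
  obtains U a b where "openin T U" "x \<in> U" "a \<in> carrier (sec F U)" "b \<in> carrier (sec F U)"
    "p = germ T F x U a" "q = germ T F x U b"
proof -
  obtain U a where U: "openin T U" "x \<in> U" "a \<in> carrier (sec F U)" "p = germ T F x U a"
    using stalk_carrierE[OF assms(1)] .
  obtain V b where V: "openin T V" "x \<in> V" "b \<in> carrier (sec F V)" "q = germ T F x V b"
    using stalk_carrierE[OF assms(2)] .
  have op: "openin T (U \<inter> V)" "x \<in> U \<inter> V" "U \<inter> V \<subseteq> U" "U \<inter> V \<subseteq> V" using U V by auto
  show ?thesis
    using that[OF op(1,2) rest_closed[OF U(3,1) op(1,3)] rest_closed[OF V(3,1) op(1,4)]]
      germ_rest[OF U(1,3) op(1,2,3)] germ_rest[OF V(1,3) op(1,2,4)] U(4) V(4) by simp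
qed

lemma stalk_one:
  assumes "openin T U" "x \<in> U"
  shows "\<one>\<^bsub>stalk T F x\<^esub> = germ T F x U \<one>\<^bsub>sec F U\<^esub>"
proof -
  have U: "U \<subseteq> topspace T" using assms openin_subset by blast
  interpret X: group "sec F (topspace T)" using group_sec by simp
  have "germ T F x U (rest F U \<one>\<^bsub>sec F (topspace T)\<^esub>) = germ T F x (topspace T) \<one>\<^bsub>sec F (topspace T)\<^esub>"
    by (rule germ_rest[OF _ _ assms U]) auto
  thus ?thesis using rest_one[OF _ assms(1) U] by (simp add: stalk_def)
qed

lemma group_stalk: assumes x: "x \<in> topspace T" shows "group (stalk T F x)"
proof (rule groupI)
  interpret X: group "sec F (topspace T)" using group_sec by simp
  show "\<one>\<^bsub>stalk T F x\<^esub> \<in> carrier (stalk T F x)"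
    using x by (auto simp: stalk_one[of "topspace T"] intro: stalk_carrierI)
  fix p assume p: "p \<in> carrier (stalk T F x)"
  obtain U a where U: "openin T U" "x \<in> U" "a \<in> carrier (sec F U)" "p = germ T F x U a"
    using stalk_carrierE[OF p] .
  interpret U: group "sec F U" using group_sec U(1) .
  show "\<one>\<^bsub>stalk T F x\<^esub> \<otimes>\<^bsub>stalk T F x\<^esub> p = p"
    using U by (simp add: stalk_one[OF U(1,2)] stalk_mult)
  have "germ T F x U (inv\<^bsub>sec F U\<^esub> a) \<otimes>\<^bsub>stalk T F x\<^esub> p = \<one>\<^bsub>stalk T F x\<^esub>"
    using U by (simp add: stalk_one[OF U(1,2)] stalk_mult)
  thus "\<exists>q\<in>carrier (stalk T F x). q \<otimes>\<^bsub>stalk T F x\<^esub> p = \<one>\<^bsub>stalk T F x\<^esub>"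
    using U stalk_carrierI[OF U(1,2), of "inv\<^bsub>sec F U\<^esub> a"] by auto
  fix q assume q: "q \<in> carrier (stalk T F x)"
  obtain V a b where V: "openin T V" "x \<in> V" "a \<in> carrier (sec F V)" "b \<in> carrier (sec F V)"
    "p = germ T F x V a" "q = germ T F x V b" using common_nbhd[OF p q] .
  interpret V: group "sec F V" using group_sec V(1) .
  show pq: "p \<otimes>\<^bsub>stalk T F x\<^esub> q \<in> carrier (stalk T F x)"
    using V by (simp add: stalk_mult stalk_carrierI)
  fix r assume r: "r \<in> carrier (stalk T F x)"
  obtain W c where W: "openin T W" "x \<in> W" "c \<in> carrier (sec F W)" "r = germ T F x W c"
    using stalk_carrierE[OF r] .
  let ?Q = "V \<inter> W"
  have Q: "openin T ?Q" "x \<in> ?Q" "?Q \<subseteq> V" "?Q \<subseteq> W" using V W by auto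
  interpret Q: group "sec F ?Q" using group_sec Q(1) .
  have *: "p = germ T F x ?Q (rest F ?Q a)" "q = germ T F x ?Q (rest F ?Q b)" "r = germ T F x ?Q (rest F ?Q c)"
    using germ_rest[OF V(1,3) Q(1-3)] germ_rest[OF V(1,4) Q(1-3)] germ_rest[OF W(1,3) Q(1,2,4)] V W by auto
  have "rest F ?Q a \<in> carrier (sec F ?Q)" "rest F ?Q b \<in> carrier (sec F ?Q)" "rest F ?Q c \<in> carrier (sec F ?Q)"
    using rest_closed[OF V(3,1) Q(1,3)] rest_closed[OF V(4,1) Q(1,3)] rest_closed[OF W(3,1) Q(1,4)] by auto
  thus "p \<otimes>\<^bsub>stalk T F x\<^esub> q \<otimes>\<^bsub>stalk T F x\<^esub> r = p \<otimes>\<^bsub>stalk T F x\<^esub> (q \<otimes>\<^bsub>stalk T F x\<^esub> r)"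
    unfolding * using Q by (simp add: stalk_mult Q.m_assoc)
qed

lemma germ_group_hom:
  assumes "openin T U" "x \<in> U" shows "group_hom (sec F U) (stalk T F x) (germ T F x U)"
proof -
  have "x \<in> topspace T" using assms openin_subset by blast
  thus ?thesis
    using assms group_sec group_stalk stalk_mult stalk_carrierI
    by (auto simp: group_hom_def group_hom_axioms_def hom_def)
qed

lemma germ_inv:
  "openin T U \<Longrightarrow> x \<in> U \<Longrightarrow> a \<in> carrier (sec F U) \<Longrightarrow>
    inv\<^bsub>stalk T F x\<^esub> (germ T F x U a) = germ T F x U (inv\<^bsub>sec F U\<^esub> a)"
  using group_hom.hom_inv[OF germ_group_hom] by metis

end

text \<open>The locality axiom \<open>local_mem\<close> is what identifies the kernel of the map to the quotient sheaf with the
  sections of \<open>N\<close>: that kernel consists of the sections whose germs lie in the stalks of \<open>N\<close>.\<close>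

locale normal_subsheaf = presheaf T F for T :: "'x topology" and F :: "('x, 's) group_sheaf" +
  fixes N :: "('x, 's) group_sheaf"
  assumes sec_N: "sec N U = (sec F U)\<lparr>carrier := carrier (sec N U)\<rparr>"
    and rest_N: "rest N = rest F"
    and normal_sec: "openin T U \<Longrightarrow> carrier (sec N U) \<lhd> sec F U"
    and rest_mem: "a \<in> carrier (sec N U) \<Longrightarrow> openin T U \<Longrightarrow> openin T V \<Longrightarrow> V \<subseteq> U \<Longrightarrow>
      rest F V a \<in> carrier (sec N V)"
    and local_mem: "a \<in> carrier (sec F U) \<Longrightarrow> openin T U \<Longrightarrow>
      (\<And>x. x \<in> U \<Longrightarrow> \<exists>W. openin T W \<and> x \<in> W \<and> W \<subseteq> U \<and> rest F W a \<in> carrier (sec N W)) \<Longrightarrow>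
      a \<in> carrier (sec N U)"
begin

lemma subgroup_sec: "openin T U \<Longrightarrow> subgroup (carrier (sec N U)) (sec F U)"
  using normal_sec normal_imp_subgroup by blast

lemma sec_subset: "openin T U \<Longrightarrow> a \<in> carrier (sec N U) \<Longrightarrow> a \<in> carrier (sec F U)"
  using subgroup_sec subgroup.mem_carrier by metis

lemma mult_sec [simp]: "monoid.mult (sec N U) = monoid.mult (sec F U)"
  by (subst sec_N) simp

lemma one_sec [simp]: "\<one>\<^bsub>sec N U\<^esub> = \<one>\<^bsub>sec F U\<^esub>"
  by (subst sec_N) simp

lemma inv_sec: "openin T U \<Longrightarrow> a \<in> carrier (sec N U) \<Longrightarrow> inv\<^bsub>sec N U\<^esub> a = inv\<^bsub>sec F U\<^esub> a"
  by (subst sec_N) (rule group.m_inv_consistent[OF group_sec subgroup_sec])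

lemma presheaf_N: "presheaf T N"
proof (rule presheaf.intro)
  fix U assume U: "openin T U"
  show "group (sec N U)"
    by (subst sec_N) (rule subgroup.subgroup_is_group[OF subgroup_sec[OF U] group_sec[OF U]])
  {
    fix V assume V: "openin T V" "V \<subseteq> U"
    show "rest N V \<in> hom (sec N U) (sec N V)"
      using rest_mem[OF _ U V] rest_mult[OF sec_subset[OF U] sec_subset[OF U] U V]
      by (auto simp: hom_def rest_N)
  }
  fix a assume a: "a \<in> carrier (sec N U)"
  show "rest N U a = a" using rest_id[OF U sec_subset[OF U a]] by (simp add: rest_N)
  fix V W assume "openin T V" "openin T W" "W \<subseteq> V" "V \<subseteq> U"
  thus "rest N W (rest N V a) = rest N W a" using rest_rest[OF sec_subset[OF U a] U] by (simp add: rest_N)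
qed

lemma substalk_iff:
  assumes a: "openin T U" "x \<in> U" "a \<in> carrier (sec F U)"
  shows "germ T F x U a \<in> substalk T F N x \<longleftrightarrow>
    (\<exists>W. openin T W \<and> x \<in> W \<and> W \<subseteq> U \<and> rest F W a \<in> carrier (sec N W))"
proof
  assume "germ T F x U a \<in> substalk T F N x"
  then obtain V b where V: "openin T V" "x \<in> V" "b \<in> carrier (sec N V)" "germ T F x U a = germ T F x V b"
    unfolding substalk_def by blast
  then obtain W where "openin T W" "x \<in> W" "W \<subseteq> U \<inter> V" "rest F W a = rest F W b"
    using germ_eq_iff[OF a V(1,2) sec_subset[OF V(1,3)]] by blast
  thus "\<exists>W. openin T W \<and> x \<in> W \<and> W \<subseteq> U \<and> rest F W a \<in> carrier (sec N W)"
    using rest_mem[OF V(3,1), of W] by (intro exI[of _ W]) auto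
next
  assume "\<exists>W. openin T W \<and> x \<in> W \<and> W \<subseteq> U \<and> rest F W a \<in> carrier (sec N W)"
  then obtain W where W: "openin T W" "x \<in> W" "W \<subseteq> U" "rest F W a \<in> carrier (sec N W)" by blast
  have "germ T F x U a = germ T F x W (rest F W a)" using germ_rest[OF a(1,3) W(1-3)] by simp
  thus "germ T F x U a \<in> substalk T F N x" using W unfolding substalk_def by blast
qed

lemma substalkI:
  assumes "openin T U" "x \<in> U" "a \<in> carrier (sec N U)" shows "germ T F x U a \<in> substalk T F N x"
  using assms unfolding substalk_def by blast

lemma substalkE:
  assumes "p \<in> substalk T F N x"
  obtains U a where "openin T U" "x \<in> U" "a \<in> carrier (sec N U)" "p = germ T F x U a"
  using assms unfolding substalk_def by blast

lemma substalk_subset: "substalk T F N x \<subseteq> carrier (stalk T F x)"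
  using sec_subset stalk_carrierI by (auto elim!: substalkE)

lemma normal_substalk:
  assumes x: "x \<in> topspace T" shows "substalk T F N x \<lhd> stalk T F x"
proof -
  interpret S: group "stalk T F x" using group_stalk x .
  have "subgroup (substalk T F N x) (stalk T F x)"
  proof
    show "substalk T F N x \<subseteq> carrier (stalk T F x)" by (rule substalk_subset)
    show "\<one>\<^bsub>stalk T F x\<^esub> \<in> substalk T F N x"
      using x subgroup.one_closed[OF subgroup_sec[OF openin_topspace]]
      by (auto simp: stalk_one[of "topspace T"] intro: substalkI)
    fix p assume p: "p \<in> substalk T F N x"
    obtain U a where U: "openin T U" "x \<in> U" "a \<in> carrier (sec N U)" "p = germ T F x U a"
      using substalkE[OF p] .
    show "inv\<^bsub>stalk T F x\<^esub> p \<in> substalk T F N x"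
      unfolding U(4) germ_inv[OF U(1,2) sec_subset[OF U(1,3)]]
      using U subgroup.m_inv_closed[OF subgroup_sec[OF U(1)] U(3)] by (intro substalkI)
    fix q assume q: "q \<in> substalk T F N x"
    obtain V b where V: "openin T V" "x \<in> V" "b \<in> carrier (sec N V)" "q = germ T F x V b"
      using substalkE[OF q] .
    let ?Q = "U \<inter> V"
    have Q: "openin T ?Q" "x \<in> ?Q" "?Q \<subseteq> U" "?Q \<subseteq> V" using U V by auto
    have r: "rest F ?Q a \<in> carrier (sec N ?Q)" "rest F ?Q b \<in> carrier (sec N ?Q)"
      using rest_mem[OF U(3,1) Q(1,3)] rest_mem[OF V(3,1) Q(1,4)] by auto
    have "p \<otimes>\<^bsub>stalk T F x\<^esub> q = germ T F x ?Q (rest F ?Q a \<otimes>\<^bsub>sec F ?Q\<^esub> rest F ?Q b)"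
      using stalk_mult[OF Q(1,2) sec_subset[OF Q(1) r(1)] sec_subset[OF Q(1) r(2)]]
        germ_rest[OF U(1) sec_subset[OF U(1,3)] Q(1-3)] germ_rest[OF V(1) sec_subset[OF V(1,3)] Q(1,2,4)] U V by simp
    thus "p \<otimes>\<^bsub>stalk T F x\<^esub> q \<in> substalk T F N x"
      using substalkI[OF Q(1,2) subgroup.m_closed[OF subgroup_sec[OF Q(1)] r]] by simp
  qed
  moreover have "q \<otimes>\<^bsub>stalk T F x\<^esub> p \<otimes>\<^bsub>stalk T F x\<^esub> inv\<^bsub>stalk T F x\<^esub> q \<in> substalk T F N x"
    if q: "q \<in> carrier (stalk T F x)" and p: "p \<in> substalk T F N x" for p q
  proof -
    obtain U a where U: "openin T U" "x \<in> U" "a \<in> carrier (sec N U)" "p = germ T F x U a"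
      using substalkE[OF p] .
    obtain V b where V: "openin T V" "x \<in> V" "b \<in> carrier (sec F V)" "q = germ T F x V b"
      using stalk_carrierE[OF q] .
    let ?Q = "U \<inter> V"
    have Q: "openin T ?Q" "x \<in> ?Q" "?Q \<subseteq> U" "?Q \<subseteq> V" using U V by auto
    interpret Q: group "sec F ?Q" using group_sec Q(1) .
    have r: "rest F ?Q a \<in> carrier (sec N ?Q)" "rest F ?Q b \<in> carrier (sec F ?Q)"
      using rest_mem[OF U(3,1) Q(1,3)] rest_closed[OF V(3,1) Q(1,4)] by auto
    have "q \<otimes>\<^bsub>stalk T F x\<^esub> p \<otimes>\<^bsub>stalk T F x\<^esub> inv\<^bsub>stalk T F x\<^esub> q =
       germ T F x ?Q (rest F ?Q b \<otimes>\<^bsub>sec F ?Q\<^esub> rest F ?Q a \<otimes>\<^bsub>sec F ?Q\<^esub> inv\<^bsub>sec F ?Q\<^esub> rest F ?Q b)"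
      using germ_rest[OF U(1) sec_subset[OF U(1,3)] Q(1-3), symmetric] germ_rest[OF V(1,3) Q(1,2,4), symmetric] U V
        r sec_subset[OF Q(1) r(1)] Q by (simp add: stalk_mult germ_inv)
    thus ?thesis
      using substalkI[OF Q(1,2) normal.inv_op_closed2[OF normal_sec[OF Q(1)] r(2,1)]] by simp
  qed
  ultimately show ?thesis unfolding S.normal_inv_iff by blast
qed

lemma group_Mod: "x \<in> topspace T \<Longrightarrow> group (stalk T F x Mod substalk T F N x)"
  using normal.factorgroup_is_group[OF normal_substalk] .

text \<open>Equality of the cosets at a point gives membership in \<open>N\<close> over a neighbourhood of this point, and locality
  combines these neighbourhoods.\<close>

lemma quot_map_eq_iff:
  assumes U: "openin T U" and a: "a \<in> carrier (sec F U)" and b: "b \<in> carrier (sec F U)"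
  shows "quot_map T F N U a = quot_map T F N U b \<longleftrightarrow> a \<otimes>\<^bsub>sec F U\<^esub> inv\<^bsub>sec F U\<^esub> b \<in> carrier (sec N U)"
proof -
  interpret U: group "sec F U" using group_sec U .
  have c: "a \<otimes>\<^bsub>sec F U\<^esub> inv\<^bsub>sec F U\<^esub> b \<in> carrier (sec F U)" using a b by simp
  have *: "substalk T F N x #>\<^bsub>stalk T F x\<^esub> germ T F x U a = substalk T F N x #>\<^bsub>stalk T F x\<^esub> germ T F x U b \<longleftrightarrow>
     (\<exists>W. openin T W \<and> x \<in> W \<and> W \<subseteq> U \<and> rest F W (a \<otimes>\<^bsub>sec F U\<^esub> inv\<^bsub>sec F U\<^esub> b) \<in> carrier (sec N W))"
    if x: "x \<in> U" for x
  proof -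
    have xt: "x \<in> topspace T" using x U openin_subset by blast
    interpret S: group "stalk T F x" using group_stalk xt .
    interpret N: normal "substalk T F N x" "stalk T F x" using normal_substalk xt .
    have ga: "germ T F x U a \<in> carrier (stalk T F x)" "germ T F x U b \<in> carrier (stalk T F x)"
      using stalk_carrierI U x a b by auto
    have "substalk T F N x #>\<^bsub>stalk T F x\<^esub> germ T F x U a = substalk T F N x #>\<^bsub>stalk T F x\<^esub> germ T F x U b \<longleftrightarrow>
       germ T F x U a \<in> substalk T F N x #>\<^bsub>stalk T F x\<^esub> germ T F x U b"
      using S.repr_independence[OF _ ga(2) N.subgroup_axioms] S.rcos_self[OF ga(1) N.subgroup_axioms] by metis
    also have "\<dots> \<longleftrightarrow> germ T F x U a \<otimes>\<^bsub>stalk T F x\<^esub> inv\<^bsub>stalk T F x\<^esub> germ T F x U b \<in> substalk T F N x"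
      using N.rcos_module[OF S.is_group ga(2,1)] .
    also have "\<dots> \<longleftrightarrow> germ T F x U (a \<otimes>\<^bsub>sec F U\<^esub> inv\<^bsub>sec F U\<^esub> b) \<in> substalk T F N x"
      using a b by (simp add: germ_inv[OF U x b] stalk_mult[OF U x])
    finally show ?thesis unfolding substalk_iff[OF U x c] .
  qed
  show ?thesis
  proof
    assume L: "quot_map T F N U a = quot_map T F N U b"
    have "substalk T F N x #>\<^bsub>stalk T F x\<^esub> germ T F x U a = substalk T F N x #>\<^bsub>stalk T F x\<^esub> germ T F x U b" if "x \<in> U" for x
      using fun_cong[OF L, of x] that by (simp add: quot_map_def)
    with * show "a \<otimes>\<^bsub>sec F U\<^esub> inv\<^bsub>sec F U\<^esub> b \<in> carrier (sec N U)" by (intro local_mem[OF c U]) blast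
  next
    assume R: "a \<otimes>\<^bsub>sec F U\<^esub> inv\<^bsub>sec F U\<^esub> b \<in> carrier (sec N U)"
    have "rest F U (a \<otimes>\<^bsub>sec F U\<^esub> inv\<^bsub>sec F U\<^esub> b) \<in> carrier (sec N U)" using rest_id[OF U c] R by simp
    with * U have "substalk T F N x #>\<^bsub>stalk T F x\<^esub> germ T F x U a = substalk T F N x #>\<^bsub>stalk T F x\<^esub> germ T F x U b" if "x \<in> U" for x
      using that by blast
    thus "quot_map T F N U a = quot_map T F N U b" unfolding quot_map_def by (intro restrict_ext)
  qed
qed

lemma quot_map_mult:
  assumes U: "openin T U" and x: "x \<in> U" and a: "a \<in> carrier (sec F U)" and b: "b \<in> carrier (sec F U)"
  shows "quot_map T F N U a x <#>\<^bsub>stalk T F x\<^esub> quot_map T F N U b x = quot_map T F N U (a \<otimes>\<^bsub>sec F U\<^esub> b) x"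
proof -
  have xt: "x \<in> topspace T" using x U openin_subset by blast
  interpret N: normal "substalk T F N x" "stalk T F x" using normal_substalk xt .
  have ga: "germ T F x U a \<in> carrier (stalk T F x)" "germ T F x U b \<in> carrier (stalk T F x)"
    using stalk_carrierI U x a b by auto
  show ?thesis using x N.rcos_sum[OF ga] stalk_mult[OF U x a b] by (simp add: quot_map_def)
qed

lemma quot_map_rest:
  assumes U: "openin T U" and V: "openin T V" "V \<subseteq> U" and a: "a \<in> carrier (sec F U)"
  shows "quot_map T F N V (rest F V a) = restrict (quot_map T F N U a) V"
  unfolding quot_map_def using germ_rest[OF U a V(1) _ V(2)] V(2) by (intro ext) (auto simp: restrict_def)

lemma quot_map_in_Mod:
  assumes U: "openin T U" and x: "x \<in> U" and a: "a \<in> carrier (sec F U)"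
  shows "quot_map T F N U a x \<in> carrier (stalk T F x Mod substalk T F N x)"
  using x stalk_carrierI[OF U x a] by (auto simp: quot_map_def carrier_FactGroup)

lemma quot_map_one:
  assumes U: "openin T U" and x: "x \<in> U"
  shows "quot_map T F N U \<one>\<^bsub>sec F U\<^esub> x = substalk T F N x"
proof -
  have xt: "x \<in> topspace T" using x U openin_subset by blast
  interpret S: group "stalk T F x" using group_stalk xt .
  show ?thesis using x by (simp add: quot_map_def stalk_one[OF U x, symmetric] substalk_subset)
qed

end

subsection \<open>Quotient sheaves\<close>

locale quotient_sheaf = G: normal_subsheaf T F G + N: normal_subsheaf T F N
  for T :: "'x topology" and F :: "('x, 's) group_sheaf" and G N
begin

abbreviation Q where "Q \<equiv> quot_sheaf T F G N"

lemma rest_Q: "rest Q V s = restrict s V"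
  by (simp add: quot_sheaf_def)

lemma mult_Q: "monoid.mult (sec Q U) = (\<lambda>s t. \<lambda>x\<in>U. s x <#>\<^bsub>stalk T F x\<^esub> t x)"
  by (simp add: quot_sheaf_def)

lemma one_Q: "\<one>\<^bsub>sec Q U\<^esub> = (\<lambda>x\<in>U. substalk T F N x)"
  by (simp add: quot_sheaf_def)

lemma sec_Q_extensional: "s \<in> carrier (sec Q U) \<Longrightarrow> s \<in> extensional U"
  by (simp add: quot_sheaf_def)

lemma sec_Q_local:
  assumes "s \<in> carrier (sec Q U)" "x \<in> U"
  obtains V a where "openin T V" "x \<in> V" "V \<subseteq> U" "a \<in> carrier (sec G V)" "restrict s V = quot_map T F N V a"
proof -
  obtain V a where V: "openin T V" "x \<in> V" "V \<subseteq> U" "a \<in> carrier (sec G V)" "\<forall>y\<in>V. s y = quot_map T F N V a y"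
    using assms unfolding quot_sheaf_def by auto
  have "restrict s V = quot_map T F N V a"
    using V(5) by (intro extensionalityI[of _ V]) (auto simp: quot_map_def)
  with V that show ?thesis by blast
qed

lemma sec_Q_local2:
  assumes U: "openin T U" and s: "s \<in> carrier (sec Q U)" "t \<in> carrier (sec Q U)" and x: "x \<in> U"
  obtains V a b where "openin T V" "x \<in> V" "V \<subseteq> U" "a \<in> carrier (sec G V)" "restrict s V = quot_map T F N V a"
    "b \<in> carrier (sec G V)" "restrict t V = quot_map T F N V b"
proof -
  obtain V a where V: "openin T V" "x \<in> V" "V \<subseteq> U" "a \<in> carrier (sec G V)" "restrict s V = quot_map T F N V a"
    using sec_Q_local[OF s(1) x] .
  obtain W b where W: "openin T W" "x \<in> W" "W \<subseteq> U" "b \<in> carrier (sec G W)" "restrict t W = quot_map T F N W b"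
    using sec_Q_local[OF s(2) x] .
  let ?P = "V \<inter> W"
  have P: "openin T ?P" "x \<in> ?P" "?P \<subseteq> U" "?P \<subseteq> V" "?P \<subseteq> W" using V W by auto
  have "restrict s ?P = quot_map T F N ?P (rest F ?P a)" "restrict t ?P = quot_map T F N ?P (rest F ?P b)"
    using N.quot_map_rest[OF V(1) P(1,4) G.sec_subset[OF V(1,4)]] N.quot_map_rest[OF W(1) P(1,5) G.sec_subset[OF W(1,4)]]
      V(5)[symmetric] W(5)[symmetric] by (auto simp: Int_absorb1 Int_absorb2 Int_commute)
  with that[OF P(1-3) G.rest_mem[OF V(4,1) P(1,4)] _ G.rest_mem[OF W(4,1) P(1,5)]] show ?thesis by blast
qed

lemma sec_Q_I:
  assumes "s \<in> extensional U"
    and "\<And>x. x \<in> U \<Longrightarrow> \<exists>V a. openin T V \<and> x \<in> V \<and> V \<subseteq> U \<and> a \<in> carrier (sec G V) \<and> restrict s V = quot_map T F N V a"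
  shows "s \<in> carrier (sec Q U)"
proof -
  have "\<exists>V a. openin T V \<and> x \<in> V \<and> V \<subseteq> U \<and> a \<in> carrier (sec G V) \<and> (\<forall>y\<in>V. s y = quot_map T F N V a y)"
    if "x \<in> U" for x
  proof -
    obtain V a where "openin T V" "x \<in> V" "V \<subseteq> U" "a \<in> carrier (sec G V)" "restrict s V = quot_map T F N V a"
      using assms(2)[OF \<open>x \<in> U\<close>] by blast
    moreover from this have "\<forall>y\<in>V. s y = quot_map T F N V a y" by (metis restrict_apply')
    ultimately show ?thesis by blast
  qed
  with assms(1) show ?thesis unfolding quot_sheaf_def by simp
qed

lemma quot_map_closed:
  assumes U: "openin T U" and a: "a \<in> carrier (sec G U)" shows "quot_map T F N U a \<in> carrier (sec Q U)"
proof (rule sec_Q_I)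
  show "quot_map T F N U a \<in> extensional U" by (simp add: quot_map_def)
  thus "\<exists>V b. openin T V \<and> x \<in> V \<and> V \<subseteq> U \<and> b \<in> carrier (sec G V) \<and> restrict (quot_map T F N U a) V = quot_map T F N V b" if "x \<in> U" for x
    using U a that by (intro exI[of _ U] exI[of _ a]) (auto simp: extensional_restrict)
qed

text \<open>The sections over \<open>U\<close> form a subgroup of the product of the quotients of the stalks over
  the points of \<open>U\<close>, so that the group axioms hold pointwise.\<close>

lemma sec_Q_product:
  "sec Q U = (product_group U (\<lambda>x. stalk T F x Mod substalk T F N x))\<lparr>carrier := carrier (sec Q U)\<rparr>"
  by (simp add: quot_sheaf_def product_group_def)

lemma subgroup_product:
  assumes U: "openin T U"
  shows "subgroup (carrier (sec Q U)) (product_group U (\<lambda>x. stalk T F x Mod substalk T F N x))" (is "subgroup _ ?P")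
proof -
  have UT: "x \<in> topspace T" if "x \<in> U" for x using that U openin_subset by blast
  have gM: "group (stalk T F x Mod substalk T F N x)" if "x \<in> U" for x using N.group_Mod UT that by blast
  interpret P: group ?P using gM by (rule product_group)
  interpret U: group "sec F U" using G.group_sec U .
  have car: "s x \<in> carrier (stalk T F x Mod substalk T F N x)" if sx: "s \<in> carrier (sec Q U)" "x \<in> U" for s x
  proof -
    obtain V a where V: "openin T V" "x \<in> V" "V \<subseteq> U" "a \<in> carrier (sec G V)" "restrict s V = quot_map T F N V a"
      using sec_Q_local[OF sx] .
    have "s x = quot_map T F N V a x" using fun_cong[OF V(5), of x] V(2) by simp
    with sx show ?thesis using N.quot_map_in_Mod[OF V(1,2) G.sec_subset[OF V(1,4)]] by simp
  qed
  have sub: "carrier (sec Q U) \<subseteq> carrier ?P"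
  proof
    fix s assume "s \<in> carrier (sec Q U)"
    thus "s \<in> carrier ?P" unfolding carrier_product_group PiE_iff using car sec_Q_extensional by blast
  qed
  show ?thesis
  proof (rule P.subgroupI)
    show "carrier (sec Q U) \<subseteq> carrier ?P" by fact
    have "quot_map T F N U \<one>\<^bsub>sec F U\<^esub> \<in> carrier (sec Q U)"
      using quot_map_closed[OF U] subgroup.one_closed[OF G.subgroup_sec[OF U]] by blast
    thus "carrier (sec Q U) \<noteq> {}" by blast
    fix s assume s: "s \<in> carrier (sec Q U)"
    have invs: "inv\<^bsub>?P\<^esub> s = (\<lambda>x\<in>U. inv\<^bsub>stalk T F x Mod substalk T F N x\<^esub> (s x))"
      using sub s gM by (subst inv_product_group) auto
    show "inv\<^bsub>?P\<^esub> s \<in> carrier (sec Q U)"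
    proof (rule sec_Q_I)
      show "inv\<^bsub>?P\<^esub> s \<in> extensional U" unfolding invs by simp
      fix x assume "x \<in> U"
      then obtain V a where V: "openin T V" "x \<in> V" "V \<subseteq> U" "a \<in> carrier (sec G V)" "restrict s V = quot_map T F N V a"
        using sec_Q_local[OF s] by metis
      interpret V: group "sec F V" using G.group_sec V(1) .
      have aF: "a \<in> carrier (sec F V)" using G.sec_subset[OF V(1,4)] .
      have "inv\<^bsub>stalk T F y Mod substalk T F N y\<^esub> (s y) = quot_map T F N V (inv\<^bsub>sec F V\<^esub> a) y" if y: "y \<in> V" for y
      proof -
        have yU: "y \<in> U" using y V by blast
        have sy: "s y = quot_map T F N V a y" using fun_cong[OF V(5), of y] y by simp
        have "quot_map T F N V (inv\<^bsub>sec F V\<^esub> a) y <#>\<^bsub>stalk T F y\<^esub> s y = \<one>\<^bsub>stalk T F y Mod substalk T F N y\<^esub>"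
          unfolding sy using N.quot_map_mult[OF V(1) y, of "inv\<^bsub>sec F V\<^esub> a" a] aF N.quot_map_one[OF V(1) y] by simp
        thus ?thesis using car[OF s yU] N.quot_map_in_Mod[OF V(1) y V.inv_closed[OF aF]]
          by (intro group.inv_equality[OF gM[OF yU]]) auto
      qed
      hence "restrict (inv\<^bsub>?P\<^esub> s) V = quot_map T F N V (inv\<^bsub>sec F V\<^esub> a)"
        unfolding invs using V(3) by (intro extensionalityI[of _ V]) (auto simp: quot_map_def)
      thus "\<exists>V a. openin T V \<and> x \<in> V \<and> V \<subseteq> U \<and> a \<in> carrier (sec G V) \<and> restrict (inv\<^bsub>?P\<^esub> s) V = quot_map T F N V a"
        using V subgroup.m_inv_closed[OF G.subgroup_sec[OF V(1)] V(4)] by blast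
    qed
    fix t assume t: "t \<in> carrier (sec Q U)"
    show "s \<otimes>\<^bsub>?P\<^esub> t \<in> carrier (sec Q U)"
    proof (rule sec_Q_I)
      show "s \<otimes>\<^bsub>?P\<^esub> t \<in> extensional U" by simp
      fix x assume x: "x \<in> U"
      obtain V a b where V: "openin T V" "x \<in> V" "V \<subseteq> U" "a \<in> carrier (sec G V)" "restrict s V = quot_map T F N V a"
        "b \<in> carrier (sec G V)" "restrict t V = quot_map T F N V b"
        using sec_Q_local2[OF U s t x] .
      have "s y <#>\<^bsub>stalk T F y\<^esub> t y = quot_map T F N V (a \<otimes>\<^bsub>sec F V\<^esub> b) y" if y: "y \<in> V" for y
        using N.quot_map_mult[OF V(1) y G.sec_subset[OF V(1,4)] G.sec_subset[OF V(1,6)]]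
          fun_cong[OF V(5), of y] fun_cong[OF V(7), of y] y by simp
      hence "restrict (s \<otimes>\<^bsub>?P\<^esub> t) V = quot_map T F N V (a \<otimes>\<^bsub>sec F V\<^esub> b)"
        using V(3) by (intro extensionalityI[of _ V]) (auto simp: quot_map_def)
      thus "\<exists>V a. openin T V \<and> x \<in> V \<and> V \<subseteq> U \<and> a \<in> carrier (sec G V) \<and> restrict (s \<otimes>\<^bsub>?P\<^esub> t) V = quot_map T F N V a"
        using V subgroup.m_closed[OF G.subgroup_sec[OF V(1)] V(4,6)] by blast
    qed
  qed
qed

lemma group_sec_Q: "openin T U \<Longrightarrow> group (sec Q U)"
proof -
  assume U: "openin T U"
  have gM: "group (stalk T F x Mod substalk T F N x)" if "x \<in> U" for x using N.group_Mod that U openin_subset by blast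
  have P: "group (product_group U (\<lambda>x. stalk T F x Mod substalk T F N x))" using gM by (rule product_group)
  show ?thesis by (subst sec_Q_product) (rule subgroup.subgroup_is_group[OF subgroup_product[OF U] P])
qed

lemma rest_closed_Q:
  assumes U: "openin T U" and V: "openin T V" "V \<subseteq> U" and s: "s \<in> carrier (sec Q U)"
  shows "restrict s V \<in> carrier (sec Q V)"
proof (rule sec_Q_I)
  fix x assume x: "x \<in> V"
  hence "x \<in> U" using V by blast
  then obtain W a where W: "openin T W" "x \<in> W" "W \<subseteq> U" "a \<in> carrier (sec G W)" "restrict s W = quot_map T F N W a"
    using sec_Q_local[OF s] by metis
  let ?P = "W \<inter> V"
  have P: "openin T ?P" "x \<in> ?P" "?P \<subseteq> V" "?P \<subseteq> W" using V W x by auto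
  have "restrict (restrict s V) ?P = quot_map T F N ?P (rest F ?P a)"
    unfolding N.quot_map_rest[OF W(1) P(1,4) G.sec_subset[OF W(1,4)]] W(5)[symmetric] restrict_restrict by (auto intro: arg_cong)
  thus "\<exists>W a. openin T W \<and> x \<in> W \<and> W \<subseteq> V \<and> a \<in> carrier (sec G W) \<and> restrict (restrict s V) W = quot_map T F N W a"
    using P G.rest_mem[OF W(4,1) P(1,4)] by blast
qed simp

text \<open>The quotient is a presheaf of groups, so that the results on degree one cohomology apply to it.\<close>

sublocale Q: presheaf T Q
proof (rule presheaf.intro)
  fix U assume U: "openin T U"
  show "group (sec Q U)" using group_sec_Q U .
  {
    fix V assume V: "openin T V" "V \<subseteq> U"
    have "restrict (\<lambda>x\<in>U. s x <#>\<^bsub>stalk T F x\<^esub> t x) V = (\<lambda>x\<in>V. restrict s V x <#>\<^bsub>stalk T F x\<^esub> restrict t V x)" for s t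
      using V(2) by (intro extensionalityI[of _ V]) auto
    thus "rest Q V \<in> hom (sec Q U) (sec Q V)"
      using rest_closed_Q[OF U V] by (auto simp: hom_def rest_Q mult_Q)
  }
  fix s assume s: "s \<in> carrier (sec Q U)"
  show "rest Q U s = s" using sec_Q_extensional[OF s] by (simp add: rest_Q extensional_restrict)
  fix V W :: "'x set" assume "W \<subseteq> V"
  thus "rest Q W (rest Q V s) = rest Q W s" by (simp add: rest_Q restrict_restrict Int_absorb1)
qed

lemma sec_Q_eqI:
  assumes "openin T U" "s \<in> carrier (sec Q U)" "t \<in> carrier (sec Q U)" "\<And>x. x \<in> U \<Longrightarrow> s x = t x"
  shows "s = t"
  using sec_Q_extensional assms by (intro extensionalityI[of _ U]) auto

sublocale quot: presheaf_morphism T G Q "quot_map T F N"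
proof (intro presheaf_morphism.intro presheaf_morphism_axioms.intro)
  show "presheaf T G" by (rule G.presheaf_N)
  show "presheaf T Q" by (rule Q.presheaf_axioms)
  fix U assume U: "openin T U"
  have "quot_map T F N U (a \<otimes>\<^bsub>sec F U\<^esub> b) = (\<lambda>x\<in>U. quot_map T F N U a x <#>\<^bsub>stalk T F x\<^esub> quot_map T F N U b x)"
    if "a \<in> carrier (sec G U)" "b \<in> carrier (sec G U)" for a b
    using N.quot_map_mult[OF U _ G.sec_subset[OF U] G.sec_subset[OF U]] that
    by (intro extensionalityI[of _ U]) (auto simp: quot_map_def)
  thus "quot_map T F N U \<in> hom (sec G U) (sec Q U)"
    using quot_map_closed[OF U] by (auto simp: hom_def mult_Q)
  fix V a assume "openin T V" "V \<subseteq> U" "a \<in> carrier (sec G U)"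
  thus "rest Q V (quot_map T F N U a) = quot_map T F N V (rest G V a)"
    using N.quot_map_rest[OF U] G.sec_subset[OF U] by (simp add: rest_Q G.rest_N)
qed

text \<open>A section of the quotient has representatives in \<open>G\<close> only locally, so a cochain lifts to \<open>G\<close> only
  after its cover has been refined.\<close>

lemma lift_cover:
  assumes B: "open_cover T B" and k: "\<And>U. U \<in> B \<Longrightarrow> k U \<in> carrier (sec Q U)"
  obtains D \<upsilon> a where "open_cover T D" "refines \<upsilon> D B"
    "\<forall>V\<in>D. a V \<in> carrier (sec G V) \<and> rest Q V (k (\<upsilon> V)) = quot_map T F N V (a V)"
proof -
  have "\<exists>V. openin T V \<and> x \<in> V \<and> V \<subseteq> U \<and> (\<exists>a. a \<in> carrier (sec G V) \<and> rest Q V (k U) = quot_map T F N V a)"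
    if U: "U \<in> B" and x: "x \<in> U" for U x
  proof -
    obtain V a where "openin T V" "x \<in> V" "V \<subseteq> U" "a \<in> carrier (sec G V)" "restrict (k U) V = quot_map T F N V a"
      using sec_Q_local[OF k[OF U] x] .
    thus ?thesis by (auto simp: rest_Q)
  qed
  then obtain D \<upsilon> where D: "open_cover T D" "refines \<upsilon> D B"
    and ex: "\<And>V. V \<in> D \<Longrightarrow> \<exists>a. a \<in> carrier (sec G V) \<and> rest Q V (k (\<upsilon> V)) = quot_map T F N V a"
    using refinement_by_property[OF B, of "\<lambda>U V. \<exists>a. a \<in> carrier (sec G V) \<and> rest Q V (k U) = quot_map T F N V a"]
    by metis
  from ex obtain a where "\<And>V. V \<in> D \<Longrightarrow> a V \<in> carrier (sec G V) \<and> rest Q V (k (\<upsilon> V)) = quot_map T F N V (a V)" by metis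
  with D that show ?thesis by blast
qed

text \<open>Commutators of sections of \<open>G\<close> vanish in the quotient, and every section of the quotient comes locally from \<open>G\<close>.\<close>

lemma comm_sec_Q:
  assumes comm: "\<And>U a b. openin T U \<Longrightarrow> a \<in> carrier (sec G U) \<Longrightarrow> b \<in> carrier (sec G U) \<Longrightarrow>
      a \<otimes>\<^bsub>sec F U\<^esub> b \<otimes>\<^bsub>sec F U\<^esub> inv\<^bsub>sec F U\<^esub> (b \<otimes>\<^bsub>sec F U\<^esub> a) \<in> carrier (sec N U)"
  shows "abelian_presheaf T Q"
proof (intro abelian_presheaf.intro abelian_presheaf_axioms.intro)
  show "presheaf T Q" by (rule Q.presheaf_axioms)
  fix U assume U: "openin T U"
  interpret U: group "sec Q U" using group_sec_Q[OF U] .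
  show "comm_group (sec Q U)"
  proof (rule U.group_comm_groupI, rule sec_Q_eqI[OF U])
    fix s t assume st: "s \<in> carrier (sec Q U)" "t \<in> carrier (sec Q U)"
    show "s \<otimes>\<^bsub>sec Q U\<^esub> t \<in> carrier (sec Q U)" "t \<otimes>\<^bsub>sec Q U\<^esub> s \<in> carrier (sec Q U)" using st by auto
    fix x assume x: "x \<in> U"
    obtain V a b where V: "openin T V" "x \<in> V" "V \<subseteq> U" "a \<in> carrier (sec G V)" "restrict s V = quot_map T F N V a"
        "b \<in> carrier (sec G V)" "restrict t V = quot_map T F N V b"
      using sec_Q_local2[OF U st x] .
    interpret V: group "sec F V" using G.group_sec V(1) .
    have ab: "a \<in> carrier (sec F V)" "b \<in> carrier (sec F V)" using G.sec_subset V by auto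
    have "quot_map T F N V (a \<otimes>\<^bsub>sec F V\<^esub> b) = quot_map T F N V (b \<otimes>\<^bsub>sec F V\<^esub> a)"
      using comm[OF V(1,4,6)] ab by (subst N.quot_map_eq_iff[OF V(1)]) auto
    with N.quot_map_mult[OF V(1,2) ab] N.quot_map_mult[OF V(1,2) ab(2,1)] fun_cong[OF V(5), of x] fun_cong[OF V(7), of x] V(2)
    show "(s \<otimes>\<^bsub>sec Q U\<^esub> t) x = (t \<otimes>\<^bsub>sec Q U\<^esub> s) x"
      using x by (simp add: mult_Q)
  qed
qed

end

subsection \<open>The exact sequence of a tower\<close>

text \<open>For \<open>N \<subseteq> K \<subseteq> G\<close> the sequence \<open>K/N \<rightarrow> G/N \<rightarrow> G/K\<close> is exact. All three sheaves consist of functions whose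
  values are sets of germs of the same sheaf \<open>F\<close>, so that the first map is an inclusion of sets; the second
  one enlarges each coset of \<open>N\<close> to a coset of \<open>K\<close>.\<close>

definition quot_proj :: "'x topology \<Rightarrow> ('x, 's) group_sheaf \<Rightarrow> ('x, 's) group_sheaf \<Rightarrow> 'x set
    \<Rightarrow> ('x \<Rightarrow> ('x set \<times> 's) set set) \<Rightarrow> 'x \<Rightarrow> ('x set \<times> 's) set set"
  where "quot_proj T F K U s = (\<lambda>x\<in>U. substalk T F K x <#>\<^bsub>stalk T F x\<^esub> s x)"

locale quotient_tower = GN: quotient_sheaf T F G N + GK: quotient_sheaf T F G K
  for T :: "'x topology" and F :: "('x, 's) group_sheaf" and G K N +
  assumes N_K: "openin T U \<Longrightarrow> carrier (sec N U) \<subseteq> carrier (sec K U)"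
    and K_G: "openin T U \<Longrightarrow> carrier (sec K U) \<subseteq> carrier (sec G U)"
begin

sublocale KN: quotient_sheaf T F K N ..

lemma proj_quot_map_at:
  assumes U: "openin T U" and x: "x \<in> U" and a: "a \<in> carrier (sec F U)"
  shows "substalk T F K x <#>\<^bsub>stalk T F x\<^esub> quot_map T F N U a x = quot_map T F K U a x"
proof -
  have xt: "x \<in> topspace T" using x U openin_subset by blast
  interpret S: group "stalk T F x" using GN.G.group_stalk xt .
  interpret N: normal "substalk T F N x" "stalk T F x" using GN.N.normal_substalk xt .
  interpret K: normal "substalk T F K x" "stalk T F x" using GK.N.normal_substalk xt .
  have ga: "germ T F x U a \<in> carrier (stalk T F x)" using GN.G.stalk_carrierI U x a by auto
  have NK: "substalk T F N x \<subseteq> substalk T F K x"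
    using N_K unfolding substalk_def by blast
  have "substalk T F K x <#>\<^bsub>stalk T F x\<^esub> substalk T F N x = substalk T F K x"
  proof
    show "substalk T F K x <#>\<^bsub>stalk T F x\<^esub> substalk T F N x \<subseteq> substalk T F K x"
      using NK K.m_closed unfolding set_mult_def by blast
    show "substalk T F K x \<subseteq> substalk T F K x <#>\<^bsub>stalk T F x\<^esub> substalk T F N x"
    proof
      fix p assume p: "p \<in> substalk T F K x"
      have "p = p \<otimes>\<^bsub>stalk T F x\<^esub> \<one>\<^bsub>stalk T F x\<^esub>" using p K.subset by (metis S.r_one subsetD)
      thus "p \<in> substalk T F K x <#>\<^bsub>stalk T F x\<^esub> substalk T F N x"
        using p N.one_closed unfolding set_mult_def by blast
    qed
  qed
  thus ?thesis using x S.setmult_rcos_assoc[OF K.subset N.subset ga] by (simp add: quot_map_def)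
qed

lemma proj_quot_map:
  assumes "openin T U" "a \<in> carrier (sec F U)"
  shows "quot_proj T F K U (quot_map T F N U a) = quot_map T F K U a"
  using proj_quot_map_at[OF assms(1) _ assms(2)]
  by (intro extensionalityI[of _ U]) (auto simp: quot_proj_def quot_map_def)

lemma proj_rest: "V \<subseteq> U \<Longrightarrow> restrict (quot_proj T F K U s) V = quot_proj T F K V (restrict s V)"
  by (intro extensionalityI[of _ V]) (auto simp: quot_proj_def)

sublocale proj: presheaf_morphism T GN.Q GK.Q "quot_proj T F K"
proof (intro presheaf_morphism.intro presheaf_morphism_axioms.intro)
  show "presheaf T GN.Q" "presheaf T GK.Q" by (rule GN.Q.presheaf_axioms GK.Q.presheaf_axioms)+
  fix U assume U: "openin T U"
  show "quot_proj T F K U \<in> hom (sec GN.Q U) (sec GK.Q U)"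
    unfolding hom_def
  proof (intro CollectI conjI funcsetI ballI)
    have loc: "restrict (quot_proj T F K U s) V = quot_map T F K V a" if "openin T V" "V \<subseteq> U" "a \<in> carrier (sec G V)"
      "restrict s V = quot_map T F N V a" for s V a
      unfolding proj_rest[OF that(2)] that(4) by (rule proj_quot_map[OF that(1) GN.G.sec_subset[OF that(1,3)]])
    fix s assume s: "s \<in> carrier (sec GN.Q U)"
    show "quot_proj T F K U s \<in> carrier (sec GK.Q U)"
    proof (rule GK.sec_Q_I)
      show "quot_proj T F K U s \<in> extensional U" by (simp add: quot_proj_def)
      fix x assume "x \<in> U"
      then obtain V a where "openin T V" "x \<in> V" "V \<subseteq> U" "a \<in> carrier (sec G V)" "restrict s V = quot_map T F N V a"
        using GN.sec_Q_local[OF s] by metis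
      thus "\<exists>V a. openin T V \<and> x \<in> V \<and> V \<subseteq> U \<and> a \<in> carrier (sec G V) \<and> restrict (quot_proj T F K U s) V = quot_map T F K V a"
        using loc by blast
    qed
    fix t assume t: "t \<in> carrier (sec GN.Q U)"
    show "quot_proj T F K U (s \<otimes>\<^bsub>sec GN.Q U\<^esub> t) = quot_proj T F K U s \<otimes>\<^bsub>sec GK.Q U\<^esub> quot_proj T F K U t"
    proof (intro extensionalityI[of _ U])
      fix x assume x: "x \<in> U"
      obtain V a b where V: "openin T V" "x \<in> V" "V \<subseteq> U" "a \<in> carrier (sec G V)" "restrict s V = quot_map T F N V a"
          "b \<in> carrier (sec G V)" "restrict t V = quot_map T F N V b"
        using GN.sec_Q_local2[OF U s t x] .
      have ab: "a \<in> carrier (sec F V)" "b \<in> carrier (sec F V)" using GN.G.sec_subset V by auto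
      interpret V: group "sec F V" using GN.G.group_sec V(1) .
      have sx: "s x = quot_map T F N V a x" "t x = quot_map T F N V b x"
        using fun_cong[OF V(5), of x] fun_cong[OF V(7), of x] V(2) by simp_all
      show "quot_proj T F K U (s \<otimes>\<^bsub>sec GN.Q U\<^esub> t) x = (quot_proj T F K U s \<otimes>\<^bsub>sec GK.Q U\<^esub> quot_proj T F K U t) x"
        using x ab by (simp add: GN.mult_Q GK.mult_Q quot_proj_def sx proj_quot_map_at[OF V(1,2)]
          GN.N.quot_map_mult[OF V(1,2)] GK.N.quot_map_mult[OF V(1,2)])
    qed (simp_all add: quot_proj_def GK.mult_Q)
  qed
  fix V s assume "V \<subseteq> U"
  thus "rest GK.Q V (quot_proj T F K U s) = quot_proj T F K V (rest GN.Q V s)"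
    by (simp add: GK.rest_Q GN.rest_Q proj_rest)
qed

lemma sec_KN_subset: "openin T U \<Longrightarrow> s \<in> carrier (sec KN.Q U) \<Longrightarrow> s \<in> carrier (sec GN.Q U)"
  using K_G unfolding quot_sheaf_def by (simp, blast)

lemma sec_KN_eq: "sec KN.Q U = (sec GN.Q U)\<lparr>carrier := carrier (sec KN.Q U)\<rparr>"
  by (simp add: quot_sheaf_def)

lemma rest_KN: "rest KN.Q = rest GN.Q"
  by (simp add: quot_sheaf_def)

lemma mult_KN: "monoid.mult (sec KN.Q U) = monoid.mult (sec GN.Q U)"
  by (simp add: quot_sheaf_def)

lemma one_KN: "\<one>\<^bsub>sec KN.Q U\<^esub> = \<one>\<^bsub>sec GN.Q U\<^esub>"
  by (simp add: quot_sheaf_def)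

lemma subgroup_KN: "openin T U \<Longrightarrow> subgroup (carrier (sec KN.Q U)) (sec GN.Q U)"
  using group.group_incl_imp_subgroup[OF GN.group_sec_Q, of U "carrier (sec KN.Q U)"] sec_KN_subset
    KN.group_sec_Q[of U] sec_KN_eq[of U] by (metis subsetI)

lemma inv_KN:
  "openin T U \<Longrightarrow> s \<in> carrier (sec KN.Q U) \<Longrightarrow> inv\<^bsub>sec KN.Q U\<^esub> s = inv\<^bsub>sec GN.Q U\<^esub> s"
  by (subst sec_KN_eq) (rule group.m_inv_consistent[OF GN.group_sec_Q subgroup_KN])

text \<open>If the coset of a local representative in \<open>G\<close> becomes trivial modulo \<open>K\<close>, then by \<open>quot_map_eq_iff\<close> the
  representative itself lies in \<open>K\<close>.\<close>

lemma proj_kernel: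
  assumes U: "openin T U" and s: "s \<in> carrier (sec GN.Q U)" and one: "quot_proj T F K U s = \<one>\<^bsub>sec GK.Q U\<^esub>"
  shows "s \<in> carrier (sec KN.Q U)"
proof (rule KN.sec_Q_I)
  show "s \<in> extensional U" using GN.sec_Q_extensional[OF s] .
  fix x assume x: "x \<in> U"
  obtain V a where V: "openin T V" "x \<in> V" "V \<subseteq> U" "a \<in> carrier (sec G V)" "restrict s V = quot_map T F N V a"
    using GN.sec_Q_local[OF s x] .
  interpret V: group "sec F V" using GN.G.group_sec V(1) .
  have a: "a \<in> carrier (sec F V)" using GN.G.sec_subset V by auto
  have "quot_map T F K V a = restrict (quot_proj T F K U s) V"
    unfolding proj_rest[OF V(3)] V(5) by (rule proj_quot_map[OF V(1) a, symmetric])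
  also have "\<dots> = quot_map T F K V \<one>\<^bsub>sec F V\<^esub>"
    unfolding one using V(3) GK.N.quot_map_one[OF V(1)]
    by (intro extensionalityI[of _ V]) (auto simp: GK.one_Q quot_map_def)
  finally have "a \<in> carrier (sec K V)" using a GK.N.quot_map_eq_iff[OF V(1) a V.one_closed] by simp
  with V show "\<exists>V a. openin T V \<and> x \<in> V \<and> V \<subseteq> U \<and> a \<in> carrier (sec K V) \<and> restrict s V = quot_map T F N V a" by blast
qed

end

section \<open>Connecting maps\<close>

subsection \<open>Cocycles from cochains\<close>

context presheaf
begin

text \<open>A gauge transformation of a cocycle by an arbitrary 0-cochain produces a cocycle again. This is how
  cocycles of \<open>G/N\<close> are constructed from lifts of gauge transformations of \<open>G/K\<close>.\<close>

lemma gauge_transform: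
  assumes g: "(C, g) \<in> Z1 T F" and D: "open_cover T D" "refines \<mu> D C" and k: "\<And>U. U \<in> D \<Longrightarrow> k U \<in> carrier (sec F U)"
  defines "h \<equiv> \<lambda>U V. inv\<^bsub>sec F (U \<inter> V)\<^esub> rest F (U \<inter> V) (k U) \<otimes>\<^bsub>sec F (U \<inter> V)\<^esub> rest F (U \<inter> V) (g (\<mu> U) (\<mu> V))
    \<otimes>\<^bsub>sec F (U \<inter> V)\<^esub> rest F (U \<inter> V) (k V)"
  shows "(D, h) \<in> Z1 T F" "gauge D k (\<lambda>U V. g (\<mu> U) (\<mu> V)) h"
proof -
  have r: "\<mu> U \<in> C" "U \<subseteq> \<mu> U" "openin T U" if "U \<in> D" for U
    using refinesD[OF D(2) that] open_coverD[OF D(1) that] by auto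
  have c: "rest F P (k U) \<in> carrier (sec F P)" if "U \<in> D" "openin T P" "P \<subseteq> U" for U P
    using rest_closed[OF k[OF that(1)] r(3)[OF that(1)] that(2,3)] .
  have cg: "rest F P (g (\<mu> U) (\<mu> V)) \<in> carrier (sec F P)" if "U \<in> D" "V \<in> D" "openin T P" "P \<subseteq> U \<inter> V" for U V P
    using r[OF that(1)] r[OF that(2)] that by (intro Z1_closed[OF g]) auto
  have eq: "rest F P (h U V) = inv\<^bsub>sec F P\<^esub> rest F P (k U) \<otimes>\<^bsub>sec F P\<^esub> rest F P (g (\<mu> U) (\<mu> V)) \<otimes>\<^bsub>sec F P\<^esub> rest F P (k V)"
    and hc: "h U V \<in> carrier (sec F (U \<inter> V))"
    if UV: "U \<in> D" "V \<in> D" and P: "openin T P" "P \<subseteq> U \<inter> V" for U V P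
  proof -
    let ?R = "U \<inter> V"
    have R: "openin T ?R" "?R \<subseteq> U" "?R \<subseteq> V" "?R \<subseteq> \<mu> U \<inter> \<mu> V" using r[OF UV(1)] r[OF UV(2)] by auto
    interpret R: group "sec F ?R" using group_sec R(1) .
    have m: "rest F ?R (k U) \<in> carrier (sec F ?R)" "rest F ?R (k V) \<in> carrier (sec F ?R)" "rest F ?R (g (\<mu> U) (\<mu> V)) \<in> carrier (sec F ?R)"
      using c[OF UV(1) R(1,2)] c[OF UV(2) R(1,3)] cg[OF UV R(1) order_refl] by auto
    show "h U V \<in> carrier (sec F ?R)" unfolding h_def using m by simp
    have "rest F P (rest F ?R (k U)) = rest F P (k U)" "rest F P (rest F ?R (k V)) = rest F P (k V)"
      "rest F P (rest F ?R (g (\<mu> U) (\<mu> V))) = rest F P (g (\<mu> U) (\<mu> V))"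
      using rest_rest[OF k[OF UV(1)] r(3)[OF UV(1)] R(1) P(1,2) R(2)] rest_rest[OF k[OF UV(2)] r(3)[OF UV(2)] R(1) P(1,2) R(3)]
        Z1_rest_rest[OF g r(1)[OF UV(1)] r(1)[OF UV(2)] R(1) P R(4)] by auto
    thus "rest F P (h U V) = inv\<^bsub>sec F P\<^esub> rest F P (k U) \<otimes>\<^bsub>sec F P\<^esub> rest F P (g (\<mu> U) (\<mu> V)) \<otimes>\<^bsub>sec F P\<^esub> rest F P (k V)"
      unfolding h_def using m R(1) P by (simp add: rest_mult rest_inv)
  qed
  show "gauge D k (\<lambda>U V. g (\<mu> U) (\<mu> V)) h" unfolding gauge_def using k eq by blast
  show "(D, h) \<in> Z1 T F"
    unfolding Z1_iff
  proof (intro conjI ballI)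
    show "open_cover T D" by fact
    fix U V assume UV: "U \<in> D" "V \<in> D"
    have "openin T (U \<inter> V)" using r UV by auto
    with hc[OF UV] show "h U V \<in> carrier (sec F (U \<inter> V))" by blast
    fix W assume W: "W \<in> D"
    let ?Q = "U \<inter> V \<inter> W"
    have Q: "openin T ?Q" "?Q \<subseteq> U \<inter> V" "?Q \<subseteq> V \<inter> W" "?Q \<subseteq> U \<inter> W" "?Q \<subseteq> U" "?Q \<subseteq> V" "?Q \<subseteq> W" "?Q \<subseteq> \<mu> U \<inter> \<mu> V \<inter> \<mu> W"
      using r[OF UV(1)] r[OF UV(2)] r[OF W] by auto
    interpret Q: group "sec F ?Q" using group_sec Q(1) .
    have coc: "rest F ?Q (g (\<mu> U) (\<mu> W)) = rest F ?Q (g (\<mu> U) (\<mu> V)) \<otimes>\<^bsub>sec F ?Q\<^esub> rest F ?Q (g (\<mu> V) (\<mu> W))"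
      by (rule Z1_cocycle[OF g r(1)[OF UV(1)] r(1)[OF UV(2)] r(1)[OF W] Q(1,8), symmetric])
    show "rest F ?Q (h U V) \<otimes>\<^bsub>sec F ?Q\<^esub> rest F ?Q (h V W) = rest F ?Q (h U W)"
      unfolding eq[OF UV Q(1,2)] eq[OF UV(2) W Q(1,3)] eq[OF UV(1) W Q(1,4)] coc
      using c[OF UV(1) Q(1,5)] c[OF UV(2) Q(1,6)] c[OF W Q(1,7)] cg[OF UV Q(1,2)] cg[OF UV(2) W Q(1,3)]
      by (simp add: Q.m_assoc Q.r_inv_cancel)
  qed
qed

text \<open>The difference of a 0-cochain is the gauge transform of the trivial cocycle by it.\<close>

lemma Z1_difference:
  assumes D: "open_cover T D" and k: "\<And>U. U \<in> D \<Longrightarrow> k U \<in> carrier (sec F U)"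
  shows "(D, \<lambda>U V. inv\<^bsub>sec F (U \<inter> V)\<^esub> rest F (U \<inter> V) (k U) \<otimes>\<^bsub>sec F (U \<inter> V)\<^esub> rest F (U \<inter> V) (k V)) \<in> Z1 T F"
proof (rule class1_cong(1)[OF gauge_transform(1)[OF Z1_one[OF D] D refines_id k]])
  fix U V assume UV: "U \<in> D" "V \<in> D"
  hence op: "openin T U" "openin T V" "openin T (U \<inter> V)" using D by (auto simp: open_cover_def)
  interpret Q: group "sec F (U \<inter> V)" using group_sec op(3) .
  have "rest F (U \<inter> V) \<one>\<^bsub>sec F (U \<inter> V)\<^esub> = \<one>\<^bsub>sec F (U \<inter> V)\<^esub>" by (rule rest_one[OF op(3,3) order_refl])
  moreover have "rest F (U \<inter> V) (k U) \<in> carrier (sec F (U \<inter> V))"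
    using rest_closed[OF k[OF UV(1)] op(1,3)] by auto
  ultimately show "inv\<^bsub>sec F (U \<inter> V)\<^esub> rest F (U \<inter> V) (k U) \<otimes>\<^bsub>sec F (U \<inter> V)\<^esub> rest F (U \<inter> V) (k V) =
    inv\<^bsub>sec F (U \<inter> V)\<^esub> rest F (U \<inter> V) (k U) \<otimes>\<^bsub>sec F (U \<inter> V)\<^esub> rest F (U \<inter> V) \<one>\<^bsub>sec F (U \<inter> V)\<^esub>
      \<otimes>\<^bsub>sec F (U \<inter> V)\<^esub> rest F (U \<inter> V) (k V)"
    by simp
qed simp_all

end

subsection \<open>Coboundaries of one-cochains\<close>

definition (in presheaf) cochains1 :: "'x set set \<Rightarrow> ('x set \<Rightarrow> 'x set \<Rightarrow> 's) set"
  where "cochains1 B = {k. \<forall>U\<in>B. \<forall>V\<in>B. k U V \<in> carrier (sec F (U \<inter> V))}"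

lemma (in presheaf) cochains1D: "k \<in> cochains1 B \<Longrightarrow> U \<in> B \<Longrightarrow> V \<in> B \<Longrightarrow> k U V \<in> carrier (sec F (U \<inter> V))"
  by (simp add: cochains1_def)

lemma (in presheaf) cochain1_rest_closed:
  assumes "k \<in> cochains1 B" "open_cover T B" "U \<in> B" "V \<in> B" "openin T P" "P \<subseteq> U \<inter> V"
  shows "rest F P (k U V) \<in> carrier (sec F P)"
  using assms open_coverD[OF assms(2)] by (intro rest_closed[of _ "U \<inter> V"]) (auto simp: cochains1_def)

lemma (in presheaf) cochains1_refine:
  assumes k: "k \<in> cochains1 B" and B: "open_cover T B" and D: "open_cover T D" "refines \<upsilon> D B"
  shows "(\<lambda>U V. rest F (U \<inter> V) (k (\<upsilon> U) (\<upsilon> V))) \<in> cochains1 D"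
  unfolding cochains1_def
proof (intro CollectI ballI)
  fix U V assume UV: "U \<in> D" "V \<in> D"
  note r = refinesD[OF D(2) UV(1)] refinesD[OF D(2) UV(2)]
  have "openin T (U \<inter> V)" using open_coverD[OF D(1)] UV by auto
  thus "rest F (U \<inter> V) (k (\<upsilon> U) (\<upsilon> V)) \<in> carrier (sec F (U \<inter> V))"
    using r by (intro cochain1_rest_closed[OF k B]) auto
qed

context presheaf
begin

lemma coboundary1_closed:
  assumes "k \<in> cochains1 B" "open_cover T B" "U \<in> B" "V \<in> B" "W \<in> B"
  shows "coboundary1 F k U V W \<in> carrier (sec F (U \<inter> V \<inter> W))"
proof -
  have Q: "openin T (U \<inter> V \<inter> W)" using open_coverD[OF assms(2)] assms by auto
  interpret Q: group "sec F (U \<inter> V \<inter> W)" using group_sec Q .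
  show ?thesis unfolding coboundary1_def Let_def
    using assms Q by (intro Q.m_closed Q.inv_closed cochain1_rest_closed[OF assms(1,2)]) auto
qed

lemma coboundary1_refine:
  assumes k: "k \<in> cochains1 B" and B: "open_cover T B" and D: "open_cover T D" "refines \<upsilon> D B"
    and UVW: "U \<in> D" "V \<in> D" "W \<in> D"
  shows "coboundary1 F (\<lambda>U V. rest F (U \<inter> V) (k (\<upsilon> U) (\<upsilon> V))) U V W =
    rest F (U \<inter> V \<inter> W) (coboundary1 F k (\<upsilon> U) (\<upsilon> V) (\<upsilon> W))"
proof -
  let ?Q = "U \<inter> V \<inter> W" and ?R = "\<upsilon> U \<inter> \<upsilon> V \<inter> \<upsilon> W"
  note r = refinesD[OF D(2) UVW(1)] refinesD[OF D(2) UVW(2)] refinesD[OF D(2) UVW(3)]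
  have op: "openin T U" "openin T V" "openin T W" "openin T (\<upsilon> U)" "openin T (\<upsilon> V)" "openin T (\<upsilon> W)"
    using open_coverD[OF D(1)] open_coverD[OF B] UVW r by auto
  have Q: "openin T ?Q" "openin T ?R" "?Q \<subseteq> ?R" using op r by auto
  interpret R: group "sec F ?R" using group_sec Q(2) .
  have kk: "rest F ?Q (rest F ?R (k Y Z)) = rest F ?Q (k Y Z)" "rest F ?R (k Y Z) \<in> carrier (sec F ?R)"
    if "Y \<in> B" "Z \<in> B" "?R \<subseteq> Y \<inter> Z" for Y Z
  proof -
    have o: "openin T (Y \<inter> Z)" using open_coverD[OF B] that by auto
    show "rest F ?Q (rest F ?R (k Y Z)) = rest F ?Q (k Y Z)"
      by (rule rest_rest[OF cochains1D[OF k that(1,2)] o Q(2,1,3) that(3)])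
    show "rest F ?R (k Y Z) \<in> carrier (sec F ?R)" by (rule cochain1_rest_closed[OF k B that(1,2) Q(2) that(3)])
  qed
  have ll: "rest F ?Q (rest F (Y \<inter> Z) (k (\<upsilon> Y) (\<upsilon> Z))) = rest F ?Q (k (\<upsilon> Y) (\<upsilon> Z))"
    if "Y \<in> D" "Z \<in> D" "?Q \<subseteq> Y \<inter> Z" for Y Z
  proof -
    note r' = refinesD[OF D(2) that(1)] refinesD[OF D(2) that(2)]
    have "openin T (\<upsilon> Y \<inter> \<upsilon> Z)" "openin T (Y \<inter> Z)" using open_coverD[OF B] open_coverD[OF D(1)] r' that by auto
    moreover have "Y \<inter> Z \<subseteq> \<upsilon> Y \<inter> \<upsilon> Z" using r' by auto
    ultimately show ?thesis using rest_rest[OF cochains1D[OF k r'(1,3)]] Q that by auto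
  qed
  have sub: "?R \<subseteq> \<upsilon> V \<inter> \<upsilon> W" "?R \<subseteq> \<upsilon> U \<inter> \<upsilon> W" "?R \<subseteq> \<upsilon> U \<inter> \<upsilon> V" "?Q \<subseteq> V \<inter> W" "?Q \<subseteq> U \<inter> W" "?Q \<subseteq> U \<inter> V" by auto
  note k1 = kk[OF r(3,5) sub(1)] and k2 = kk[OF r(1,5) sub(2)] and k3 = kk[OF r(1,3) sub(3)]
  have "rest F ?Q (coboundary1 F k (\<upsilon> U) (\<upsilon> V) (\<upsilon> W)) =
      rest F ?Q (k (\<upsilon> V) (\<upsilon> W)) \<otimes>\<^bsub>sec F ?Q\<^esub> inv\<^bsub>sec F ?Q\<^esub> (rest F ?Q (k (\<upsilon> U) (\<upsilon> W))) \<otimes>\<^bsub>sec F ?Q\<^esub> rest F ?Q (k (\<upsilon> U) (\<upsilon> V))"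
    unfolding coboundary1_def Let_def using k1 k2 k3 Q by (simp add: rest_mult rest_inv)
  thus ?thesis unfolding coboundary1_def Let_def
    using ll[OF UVW(2,3) sub(4)] ll[OF UVW(1,3) sub(5)] ll[OF UVW(1,2) sub(6)] by simp
qed

end

context abelian_presheaf
begin

lemma cochains1_mult:
  assumes "k \<in> cochains1 B" "l \<in> cochains1 B" "open_cover T B"
  shows "(\<lambda>U V. k U V \<otimes>\<^bsub>sec F (U \<inter> V)\<^esub> l U V) \<in> cochains1 B"
  unfolding cochains1_def
proof (intro CollectI ballI)
  fix U V assume UV: "U \<in> B" "V \<in> B"
  have "openin T (U \<inter> V)" using open_coverD[OF assms(3)] UV by auto
  then interpret Q: comm_group "sec F (U \<inter> V)" by (rule comm_sec)
  show "k U V \<otimes>\<^bsub>sec F (U \<inter> V)\<^esub> l U V \<in> carrier (sec F (U \<inter> V))"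
    using cochains1D[OF assms(1) UV] cochains1D[OF assms(2) UV] by simp
qed

lemma cochains1_inv:
  assumes "k \<in> cochains1 B" "open_cover T B"
  shows "(\<lambda>U V. inv\<^bsub>sec F (U \<inter> V)\<^esub> k U V) \<in> cochains1 B"
  unfolding cochains1_def
proof (intro CollectI ballI)
  fix U V assume UV: "U \<in> B" "V \<in> B"
  have "openin T (U \<inter> V)" using open_coverD[OF assms(2)] UV by auto
  then interpret Q: comm_group "sec F (U \<inter> V)" by (rule comm_sec)
  show "inv\<^bsub>sec F (U \<inter> V)\<^esub> k U V \<in> carrier (sec F (U \<inter> V))"
    using cochains1D[OF assms(1) UV] by simp
qed

lemma coboundary1_mult:
  assumes k: "k \<in> cochains1 B" and l: "l \<in> cochains1 B" and B: "open_cover T B" and UVW: "U \<in> B" "V \<in> B" "W \<in> B"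
  shows "coboundary1 F (\<lambda>U V. k U V \<otimes>\<^bsub>sec F (U \<inter> V)\<^esub> l U V) U V W =
    coboundary1 F k U V W \<otimes>\<^bsub>sec F (U \<inter> V \<inter> W)\<^esub> coboundary1 F l U V W"
proof -
  let ?Q = "U \<inter> V \<inter> W"
  have op: "openin T ?Q" "openin T (V \<inter> W)" "openin T (U \<inter> W)" "openin T (U \<inter> V)"
    using open_coverD[OF B] UVW by auto
  have sub: "?Q \<subseteq> V \<inter> W" "?Q \<subseteq> U \<inter> W" "?Q \<subseteq> U \<inter> V" by auto
  interpret Q: comm_group "sec F ?Q" using comm_sec op(1) .
  note c = cochains1D[OF k UVW(2,3)] cochains1D[OF k UVW(1,3)] cochains1D[OF k UVW(1,2)]
     cochains1D[OF l UVW(2,3)] cochains1D[OF l UVW(1,3)] cochains1D[OF l UVW(1,2)]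
  note m = rest_mult[OF c(1,4) op(2,1) sub(1)] rest_mult[OF c(2,5) op(3,1) sub(2)] rest_mult[OF c(3,6) op(4,1) sub(3)]
  note rc = rest_closed[OF c(1) op(2,1) sub(1)] rest_closed[OF c(2) op(3,1) sub(2)] rest_closed[OF c(3) op(4,1) sub(3)]
     rest_closed[OF c(4) op(2,1) sub(1)] rest_closed[OF c(5) op(3,1) sub(2)] rest_closed[OF c(6) op(4,1) sub(3)]
  show ?thesis unfolding coboundary1_def Let_def m using rc by (simp add: Q.inv_mult Q.m_ac)
qed

lemma coboundary1_inv:
  assumes k: "k \<in> cochains1 B" and B: "open_cover T B" and UVW: "U \<in> B" "V \<in> B" "W \<in> B"
  shows "coboundary1 F (\<lambda>U V. inv\<^bsub>sec F (U \<inter> V)\<^esub> k U V) U V W = inv\<^bsub>sec F (U \<inter> V \<inter> W)\<^esub> coboundary1 F k U V W"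
proof -
  let ?Q = "U \<inter> V \<inter> W"
  have op: "openin T ?Q" "openin T (V \<inter> W)" "openin T (U \<inter> W)" "openin T (U \<inter> V)"
    using open_coverD[OF B] UVW by auto
  have sub: "?Q \<subseteq> V \<inter> W" "?Q \<subseteq> U \<inter> W" "?Q \<subseteq> U \<inter> V" by auto
  interpret Q: comm_group "sec F ?Q" using comm_sec op(1) .
  note c = cochains1D[OF k UVW(2,3)] cochains1D[OF k UVW(1,3)] cochains1D[OF k UVW(1,2)]
  note m = rest_inv[OF c(1) op(2,1) sub(1)] rest_inv[OF c(2) op(3,1) sub(2)] rest_inv[OF c(3) op(4,1) sub(3)]
  note rc = rest_closed[OF c(1) op(2,1) sub(1)] rest_closed[OF c(2) op(3,1) sub(2)] rest_closed[OF c(3) op(4,1) sub(3)]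
  show ?thesis unfolding coboundary1_def Let_def m using rc by (simp add: Q.inv_mult)
qed

end

lemma cohomologous2_iff:
  "cohomologous2 T F (C, c) (D, d) \<longleftrightarrow> (\<exists>B \<sigma> \<tau> k.
    open_cover T B \<and> refines \<sigma> B C \<and> refines \<tau> B D \<and>
    (\<forall>U\<in>B. \<forall>V\<in>B. k U V \<in> carrier (sec F (U \<inter> V))) \<and>
    (\<forall>U\<in>B. \<forall>V\<in>B. \<forall>W\<in>B. rest F (U \<inter> V \<inter> W) (d (\<tau> U) (\<tau> V) (\<tau> W)) =
         rest F (U \<inter> V \<inter> W) (c (\<sigma> U) (\<sigma> V) (\<sigma> W)) \<otimes>\<^bsub>sec F (U \<inter> V \<inter> W)\<^esub> coboundary1 F k U V W))"
  by (simp add: cohomologous2_def Let_def)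

subsection \<open>Connecting maps of central extensions\<close>

text \<open>The elements \<open>e1\<close>, \<open>e2\<close> and \<open>e1 \<otimes> e2\<close> are the three values of a cocycle, which is multiplied by a
  central cochain with the values \<open>c3\<close>, \<open>c1\<close> and \<open>c2\<close>: only the coboundary of the latter remains.\<close>

lemma (in group) coboundary_central_twist:
  assumes c: "e1 \<in> carrier G" "e2 \<in> carrier G" "c1 \<in> carrier G" "c2 \<in> carrier G" "c3 \<in> carrier G"
    and central: "\<And>x. x \<in> carrier G \<Longrightarrow> x \<otimes> c1 = c1 \<otimes> x" "\<And>x. x \<in> carrier G \<Longrightarrow> x \<otimes> c2 = c2 \<otimes> x"
  shows "(e2 \<otimes> c1) \<otimes> inv ((e1 \<otimes> e2) \<otimes> c2) \<otimes> (e1 \<otimes> c3) = c1 \<otimes> inv c2 \<otimes> c3"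
proof -
  have i: "inv ((e1 \<otimes> e2) \<otimes> c2) = inv e2 \<otimes> inv e1 \<otimes> inv c2"
    using c central(2)[of "e1 \<otimes> e2"] by (simp add: inv_mult_group)
  have i2: "inv c2 \<otimes> x = x \<otimes> inv c2" if "x \<in> carrier G" for x
    using central(2)[of "inv x"] that c by (metis inv_closed inv_inv inv_mult_group)
  have "(e2 \<otimes> c1) \<otimes> inv ((e1 \<otimes> e2) \<otimes> c2) \<otimes> (e1 \<otimes> c3) = c1 \<otimes> (e2 \<otimes> (inv e2 \<otimes> (inv e1 \<otimes> (inv c2 \<otimes> (e1 \<otimes> c3)))))"
    unfolding i central(1)[OF c(2)] using c by (simp add: m_assoc)
  also have "inv c2 \<otimes> (e1 \<otimes> c3) = e1 \<otimes> (inv c2 \<otimes> c3)"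
    using c i2[of e1] by (simp add: m_assoc[symmetric])
  finally show ?thesis using c by (simp add: r_inv_cancel l_inv_cancel m_assoc)
qed

text \<open>The commutator conditions say that \<open>G/K\<close> is abelian and that \<open>K/N\<close> is central in \<open>G/N\<close>.\<close>

locale central_tower = quotient_tower +
  assumes comm_G: "openin T U \<Longrightarrow> a \<in> carrier (sec G U) \<Longrightarrow> b \<in> carrier (sec G U) \<Longrightarrow>
      a \<otimes>\<^bsub>sec F U\<^esub> b \<otimes>\<^bsub>sec F U\<^esub> inv\<^bsub>sec F U\<^esub> (b \<otimes>\<^bsub>sec F U\<^esub> a) \<in> carrier (sec K U)"
    and comm_K: "openin T U \<Longrightarrow> a \<in> carrier (sec G U) \<Longrightarrow> b \<in> carrier (sec K U) \<Longrightarrow>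
      a \<otimes>\<^bsub>sec F U\<^esub> b \<otimes>\<^bsub>sec F U\<^esub> inv\<^bsub>sec F U\<^esub> (b \<otimes>\<^bsub>sec F U\<^esub> a) \<in> carrier (sec N U)"
begin

sublocale GK: abelian_presheaf T GK.Q
  using GK.comm_sec_Q comm_G .

sublocale KN: abelian_presheaf T KN.Q
  by (rule KN.comm_sec_Q) (use comm_K K_G in blast)

lemma KN_central:
  assumes U: "openin T U" and s: "s \<in> carrier (sec GN.Q U)" and t: "t \<in> carrier (sec KN.Q U)"
  shows "s \<otimes>\<^bsub>sec GN.Q U\<^esub> t = t \<otimes>\<^bsub>sec GN.Q U\<^esub> s"
proof (rule GN.sec_Q_eqI[OF U])
  interpret U: group "sec GN.Q U" using GN.group_sec_Q[OF U] .
  have t': "t \<in> carrier (sec GN.Q U)" using sec_KN_subset[OF U t] .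
  show "s \<otimes>\<^bsub>sec GN.Q U\<^esub> t \<in> carrier (sec GN.Q U)" "t \<otimes>\<^bsub>sec GN.Q U\<^esub> s \<in> carrier (sec GN.Q U)" using s t' by auto
  fix x assume x: "x \<in> U"
  obtain V a where V: "openin T V" "x \<in> V" "V \<subseteq> U" "a \<in> carrier (sec G V)" "restrict s V = quot_map T F N V a"
    using GN.sec_Q_local[OF s x] .
  obtain W b where W: "openin T W" "x \<in> W" "W \<subseteq> U" "b \<in> carrier (sec K W)" "restrict t W = quot_map T F N W b"
    using KN.sec_Q_local[OF t x] .
  let ?P = "V \<inter> W"
  have P: "openin T ?P" "x \<in> ?P" "?P \<subseteq> V" "?P \<subseteq> W" using V W by auto
  define a' where "a' = rest F ?P a"
  define b' where "b' = rest F ?P b"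
  have a': "a' \<in> carrier (sec G ?P)" and b': "b' \<in> carrier (sec K ?P)"
    unfolding a'_def b'_def using GN.G.rest_mem[OF V(4,1) P(1,3)] GK.N.rest_mem[OF W(4,1) P(1,4)] by auto
  have ab: "a' \<in> carrier (sec F ?P)" "b' \<in> carrier (sec F ?P)"
    using GN.G.sec_subset[OF P(1) a'] GK.N.sec_subset[OF P(1) b'] by auto
  have sx: "s x = quot_map T F N ?P a' x" "t x = quot_map T F N ?P b' x"
    unfolding a'_def b'_def using P fun_cong[OF V(5), of x] fun_cong[OF W(5), of x]
      GN.N.quot_map_rest[OF V(1) P(1,3) GN.G.sec_subset[OF V(1,4)]] GN.N.quot_map_rest[OF W(1) P(1,4) GK.N.sec_subset[OF W(1,4)]]
    by simp_all
  interpret P: group "sec F ?P" using GN.G.group_sec P(1) .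
  have "quot_map T F N ?P (a' \<otimes>\<^bsub>sec F ?P\<^esub> b') = quot_map T F N ?P (b' \<otimes>\<^bsub>sec F ?P\<^esub> a')"
    using comm_K[OF P(1) a' b'] ab by (subst GN.N.quot_map_eq_iff[OF P(1)]) auto
  with GN.N.quot_map_mult[OF P(1,2) ab] GN.N.quot_map_mult[OF P(1,2) ab(2,1)]
  show "(s \<otimes>\<^bsub>sec GN.Q U\<^esub> t) x = (t \<otimes>\<^bsub>sec GN.Q U\<^esub> s) x"
    using x by (simp add: GN.mult_Q sx)
qed

text \<open>The local lifts of a section of \<open>G/K\<close> to \<open>G/N\<close>, and the cocycle of their differences, from which the
  connecting map in degree zero is defined.\<close>

definition lift0 where
  "lift0 s C b \<longleftrightarrow> open_cover T C \<and> (\<forall>U\<in>C. b U \<in> carrier (sec GN.Q U) \<and> quot_proj T F K U (b U) = rest GK.Q U s)"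

definition diff0 where
  "diff0 b = (\<lambda>U V. inv\<^bsub>sec GN.Q (U \<inter> V)\<^esub> (rest GN.Q (U \<inter> V) (b U)) \<otimes>\<^bsub>sec GN.Q (U \<inter> V)\<^esub> rest GN.Q (U \<inter> V) (b V))"

lemma diff_in_K:
  assumes U: "openin T U" and b: "b \<in> carrier (sec GN.Q U)" "b' \<in> carrier (sec GN.Q U)"
    and eq: "quot_proj T F K U b = quot_proj T F K U b'"
  shows "inv\<^bsub>sec GN.Q U\<^esub> b \<otimes>\<^bsub>sec GN.Q U\<^esub> b' \<in> carrier (sec KN.Q U)"
proof (rule proj_kernel[OF U])
  interpret U: group "sec GN.Q U" using GN.group_sec_Q[OF U] .
  interpret V: group "sec GK.Q U" using GK.group_sec_Q[OF U] .
  show "inv\<^bsub>sec GN.Q U\<^esub> b \<otimes>\<^bsub>sec GN.Q U\<^esub> b' \<in> carrier (sec GN.Q U)" using b by simp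
  have "quot_proj T F K U b' \<in> carrier (sec GK.Q U)" using proj.mor_closed b(2) U by blast
  thus "quot_proj T F K U (inv\<^bsub>sec GN.Q U\<^esub> b \<otimes>\<^bsub>sec GN.Q U\<^esub> b') = \<one>\<^bsub>sec GK.Q U\<^esub>"
    using b U by (simp add: proj.mor_mult proj.mor_inv eq)
qed

lemma diff0_Z1:
  assumes s: "s \<in> carrier (sec GK.Q (topspace T))" and l: "lift0 s C b"
  shows "(C, diff0 b) \<in> Z1 T KN.Q" "(C, diff0 b) \<in> Z1 T GN.Q"
proof -
  have C: "open_cover T C" and b: "\<And>U. U \<in> C \<Longrightarrow> b U \<in> carrier (sec GN.Q U)"
    "\<And>U. U \<in> C \<Longrightarrow> quot_proj T F K U (b U) = rest GK.Q U s" using l unfolding lift0_def by auto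
  show z: "(C, diff0 b) \<in> Z1 T GN.Q" unfolding diff0_def using C b(1) by (rule GN.Q.Z1_difference)
  have "diff0 b U V \<in> carrier (sec KN.Q (U \<inter> V))" if UV: "U \<in> C" "V \<in> C" for U V
    unfolding diff0_def
  proof (rule diff_in_K)
    have op: "openin T U" "openin T V" "openin T (U \<inter> V)" using open_coverD[OF C] UV by auto
    thus "openin T (U \<inter> V)" "rest GN.Q (U \<inter> V) (b U) \<in> carrier (sec GN.Q (U \<inter> V))"
      "rest GN.Q (U \<inter> V) (b V) \<in> carrier (sec GN.Q (U \<inter> V))"
      using GN.Q.rest_closed[OF b(1)[OF UV(1)] op(1,3)] GN.Q.rest_closed[OF b(1)[OF UV(2)] op(2,3)] by auto
    have "rest GK.Q (U \<inter> V) (rest GK.Q U s) = rest GK.Q (U \<inter> V) (rest GK.Q V s)"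
      using GK.Q.rest_rest[OF s openin_topspace op(1,3)] GK.Q.rest_rest[OF s openin_topspace op(2,3)]
        openin_subset[OF op(1)] openin_subset[OF op(2)] by auto
    thus "quot_proj T F K (U \<inter> V) (rest GN.Q (U \<inter> V) (b U)) = quot_proj T F K (U \<inter> V) (rest GN.Q (U \<inter> V) (b V))"
      using proj.mor_rest[OF b(1)[OF UV(1)] op(1,3)] proj.mor_rest[OF b(1)[OF UV(2)] op(2,3)] b(2)[OF UV(1)] b(2)[OF UV(2)]
      by auto
  qed
  with z show "(C, diff0 b) \<in> Z1 T KN.Q" unfolding Z1_iff rest_KN mult_KN by blast
qed

text \<open>Two families of lifts differ, over a common refinement, by a 0-cochain with values in \<open>K/N\<close>. Hence the
  definite description in \<open>connecting0\<close> has a value.\<close>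

lemma diff0_unique:
  assumes s: "s \<in> carrier (sec GK.Q (topspace T))" and l: "lift0 s C b" and l': "lift0 s C' b'"
  shows "class1 T KN.Q (C, diff0 b) = class1 T KN.Q (C', diff0 b')"
proof -
  have C: "open_cover T C" and b: "\<And>U. U \<in> C \<Longrightarrow> b U \<in> carrier (sec GN.Q U)"
    "\<And>U. U \<in> C \<Longrightarrow> quot_proj T F K U (b U) = rest GK.Q U s" using l unfolding lift0_def by auto
  have C': "open_cover T C'" and b': "\<And>U. U \<in> C' \<Longrightarrow> b' U \<in> carrier (sec GN.Q U)"
    "\<And>U. U \<in> C' \<Longrightarrow> quot_proj T F K U (b' U) = rest GK.Q U s" using l' unfolding lift0_def by auto
  obtain D \<sigma> \<tau> where D: "open_cover T D" "refines \<sigma> D C" "refines \<tau> D C'"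
    by (rule common_refinement[OF C C'])
  define k where "k U = inv\<^bsub>sec GN.Q U\<^esub> rest GN.Q U (b (\<sigma> U)) \<otimes>\<^bsub>sec GN.Q U\<^esub> rest GN.Q U (b' (\<tau> U))" for U
  have r: "\<sigma> U \<in> C" "U \<subseteq> \<sigma> U" "\<tau> U \<in> C'" "U \<subseteq> \<tau> U" "openin T U" "openin T (\<sigma> U)" "openin T (\<tau> U)" if "U \<in> D" for U
    using refinesD[OF D(2) that] refinesD[OF D(3) that] open_coverD[OF D(1) that] open_coverD[OF C] open_coverD[OF C'] by auto
  have bc: "rest GN.Q P (b (\<sigma> U)) \<in> carrier (sec GN.Q P)" "rest GN.Q P (b' (\<tau> U)) \<in> carrier (sec GN.Q P)"
    if "U \<in> D" "openin T P" "P \<subseteq> U" for U P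
    using GN.Q.rest_closed[OF b(1)[OF r(1)[OF that(1)]] r(6)[OF that(1)] that(2)]
      GN.Q.rest_closed[OF b'(1)[OF r(3)[OF that(1)]] r(7)[OF that(1)] that(2)] r(2,4)[OF that(1)] that(3) by auto
  have kc: "k U \<in> carrier (sec KN.Q U)" if U: "U \<in> D" for U
    unfolding k_def
  proof (rule diff_in_K)
    note rU = r[OF U]
    show "openin T U" by (rule rU(5))
    show "rest GN.Q U (b (\<sigma> U)) \<in> carrier (sec GN.Q U)" "rest GN.Q U (b' (\<tau> U)) \<in> carrier (sec GN.Q U)"
      using bc[OF U rU(5) order_refl] by auto
    have "rest GK.Q U (rest GK.Q (\<sigma> U) s) = rest GK.Q U (rest GK.Q (\<tau> U) s)"
      using GK.Q.rest_rest[OF s openin_topspace rU(6,5,2)] GK.Q.rest_rest[OF s openin_topspace rU(7,5,4)]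
        openin_subset[OF rU(6)] openin_subset[OF rU(7)] by auto
    thus "quot_proj T F K U (rest GN.Q U (b (\<sigma> U))) = quot_proj T F K U (rest GN.Q U (b' (\<tau> U)))"
      using proj.mor_rest[OF b(1)[OF rU(1)] rU(6,5,2)] proj.mor_rest[OF b'(1)[OF rU(3)] rU(7,5,4)] b(2)[OF rU(1)] b'(2)[OF rU(3)]
      by auto
  qed
  have "KN.Q.gauge D k (\<lambda>U V. diff0 b (\<sigma> U) (\<sigma> V)) (\<lambda>U V. diff0 b' (\<tau> U) (\<tau> V))"
    unfolding KN.Q.gauge_def
  proof (intro conjI ballI allI impI kc)
    fix U V P assume UV: "U \<in> D" "V \<in> D" and P: "openin T P" "P \<subseteq> U \<inter> V"
    note rU = r[OF UV(1)] and rV = r[OF UV(2)]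
    have PU: "P \<subseteq> U" "P \<subseteq> V" using P by auto
    interpret P: group "sec GN.Q P" using GN.group_sec_Q[OF P(1)] .
    note cU = bc[OF UV(1) P(1) PU(1)] and cV = bc[OF UV(2) P(1) PU(2)]
    have rk: "rest GN.Q P (k W) = inv\<^bsub>sec GN.Q P\<^esub> rest GN.Q P (b (\<sigma> W)) \<otimes>\<^bsub>sec GN.Q P\<^esub> rest GN.Q P (b' (\<tau> W))"
      if W: "W \<in> D" "P \<subseteq> W" for W
    proof -
      note rW = r[OF W(1)]
      interpret W: group "sec GN.Q W" using GN.group_sec_Q[OF rW(5)] .
      have "rest GN.Q P (rest GN.Q W (b (\<sigma> W))) = rest GN.Q P (b (\<sigma> W))" "rest GN.Q P (rest GN.Q W (b' (\<tau> W))) = rest GN.Q P (b' (\<tau> W))"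
        using GN.Q.rest_rest[OF b(1)[OF rW(1)] rW(6,5) P(1) W(2) rW(2)] GN.Q.rest_rest[OF b'(1)[OF rW(3)] rW(7,5) P(1) W(2) rW(4)] by auto
      thus ?thesis unfolding k_def using bc[OF W(1) rW(5) order_refl] rW(5) P(1) W(2)
        by (simp add: GN.Q.rest_mult GN.Q.rest_inv)
    qed
    have rd: "rest GN.Q P (diff0 c Y Z) = inv\<^bsub>sec GN.Q P\<^esub> rest GN.Q P (c Y) \<otimes>\<^bsub>sec GN.Q P\<^esub> rest GN.Q P (c Z)"
      if c: "c Y \<in> carrier (sec GN.Q Y)" "c Z \<in> carrier (sec GN.Q Z)" and op: "openin T Y" "openin T Z" and sub: "P \<subseteq> Y \<inter> Z" for c Y Z
    proof -
      have R: "openin T (Y \<inter> Z)" using op by auto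
      interpret R: group "sec GN.Q (Y \<inter> Z)" using GN.group_sec_Q[OF R] .
      have "rest GN.Q P (rest GN.Q (Y \<inter> Z) (c Y)) = rest GN.Q P (c Y)" "rest GN.Q P (rest GN.Q (Y \<inter> Z) (c Z)) = rest GN.Q P (c Z)"
        using GN.Q.rest_rest[OF c(1) op(1) R P(1) sub] GN.Q.rest_rest[OF c(2) op(2) R P(1) sub] by auto
      thus ?thesis unfolding diff0_def
        using GN.Q.rest_closed[OF c(1) op(1) R] GN.Q.rest_closed[OF c(2) op(2) R] R P(1) sub
        by (simp add: GN.Q.rest_mult GN.Q.rest_inv)
    qed
    have sub: "P \<subseteq> \<sigma> U \<inter> \<sigma> V" "P \<subseteq> \<tau> U \<inter> \<tau> V" using rU rV PU by auto
    have kcP: "rest GN.Q P (k U) \<in> carrier (sec KN.Q P)"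
      using KN.Q.rest_closed[OF kc[OF UV(1)] rU(5) P(1) PU(1)] by (simp add: rest_KN)
    show "rest KN.Q P (diff0 b' (\<tau> U) (\<tau> V)) = inv\<^bsub>sec KN.Q P\<^esub> rest KN.Q P (k U) \<otimes>\<^bsub>sec KN.Q P\<^esub> rest KN.Q P (diff0 b (\<sigma> U) (\<sigma> V))
       \<otimes>\<^bsub>sec KN.Q P\<^esub> rest KN.Q P (k V)"
      unfolding rest_KN mult_KN unfolding inv_KN[OF P(1) kcP] unfolding rk[OF UV(1) PU(1)] rk[OF UV(2) PU(2)]
        rd[OF b(1)[OF rU(1)] b(1)[OF rV(1)] rU(6) rV(6) sub(1)] rd[OF b'(1)[OF rU(3)] b'(1)[OF rV(3)] rU(7) rV(7) sub(2)]
      using cU cV by (simp add: P.inv_mult_group P.m_assoc P.r_inv_cancel)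
  qed
  hence "cohomologous1 T KN.Q (C, diff0 b) (C', diff0 b')" by (rule KN.Q.gauge_cohomologous1[OF D])
  thus ?thesis using KN.Q.class1_eq_iff[OF diff0_Z1(1)[OF s l] diff0_Z1(1)[OF s l']] by simp
qed

lemma connecting0_eq:
  assumes s: "s \<in> carrier (sec GK.Q (topspace T))" and l: "lift0 s C b"
  shows "connecting0 T KN.Q GN.Q GK.Q (quot_proj T F K) s = class1 T KN.Q (C, diff0 b)"
  unfolding connecting0_def
proof (rule the_equality)
  show "\<exists>C' b'. open_cover T C' \<and> (\<forall>U\<in>C'. b' U \<in> carrier (sec GN.Q U) \<and> quot_proj T F K U (b' U) = rest GK.Q U s) \<and>
     class1 T KN.Q (C, diff0 b) = class1 T KN.Q (C', \<lambda>U V. inv\<^bsub>sec GN.Q (U \<inter> V)\<^esub> rest GN.Q (U \<inter> V) (b' U) \<otimes>\<^bsub>sec GN.Q (U \<inter> V)\<^esub> rest GN.Q (U \<inter> V) (b' V))"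
    using l unfolding lift0_def diff0_def by blast
  fix h assume "\<exists>C' b'. open_cover T C' \<and> (\<forall>U\<in>C'. b' U \<in> carrier (sec GN.Q U) \<and> quot_proj T F K U (b' U) = rest GK.Q U s) \<and>
     h = class1 T KN.Q (C', \<lambda>U V. inv\<^bsub>sec GN.Q (U \<inter> V)\<^esub> rest GN.Q (U \<inter> V) (b' U) \<otimes>\<^bsub>sec GN.Q (U \<inter> V)\<^esub> rest GN.Q (U \<inter> V) (b' V))"
  then obtain C' b' where l': "lift0 s C' b'" and h: "h = class1 T KN.Q (C', diff0 b')"
    unfolding lift0_def diff0_def by blast
  show "h = class1 T KN.Q (C, diff0 b)" unfolding h by (rule diff0_unique[OF s l' l])
qed

text \<open>The local lifts can be chosen as images of sections of \<open>G\<close> itself. Their differences form a cocycle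
  before they are reduced modulo \<open>N\<close>, and they lie in \<open>K\<close> since they are trivial modulo \<open>K\<close>.\<close>

lemma connecting0_cocycle:
  assumes s: "s \<in> carrier (sec GK.Q (topspace T))"
  obtains C g where "(C, g) \<in> Z1 T K"
    "connecting0 T KN.Q GN.Q GK.Q (quot_proj T F K) s = class1 T KN.Q (C, \<lambda>U V. quot_map T F N (U \<inter> V) (g U V))"
proof -
  have "\<exists>D \<upsilon> a. open_cover T D \<and> refines \<upsilon> D {topspace T} \<and> (\<forall>V\<in>D. a V \<in> carrier (sec G V)) \<and>
    (\<forall>V\<in>D. rest GK.Q V s = quot_map T F K V (a V))"
    by (rule GK.lift_cover[of "{topspace T}" "\<lambda>_. s"]) (use s open_cover_space in auto)
  then obtain D a where D: "open_cover T D" and a: "\<And>V. V \<in> D \<Longrightarrow> a V \<in> carrier (sec G V)"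
    and sa: "\<And>V. V \<in> D \<Longrightarrow> rest GK.Q V s = quot_map T F K V (a V)" by blast
  define g where "g U V = inv\<^bsub>sec G (U \<inter> V)\<^esub> rest G (U \<inter> V) (a U) \<otimes>\<^bsub>sec G (U \<inter> V)\<^esub> rest G (U \<inter> V) (a V)" for U V
  have gZ: "(D, g) \<in> Z1 T G" unfolding g_def using D a by (rule GN.quot.dom.Z1_difference)
  have gK: "g U V \<in> carrier (sec K (U \<inter> V))" and qg: "quot_map T F N (U \<inter> V) (g U V) = diff0 (\<lambda>U. quot_map T F N U (a U)) U V"
    if UV: "U \<in> D" "V \<in> D" for U V
  proof -
    have op: "openin T U" "openin T V" "openin T (U \<inter> V)" "U \<inter> V \<subseteq> U" "U \<inter> V \<subseteq> V" using open_coverD[OF D] UV by auto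
    interpret R: group "sec F (U \<inter> V)" using GN.G.group_sec op(3) .
    interpret RG: group "sec G (U \<inter> V)" using GN.quot.dom.group_sec op(3) .
    have cl: "rest G (U \<inter> V) (a U) \<in> carrier (sec G (U \<inter> V))" "rest G (U \<inter> V) (a V) \<in> carrier (sec G (U \<inter> V))"
      using GN.quot.dom.rest_closed[OF a[OF UV(1)] op(1,3,4)] GN.quot.dom.rest_closed[OF a[OF UV(2)] op(2,3,5)] by auto
    note cF = cl[THEN GN.G.sec_subset[OF op(3)]]
    have "rest GK.Q (U \<inter> V) (rest GK.Q U s) = rest GK.Q (U \<inter> V) (rest GK.Q V s)"
      using GK.Q.rest_rest[OF s openin_topspace op(1,3,4)] GK.Q.rest_rest[OF s openin_topspace op(2,3,5)]
        openin_subset[OF op(1)] openin_subset[OF op(2)] by auto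
    hence "quot_map T F K (U \<inter> V) (rest G (U \<inter> V) (a V)) = quot_map T F K (U \<inter> V) (rest G (U \<inter> V) (a U))"
      using GK.quot.mor_rest[OF a[OF UV(1)] op(1,3,4)] GK.quot.mor_rest[OF a[OF UV(2)] op(2,3,5)] sa[OF UV(1)] sa[OF UV(2)] by simp
    hence "rest G (U \<inter> V) (a V) \<otimes>\<^bsub>sec F (U \<inter> V)\<^esub> inv\<^bsub>sec F (U \<inter> V)\<^esub> rest G (U \<inter> V) (a U) \<in> carrier (sec K (U \<inter> V))"
      using GK.N.quot_map_eq_iff[OF op(3) cF(2,1)] by simp
    from normal.inv_op_closed1[OF GK.N.normal_sec[OF op(3)] cF(1) this]
    show "g U V \<in> carrier (sec K (U \<inter> V))"
      unfolding g_def using cF cl by (simp add: GN.G.inv_sec[OF op(3)] R.m_assoc)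
    show "quot_map T F N (U \<inter> V) (g U V) = diff0 (\<lambda>U. quot_map T F N U (a U)) U V"
      unfolding diff0_def g_def using cl op(3)
        GN.quot.mor_rest[OF a[OF UV(1)] op(1,3,4)] GN.quot.mor_rest[OF a[OF UV(2)] op(2,3,5)]
        GN.quot.mor_mult[OF RG.inv_closed[OF cl(1)] cl(2) op(3)] GN.quot.mor_inv[OF cl(1) op(3)] by simp
  qed
  have "(D, g) \<in> Z1 T K"
    using gZ gK unfolding Z1_iff by (simp add: GN.G.rest_N GK.N.rest_N)
  moreover have l: "lift0 s D (\<lambda>U. quot_map T F N U (a U))"
    unfolding lift0_def using D GN.quot_map_closed a sa proj_quot_map GN.G.sec_subset open_coverD[OF D] by metis
  hence "connecting0 T KN.Q GN.Q GK.Q (quot_proj T F K) s = class1 T KN.Q (D, \<lambda>U V. quot_map T F N (U \<inter> V) (g U V))"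
    using connecting0_eq[OF s l] KN.Q.class1_cong(2)[OF diff0_Z1(1)[OF s l] qg] by simp
  ultimately show ?thesis by (rule that)
qed

lemma connecting0_one:
  "connecting0 T KN.Q GN.Q GK.Q (quot_proj T F K) \<one>\<^bsub>sec GK.Q (topspace T)\<^esub> = \<one>\<^bsub>H1 T KN.Q\<^esub>"
proof -
  let ?T = "topspace T"
  interpret S: group "sec GK.Q ?T" using GK.group_sec_Q by simp
  interpret R: group "sec GN.Q ?T" using GN.group_sec_Q by simp
  have l: "lift0 \<one>\<^bsub>sec GK.Q ?T\<^esub> {?T} (\<lambda>U. \<one>\<^bsub>sec GN.Q U\<^esub>)"
    unfolding lift0_def using open_cover_space proj.mor_one[OF openin_topspace] GK.Q.rest_id[OF openin_topspace S.one_closed]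
    by simp
  have "class1 T KN.Q ({?T}, diff0 (\<lambda>U. \<one>\<^bsub>sec GN.Q U\<^esub>)) = class1 T KN.Q ({?T}, \<lambda>U V. \<one>\<^bsub>sec KN.Q (U \<inter> V)\<^esub>)"
    by (rule KN.Q.class1_cong(2)[OF KN.Q.Z1_one[OF open_cover_space]])
      (use GN.Q.rest_id[OF openin_topspace R.one_closed] in \<open>simp add: diff0_def one_KN\<close>)
  thus ?thesis
    using connecting0_eq[OF S.one_closed l] KN.Q.class1_one[OF open_cover_space] by simp
qed

text \<open>The 2-cocycle of a lift \<open>b\<close> is a coboundary if the class of the lifted cocycle comes from a cocycle \<open>a\<close> of \<open>G\<close>.
  Over a fine cover the lifted cocycle is the transform of \<open>a\<close> by a gauge transformation of \<open>G/K\<close>, which can be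
  lifted to \<open>G/N\<close>. The corresponding transform \<open>e\<close> of the image of \<open>a\<close> in \<open>G/N\<close> is a cocycle with the same image in \<open>G/K\<close>
  as \<open>b\<close>. So \<open>b = e c\<close> with \<open>c\<close> in \<open>K/N\<close>, and as \<open>c\<close> is central the coboundary of \<open>b\<close> is that of \<open>c\<close>.\<close>

lemma lift_coboundary:
  assumes a: "(C, a) \<in> Z1 T G" and g: "(C', g) \<in> class1 T GK.Q (C, \<lambda>U V. quot_map T F K (U \<inter> V) (a U V))"
    and b: "\<And>U V. U \<in> C' \<Longrightarrow> V \<in> C' \<Longrightarrow> b U V \<in> carrier (sec GN.Q (U \<inter> V)) \<and> quot_proj T F K (U \<inter> V) (b U V) = g U V"
    and B: "open_cover T B" "refines \<sigma> B C'"
  obtains D \<upsilon> c where "open_cover T D" "refines \<upsilon> D B" "c \<in> KN.Q.cochains1 D"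
    "\<forall>U\<in>D. \<forall>V\<in>D. \<forall>W\<in>D.
      rest KN.Q (U \<inter> V \<inter> W) (coboundary1 GN.Q b (\<sigma> (\<upsilon> U)) (\<sigma> (\<upsilon> V)) (\<sigma> (\<upsilon> W))) = coboundary1 KN.Q c U V W"
proof -
  define qa where "qa U V = quot_map T F K (U \<inter> V) (a U V)" for U V
  define na where "na U V = quot_map T F N (U \<inter> V) (a U V)" for U V
  have qa: "(C, qa) \<in> Z1 T GK.Q" unfolding qa_def using a by (rule GK.quot.mor_Z1)
  have na: "(C, na) \<in> Z1 T GN.Q" unfolding na_def using a by (rule GN.quot.mor_Z1)
  have g: "(C', g) \<in> Z1 T GK.Q" "cohomologous1 T GK.Q (C, qa) (C', g)"
    using g unfolding class1_def qa_def by auto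
  obtain B0 \<gamma> \<beta> where B0: "open_cover T B0" "refines \<gamma> B0 C" "refines \<beta> B0 B"
    by (rule common_refinement[OF GK.Q.Z1_cover[OF qa] B(1)])
  obtain A \<rho> k where A: "open_cover T A" "refines \<rho> A B0"
    and k: "GK.Q.gauge A k (\<lambda>U V. qa (\<gamma> (\<rho> U)) (\<gamma> (\<rho> V))) (\<lambda>U V. g (\<sigma> (\<beta> (\<rho> U))) (\<sigma> (\<beta> (\<rho> V))))"
    by (rule GK.Q.coh1_refined[OF qa g B0(1,2) refines_comp[OF B(2) B0(3)]])
  obtain D \<upsilon>0 \<kappa> where D: "open_cover T D" "refines \<upsilon>0 D A"
    and \<kappa>0: "\<forall>V\<in>D. \<kappa> V \<in> carrier (sec G V) \<and> rest GK.Q V (k (\<upsilon>0 V)) = quot_map T F K V (\<kappa> V)"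
    by (rule GK.lift_cover[OF A(1) GK.Q.gauge_closed[OF k]])
  have \<kappa>: "\<And>V. V \<in> D \<Longrightarrow> \<kappa> V \<in> carrier (sec G V)"
    "\<And>V. V \<in> D \<Longrightarrow> rest GK.Q V (k (\<upsilon>0 V)) = quot_map T F K V (\<kappa> V)" using \<kappa>0 by auto
  define \<mu> where "\<mu> U = \<gamma> (\<rho> (\<upsilon>0 U))" for U
  define \<upsilon> where "\<upsilon> U = \<beta> (\<rho> (\<upsilon>0 U))" for U
  have \<mu>: "refines \<mu> D C" and \<upsilon>: "refines \<upsilon> D B"
    unfolding \<mu>_def \<upsilon>_def using refines_comp[OF B0(2) refines_comp[OF A(2) D(2)]] refines_comp[OF B0(3) refines_comp[OF A(2) D(2)]] by auto
  have \<nu>: "refines (\<lambda>U. \<sigma> (\<upsilon> U)) D C'" using refines_comp[OF B(2) \<upsilon>] .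
  define l where "l U = quot_map T F N U (\<kappa> U)" for U
  have lc: "l U \<in> carrier (sec GN.Q U)" "quot_proj T F K U (l U) = rest GK.Q U (k (\<upsilon>0 U))" if "U \<in> D" for U
    unfolding l_def using GN.quot_map_closed[OF open_coverD[OF D(1) that] \<kappa>(1)[OF that]] \<kappa>(2)[OF that]
      proj_quot_map[OF open_coverD[OF D(1) that] GN.G.sec_subset[OF open_coverD[OF D(1) that] \<kappa>(1)[OF that]]] by auto
  define e where "e = (\<lambda>U V. inv\<^bsub>sec GN.Q (U \<inter> V)\<^esub> rest GN.Q (U \<inter> V) (l U) \<otimes>\<^bsub>sec GN.Q (U \<inter> V)\<^esub>
    rest GN.Q (U \<inter> V) (na (\<mu> U) (\<mu> V)) \<otimes>\<^bsub>sec GN.Q (U \<inter> V)\<^esub> rest GN.Q (U \<inter> V) (l V))"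
  have e: "(D, e) \<in> Z1 T GN.Q" unfolding e_def by (rule GN.Q.gauge_transform(1)[OF na D(1) \<mu> lc(1)])
  define c where "c U V = inv\<^bsub>sec GN.Q (U \<inter> V)\<^esub> e U V \<otimes>\<^bsub>sec GN.Q (U \<inter> V)\<^esub> rest GN.Q (U \<inter> V) (b (\<sigma> (\<upsilon> U)) (\<sigma> (\<upsilon> V)))" for U V
  have c: "c U V \<in> carrier (sec KN.Q (U \<inter> V))" and bc: "rest GN.Q (U \<inter> V) (b (\<sigma> (\<upsilon> U)) (\<sigma> (\<upsilon> V))) \<in> carrier (sec GN.Q (U \<inter> V))"
    and ec: "e U V \<in> carrier (sec GN.Q (U \<inter> V))"
    if UV: "U \<in> D" "V \<in> D" for U V
  proof -
    note n = refinesD[OF \<nu> UV(1)] refinesD[OF \<nu> UV(2)] and m = refinesD[OF \<mu> UV(1)] refinesD[OF \<mu> UV(2)]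
    have op: "openin T U" "openin T V" "openin T (U \<inter> V)" "U \<inter> V \<subseteq> U" "U \<inter> V \<subseteq> V"
       "openin T (\<sigma> (\<upsilon> U) \<inter> \<sigma> (\<upsilon> V))" "openin T (\<mu> U \<inter> \<mu> V)"
      using open_coverD[OF D(1)] UV open_coverD[OF GK.Q.Z1_cover[OF g(1)]] open_coverD[OF GK.Q.Z1_cover[OF qa]] n m by auto
    have sub: "U \<inter> V \<subseteq> \<sigma> (\<upsilon> U) \<inter> \<sigma> (\<upsilon> V)" "U \<inter> V \<subseteq> \<mu> U \<inter> \<mu> V" using n m by auto
    note bb = b[OF n(1,3)]
    show bc: "rest GN.Q (U \<inter> V) (b (\<sigma> (\<upsilon> U)) (\<sigma> (\<upsilon> V))) \<in> carrier (sec GN.Q (U \<inter> V))"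
      using GN.Q.rest_closed[OF conjunct1[OF bb] op(6,3) sub(1)] .
    show ec: "e U V \<in> carrier (sec GN.Q (U \<inter> V))" using e UV by (simp add: Z1_iff)
    interpret R: group "sec GN.Q (U \<inter> V)" using GN.group_sec_Q[OF op(3)] .
    have A': "\<upsilon>0 U \<in> A" "\<upsilon>0 V \<in> A" "U \<subseteq> \<upsilon>0 U" "V \<subseteq> \<upsilon>0 V" "openin T (\<upsilon>0 U)" "openin T (\<upsilon>0 V)"
      using refinesD[OF D(2) UV(1)] refinesD[OF D(2) UV(2)] open_coverD[OF A(1)] by auto
    have kU: "rest GK.Q (U \<inter> V) (k (\<upsilon>0 U)) = quot_proj T F K (U \<inter> V) (rest GN.Q (U \<inter> V) (l U))"
      using proj.mor_rest[OF lc(1)[OF UV(1)] op(1,3,4)] lc(2)[OF UV(1)]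
        GK.Q.rest_rest[OF GK.Q.gauge_closed[OF k A'(1)] A'(5) op(1,3,4) A'(3)] by simp
    have kV: "rest GK.Q (U \<inter> V) (k (\<upsilon>0 V)) = quot_proj T F K (U \<inter> V) (rest GN.Q (U \<inter> V) (l V))"
      using proj.mor_rest[OF lc(1)[OF UV(2)] op(2,3,5)] lc(2)[OF UV(2)]
        GK.Q.rest_rest[OF GK.Q.gauge_closed[OF k A'(2)] A'(6) op(2,3,5) A'(4)] by simp
    have nac: "na (\<mu> U) (\<mu> V) \<in> carrier (sec GN.Q (\<mu> U \<inter> \<mu> V))" using na m by (simp add: Z1_iff)
    have aG: "a (\<mu> U) (\<mu> V) \<in> carrier (sec F (\<mu> U \<inter> \<mu> V))"
      using a m GN.G.sec_subset[OF op(7)] by (simp add: Z1_iff)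
    have kq: "rest GK.Q (U \<inter> V) (qa (\<mu> U) (\<mu> V)) = quot_proj T F K (U \<inter> V) (rest GN.Q (U \<inter> V) (na (\<mu> U) (\<mu> V)))"
      using proj.mor_rest[OF nac op(7,3) sub(2)] proj_quot_map[OF op(7) aG] unfolding na_def qa_def by simp
    have lcl: "rest GN.Q (U \<inter> V) (l U) \<in> carrier (sec GN.Q (U \<inter> V))" "rest GN.Q (U \<inter> V) (l V) \<in> carrier (sec GN.Q (U \<inter> V))"
      "rest GN.Q (U \<inter> V) (na (\<mu> U) (\<mu> V)) \<in> carrier (sec GN.Q (U \<inter> V))"
      using GN.Q.rest_closed[OF lc(1)[OF UV(1)] op(1,3,4)] GN.Q.rest_closed[OF lc(1)[OF UV(2)] op(2,3,5)]
        GN.Q.rest_closed[OF nac op(7,3) sub(2)] by auto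
    have AUV: "U \<inter> V \<subseteq> \<upsilon>0 U \<inter> \<upsilon>0 V" using A' by auto
    have "quot_proj T F K (U \<inter> V) (rest GN.Q (U \<inter> V) (b (\<sigma> (\<upsilon> U)) (\<sigma> (\<upsilon> V)))) = rest GK.Q (U \<inter> V) (g (\<sigma> (\<upsilon> U)) (\<sigma> (\<upsilon> V)))"
      using proj.mor_rest[OF conjunct1[OF bb] op(6,3) sub(1)] bb by simp
    also have "\<dots> = inv\<^bsub>sec GK.Q (U \<inter> V)\<^esub> rest GK.Q (U \<inter> V) (k (\<upsilon>0 U)) \<otimes>\<^bsub>sec GK.Q (U \<inter> V)\<^esub>
       rest GK.Q (U \<inter> V) (qa (\<mu> U) (\<mu> V)) \<otimes>\<^bsub>sec GK.Q (U \<inter> V)\<^esub> rest GK.Q (U \<inter> V) (k (\<upsilon>0 V))"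
      unfolding \<mu>_def \<upsilon>_def by (rule GK.Q.gauge_eq[OF k A'(1,2) op(3) AUV])
    also have "\<dots> = quot_proj T F K (U \<inter> V) (e U V)"
      unfolding kU kV kq e_def using lcl op(3) by (simp add: proj.mor_mult proj.mor_inv)
    finally show "c U V \<in> carrier (sec KN.Q (U \<inter> V))"
      unfolding c_def by (intro diff_in_K[OF op(3) ec bc]) simp
  qed
  have "rest KN.Q (U \<inter> V \<inter> W) (coboundary1 GN.Q b (\<sigma> (\<upsilon> U)) (\<sigma> (\<upsilon> V)) (\<sigma> (\<upsilon> W))) = coboundary1 KN.Q c U V W"
    if UVW: "U \<in> D" "V \<in> D" "W \<in> D" for U V W
  proof -
    let ?Q = "U \<inter> V \<inter> W" and ?R = "\<sigma> (\<upsilon> U) \<inter> \<sigma> (\<upsilon> V) \<inter> \<sigma> (\<upsilon> W)"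
    note n = refinesD[OF \<nu> UVW(1)] refinesD[OF \<nu> UVW(2)] refinesD[OF \<nu> UVW(3)]
    have opn: "openin T (\<sigma> (\<upsilon> U))" "openin T (\<sigma> (\<upsilon> V))" "openin T (\<sigma> (\<upsilon> W))"
      using open_coverD[OF GK.Q.Z1_cover[OF g(1)]] n by auto
    have op: "openin T U" "openin T V" "openin T W" using open_coverD[OF D(1)] UVW by auto
    have Q: "openin T ?Q" "openin T ?R" "?Q \<subseteq> ?R" using op opn n by auto
    interpret Q: group "sec GN.Q ?Q" using GN.group_sec_Q[OF Q(1)] .
    interpret R: group "sec GN.Q ?R" using GN.group_sec_Q[OF Q(2)] .
    have bR: "rest GN.Q ?R (b Y Z) \<in> carrier (sec GN.Q ?R)" "rest GN.Q ?Q (rest GN.Q ?R (b Y Z)) = rest GN.Q ?Q (b Y Z)"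
      if "Y \<in> C'" "Z \<in> C'" "openin T Y" "openin T Z" "?R \<subseteq> Y \<inter> Z" for Y Z
      using GN.Q.rest_closed[OF conjunct1[OF b[OF that(1,2)]] _ Q(2) that(5)]
        GN.Q.rest_rest[OF conjunct1[OF b[OF that(1,2)]] _ Q(2,1,3) that(5)] that(3,4) by auto
    have sR: "?R \<subseteq> \<sigma> (\<upsilon> V) \<inter> \<sigma> (\<upsilon> W)" "?R \<subseteq> \<sigma> (\<upsilon> U) \<inter> \<sigma> (\<upsilon> W)" "?R \<subseteq> \<sigma> (\<upsilon> U) \<inter> \<sigma> (\<upsilon> V)" by auto
    note b1 = bR[OF n(3,5) opn(2,3) sR(1)] and b2 = bR[OF n(1,5) opn(1,3) sR(2)] and b3 = bR[OF n(1,3) opn(1,2) sR(3)]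
    have lhs: "rest GN.Q ?Q (coboundary1 GN.Q b (\<sigma> (\<upsilon> U)) (\<sigma> (\<upsilon> V)) (\<sigma> (\<upsilon> W))) =
      rest GN.Q ?Q (b (\<sigma> (\<upsilon> V)) (\<sigma> (\<upsilon> W))) \<otimes>\<^bsub>sec GN.Q ?Q\<^esub> inv\<^bsub>sec GN.Q ?Q\<^esub> rest GN.Q ?Q (b (\<sigma> (\<upsilon> U)) (\<sigma> (\<upsilon> W)))
        \<otimes>\<^bsub>sec GN.Q ?Q\<^esub> rest GN.Q ?Q (b (\<sigma> (\<upsilon> U)) (\<sigma> (\<upsilon> V)))"
      unfolding coboundary1_def Let_def using b1 b2 b3 Q by (simp add: GN.Q.rest_mult GN.Q.rest_inv)
    have dec: "rest GN.Q ?Q (b (\<sigma> (\<upsilon> Y)) (\<sigma> (\<upsilon> Z))) = rest GN.Q ?Q (e Y Z) \<otimes>\<^bsub>sec GN.Q ?Q\<^esub> rest GN.Q ?Q (c Y Z)"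
      "rest GN.Q ?Q (c Y Z) \<in> carrier (sec KN.Q ?Q)" "rest GN.Q ?Q (e Y Z) \<in> carrier (sec GN.Q ?Q)"
      if YZ: "Y \<in> D" "Z \<in> D" and sub: "?Q \<subseteq> Y \<inter> Z" for Y Z
    proof -
      note n' = refinesD[OF \<nu> YZ(1)] refinesD[OF \<nu> YZ(2)]
      have o: "openin T (Y \<inter> Z)" "openin T (\<sigma> (\<upsilon> Y) \<inter> \<sigma> (\<upsilon> Z))" "Y \<inter> Z \<subseteq> \<sigma> (\<upsilon> Y) \<inter> \<sigma> (\<upsilon> Z)"
        using open_coverD[OF D(1)] YZ open_coverD[OF GK.Q.Z1_cover[OF g(1)]] n' by auto
      interpret S: group "sec GN.Q (Y \<inter> Z)" using GN.group_sec_Q[OF o(1)] .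
      have cG: "c Y Z \<in> carrier (sec GN.Q (Y \<inter> Z))" using sec_KN_subset[OF o(1) c[OF YZ]] .
      have "rest GN.Q (Y \<inter> Z) (b (\<sigma> (\<upsilon> Y)) (\<sigma> (\<upsilon> Z))) = e Y Z \<otimes>\<^bsub>sec GN.Q (Y \<inter> Z)\<^esub> c Y Z"
        unfolding c_def using ec[OF YZ] bc[OF YZ] by (simp add: S.r_inv_cancel)
      hence "rest GN.Q ?Q (rest GN.Q (Y \<inter> Z) (b (\<sigma> (\<upsilon> Y)) (\<sigma> (\<upsilon> Z)))) = rest GN.Q ?Q (e Y Z) \<otimes>\<^bsub>sec GN.Q ?Q\<^esub> rest GN.Q ?Q (c Y Z)"
        using GN.Q.rest_mult[OF ec[OF YZ] cG o(1) Q(1) sub] by simp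
      thus "rest GN.Q ?Q (b (\<sigma> (\<upsilon> Y)) (\<sigma> (\<upsilon> Z))) = rest GN.Q ?Q (e Y Z) \<otimes>\<^bsub>sec GN.Q ?Q\<^esub> rest GN.Q ?Q (c Y Z)"
        using GN.Q.rest_rest[OF conjunct1[OF b[OF n'(1,3)]] o(2,1) Q(1) sub o(3)] by simp
      show "rest GN.Q ?Q (c Y Z) \<in> carrier (sec KN.Q ?Q)" using KN.Q.rest_closed[OF c[OF YZ] o(1) Q(1) sub] by (simp add: rest_KN)
      show "rest GN.Q ?Q (e Y Z) \<in> carrier (sec GN.Q ?Q)" using GN.Q.rest_closed[OF ec[OF YZ] o(1) Q(1) sub] .
    qed
    have sQ: "?Q \<subseteq> V \<inter> W" "?Q \<subseteq> U \<inter> W" "?Q \<subseteq> U \<inter> V" by auto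
    note d1 = dec[OF UVW(2,3) sQ(1)] and d2 = dec[OF UVW(1,3) sQ(2)] and d3 = dec[OF UVW(1,2) sQ(3)]
    have coc: "rest GN.Q ?Q (e U W) = rest GN.Q ?Q (e U V) \<otimes>\<^bsub>sec GN.Q ?Q\<^esub> rest GN.Q ?Q (e V W)"
      by (rule GN.Q.Z1_cocycle[OF e UVW Q(1) order_refl, symmetric])
    have "rest GN.Q ?Q (coboundary1 GN.Q b (\<sigma> (\<upsilon> U)) (\<sigma> (\<upsilon> V)) (\<sigma> (\<upsilon> W))) =
      rest GN.Q ?Q (c V W) \<otimes>\<^bsub>sec GN.Q ?Q\<^esub> inv\<^bsub>sec GN.Q ?Q\<^esub> rest GN.Q ?Q (c U W) \<otimes>\<^bsub>sec GN.Q ?Q\<^esub> rest GN.Q ?Q (c U V)"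
      unfolding lhs d1(1) d2(1) d3(1) coc
      by (rule Q.coboundary_central_twist[OF d3(3) d1(3) sec_KN_subset[OF Q(1) d1(2)] sec_KN_subset[OF Q(1) d2(2)]
          sec_KN_subset[OF Q(1) d3(2)] KN_central[OF Q(1) _ d1(2)] KN_central[OF Q(1) _ d2(2)]])
    thus ?thesis unfolding coboundary1_def Let_def rest_KN mult_KN inv_KN[OF Q(1) d2(2)] .
  qed
  moreover have "c \<in> KN.Q.cochains1 D" unfolding KN.Q.cochains1_def using c by blast
  ultimately show ?thesis using that[OF D(1) \<upsilon>] by blast
qed

text \<open>The unit of \<open>H2\<close> is a set of 2-cocycles, the ones that are cohomologous to the trivial cocycle. Multiplying
  the witnesses by the cochain of \<open>lift_coboundary\<close>, or by its inverse, shows that they are exactly those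
  that are cohomologous to the 2-cocycle of the lift.\<close>

lemma class2_lift_trivial:
  assumes a: "(C, a) \<in> Z1 T G" and g: "(C', g) \<in> class1 T GK.Q (C, \<lambda>U V. quot_map T F K (U \<inter> V) (a U V))"
    and b: "\<And>U V. U \<in> C' \<Longrightarrow> V \<in> C' \<Longrightarrow> b U V \<in> carrier (sec GN.Q (U \<inter> V)) \<and> quot_proj T F K (U \<inter> V) (b U V) = g U V"
  shows "class2 T KN.Q (C', coboundary1 GN.Q b) = \<one>\<^bsub>H2 T KN.Q\<^esub>"
proof -
  let ?one = "\<lambda>U V W. \<one>\<^bsub>sec KN.Q (U \<inter> V \<inter> W)\<^esub>"
  have C': "open_cover T C'" using g unfolding class1_def by (auto simp: Z1_iff)
  have bc: "b \<in> GN.Q.cochains1 C'" unfolding GN.Q.cochains1_def using b by blast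
  have dr: "rest KN.Q P (rest KN.Q R (d Y1 Y2 Y3)) = rest KN.Q P (d Y1 Y2 Y3)"
    if "(E, d) \<in> Z2 T KN.Q" "Y1 \<in> E" "Y2 \<in> E" "Y3 \<in> E" "openin T R" "openin T P" "P \<subseteq> R" "R \<subseteq> Y1 \<inter> Y2 \<inter> Y3" for E d Y1 Y2 Y3 R P
    using that by (intro KN.Q.rest_rest[of _ "Y1 \<inter> Y2 \<inter> Y3"]) (auto simp: Z2_def open_cover_def)
  have br: "rest KN.Q R (coboundary1 GN.Q b Y1 Y2 Y3) \<in> carrier (sec GN.Q R)"
    "rest KN.Q P (rest KN.Q R (coboundary1 GN.Q b Y1 Y2 Y3)) = rest KN.Q P (coboundary1 GN.Q b Y1 Y2 Y3)"
    if "Y1 \<in> C'" "Y2 \<in> C'" "Y3 \<in> C'" "openin T R" "openin T P" "P \<subseteq> R" "R \<subseteq> Y1 \<inter> Y2 \<inter> Y3" for Y1 Y2 Y3 R P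
  proof -
    have "openin T (Y1 \<inter> Y2 \<inter> Y3)" using open_coverD[OF C'] that by auto
    thus "rest KN.Q R (coboundary1 GN.Q b Y1 Y2 Y3) \<in> carrier (sec GN.Q R)"
    "rest KN.Q P (rest KN.Q R (coboundary1 GN.Q b Y1 Y2 Y3)) = rest KN.Q P (coboundary1 GN.Q b Y1 Y2 Y3)"
      using GN.Q.rest_closed[OF GN.Q.coboundary1_closed[OF bc C' that(1-3)] _ that(4,7)]
       GN.Q.rest_rest[OF GN.Q.coboundary1_closed[OF bc C' that(1-3)] _ that(4-7)] by (auto simp: rest_KN)
  qed
  have "cohomologous2 T KN.Q (C', coboundary1 GN.Q b) (E, d) \<longleftrightarrow> cohomologous2 T KN.Q ({topspace T}, ?one) (E, d)"
    if d: "(E, d) \<in> Z2 T KN.Q" for E d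
  proof
    assume "cohomologous2 T KN.Q (C', coboundary1 GN.Q b) (E, d)"
    then obtain B \<sigma> \<tau> k where B: "open_cover T B" "refines \<sigma> B C'" "refines \<tau> B E" and k: "k \<in> KN.Q.cochains1 B"
      and eq: "\<And>U V W. U \<in> B \<Longrightarrow> V \<in> B \<Longrightarrow> W \<in> B \<Longrightarrow> rest KN.Q (U \<inter> V \<inter> W) (d (\<tau> U) (\<tau> V) (\<tau> W)) =
         rest KN.Q (U \<inter> V \<inter> W) (coboundary1 GN.Q b (\<sigma> U) (\<sigma> V) (\<sigma> W)) \<otimes>\<^bsub>sec KN.Q (U \<inter> V \<inter> W)\<^esub> coboundary1 KN.Q k U V W"
      unfolding cohomologous2_iff KN.Q.cochains1_def by blast
    obtain D \<upsilon> c where D: "open_cover T D" "refines \<upsilon> D B" and c: "c \<in> KN.Q.cochains1 D" and cb: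
      "\<forall>U\<in>D. \<forall>V\<in>D. \<forall>W\<in>D.
      rest KN.Q (U \<inter> V \<inter> W) (coboundary1 GN.Q b (\<sigma> (\<upsilon> U)) (\<sigma> (\<upsilon> V)) (\<sigma> (\<upsilon> W))) = coboundary1 KN.Q c U V W"
      by (rule lift_coboundary[OF a g b B(1,2)])
    define k' where "k' = (\<lambda>U V. rest KN.Q (U \<inter> V) (k (\<upsilon> U) (\<upsilon> V)))"
    have k': "k' \<in> KN.Q.cochains1 D" unfolding k'_def by (rule KN.Q.cochains1_refine[OF k B(1) D])
    define c' where "c' = (\<lambda>U V. c U V \<otimes>\<^bsub>sec KN.Q (U \<inter> V)\<^esub> k' U V)"
    have c': "c' \<in> KN.Q.cochains1 D" unfolding c'_def by (rule KN.cochains1_mult[OF c k' D(1)])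
    show "cohomologous2 T KN.Q ({topspace T}, ?one) (E, d)"
      unfolding cohomologous2_iff
    proof (rule exI[of _ D], rule exI[of _ "\<lambda>_. topspace T"], rule exI[of _ "\<lambda>U. \<tau> (\<upsilon> U)"], rule exI[of _ c'], intro conjI ballI)
      show "open_cover T D" "refines (\<lambda>_. topspace T) D {topspace T}" "refines (\<lambda>U. \<tau> (\<upsilon> U)) D E"
        using D(1) refines_space[OF D(1)] refines_comp[OF B(3) D(2)] by auto
      fix U V assume UV: "U \<in> D" "V \<in> D"
      show "c' U V \<in> carrier (sec KN.Q (U \<inter> V))" using KN.Q.cochains1D[OF c' UV] .
      fix W assume W: "W \<in> D"
      let ?Q = "U \<inter> V \<inter> W" and ?R = "\<upsilon> U \<inter> \<upsilon> V \<inter> \<upsilon> W"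
      note r = refinesD[OF D(2) UV(1)] refinesD[OF D(2) UV(2)] refinesD[OF D(2) W]
      have op: "openin T ?Q" "openin T ?R" "?Q \<subseteq> ?R" "openin T U" "openin T V" "openin T W"
        using open_coverD[OF D(1)] UV W open_coverD[OF B(1)] r by auto
      note t = refinesD[OF B(3) r(1)] refinesD[OF B(3) r(3)] refinesD[OF B(3) r(5)]
      note s = refinesD[OF B(2) r(1)] refinesD[OF B(2) r(3)] refinesD[OF B(2) r(5)]
      interpret Q: comm_group "sec KN.Q ?Q" using KN.comm_sec op(1) .
      have sub: "?R \<subseteq> \<tau> (\<upsilon> U) \<inter> \<tau> (\<upsilon> V) \<inter> \<tau> (\<upsilon> W)" "?R \<subseteq> \<sigma> (\<upsilon> U) \<inter> \<sigma> (\<upsilon> V) \<inter> \<sigma> (\<upsilon> W)" using t s by auto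
      note bR = br[OF s(1,3,5) op(2,1,3) sub(2)]
      have "rest KN.Q ?Q (d (\<tau> (\<upsilon> U)) (\<tau> (\<upsilon> V)) (\<tau> (\<upsilon> W))) = rest KN.Q ?Q (rest KN.Q ?R (d (\<tau> (\<upsilon> U)) (\<tau> (\<upsilon> V)) (\<tau> (\<upsilon> W))))"
        by (rule dr[OF d t(1,3,5) op(2,1,3) sub(1), symmetric])
      also have "\<dots> = rest KN.Q ?Q (rest KN.Q ?R (coboundary1 GN.Q b (\<sigma> (\<upsilon> U)) (\<sigma> (\<upsilon> V)) (\<sigma> (\<upsilon> W))) \<otimes>\<^bsub>sec KN.Q ?R\<^esub> coboundary1 KN.Q k (\<upsilon> U) (\<upsilon> V) (\<upsilon> W))"
        unfolding eq[OF r(1,3,5)] ..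
      also have "\<dots> = rest KN.Q ?Q (rest KN.Q ?R (coboundary1 GN.Q b (\<sigma> (\<upsilon> U)) (\<sigma> (\<upsilon> V)) (\<sigma> (\<upsilon> W)))) \<otimes>\<^bsub>sec KN.Q ?Q\<^esub> rest KN.Q ?Q (coboundary1 KN.Q k (\<upsilon> U) (\<upsilon> V) (\<upsilon> W))"
        using GN.Q.rest_mult[OF bR(1) sec_KN_subset[OF op(2) KN.Q.coboundary1_closed[OF k B(1) r(1,3,5)]] op(2,1,3)]
        by (simp add: rest_KN mult_KN)
      also have "\<dots> = coboundary1 KN.Q c U V W \<otimes>\<^bsub>sec KN.Q ?Q\<^esub> coboundary1 KN.Q k' U V W"
        unfolding bR(2) cb[rule_format, OF UV W] k'_def KN.Q.coboundary1_refine[OF k B(1) D UV W] ..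
      also have "\<dots> = coboundary1 KN.Q c' U V W"
        unfolding c'_def by (rule KN.coboundary1_mult[OF c k' D(1) UV W, symmetric])
      also have "\<dots> = rest KN.Q ?Q \<one>\<^bsub>sec KN.Q (topspace T \<inter> topspace T \<inter> topspace T)\<^esub> \<otimes>\<^bsub>sec KN.Q ?Q\<^esub> coboundary1 KN.Q c' U V W"
        using KN.Q.rest_one[OF openin_topspace op(1) openin_subset[OF op(1)]] KN.Q.coboundary1_closed[OF c' D(1) UV W] by simp
      finally show "rest KN.Q ?Q (d (\<tau> (\<upsilon> U)) (\<tau> (\<upsilon> V)) (\<tau> (\<upsilon> W))) =
        rest KN.Q ?Q \<one>\<^bsub>sec KN.Q (topspace T \<inter> topspace T \<inter> topspace T)\<^esub> \<otimes>\<^bsub>sec KN.Q ?Q\<^esub> coboundary1 KN.Q c' U V W" .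
    qed
  next
    assume "cohomologous2 T KN.Q ({topspace T}, ?one) (E, d)"
    then obtain B \<sigma> \<tau> k where B: "open_cover T B" "refines \<sigma> B {topspace T}" "refines \<tau> B E" and k: "k \<in> KN.Q.cochains1 B"
      and eq: "\<And>U V W. U \<in> B \<Longrightarrow> V \<in> B \<Longrightarrow> W \<in> B \<Longrightarrow> rest KN.Q (U \<inter> V \<inter> W) (d (\<tau> U) (\<tau> V) (\<tau> W)) =
         rest KN.Q (U \<inter> V \<inter> W) \<one>\<^bsub>sec KN.Q (\<sigma> U \<inter> \<sigma> V \<inter> \<sigma> W)\<^esub> \<otimes>\<^bsub>sec KN.Q (U \<inter> V \<inter> W)\<^esub> coboundary1 KN.Q k U V W"
      unfolding cohomologous2_iff KN.Q.cochains1_def by blast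
    obtain B0 \<beta> \<gamma> where B0: "open_cover T B0" "refines \<beta> B0 B" "refines \<gamma> B0 C'"
      by (rule common_refinement[OF B(1) C'])
    obtain D \<upsilon> c where D: "open_cover T D" "refines \<upsilon> D B0" and c: "c \<in> KN.Q.cochains1 D" and cb:
      "\<forall>U\<in>D. \<forall>V\<in>D. \<forall>W\<in>D.
      rest KN.Q (U \<inter> V \<inter> W) (coboundary1 GN.Q b (\<gamma> (\<upsilon> U)) (\<gamma> (\<upsilon> V)) (\<gamma> (\<upsilon> W))) = coboundary1 KN.Q c U V W"
      by (rule lift_coboundary[OF a g b B0(1,3)])
    note DB = refines_comp[OF B0(2) D(2)]
    define k' where "k' = (\<lambda>U V. rest KN.Q (U \<inter> V) (k (\<beta> (\<upsilon> U)) (\<beta> (\<upsilon> V))))"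
    have k': "k' \<in> KN.Q.cochains1 D" unfolding k'_def by (rule KN.Q.cochains1_refine[OF k B(1) D(1) DB])
    define i where "i = (\<lambda>U V. inv\<^bsub>sec KN.Q (U \<inter> V)\<^esub> c U V)"
    have i: "i \<in> KN.Q.cochains1 D" unfolding i_def by (rule KN.cochains1_inv[OF c D(1)])
    define c' where "c' = (\<lambda>U V. i U V \<otimes>\<^bsub>sec KN.Q (U \<inter> V)\<^esub> k' U V)"
    have c': "c' \<in> KN.Q.cochains1 D" unfolding c'_def by (rule KN.cochains1_mult[OF i k' D(1)])
    show "cohomologous2 T KN.Q (C', coboundary1 GN.Q b) (E, d)"
      unfolding cohomologous2_iff
    proof (rule exI[of _ D], rule exI[of _ "\<lambda>U. \<gamma> (\<upsilon> U)"], rule exI[of _ "\<lambda>U. \<tau> (\<beta> (\<upsilon> U))"], rule exI[of _ c'], intro conjI ballI)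
      show "open_cover T D" "refines (\<lambda>U. \<gamma> (\<upsilon> U)) D C'" "refines (\<lambda>U. \<tau> (\<beta> (\<upsilon> U))) D E"
        using D(1) refines_comp[OF B0(3) D(2)] refines_comp[OF B(3) DB] by auto
      fix U V assume UV: "U \<in> D" "V \<in> D"
      show "c' U V \<in> carrier (sec KN.Q (U \<inter> V))" using KN.Q.cochains1D[OF c' UV] .
      fix W assume W: "W \<in> D"
      let ?Q = "U \<inter> V \<inter> W" and ?R = "\<beta> (\<upsilon> U) \<inter> \<beta> (\<upsilon> V) \<inter> \<beta> (\<upsilon> W)"
      note r = refinesD[OF DB UV(1)] refinesD[OF DB UV(2)] refinesD[OF DB W]
      have op: "openin T ?Q" "openin T ?R" "?Q \<subseteq> ?R"
        using open_coverD[OF D(1)] UV W open_coverD[OF B(1)] r by auto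
      note t = refinesD[OF B(3) r(1)] refinesD[OF B(3) r(3)] refinesD[OF B(3) r(5)]
      note s = refinesD[OF B(2) r(1)] refinesD[OF B(2) r(3)] refinesD[OF B(2) r(5)]
      interpret Q: comm_group "sec KN.Q ?Q" using KN.comm_sec op(1) .
      interpret R: comm_group "sec KN.Q ?R" using KN.comm_sec op(2) .
      have sub: "?R \<subseteq> \<tau> (\<beta> (\<upsilon> U)) \<inter> \<tau> (\<beta> (\<upsilon> V)) \<inter> \<tau> (\<beta> (\<upsilon> W))" using t by auto
      have cc': "coboundary1 KN.Q c' U V W = coboundary1 KN.Q i U V W \<otimes>\<^bsub>sec KN.Q ?Q\<^esub> coboundary1 KN.Q k' U V W"
        unfolding c'_def by (rule KN.coboundary1_mult[OF i k' D(1) UV W])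
      have ci: "coboundary1 KN.Q i U V W = inv\<^bsub>sec KN.Q ?Q\<^esub> coboundary1 KN.Q c U V W"
        unfolding i_def by (rule KN.coboundary1_inv[OF c D(1) UV W])
      have sX: "\<sigma> (\<beta> (\<upsilon> U)) \<inter> \<sigma> (\<beta> (\<upsilon> V)) \<inter> \<sigma> (\<beta> (\<upsilon> W)) = topspace T" using s by auto
      have "rest KN.Q ?Q (d (\<tau> (\<beta> (\<upsilon> U))) (\<tau> (\<beta> (\<upsilon> V))) (\<tau> (\<beta> (\<upsilon> W)))) =
          rest KN.Q ?Q (rest KN.Q ?R (d (\<tau> (\<beta> (\<upsilon> U))) (\<tau> (\<beta> (\<upsilon> V))) (\<tau> (\<beta> (\<upsilon> W)))))"
        by (rule dr[OF d t(1,3,5) op(2,1,3) sub, symmetric])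
      also have "\<dots> = rest KN.Q ?Q (coboundary1 KN.Q k (\<beta> (\<upsilon> U)) (\<beta> (\<upsilon> V)) (\<beta> (\<upsilon> W)))"
        unfolding eq[OF r(1,3,5)] sX
        using KN.Q.rest_one[OF openin_topspace op(2) openin_subset[OF op(2)]] KN.Q.coboundary1_closed[OF k B(1) r(1,3,5)] by simp
      also have "\<dots> = coboundary1 KN.Q k' U V W"
        unfolding k'_def KN.Q.coboundary1_refine[OF k B(1) D(1) DB UV W] ..
      also have "\<dots> = coboundary1 KN.Q c U V W \<otimes>\<^bsub>sec KN.Q ?Q\<^esub> coboundary1 KN.Q c' U V W"
        unfolding cc' ci using KN.Q.coboundary1_closed[OF c D(1) UV W] KN.Q.coboundary1_closed[OF k' D(1) UV W] by (simp add: Q.r_inv_cancel)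
      finally show "rest KN.Q ?Q (d (\<tau> (\<beta> (\<upsilon> U))) (\<tau> (\<beta> (\<upsilon> V))) (\<tau> (\<beta> (\<upsilon> W)))) =
        rest KN.Q ?Q (coboundary1 GN.Q b (\<gamma> (\<upsilon> U)) (\<gamma> (\<upsilon> V)) (\<gamma> (\<upsilon> W))) \<otimes>\<^bsub>sec KN.Q ?Q\<^esub> coboundary1 KN.Q c' U V W"
        unfolding cb[rule_format, OF UV W] .
    qed
  qed
  thus ?thesis unfolding H2_def class2_def by auto
qed

text \<open>All representatives and all lifts that the definite description of \<open>connecting1\<close> admits lead to the unit.\<close>

lemma connecting1_trivial:
  assumes a: "(C, a) \<in> Z1 T G"
  shows "connecting1 T KN.Q GN.Q (quot_proj T F K) (class1 T GK.Q (C, \<lambda>U V. quot_map T F K (U \<inter> V) (a U V))) = \<one>\<^bsub>H2 T KN.Q\<^esub>"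
    (is "connecting1 _ _ _ _ ?\<theta> = _")
  unfolding connecting1_def
proof (rule the_equality)
  note qa = GK.quot.mor_Z1[OF a]
  let ?b = "\<lambda>U V. quot_map T F N (U \<inter> V) (a U V)"
  have ag: "(C, \<lambda>U V. quot_map T F K (U \<inter> V) (a U V)) \<in> ?\<theta>" by (rule GK.Q.class1_self[OF qa])
  have b: "?b U V \<in> carrier (sec GN.Q (U \<inter> V)) \<and> quot_proj T F K (U \<inter> V) (?b U V) = quot_map T F K (U \<inter> V) (a U V)"
    if "U \<in> C" "V \<in> C" for U V
  proof -
    have "openin T (U \<inter> V)" "a U V \<in> carrier (sec G (U \<inter> V))" using a that by (auto simp: Z1_iff open_cover_def)
    thus ?thesis using GN.quot_map_closed proj_quot_map GN.G.sec_subset by blast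
  qed
  show "\<exists>C g b. (C, g) \<in> ?\<theta> \<and> (\<forall>U\<in>C. \<forall>V\<in>C. b U V \<in> carrier (sec GN.Q (U \<inter> V)) \<and> quot_proj T F K (U \<inter> V) (b U V) = g U V) \<and>
     \<one>\<^bsub>H2 T KN.Q\<^esub> = class2 T KN.Q (C, coboundary1 GN.Q b)"
    using ag b class2_lift_trivial[OF a ag b] by (intro exI[of _ C] exI[of _ "\<lambda>U V. quot_map T F K (U \<inter> V) (a U V)"] exI[of _ ?b]) auto
  fix h assume "\<exists>C g b. (C, g) \<in> ?\<theta> \<and> (\<forall>U\<in>C. \<forall>V\<in>C. b U V \<in> carrier (sec GN.Q (U \<inter> V)) \<and> quot_proj T F K (U \<inter> V) (b U V) = g U V) \<and>
     h = class2 T KN.Q (C, coboundary1 GN.Q b)"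
  then obtain C' g' b' where g': "(C', g') \<in> ?\<theta>" and b': "\<And>U V. U \<in> C' \<Longrightarrow> V \<in> C' \<Longrightarrow>
      b' U V \<in> carrier (sec GN.Q (U \<inter> V)) \<and> quot_proj T F K (U \<inter> V) (b' U V) = g' U V"
    and h: "h = class2 T KN.Q (C', coboundary1 GN.Q b')" by blast
  show "h = \<one>\<^bsub>H2 T KN.Q\<^esub>" unfolding h by (rule class2_lift_trivial[OF a g' b'])
qed

end

section \<open>Atlases and the obstruction complex\<close>

text \<open>The properties of the sheaves \<open>G\<^sub>k\<close> on which the cohomological argument rests. They make
  \<open>G\<^sub>j \<supseteq> G\<^bsub>j+1\<^esub> \<supseteq> G\<^bsub>j+2\<^esub>\<close> a central tower for every \<open>j \<ge> 2\<close>.\<close>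

locale obstruction_tower =
  fixes M :: "('x, 'v) model_data"
  assumes normal_G: "2 \<le> k \<Longrightarrow> normal_subsheaf (space M) (G_sheaf M 2) (G_sheaf M k)"
    and G_decreasing: "2 \<le> j \<Longrightarrow> j \<le> k \<Longrightarrow> carrier (sec (G_sheaf M k) U) \<subseteq> carrier (sec (G_sheaf M j) U)"
    and commutator_G: "2 \<le> j \<Longrightarrow> j \<le> k \<Longrightarrow> openin (space M) U \<Longrightarrow> a \<in> carrier (sec (G_sheaf M j) U) \<Longrightarrow> b \<in> carrier (sec (G_sheaf M k) U) \<Longrightarrow>
      a \<otimes>\<^bsub>sec (G_sheaf M 2) U\<^esub> b \<otimes>\<^bsub>sec (G_sheaf M 2) U\<^esub> inv\<^bsub>sec (G_sheaf M 2) U\<^esub> (b \<otimes>\<^bsub>sec (G_sheaf M 2) U\<^esub> a)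
        \<in> carrier (sec (G_sheaf M (k + 1)) U)"
begin

abbreviation T where "T \<equiv> space M"

lemma central_tower: "2 \<le> j \<Longrightarrow> central_tower T (G_sheaf M 2) (G_sheaf M j) (G_sheaf M (j + 1)) (G_sheaf M (j + 2))"
proof (intro central_tower.intro central_tower_axioms.intro quotient_tower.intro quotient_tower_axioms.intro quotient_sheaf.intro)
  assume j: "2 \<le> j"
  show "normal_subsheaf T (G_sheaf M 2) (G_sheaf M j)" "normal_subsheaf T (G_sheaf M 2) (G_sheaf M j)"
    "normal_subsheaf T (G_sheaf M 2) (G_sheaf M (j + 1))" "normal_subsheaf T (G_sheaf M 2) (G_sheaf M (j + 2))"
    using j by (auto intro: normal_G)
  fix U assume U: "openin T U"
  show "carrier (sec (G_sheaf M (j + 2)) U) \<subseteq> carrier (sec (G_sheaf M (j + 1)) U)"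
    "carrier (sec (G_sheaf M (j + 1)) U) \<subseteq> carrier (sec (G_sheaf M j) U)"
    using G_decreasing[of "j + 1" "j + 2" U] G_decreasing[of j "j + 1" U] j by auto
  fix a b assume a: "a \<in> carrier (sec (G_sheaf M j) U)"
  {
    assume "b \<in> carrier (sec (G_sheaf M j) U)"
    thus "a \<otimes>\<^bsub>sec (G_sheaf M 2) U\<^esub> b \<otimes>\<^bsub>sec (G_sheaf M 2) U\<^esub> inv\<^bsub>sec (G_sheaf M 2) U\<^esub> (b \<otimes>\<^bsub>sec (G_sheaf M 2) U\<^esub> a)
        \<in> carrier (sec (G_sheaf M (j + 1)) U)"
      using commutator_G[OF j _ U a] by simp
  }
  assume "b \<in> carrier (sec (G_sheaf M (j + 1)) U)"
  thus "a \<otimes>\<^bsub>sec (G_sheaf M 2) U\<^esub> b \<otimes>\<^bsub>sec (G_sheaf M 2) U\<^esub> inv\<^bsub>sec (G_sheaf M 2) U\<^esub> (b \<otimes>\<^bsub>sec (G_sheaf M 2) U\<^esub> a)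
        \<in> carrier (sec (G_sheaf M (j + 2)) U)"
    using commutator_G[OF j _ U a, of "j + 1"] by simp
qed

lemma G_proj_eq: "G_proj M k = quot_proj T (G_sheaf M 2) (G_sheaf M k)"
  by (simp add: G_proj_def quot_proj_def fun_eq_iff)

lemma obs_sheaf_nat: "2 \<le> j \<Longrightarrow> obs_sheaf M (int j) = quot_sheaf T (G_sheaf M 2) (G_sheaf M j) (G_sheaf M (j + 1))"
  by (simp add: obs_sheaf_def G_quot_def)

lemma obs_sheaf_Suc: "2 \<le> j \<Longrightarrow> obs_sheaf M (int j + 1) = quot_sheaf T (G_sheaf M 2) (G_sheaf M (j + 1)) (G_sheaf M (j + 2))"
  using obs_sheaf_nat[of "j + 1"] by (simp add: add.commute)

lemma int_ge_2: "2 \<le> (i::int) \<Longrightarrow> \<exists>j. i = int j \<and> 2 \<le> j"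
  by (intro exI[of _ "nat i"]) auto

lemma abelian_obs: "abelian_presheaf T (obs_sheaf M i)"
proof (cases "2 \<le> i")
  case True
  then obtain j where j: "i = int j" "2 \<le> j" using int_ge_2 by blast
  interpret central_tower T "G_sheaf M 2" "G_sheaf M j" "G_sheaf M (j + 1)" "G_sheaf M (j + 2)"
    using central_tower[OF j(2)] .
  show ?thesis using GK.abelian_presheaf_axioms obs_sheaf_nat[OF j(2)] j(1) by simp
next
  case False
  interpret quotient_sheaf T "G_sheaf M 2" "G_sheaf M 2" "G_sheaf M 2"
    using normal_G by (intro quotient_sheaf.intro) auto
  have "abelian_presheaf T Q"
  proof (rule comm_sec_Q)
    fix U a b assume U: "openin T U" and ab: "a \<in> carrier (sec (G_sheaf M 2) U)" "b \<in> carrier (sec (G_sheaf M 2) U)"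
    interpret U: group "sec (G_sheaf M 2) U" using G.group_sec U .
    show "a \<otimes>\<^bsub>sec (G_sheaf M 2) U\<^esub> b \<otimes>\<^bsub>sec (G_sheaf M 2) U\<^esub> inv\<^bsub>sec (G_sheaf M 2) U\<^esub> (b \<otimes>\<^bsub>sec (G_sheaf M 2) U\<^esub> a)
        \<in> carrier (sec (G_sheaf M 2) U)" by (intro U.m_closed U.inv_closed ab)
  qed
  with False show ?thesis by (simp add: obs_sheaf_def G_quot_def)
qed

lemma group_obs_H1: "group (obs_H1 M i)"
  using abelian_presheaf.group_H1[OF abelian_obs] .

text \<open>The component of the obstruction in degree \<open>j\<close>, computed from a cocycle instead of its class.\<close>

definition atlas_class where
  "atlas_class j C a = class1 T (obs_sheaf M (int j)) (C, \<lambda>U V. quot_map T (G_sheaf M 2) (G_sheaf M (j + 1)) (U \<inter> V) (a U V))"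

lemma obstruction_atlas_class:
  assumes j: "2 \<le> j" and a: "(C, a) \<in> Z1 T (G_sheaf M j)"
  shows "obstruction M j (C, a) = (\<lambda>i. if i = int j then atlas_class j C a else \<one>\<^bsub>obs_H1 M i\<^esub>)"
proof -
  interpret central_tower T "G_sheaf M 2" "G_sheaf M j" "G_sheaf M (j + 1)" "G_sheaf M (j + 2)"
    using central_tower[OF j] .
  show ?thesis using GK.quot.H1_map_class1[OF a]
    by (simp add: obstruction_def atlas_class_def obs_sheaf_nat[OF j] fun_eq_iff)
qed

lemma bd1_atlas_class:
  assumes j: "2 \<le> j" and a: "(C, a) \<in> Z1 T (G_sheaf M j)"
  shows "bd1 M (int j) (atlas_class j C a) = \<one>\<^bsub>obs_H2 M (int j + 1)\<^esub>"
proof -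
  interpret central_tower T "G_sheaf M 2" "G_sheaf M j" "G_sheaf M (j + 1)" "G_sheaf M (j + 2)"
    using central_tower[OF j] .
  show ?thesis using connecting1_trivial[OF a] j obs_sheaf_Suc[OF j] obs_sheaf_nat[OF j]
    by (simp add: bd1_def atlas_class_def G_quot_def G_proj_eq)
qed

text \<open>The trivial atlas is the atlas for \<open>\<theta> = 0\<close>; it also shows that \<open>\<partial>\<close> maps the unit of \<open>H\<^sup>1\<close> to the unit.\<close>

lemma trivial_atlas:
  assumes j: "2 \<le> j"
  obtains C a where "(C, a) \<in> Z1 T (G_sheaf M j)" "atlas_class j C a = \<one>\<^bsub>obs_H1 M (int j)\<^esub>"
proof -
  interpret central_tower T "G_sheaf M 2" "G_sheaf M j" "G_sheaf M (j + 1)" "G_sheaf M (j + 2)"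
    using central_tower[OF j] .
  let ?C = "{topspace T}"
  have "class1 T GK.Q (?C, \<lambda>U V. quot_map T (G_sheaf M 2) (G_sheaf M (j + 1)) (U \<inter> V) \<one>\<^bsub>sec (G_sheaf M j) (U \<inter> V)\<^esub>)
     = class1 T GK.Q (?C, \<lambda>U V. \<one>\<^bsub>sec GK.Q (U \<inter> V)\<^esub>)"
    by (rule GK.Q.class1_cong(2)[OF GK.Q.Z1_one[OF open_cover_space]]) (use GK.quot.mor_one[of "topspace T"] in simp)
  hence "atlas_class j ?C (\<lambda>U V. \<one>\<^bsub>sec (G_sheaf M j) (U \<inter> V)\<^esub>) = \<one>\<^bsub>obs_H1 M (int j)\<^esub>"
    using GK.Q.class1_one[OF open_cover_space] obs_sheaf_nat[OF j] by (simp add: atlas_class_def)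
  with GN.quot.dom.Z1_one[OF open_cover_space] show ?thesis by (rule that)
qed

lemma bd1_one: "bd1 M i \<one>\<^bsub>obs_H1 M i\<^esub> = \<one>\<^bsub>obs_H2 M (i + 1)\<^esub>"
proof (cases "2 \<le> i")
  case True
  then obtain j where j: "i = int j" "2 \<le> j" using int_ge_2 by blast
  obtain C a where a: "(C, a) \<in> Z1 T (G_sheaf M j)" "atlas_class j C a = \<one>\<^bsub>obs_H1 M (int j)\<^esub>"
    using trivial_atlas[OF j(2)] .
  show ?thesis using bd1_atlas_class[OF j(2) a(1)] a(2) j(1) by simp
qed (simp add: bd1_def)

lemma bd0_one: "bd0 M i \<one>\<^bsub>obs_H0 M i\<^esub> = \<one>\<^bsub>obs_H1 M (i + 1)\<^esub>"
proof (cases "2 \<le> i")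
  case True
  then obtain j where j: "i = int j" "2 \<le> j" using int_ge_2 by blast
  interpret central_tower T "G_sheaf M 2" "G_sheaf M j" "G_sheaf M (j + 1)" "G_sheaf M (j + 2)"
    using central_tower[OF j(2)] .
  show ?thesis using connecting0_one j obs_sheaf_Suc[OF j(2)] obs_sheaf_nat[OF j(2)]
    by (simp add: bd0_def G_quot_def G_proj_eq H0_def)
qed (simp add: bd0_def)

text \<open>This is the construction of an atlas of order \<open>j + 1\<close> from local representatives of \<open>s\<close> in \<open>G\<^sub>j\<close>.\<close>

lemma bd0_atlas_class:
  assumes j: "2 \<le> j" and s: "s \<in> carrier (obs_H0 M (int j))"
  obtains C g where "(C, g) \<in> Z1 T (G_sheaf M (j + 1))" "bd0 M (int j) s = atlas_class (j + 1) C g"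
proof -
  interpret central_tower T "G_sheaf M 2" "G_sheaf M j" "G_sheaf M (j + 1)" "G_sheaf M (j + 2)"
    using central_tower[OF j] .
  have s: "s \<in> carrier (sec GK.Q (topspace T))" using s obs_sheaf_nat[OF j] by (simp add: H0_def)
  obtain C g where g: "(C, g) \<in> Z1 T (G_sheaf M (j + 1))"
    "connecting0 T KN.Q GN.Q GK.Q (quot_proj T (G_sheaf M 2) (G_sheaf M (j + 1))) s =
      class1 T KN.Q (C, \<lambda>U V. quot_map T (G_sheaf M 2) (G_sheaf M (j + 2)) (U \<inter> V) (g U V))"
    using connecting0_cocycle[OF s] .
  have "bd0 M (int j) s = atlas_class (j + 1) C g"
    using g(2) j obs_sheaf_Suc[OF j] obs_sheaf_nat[OF j]
    by (simp add: bd0_def G_quot_def G_proj_eq atlas_class_def add.commute)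
  with g(1) show ?thesis by (rule that)
qed

lemma atlas_class_in_H1:
  assumes j: "2 \<le> j" and a: "(C, a) \<in> Z1 T (G_sheaf M j)"
  shows "atlas_class j C a \<in> carrier (obs_H1 M (int j))"
proof -
  interpret central_tower T "G_sheaf M 2" "G_sheaf M j" "G_sheaf M (j + 1)" "G_sheaf M (j + 2)"
    using central_tower[OF j] .
  show ?thesis using GK.quot.mor_Z1[OF a] obs_sheaf_nat[OF j] by (simp add: atlas_class_def H1_def H1_set_def)
qed

lemma bd0_closed: "bd0 M i ` carrier (obs_H0 M i) \<subseteq> carrier (obs_H1 M (i + 1))"
proof (cases "2 \<le> i")
  case True
  then obtain j where j: "i = int j" "2 \<le> j" using int_ge_2 by blast
  show ?thesis
  proof clarify
    fix s assume "s \<in> carrier (obs_H0 M i)"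
    then obtain C g where "(C, g) \<in> Z1 T (G_sheaf M (j + 1))" "bd0 M i s = atlas_class (j + 1) C g"
      using bd0_atlas_class[OF j(2)] j(1) by metis
    with atlas_class_in_H1[of "j + 1" C g] j show "bd0 M i s \<in> carrier (obs_H1 M (i + 1))" by (simp add: add.commute)
  qed
next
  case False
  interpret group "obs_H1 M (i + 1)" by (rule group_obs_H1)
  show ?thesis using False by (auto simp: bd0_def)
qed

text \<open>Vanishing of the cohomology is exactness in the middle. Each summand is a quotient whose
  unit is the coset \<open>im \<partial>\<close>, so that a family concentrated in degree \<open>j\<close> is enough to test it.\<close>

lemma exact:
  assumes van: "carrier (obs_cohomology1 M) = {\<one>\<^bsub>obs_cohomology1 M\<^esub>}"
    and p: "p \<in> carrier (obs_H1 M j)" "bd1 M j p = \<one>\<^bsub>obs_H2 M (j + 1)\<^esub>"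
  shows "p \<in> bd0 M (j - 1) ` carrier (obs_H0 M (j - 1))"
proof -
  define N where "N i = bd0 M (i - 1) ` carrier (obs_H0 M (i - 1))" for i
  define Z where "Z i = (obs_H1 M i)\<lparr>carrier := kernel (obs_H1 M i) (obs_H2 M (i + 1)) (bd1 M i)\<rparr>" for i
  have N1: "\<one>\<^bsub>obs_H1 M i\<^esub> \<in> N i" and Nc: "N i \<subseteq> carrier (obs_H1 M i)" for i
  proof -
    interpret H: abelian_presheaf T "obs_sheaf M (i - 1)" by (rule abelian_obs)
    interpret S: group "sec (obs_sheaf M (i - 1)) (topspace T)" using H.group_sec by simp
    have "\<one>\<^bsub>obs_H0 M (i - 1)\<^esub> \<in> carrier (obs_H0 M (i - 1))" by (simp add: H0_def)
    with bd0_one[of "i - 1"] show "\<one>\<^bsub>obs_H1 M i\<^esub> \<in> N i" unfolding N_def by (metis diff_add_cancel imageI)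
    show "N i \<subseteq> carrier (obs_H1 M i)" using bd0_closed[of "i - 1"] unfolding N_def by simp
  qed
  have cosets: "N i #>\<^bsub>Z i\<^esub> q = (\<lambda>n. n \<otimes>\<^bsub>obs_H1 M i\<^esub> q) ` N i" for i q
    unfolding r_coset_def Z_def by auto
  have N_coset: "N i #>\<^bsub>Z i\<^esub> \<one>\<^bsub>obs_H1 M i\<^esub> = N i" for i
  proof -
    interpret group "obs_H1 M i" by (rule group_obs_H1)
    have "n \<otimes>\<^bsub>obs_H1 M i\<^esub> \<one>\<^bsub>obs_H1 M i\<^esub> = n" if "n \<in> N i" for n using that Nc[of i] by auto
    thus ?thesis unfolding cosets by force
  qed
  have one_Z: "\<one>\<^bsub>obs_H1 M i\<^esub> \<in> carrier (Z i)" for i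
  proof -
    interpret group "obs_H1 M i" by (rule group_obs_H1)
    show ?thesis by (simp add: Z_def kernel_def bd1_one)
  qed
  have N_in: "N i \<in> carrier (Z i Mod N i)" for i
    unfolding carrier_FactGroup using one_Z[of i] N_coset[of i] by (metis imageI)
  have "p \<in> carrier (Z j)" using p by (simp add: Z_def kernel_def)
  hence pN: "N j #>\<^bsub>Z j\<^esub> p \<in> carrier (Z j Mod N j)" by (simp add: carrier_FactGroup)
  define f where "f i = (if i = j then N j #>\<^bsub>Z j\<^esub> p else N i)" for i
  have coh: "obs_cohomology1 M = sum_group UNIV (\<lambda>i. Z i Mod N i)"
    unfolding obs_cohomology1_def Z_def N_def ..
  have "f \<in> (\<Pi>\<^sub>E i\<in>UNIV. carrier (Z i Mod N i))" using N_in pN by (auto simp: f_def PiE_iff)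
  moreover have "finite {i \<in> UNIV. f i \<noteq> \<one>\<^bsub>Z i Mod N i\<^esub>}"
    by (rule finite_subset[of _ "{j}"]) (auto simp: f_def)
  ultimately have "f \<in> carrier (obs_cohomology1 M)"
    unfolding coh sum_group_def subgroup_generated_def by (auto intro: generate.incl)
  hence "f = \<one>\<^bsub>obs_cohomology1 M\<^esub>" using van by simp
  hence "f j = N j" unfolding coh by (simp add: sum_group_def)
  hence "N j #>\<^bsub>Z j\<^esub> p = N j" by (simp add: f_def)
  moreover have "\<one>\<^bsub>obs_H1 M j\<^esub> \<otimes>\<^bsub>obs_H1 M j\<^esub> p \<in> N j #>\<^bsub>Z j\<^esub> p" unfolding cosets using N1[of j] by blast
  moreover have "\<one>\<^bsub>obs_H1 M j\<^esub> \<otimes>\<^bsub>obs_H1 M j\<^esub> p = p"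
    using group_obs_H1 p(1) group.is_monoid monoid.l_one by metis
  ultimately show ?thesis unfolding N_def by simp
qed

theorem obstruction_iff_boundary_one:
  assumes van: "carrier (obs_cohomology1 M) = {\<one>\<^bsub>obs_cohomology1 M\<^esub>}"
    and \<theta>: "\<theta> \<in> carrier (obs_space M)" and hom: "homogeneous M \<theta>"
  shows "(\<exists>j z. supermanifold_atlas M j z \<and> obstruction M j z = \<theta>) \<longleftrightarrow> boundary M \<theta> = \<one>\<^bsub>obs_space2 M\<^esub>"
proof -
  have one2: "\<one>\<^bsub>obs_space2 M\<^esub> = (\<lambda>i. \<one>\<^bsub>obs_H2 M i\<^esub>)"
    by (simp add: obs_space2_def sum_group_def fun_eq_iff)
  have bdry: "boundary M \<theta> = \<one>\<^bsub>obs_space2 M\<^esub> \<longleftrightarrow> (\<forall>i. bd1 M i (\<theta> i) = \<one>\<^bsub>obs_H2 M (i + 1)\<^esub>)" for \<theta>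
    unfolding one2 boundary_def fun_eq_iff
    by (metis add_diff_cancel_right' diff_add_cancel)
  show ?thesis
  proof
    assume "\<exists>j z. supermanifold_atlas M j z \<and> obstruction M j z = \<theta>"
    then obtain j C a where j: "2 \<le> j" and a: "(C, a) \<in> Z1 T (G_sheaf M j)" and eq: "obstruction M j (C, a) = \<theta>"
      unfolding supermanifold_atlas_def by (metis prod.collapse)
    have "bd1 M i (\<theta> i) = \<one>\<^bsub>obs_H2 M (i + 1)\<^esub>" for i
      using bd1_atlas_class[OF j a] bd1_one[of i] unfolding eq[symmetric] obstruction_atlas_class[OF j a] by auto
    thus "boundary M \<theta> = \<one>\<^bsub>obs_space2 M\<^esub>" unfolding bdry by blast
  next
    assume "boundary M \<theta> = \<one>\<^bsub>obs_space2 M\<^esub>"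
    hence bd: "bd1 M i (\<theta> i) = \<one>\<^bsub>obs_H2 M (i + 1)\<^esub>" for i unfolding bdry by blast
    obtain j where j: "\<And>i. i \<noteq> j \<Longrightarrow> \<theta> i = \<one>\<^bsub>obs_H1 M i\<^esub>" using hom unfolding homogeneous_def by blast
    have "\<theta> j \<in> carrier (obs_H1 M j)"
      using \<theta> carrier_sum_group[of UNIV "obs_H1 M"] group_obs_H1 by (auto simp: obs_space_def)
    from exact[OF van this bd] obtain s where s: "s \<in> carrier (obs_H0 M (j - 1))" "\<theta> j = bd0 M (j - 1) s" by blast
    \<comment> \<open>In the second case \<open>\<partial>\<close> into degree \<open>j\<close> is zero by definition, so \<open>\<theta> = 0\<close>; the order of the atlas is then arbitrary.\<close>
    obtain n C a where n: "2 \<le> n" and a: "(C, a) \<in> Z1 T (G_sheaf M n)" and eq: "\<theta> = (\<lambda>i. if i = int n then atlas_class n C a else \<one>\<^bsub>obs_H1 M i\<^esub>)"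
    proof (cases "2 \<le> j - 1")
      case True
      then obtain k where k: "j - 1 = int k" "2 \<le> k" using int_ge_2 by blast
      obtain C g where g: "(C, g) \<in> Z1 T (G_sheaf M (k + 1))" "bd0 M (int k) s = atlas_class (k + 1) C g"
        using bd0_atlas_class[OF k(2), of s] s(1) unfolding k(1) by blast
      have "j = int (k + 1)" using k(1) by simp
      with j s(2) g(2) k have "\<theta> = (\<lambda>i. if i = int (k + 1) then atlas_class (k + 1) C g else \<one>\<^bsub>obs_H1 M i\<^esub>)"
        by (auto simp: fun_eq_iff)
      with that[OF _ g(1)] k(2) show ?thesis by simp
    next
      case False
      hence "\<theta> j = \<one>\<^bsub>obs_H1 M j\<^esub>" using s(2) by (simp add: bd0_def)
      hence all: "\<theta> i = \<one>\<^bsub>obs_H1 M i\<^esub>" for i using j by metis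
      obtain C a where "(C, a) \<in> Z1 T (G_sheaf M 2)" "atlas_class 2 C a = \<one>\<^bsub>obs_H1 M (int 2)\<^esub>"
        using trivial_atlas[of 2] by blast
      with that[of 2 C a] all show ?thesis by (auto simp: fun_eq_iff)
    qed
    have "supermanifold_atlas M n (C, a)" using n a by (simp add: supermanifold_atlas_def)
    moreover have "obstruction M n (C, a) = \<theta>" using obstruction_atlas_class[OF n a] eq by simp
    ultimately show "\<exists>j z. supermanifold_atlas M j z \<and> obstruction M j z = \<theta>" by blast
  qed
qed

end

section \<open>The exterior algebra of a fibre\<close>

lemma poly_mapping_single_induct [case_names zero single add]:
  assumes "P 0" "\<And>w c. P (Poly_Mapping.single w c)" "\<And>s t. P s \<Longrightarrow> P t \<Longrightarrow> P (s + t)"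
  shows "P (t :: 'a \<Rightarrow>\<^sub>0 'b::comm_monoid_add)"
proof (induction t rule: update_induct)
  case (update f a b)
  have "Poly_Mapping.update a b f = Poly_Mapping.single a b + f"
    using update(1) by (intro poly_mapping_eqI) (auto simp: lookup_update lookup_add lookup_single when_def in_keys_iff)
  with update assms show ?case by simp
qed (rule assms)

abbreviation word_deg :: "'v gen_word \<Rightarrow> nat" where "word_deg w \<equiv> length (letters w)"

lemma letters_plus [simp]: "letters (v + w) = letters v @ letters w"
  by (simp add: plus_gen_word_def)

lemma letters_zero [simp]: "letters 0 = []"
  by (simp add: zero_gen_word_def)

definition deg_part :: "nat set \<Rightarrow> ('v gen_word \<Rightarrow>\<^sub>0 complex) \<Rightarrow> 'v gen_word \<Rightarrow>\<^sub>0 complex"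
  where "deg_part D t = Poly_Mapping.mapp (\<lambda>w c. if word_deg w \<in> D then c else 0) t"

lemma lookup_deg_part:
  "Poly_Mapping.lookup (deg_part D t) w = (if word_deg w \<in> D then Poly_Mapping.lookup t w else 0)"
  by (simp add: deg_part_def mapp.rep_eq in_keys_iff)

lemma keys_deg_part: "Poly_Mapping.keys (deg_part D t) = {w \<in> Poly_Mapping.keys t. word_deg w \<in> D}"
  by (auto simp: in_keys_iff lookup_deg_part split: if_splits)

lemma deg_part_zero [simp]: "deg_part D 0 = 0"
  by (intro poly_mapping_eqI) (simp add: lookup_deg_part)

lemma deg_part_add: "deg_part D (s + t) = deg_part D s + deg_part D t"
  by (intro poly_mapping_eqI) (simp add: lookup_deg_part lookup_add)

lemma deg_part_uminus: "deg_part D (- t) = - deg_part D t"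
  by (intro poly_mapping_eqI) (simp add: lookup_deg_part)

lemma deg_part_diff: "deg_part D (s - t) = deg_part D s - deg_part D t"
  by (intro poly_mapping_eqI) (simp add: lookup_deg_part lookup_minus)

lemma deg_part_single:
  "deg_part D (Poly_Mapping.single w c) = (if word_deg w \<in> D then Poly_Mapping.single w c else 0)"
  by (intro poly_mapping_eqI) (auto simp: lookup_deg_part lookup_single when_def)

lemma deg_part_sum: "deg_part D (sum f A) = (\<Sum>x\<in>A. deg_part D (f x))"
  by (induction A rule: infinite_finite_induct) (auto simp: deg_part_add)

lemma deg_part_id: "(\<And>w. w \<in> Poly_Mapping.keys t \<Longrightarrow> word_deg w \<in> D) \<Longrightarrow> deg_part D t = t"
  by (intro poly_mapping_eqI) (auto simp: lookup_deg_part in_keys_iff)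

lemma deg_part_disjoint: "(\<And>w. w \<in> Poly_Mapping.keys t \<Longrightarrow> word_deg w \<notin> D) \<Longrightarrow> deg_part D t = 0"
  by (intro poly_mapping_eqI) (auto simp: lookup_deg_part in_keys_iff)

lemma deg_part_compl: "deg_part D t + deg_part (- D) t = t"
  by (intro poly_mapping_eqI) (auto simp: lookup_deg_part lookup_add)

lemma deg_part_single_mult:
  "deg_part D (Poly_Mapping.single w c * t) = Poly_Mapping.single w c * deg_part {d. word_deg w + d \<in> D} t"
proof (induction t rule: poly_mapping_single_induct)
  case (single v d)
  show ?case by (simp add: mult_single deg_part_single)
qed (simp_all add: distrib_left deg_part_add)

lemma deg_part_mult_single:
  "deg_part D (t * Poly_Mapping.single w c) = deg_part {d. d + word_deg w \<in> D} t * Poly_Mapping.single w c"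
proof (induction t rule: poly_mapping_single_induct)
  case (single v d)
  show ?case by (simp add: mult_single deg_part_single)
qed (simp_all add: distrib_right deg_part_add)

locale ext_fibre =
  fixes V :: "(complex, 'v) module"
  assumes module_V: "module cfield V"
begin

sublocale V: module cfield V by (rule module_V)

abbreviation R where "R \<equiv> free_alg V"
abbreviation E where "E \<equiv> ext_alg V"
abbreviation cls where "cls \<equiv> ext_class V"

lemma R_simps:
  "monoid.mult R = (*)" "\<one>\<^bsub>R\<^esub> = 1" "\<zero>\<^bsub>R\<^esub> = 0" "add R = (+)"
  by (simp_all add: free_alg_def)

lemma in_R: "t \<in> carrier R \<longleftrightarrow> (\<forall>w\<in>Poly_Mapping.keys t. set (letters w) \<subseteq> carrier V)"
  by (simp add: free_alg_def)

lemma R_add: "s \<in> carrier R \<Longrightarrow> t \<in> carrier R \<Longrightarrow> s + t \<in> carrier R"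
  unfolding in_R using keys_add[of s t] by blast

lemma R_uminus: "s \<in> carrier R \<Longrightarrow> - s \<in> carrier R"
  unfolding in_R by (simp add: in_keys_iff)

lemma R_diff: "s \<in> carrier R \<Longrightarrow> t \<in> carrier R \<Longrightarrow> s - t \<in> carrier R"
  using R_add[of s "- t"] R_uminus[of t] by simp

lemma R_mult: "s \<in> carrier R \<Longrightarrow> t \<in> carrier R \<Longrightarrow> s * t \<in> carrier R"
  unfolding in_R using keys_mult[of s t] by fastforce

lemma R_zero: "0 \<in> carrier R"
  by (simp add: in_R)

lemma R_one: "1 \<in> carrier R"
  by (simp add: in_R)

lemma R_single: "set (letters w) \<subseteq> carrier V \<Longrightarrow> Poly_Mapping.single w c \<in> carrier R"
  by (simp add: in_R)

lemma R_scalar: "scalar c \<in> carrier R"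
  by (intro R_single) simp

lemma R_sum: "(\<And>x. x \<in> A \<Longrightarrow> f x \<in> carrier R) \<Longrightarrow> sum f A \<in> carrier R"
  by (induction A rule: infinite_finite_induct) (auto intro: R_add R_zero)

lemma R_deg_part: "t \<in> carrier R \<Longrightarrow> deg_part D t \<in> carrier R"
  by (simp add: in_R keys_deg_part)

lemma ring_R: "ring R"
proof (rule ringI)
  show "abelian_group R"
  proof (rule abelian_groupI)
    fix x assume "x \<in> carrier R"
    thus "\<exists>y\<in>carrier R. y \<oplus>\<^bsub>R\<^esub> x = \<zero>\<^bsub>R\<^esub>" using R_uminus by (intro bexI[of _ "- x"]) (auto simp: R_simps)
  qed (auto simp: R_simps R_add R_zero add.assoc add.commute)
  show "monoid R" by (rule monoidI) (auto simp: R_simps R_mult R_one mult.assoc)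
qed (auto simp: R_simps algebra_simps)

sublocale R: ring R by (rule ring_R)

lemma R_a_inv: "t \<in> carrier R \<Longrightarrow> \<ominus>\<^bsub>R\<^esub> t = - t"
  using R.minus_equality[of "- t" t] R_uminus by (simp add: R_simps)

lemma R_a_minus: "s \<in> carrier R \<Longrightarrow> t \<in> carrier R \<Longrightarrow> s \<ominus>\<^bsub>R\<^esub> t = s - t"
  by (simp add: a_minus_def R_a_inv) (simp add: R_simps)

text \<open>Induction over the words of an element; all intermediate elements stay in the free algebra over \<open>V\<close>.\<close>

lemma R_induct [consumes 1, case_names zero single add]:
  assumes t: "t \<in> carrier R" and P: "P 0" "\<And>w c. set (letters w) \<subseteq> carrier V \<Longrightarrow> P (Poly_Mapping.single w c)"
    "\<And>s t. s \<in> carrier R \<Longrightarrow> t \<in> carrier R \<Longrightarrow> P s \<Longrightarrow> P t \<Longrightarrow> P (s + t)"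
  shows "P t"
  using t
proof (induction t rule: update_induct)
  case const show ?case by (rule P(1))
next
  case (update f a b)
  have k: "Poly_Mapping.keys (Poly_Mapping.update a b f) = insert a (Poly_Mapping.keys f)"
    using update(2) by (auto simp: in_keys_iff lookup_update split: if_splits)
  hence f: "f \<in> carrier R" and a: "set (letters a) \<subseteq> carrier V" using update(4) by (auto simp: in_R)
  have "Poly_Mapping.update a b f = Poly_Mapping.single a b + f"
    using update(1) by (intro poly_mapping_eqI) (auto simp: lookup_update lookup_add lookup_single when_def in_keys_iff)
  thus ?case using P(3)[OF R_single[OF a] f P(2)[OF a] update(3)[OF f]] by simp
qed

lemma smult_closed: "v \<in> carrier V \<Longrightarrow> c \<odot>\<^bsub>V\<^esub> v \<in> carrier V"
  using V.smult_closed[of c v] by (simp add: cfield_def)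

lemma rels_R: "ext_rels V \<subseteq> carrier R"
proof
  fix r assume "r \<in> ext_rels V"
  then consider (add) u v where "u \<in> carrier V" "v \<in> carrier V" "r = gen (u \<oplus>\<^bsub>V\<^esub> v) - gen u - gen v"
    | (smult) c v where "v \<in> carrier V" "r = gen (c \<odot>\<^bsub>V\<^esub> v) - scalar c * gen v"
    | (square) v where "v \<in> carrier V" "r = gen v * gen v"
    unfolding ext_rels_def by blast
  thus "r \<in> carrier R"
    by cases (auto intro!: R_diff R_mult R_single R_scalar smult_closed)
qed

sublocale I: ideal "ext_ideal V" R
  unfolding ext_ideal_def by (rule R.genideal_ideal[OF rels_R])

abbreviation I where "I \<equiv> ext_ideal V"

lemma rels_I: "r \<in> ext_rels V \<Longrightarrow> r \<in> I"
  unfolding ext_ideal_def using R.genideal_self[OF rels_R] by blast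

lemma I_R: "t \<in> I \<Longrightarrow> t \<in> carrier R"
  by (rule I.a_Hcarr)

lemma I_add: "s \<in> I \<Longrightarrow> t \<in> I \<Longrightarrow> s + t \<in> I"
  using I.a_closed[of s t] by (simp add: R_simps)

lemma I_zero: "0 \<in> I"
  using I.zero_closed by (simp add: R_simps)

lemma I_uminus: "s \<in> I \<Longrightarrow> - s \<in> I"
  using I.a_inv_closed[of s] I_R[of s] by (simp add: R_a_inv)

lemma I_diff: "s \<in> I \<Longrightarrow> t \<in> I \<Longrightarrow> s - t \<in> I"
  using I_add[of s "- t"] I_uminus[of t] by simp

lemma I_lmult: "s \<in> carrier R \<Longrightarrow> t \<in> I \<Longrightarrow> s * t \<in> I"
  using I.I_l_closed[of t s] by (simp add: R_simps)

lemma I_rmult: "s \<in> carrier R \<Longrightarrow> t \<in> I \<Longrightarrow> t * s \<in> I"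
  using I.I_r_closed[of t s] by (simp add: R_simps)

text \<open>The relations are homogeneous, so the elements whose degree parts all lie in the ideal form an ideal that
  contains the relations. This is what makes the grading of the exterior algebra direct.\<close>

lemma deg_part_I: assumes "t \<in> I" shows "deg_part D t \<in> I"
proof -
  define K where "K = {t \<in> carrier R. \<forall>D. deg_part D t \<in> I}"
  have "ideal K R"
  proof (rule idealI[OF ring_R])
    show "subgroup K (add_monoid R)"
    proof (rule R.add.subgroupI)
      have "0 \<in> K" unfolding K_def using R_zero I_zero by simp
      thus "K \<noteq> {}" by blast
      fix s assume "s \<in> K"
      thus "\<ominus>\<^bsub>R\<^esub> s \<in> K" unfolding K_def by (auto simp: R_a_inv R_uminus deg_part_uminus I_uminus)
    next
      fix s t assume "s \<in> K" "t \<in> K"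
      thus "s \<oplus>\<^bsub>R\<^esub> t \<in> K" unfolding K_def by (auto simp: R_simps R_add deg_part_add I_add)
    qed (auto simp: K_def)
    fix t s assume t: "t \<in> K" and s: "s \<in> carrier R"
    hence tR: "t \<in> carrier R" by (simp add: K_def)
    have "\<forall>D. deg_part D (s * t) \<in> I \<and> deg_part D (t * s) \<in> I"
      using s
    proof (induction s rule: R_induct)
      case (single w c)
      thus ?case using t unfolding K_def deg_part_single_mult deg_part_mult_single
        by (auto intro: I_lmult I_rmult R_single)
    next
      case (add s1 s2)
      thus ?case by (auto simp: distrib_left distrib_right deg_part_add I_add)
    qed (simp add: I_zero)
    thus "s \<otimes>\<^bsub>R\<^esub> t \<in> K" "t \<otimes>\<^bsub>R\<^esub> s \<in> K" using tR s by (auto simp: K_def R_simps R_mult)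
  qed
  moreover have "ext_rels V \<subseteq> K"
  proof
    fix r assume r: "r \<in> ext_rels V"
    have "\<exists>n. \<forall>w\<in>Poly_Mapping.keys r. word_deg w = n"
    proof -
      from r consider (add) u v where "r = gen (u \<oplus>\<^bsub>V\<^esub> v) - gen u - gen v"
        | (smult) c v where "r = gen (c \<odot>\<^bsub>V\<^esub> v) - scalar c * gen v"
        | (square) v where "r = gen v * gen v"
        unfolding ext_rels_def by blast
      thus ?thesis
      proof cases
        case add
        have "word_deg w = 1" if "w \<in> Poly_Mapping.keys r" for w
          using that unfolding add in_keys_iff by (auto simp: lookup_minus lookup_single when_def split: if_splits)
        thus ?thesis by blast
      next
        case smult
        have "word_deg w = 1" if "w \<in> Poly_Mapping.keys r" for w
          using that unfolding smult in_keys_iff by (auto simp: mult_single lookup_minus lookup_single when_def split: if_splits)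
        thus ?thesis by blast
      next
        case square
        have "word_deg w = 2" if "w \<in> Poly_Mapping.keys r" for w
          using that unfolding square in_keys_iff by (auto simp: mult_single lookup_single when_def plus_gen_word_def split: if_splits)
        thus ?thesis by blast
      qed
    qed
    then obtain n where n: "\<And>w. w \<in> Poly_Mapping.keys r \<Longrightarrow> word_deg w = n" by blast
    have "deg_part D r \<in> I" for D
    proof (cases "n \<in> D")
      case True
      hence "deg_part D r = r" using n by (intro deg_part_id) auto
      thus ?thesis using rels_I[OF r] by simp
    next
      case False
      hence "deg_part D r = 0" using n by (intro deg_part_disjoint) auto
      thus ?thesis using I_zero by simp
    qed
    thus "r \<in> K" using rels_R r by (auto simp: K_def)
  qed
  ultimately have "I \<subseteq> K" unfolding ext_ideal_def by (rule R.genideal_minimal)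
  thus ?thesis using assms unfolding K_def by blast
qed

sublocale E: ring E
  unfolding ext_alg_def by (rule I.quotient_is_ring)

lemma cls_hom: "cls \<in> ring_hom R E"
  unfolding ext_alg_def ext_class_def[abs_def] by (rule I.rcos_ring_hom)

lemma cls_closed: "t \<in> carrier R \<Longrightarrow> cls t \<in> carrier E"
  using ring_hom_closed[OF cls_hom] .

lemma cls_mult: "s \<in> carrier R \<Longrightarrow> t \<in> carrier R \<Longrightarrow> cls s \<otimes>\<^bsub>E\<^esub> cls t = cls (s * t)"
  using ring_hom_mult[OF cls_hom] by (simp add: R_simps)

lemma cls_add: "s \<in> carrier R \<Longrightarrow> t \<in> carrier R \<Longrightarrow> cls s \<oplus>\<^bsub>E\<^esub> cls t = cls (s + t)"
  using ring_hom_add[OF cls_hom] by (simp add: R_simps)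

lemma cls_one: "\<one>\<^bsub>E\<^esub> = cls 1"
  using ring_hom_one[OF cls_hom] by (simp add: R_simps)

lemma cls_zero: "\<zero>\<^bsub>E\<^esub> = cls 0"
  using ring_hom_zero[OF cls_hom ring_R E.ring_axioms] by (simp add: R_simps)

lemma cls_uminus: "t \<in> carrier R \<Longrightarrow> \<ominus>\<^bsub>E\<^esub> (cls t) = cls (- t)"
  using cls_add[of "- t" t] by (intro E.minus_equality) (auto simp: cls_closed R_uminus cls_zero)

lemma cls_eq_iff: "s \<in> carrier R \<Longrightarrow> t \<in> carrier R \<Longrightarrow> cls s = cls t \<longleftrightarrow> s - t \<in> I"
  using R.quotient_eq_iff_same_a_r_cos[OF I.ideal_axioms, of s t] by (simp add: ext_class_def R_a_minus)

lemma cls_surj: "a \<in> carrier E \<Longrightarrow> \<exists>t\<in>carrier R. a = cls t"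
  by (auto simp: ext_alg_def ext_class_def FactRing_simps a_r_coset_def)

subsection \<open>The grading\<close>

lemma ext_partI: "t \<in> carrier R \<Longrightarrow> cls (deg_part D t) \<in> ext_part V D"
  unfolding ext_part_def using R_deg_part[of t D] by (auto simp: keys_deg_part)

lemma ext_partE:
  assumes "a \<in> ext_part V D"
  obtains t where "t \<in> carrier R" "a = cls t" "deg_part D t = t"
  using assms unfolding ext_part_def by (auto intro: deg_part_id)

lemma ext_part_iff: "t \<in> carrier R \<Longrightarrow> cls t \<in> ext_part V D \<longleftrightarrow> cls t = cls (deg_part D t)"
proof
  assume t: "t \<in> carrier R" and "cls t \<in> ext_part V D"
  then obtain s where s: "s \<in> carrier R" "cls t = cls s" "deg_part D s = s" by (elim ext_partE)
  have "t - s \<in> I" using s t cls_eq_iff by blast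
  hence "deg_part D t - s \<in> I" using deg_part_I[of "t - s" D] s(3) by (simp add: deg_part_diff)
  thus "cls t = cls (deg_part D t)" using s t cls_eq_iff[of "deg_part D t" s] R_deg_part by simp
next
  assume "t \<in> carrier R" "cls t = cls (deg_part D t)"
  thus "cls t \<in> ext_part V D" using ext_partI by metis
qed

lemma ext_part_closed: "a \<in> ext_part V D \<Longrightarrow> a \<in> carrier E"
  using cls_closed by (auto elim: ext_partE)

lemma ext_part_add:
  assumes "a \<in> ext_part V D" "b \<in> ext_part V D" shows "a \<oplus>\<^bsub>E\<^esub> b \<in> ext_part V D"
proof -
  obtain s t where "s \<in> carrier R" "a = cls s" "deg_part D s = s" "t \<in> carrier R" "b = cls t" "deg_part D t = t"
    using assms by (elim ext_partE)
  thus ?thesis using ext_partI[of "s + t" D] by (simp add: cls_add deg_part_add R_add)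
qed

lemma ext_part_uminus:
  assumes "a \<in> ext_part V D" shows "\<ominus>\<^bsub>E\<^esub> a \<in> ext_part V D"
proof -
  obtain s where "s \<in> carrier R" "a = cls s" "deg_part D s = s" using assms by (elim ext_partE)
  thus ?thesis using ext_partI[of "- s" D] by (simp add: cls_uminus deg_part_uminus R_uminus)
qed

lemma ext_part_minus: "a \<in> ext_part V D \<Longrightarrow> b \<in> ext_part V D \<Longrightarrow> a \<ominus>\<^bsub>E\<^esub> b \<in> ext_part V D"
  unfolding a_minus_def by (intro ext_part_add ext_part_uminus)

lemma ext_part_zero: "\<zero>\<^bsub>E\<^esub> \<in> ext_part V D"
  using ext_partI[OF R_zero, of D] by (simp add: cls_zero)

lemma ext_part_mono: "D \<subseteq> D' \<Longrightarrow> ext_part V D \<subseteq> ext_part V D'"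
  unfolding ext_part_def by blast

lemma ext_part_mult:
  assumes "a \<in> ext_part V {m..}" "b \<in> ext_part V {n..}" shows "a \<otimes>\<^bsub>E\<^esub> b \<in> ext_part V {m + n..}"
proof -
  obtain s t where s: "s \<in> carrier R" "a = cls s" "deg_part {m..} s = s" and t: "t \<in> carrier R" "b = cls t" "deg_part {n..} t = t"
    using assms by (elim ext_partE)
  have "word_deg w \<in> {m + n..}" if w: "w \<in> Poly_Mapping.keys (s * t)" for w
  proof -
    obtain u v where uv: "w = u + v" "u \<in> Poly_Mapping.keys s" "v \<in> Poly_Mapping.keys t" using subsetD[OF keys_mult w] by blast
    have "word_deg u \<in> {m..}" "word_deg v \<in> {n..}"
      using uv(2) s(3) uv(3) t(3) keys_deg_part[of "{m..}" s] keys_deg_part[of "{n..}" t] by auto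
    thus ?thesis using uv(1) by simp
  qed
  hence "deg_part {m + n..} (s * t) = s * t" by (rule deg_part_id)
  thus ?thesis using ext_partI[of "s * t" "{m + n..}"] s t by (simp add: cls_mult R_mult)
qed

lemma ext_part_disjoint:
  assumes "a \<in> ext_part V D" "a \<in> ext_part V D'" "D \<inter> D' = {}" shows "a = \<zero>\<^bsub>E\<^esub>"
proof -
  obtain t where t: "t \<in> carrier R" "a = cls t" "deg_part D t = t" using assms(1) by (elim ext_partE)
  have "deg_part D' t = 0"
    using keys_deg_part[of D t] t(3) assms(3) by (intro deg_part_disjoint) auto
  thus ?thesis using assms(2) t ext_part_iff[of t D'] by (simp add: cls_zero)
qed

lemma ext_part_UNIV: "ext_part V {0..} = carrier E"
proof
  show "carrier E \<subseteq> ext_part V {0..}"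
  proof
    fix a assume "a \<in> carrier E"
    then obtain t where "t \<in> carrier R" "a = cls t" using cls_surj by blast
    thus "a \<in> ext_part V {0..}" using ext_partI[of t "{0..}"] deg_part_id[of t "{0..}"] by simp
  qed
qed (use ext_part_closed in blast)

end

subsection \<open>Exterior monomials\<close>

text \<open>The sign that arises when the factor \<open>i\<close> is moved into its place in an increasing product, and the
  sign of the sorting of a whole product (0 if a factor is repeated).\<close>

fun insert_sign :: "nat \<Rightarrow> nat list \<Rightarrow> complex" where
  "insert_sign i [] = 1"
| "insert_sign i (s # S) = (if i < s then 1 else if i = s then 0 else - insert_sign i S)"

fun word_sign :: "nat list \<Rightarrow> complex" where
  "word_sign [] = 1"
| "word_sign (i # L) = word_sign L * insert_sign i (sorted_list_of_set (set L))"

definition ext_monom :: "(nat \<Rightarrow> 'v) \<Rightarrow> nat list \<Rightarrow> complex \<Rightarrow> 'v gen_word \<Rightarrow>\<^sub>0 complex"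
  where "ext_monom e L c = Poly_Mapping.single (Word (map e L)) c"

lemma ext_monom_mult: "ext_monom e L c * ext_monom e L' d = ext_monom e (L @ L') (c * d)"
  by (simp add: ext_monom_def mult_single plus_gen_word_def)

lemma ext_monom_add: "ext_monom e L c + ext_monom e L d = ext_monom e L (c + d)"
  by (simp add: ext_monom_def single_add)

lemma ext_monom_uminus: "- ext_monom e L c = ext_monom e L (- c)"
  by (simp add: ext_monom_def single_uminus)

lemma ext_monom_zero [simp]: "ext_monom e L 0 = 0"
  by (simp add: ext_monom_def)

lemma ext_monom_sum: "ext_monom e L (sum f A) = (\<Sum>x\<in>A. ext_monom e L (f x))"
  by (induction A rule: infinite_finite_induct) (auto simp: ext_monom_add[symmetric])

lemma sorted_list_of_set_Cons_less:
  "finite A \<Longrightarrow> (\<And>a. a \<in> A \<Longrightarrow> s < a) \<Longrightarrow> sorted_list_of_set (insert s A) = (s::nat) # sorted_list_of_set A"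
proof -
  assume A: "finite A" "\<And>a. a \<in> A \<Longrightarrow> s < a"
  hence "s \<notin> A" by blast
  with A show ?thesis by (simp add: insort_is_Cons less_imp_le)
qed

context ext_fibre
begin

lemma R_ext_monom: "e ` set L \<subseteq> carrier V \<Longrightarrow> ext_monom e L c \<in> carrier R"
  unfolding ext_monom_def by (intro R_single) auto

lemma gen_square_I: "v \<in> carrier V \<Longrightarrow> gen v * gen v \<in> I"
  by (rule rels_I) (auto simp: ext_rels_def)

lemma gen_anticommute_I:
  assumes v: "v \<in> carrier V" and w: "w \<in> carrier V" shows "gen v * gen w + gen w * gen v \<in> I"
proof -
  define r where "r = gen (v \<oplus>\<^bsub>V\<^esub> w) - gen v - gen w"
  define x where "x = gen (v \<oplus>\<^bsub>V\<^esub> w)"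
  have r: "r \<in> I" unfolding r_def using v w by (intro rels_I) (auto simp: ext_rels_def)
  have vw: "v \<oplus>\<^bsub>V\<^esub> w \<in> carrier V" using v w by simp
  have xR: "x \<in> carrier R" unfolding x_def using vw by (intro R_single) simp
  have "x - r = gen v + gen w" by (simp add: r_def x_def)
  hence "(gen v + gen w) * (gen v + gen w) = (x - r) * (x - r)" by simp
  also have "\<dots> = x * x - x * r - r * x + r * r" by (simp add: algebra_simps)
  also have "\<dots> \<in> I"
    by (intro I_add I_diff gen_square_I[OF vw, folded x_def] I_lmult[OF xR r] I_rmult[OF xR r] I_lmult[OF I_R[OF r] r])
  finally have *: "(gen v + gen w) * (gen v + gen w) \<in> I" .
  have "gen v * gen w + gen w * gen v = (gen v + gen w) * (gen v + gen w) - gen v * gen v - gen w * gen w"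
    by (simp add: algebra_simps)
  thus ?thesis using I_diff[OF I_diff[OF * gen_square_I[OF v]] gen_square_I[OF w]] by simp
qed

lemma ext_monom_Cons: "ext_monom e (i # L) c = gen (e i) * ext_monom e L c"
  by (simp add: ext_monom_def mult_single plus_gen_word_def)

text \<open>The new factor is moved to its place by transpositions of adjacent factors, each of which changes the sign;
  the product vanishes if the factor is already present.\<close>

lemma ext_monom_insert_I:
  assumes "sorted S" "distinct S" "e ` set (i # S) \<subseteq> carrier V"
  shows "ext_monom e (i # S) c - ext_monom e (sorted_list_of_set (insert i (set S))) (insert_sign i S * c) \<in> I"
  using assms
proof (induction S)
  case Nil
  show ?case using I_zero by simp
next
  case (Cons s S)
  have ss: "sorted S" "distinct S" "\<And>a. a \<in> set S \<Longrightarrow> s < a"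
    using Cons.prems by (auto simp: order.strict_iff_order)
  have slos: "sorted_list_of_set (set (s # S)) = s # S"
    using Cons.prems by (simp only: sorted_list_of_set.idem_if_sorted_distinct)
  consider "i < s" | "i = s" | "s < i" by linarith
  thus ?case
  proof cases
    case 1
    have "sorted_list_of_set (insert i (set (s # S))) = i # sorted_list_of_set (set (s # S))"
      using 1 ss by (intro sorted_list_of_set_Cons_less) (auto intro: less_trans)
    thus ?thesis using 1 slos I_zero by simp
  next
    case 2
    have "ext_monom e (i # s # S) c = (gen (e s) * gen (e s)) * ext_monom e S c"
      by (simp add: ext_monom_Cons 2 mult.assoc)
    also have "\<dots> \<in> I" using Cons.prems by (intro I_rmult gen_square_I R_ext_monom) auto
    finally show ?thesis using 2 by simp
  next
    case 3
    define A where "A = insert i (set S)"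
    have IH: "ext_monom e (i # S) c - ext_monom e (sorted_list_of_set A) (insert_sign i S * c) \<in> I"
      unfolding A_def using Cons ss by simp
    have "ext_monom e (i # s # S) c = (gen (e i) * gen (e s) + gen (e s) * gen (e i)) * ext_monom e S c - gen (e s) * ext_monom e (i # S) c"
      by (simp add: ext_monom_Cons algebra_simps)
    moreover have "sorted_list_of_set (insert i (set (s # S))) = s # sorted_list_of_set A"
    proof -
      have "insert i (set (s # S)) = insert s A" unfolding A_def by auto
      moreover have "sorted_list_of_set (insert s A) = s # sorted_list_of_set A"
        by (rule sorted_list_of_set_Cons_less) (use 3 ss(3) in \<open>auto simp: A_def\<close>)
      ultimately show ?thesis by simp
    qed
    moreover have "insert_sign i (s # S) * c = - (insert_sign i S * c)" using 3 by simp
    ultimately have "ext_monom e (i # s # S) c - ext_monom e (sorted_list_of_set (insert i (set (s # S)))) (insert_sign i (s # S) * c) =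
      (gen (e i) * gen (e s) + gen (e s) * gen (e i)) * ext_monom e S c -
      gen (e s) * (ext_monom e (i # S) c - ext_monom e (sorted_list_of_set A) (insert_sign i S * c))"
      by (simp only: ext_monom_Cons[of e s "sorted_list_of_set A"] ext_monom_uminus[symmetric] right_diff_distrib) simp
    also have "\<dots> \<in> I"
      using Cons.prems by (intro I_diff I_rmult I_lmult[OF _ IH] gen_anticommute_I R_ext_monom R_single) auto
    finally show ?thesis .
  qed
qed

lemma ext_monom_sort_I:
  assumes "e ` set L \<subseteq> carrier V"
  shows "ext_monom e L c - ext_monom e (sorted_list_of_set (set L)) (word_sign L * c) \<in> I"
  using assms
proof (induction L)
  case Nil
  show ?case using I_zero by simp
next
  case (Cons i L)
  let ?S = "sorted_list_of_set (set L)"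
  have 1: "gen (e i) * (ext_monom e L c - ext_monom e ?S (word_sign L * c)) \<in> I"
    using Cons by (intro I_lmult R_single) auto
  have 2: "ext_monom e (i # ?S) (word_sign L * c) - ext_monom e (sorted_list_of_set (insert i (set ?S))) (insert_sign i ?S * (word_sign L * c)) \<in> I"
    using Cons.prems by (intro ext_monom_insert_I) auto
  from I_add[OF 1 2] show ?case by (simp add: ext_monom_Cons right_diff_distrib mult_ac)
qed

end

subsection \<open>Expansions in a frame\<close>

definition expr :: "nat \<Rightarrow> (nat \<Rightarrow> 'v) \<Rightarrow> (nat set \<Rightarrow> complex) \<Rightarrow> 'v gen_word \<Rightarrow>\<^sub>0 complex"
  where "expr n e f = (\<Sum>J\<in>Pow {..<n}. ext_monom e (sorted_list_of_set J) (f J))"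

lemma finite_Pow_index: "J \<in> Pow {..<n::nat} \<Longrightarrow> finite J"
  by (meson PowD finite_lessThan finite_subset)

text \<open>The coefficients of a product of two expansions. The signs depend on the index sets alone, so that the
  product of two sections with holomorphic coefficients has holomorphic coefficients.\<close>

definition prod_coeff :: "nat \<Rightarrow> (nat set \<Rightarrow> complex) \<Rightarrow> (nat set \<Rightarrow> complex) \<Rightarrow> nat set \<Rightarrow> complex"
  where "prod_coeff n f g L = (\<Sum>J\<in>Pow {..<n}. \<Sum>K\<in>Pow {..<n}.
    (if J \<union> K = L then word_sign (sorted_list_of_set J @ sorted_list_of_set K) * (f J * g K) else 0))"

lemma expr_add: "expr n e f + expr n e g = expr n e (\<lambda>J. f J + g J)"
  by (simp add: expr_def sum.distrib[symmetric] ext_monom_add)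

lemma expr_uminus: "- expr n e f = expr n e (\<lambda>J. - f J)"
  by (simp add: expr_def sum_negf[symmetric] ext_monom_uminus)

lemma expr_zero: "expr n e (\<lambda>J. 0) = 0"
  by (simp add: expr_def)

lemma expr_delta:
  assumes "L \<in> Pow {..<n}"
  shows "expr n e (\<lambda>J. if J = L then c else 0) = ext_monom e (sorted_list_of_set L) c"
proof -
  have "expr n e (\<lambda>J. if J = L then c else 0) = (\<Sum>J\<in>Pow {..<n}. if J = L then ext_monom e (sorted_list_of_set L) c else 0)"
    unfolding expr_def by (intro sum.cong) auto
  thus ?thesis using assms by simp
qed

lemma deg_part_expr: "deg_part D (expr n e f) = expr n e (\<lambda>J. if card J \<in> D then f J else 0)"
  unfolding expr_def deg_part_sum using finite_Pow_index
  by (intro sum.cong) (auto simp: ext_monom_def deg_part_single)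

context ext_fibre
begin

lemma R_expr: "(\<And>i. i < n \<Longrightarrow> e i \<in> carrier V) \<Longrightarrow> expr n e f \<in> carrier R"
  unfolding expr_def using finite_Pow_index by (intro R_sum R_ext_monom) auto

lemma cls_expr_mult:
  assumes e: "\<And>i. i < n \<Longrightarrow> e i \<in> carrier V"
  shows "cls (expr n e f) \<otimes>\<^bsub>E\<^esub> cls (expr n e g) = cls (expr n e (prod_coeff n f g))"
proof -
  let ?P = "Pow {..<n}" and ?s = "sorted_list_of_set"
  have "expr n e f * expr n e g = (\<Sum>J\<in>?P. \<Sum>K\<in>?P. ext_monom e (?s J @ ?s K) (f J * g K))"
    unfolding expr_def sum_product by (simp add: ext_monom_mult)
  also have "\<dots> - expr n e (prod_coeff n f g) = (\<Sum>J\<in>?P. \<Sum>K\<in>?P. ext_monom e (?s J @ ?s K) (f J * g K) -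
      ext_monom e (?s (J \<union> K)) (word_sign (?s J @ ?s K) * (f J * g K)))"
  proof -
    have "expr n e (prod_coeff n f g) = (\<Sum>L\<in>?P. \<Sum>J\<in>?P. \<Sum>K\<in>?P.
        ext_monom e (?s L) (if J \<union> K = L then word_sign (?s J @ ?s K) * (f J * g K) else 0))"
      unfolding expr_def prod_coeff_def ext_monom_sum ..
    also have "\<dots> = (\<Sum>J\<in>?P. \<Sum>L\<in>?P. \<Sum>K\<in>?P.
        ext_monom e (?s L) (if J \<union> K = L then word_sign (?s J @ ?s K) * (f J * g K) else 0))"
      by (rule sum.swap)
    also have "\<dots> = (\<Sum>J\<in>?P. \<Sum>K\<in>?P. \<Sum>L\<in>?P.
        ext_monom e (?s L) (if J \<union> K = L then word_sign (?s J @ ?s K) * (f J * g K) else 0))"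
      by (intro sum.cong refl sum.swap)
    also have "\<dots> = (\<Sum>J\<in>?P. \<Sum>K\<in>?P. ext_monom e (?s (J \<union> K)) (word_sign (?s J @ ?s K) * (f J * g K)))"
    proof (intro sum.cong refl)
      fix J K assume "J \<in> ?P" "K \<in> ?P"
      hence JK: "J \<union> K \<in> ?P" by blast
      have "(\<Sum>L\<in>?P. ext_monom e (?s L) (if J \<union> K = L then word_sign (?s J @ ?s K) * (f J * g K) else 0)) =
        (\<Sum>L\<in>?P. if J \<union> K = L then ext_monom e (?s L) (word_sign (?s J @ ?s K) * (f J * g K)) else 0)"
        by (intro sum.cong) auto
      thus "(\<Sum>L\<in>?P. ext_monom e (?s L) (if J \<union> K = L then word_sign (?s J @ ?s K) * (f J * g K) else 0)) =
        ext_monom e (?s (J \<union> K)) (word_sign (?s J @ ?s K) * (f J * g K))" using JK by simp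
    qed
    finally show ?thesis by (simp add: sum_subtractf)
  qed
  also have "\<dots> \<in> I"
  proof -
    have I_sum: "sum h A \<in> I" if "\<And>x. x \<in> A \<Longrightarrow> h x \<in> I" for h and A :: "nat set set"
      using that by (induction A rule: infinite_finite_induct) (auto intro: I_zero I_add)
    have "ext_monom e (?s J @ ?s K) (f J * g K) - ext_monom e (?s (J \<union> K)) (word_sign (?s J @ ?s K) * (f J * g K)) \<in> I"
      if "J \<in> ?P" "K \<in> ?P" for J K
    proof -
      have fin: "finite J" "finite K" using that finite_Pow_index by auto
      hence "set (?s J @ ?s K) = J \<union> K" by simp
      moreover have "e ` (J \<union> K) \<subseteq> carrier V" using that e by auto
      ultimately show ?thesis using ext_monom_sort_I[of e "?s J @ ?s K" "f J * g K"] by simp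
    qed
    thus ?thesis by (intro I_sum)
  qed
  finally have *: "expr n e f * expr n e g - expr n e (prod_coeff n f g) \<in> I" .
  have R: "expr n e h \<in> carrier R" for h using R_expr e by blast
  show ?thesis unfolding cls_mult[OF R R] using * R_mult[OF R R] R by (subst cls_eq_iff) auto
qed

text \<open>The linear relations turn the generator of a linear combination of vectors into the linear combination of their
  generators. This expresses the vectors of one frame in the exterior monomials of another one.\<close>

lemma gen_add: "u \<in> carrier V \<Longrightarrow> v \<in> carrier V \<Longrightarrow> cls (gen (u \<oplus>\<^bsub>V\<^esub> v)) = cls (gen u + gen v)"
  using rels_I[of "gen (u \<oplus>\<^bsub>V\<^esub> v) - gen u - gen v"]
  by (subst cls_eq_iff) (auto simp: ext_rels_def algebra_simps intro!: R_single R_add)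

lemma gen_smult: "v \<in> carrier V \<Longrightarrow> cls (gen (c \<odot>\<^bsub>V\<^esub> v)) = cls (ext_monom (\<lambda>_. v) [0] c)"
  using rels_I[of "gen (c \<odot>\<^bsub>V\<^esub> v) - scalar c * gen v"]
  by (subst cls_eq_iff) (auto simp: ext_rels_def ext_monom_def mult_single intro!: R_single smult_closed)

lemma gen_zero: "cls (gen \<zero>\<^bsub>V\<^esub>) = cls 0"
proof -
  have "gen (\<zero>\<^bsub>V\<^esub> \<oplus>\<^bsub>V\<^esub> \<zero>\<^bsub>V\<^esub>) - gen \<zero>\<^bsub>V\<^esub> - gen \<zero>\<^bsub>V\<^esub> \<in> I"
    by (rule rels_I) (use V.zero_closed in \<open>unfold ext_rels_def, blast\<close>)
  hence "- gen \<zero>\<^bsub>V\<^esub> \<in> I" by simp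
  hence "gen \<zero>\<^bsub>V\<^esub> \<in> I" using I_uminus by fastforce
  thus ?thesis by (subst cls_eq_iff) (auto intro!: R_single simp: R_zero)
qed

lemma cls_gen_combination:
  assumes e: "\<And>k. k < n \<Longrightarrow> e k \<in> carrier V"
  shows "cls (gen (\<Oplus>\<^bsub>V\<^esub>k\<in>{..<n}. g k \<odot>\<^bsub>V\<^esub> e k)) = cls (\<Sum>k<n. ext_monom e [k] (g k))"
  using e
proof (induction n)
  case 0
  show ?case by (simp add: gen_zero)
next
  case (Suc n)
  have c: "(\<lambda>k. g k \<odot>\<^bsub>V\<^esub> e k) \<in> {..<n} \<rightarrow> carrier V" "g n \<odot>\<^bsub>V\<^esub> e n \<in> carrier V" using Suc.prems smult_closed by auto
  have "(\<Oplus>\<^bsub>V\<^esub>k\<in>{..<Suc n}. g k \<odot>\<^bsub>V\<^esub> e k) = g n \<odot>\<^bsub>V\<^esub> e n \<oplus>\<^bsub>V\<^esub> (\<Oplus>\<^bsub>V\<^esub>k\<in>{..<n}. g k \<odot>\<^bsub>V\<^esub> e k)"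
    unfolding lessThan_Suc using c by (intro V.finsum_insert) auto
  hence "cls (gen (\<Oplus>\<^bsub>V\<^esub>k\<in>{..<Suc n}. g k \<odot>\<^bsub>V\<^esub> e k)) = cls (gen (g n \<odot>\<^bsub>V\<^esub> e n)) \<oplus>\<^bsub>E\<^esub> cls (gen (\<Oplus>\<^bsub>V\<^esub>k\<in>{..<n}. g k \<odot>\<^bsub>V\<^esub> e k))"
    using gen_add[OF c(2) V.finsum_closed[OF c(1)]] c V.finsum_closed[OF c(1)] by (subst cls_add) (auto intro!: R_single)
  also have "\<dots> = cls (ext_monom e [n] (g n)) \<oplus>\<^bsub>E\<^esub> cls (\<Sum>k<n. ext_monom e [k] (g k))"
    using Suc gen_smult[of "e n" "g n"] by (simp add: ext_monom_def)
  also have "\<dots> = cls (\<Sum>k<Suc n. ext_monom e [k] (g k))"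
    using Suc.prems by (subst cls_add) (auto intro!: R_ext_monom R_sum simp: add.commute)
  finally show ?case .
qed

lemma cls_gen_expr:
  assumes e: "\<And>k. k < n \<Longrightarrow> e k \<in> carrier V"
  shows "cls (gen (\<Oplus>\<^bsub>V\<^esub>k\<in>{..<n}. g k \<odot>\<^bsub>V\<^esub> e k)) = cls (expr n e (\<lambda>J. \<Sum>k<n. if J = {k} then g k else 0))"
proof -
  have "expr n e (\<lambda>J. \<Sum>k<n. if J = {k} then g k else 0) = (\<Sum>k<n. expr n e (\<lambda>J. if J = {k} then g k else 0))"
    unfolding expr_def ext_monom_sum by (rule sum.swap)
  also have "\<dots> = (\<Sum>k<n. ext_monom e [k] (g k))"
    by (intro sum.cong refl) (subst expr_delta, auto)
  finally show ?thesis using cls_gen_combination[OF e] by simp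
qed

text \<open>Defined by an arbitrary representative; by \<open>deg_part_I\<close> the choice does not matter.\<close>

definition proj_part :: "nat set \<Rightarrow> ('v gen_word \<Rightarrow>\<^sub>0 complex) set \<Rightarrow> ('v gen_word \<Rightarrow>\<^sub>0 complex) set"
  where "proj_part D a = cls (deg_part D (SOME t. t \<in> carrier R \<and> a = cls t))"

lemma proj_part_cls: "t \<in> carrier R \<Longrightarrow> proj_part D (cls t) = cls (deg_part D t)"
proof -
  assume t: "t \<in> carrier R"
  define u where "u = (SOME u. u \<in> carrier R \<and> cls t = cls u)"
  have u: "u \<in> carrier R \<and> cls t = cls u" unfolding u_def by (rule someI[of _ t]) (use t in simp)
  hence "t - u \<in> I" using t cls_eq_iff by blast
  hence "deg_part D u - deg_part D t \<in> I" using I_uminus[OF deg_part_I[of "t - u" D]] by (simp add: deg_part_diff)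
  thus ?thesis unfolding proj_part_def u_def[symmetric] using t u R_deg_part by (subst cls_eq_iff) auto
qed

lemma proj_part_in: "a \<in> carrier E \<Longrightarrow> proj_part D a \<in> ext_part V D"
  using cls_surj[of a] ext_partI proj_part_cls by fastforce

lemma proj_part_compl: "a \<in> carrier E \<Longrightarrow> a = proj_part D a \<oplus>\<^bsub>E\<^esub> proj_part (- D) a"
proof -
  assume "a \<in> carrier E"
  then obtain t where "t \<in> carrier R" "a = cls t" using cls_surj by blast
  thus ?thesis by (simp add: proj_part_cls cls_add R_deg_part deg_part_compl)
qed

end

section \<open>The sheaf of exterior algebras\<close>

subsection \<open>Holomorphic functions\<close>

lemma continuous_map_mult_complex:
  fixes f g :: "'a \<Rightarrow> complex"
  shows "continuous_map base euclidean f \<Longrightarrow> continuous_map base euclidean g \<Longrightarrow> continuous_map base euclidean (\<lambda>x. f x * g x)"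
  by (simp add: continuous_map_atin tendsto_mult)

lemma holomorphic_Cn_add:
  "holomorphic_Cn n D f \<Longrightarrow> holomorphic_Cn n D g \<Longrightarrow> holomorphic_Cn n D (\<lambda>z. f z + g z)"
  unfolding holomorphic_Cn_def by (auto intro: continuous_map_add field_differentiable_add)

lemma holomorphic_Cn_mult:
  "holomorphic_Cn n D f \<Longrightarrow> holomorphic_Cn n D g \<Longrightarrow> holomorphic_Cn n D (\<lambda>z. f z * g z)"
  unfolding holomorphic_Cn_def by (auto intro: continuous_map_mult_complex field_differentiable_mult)

lemma holomorphic_Cn_const: "openin (Cn n) D \<Longrightarrow> holomorphic_Cn n D (\<lambda>z. c)"
  unfolding holomorphic_Cn_def by (auto simp: field_differentiable_const)

lemma holomorphic_Cn_subset:
  "holomorphic_Cn n D f \<Longrightarrow> openin (Cn n) D' \<Longrightarrow> D' \<subseteq> D \<Longrightarrow> holomorphic_Cn n D' f"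
  unfolding holomorphic_Cn_def using continuous_map_from_subtopology_mono by blast

locale complex_model =
  fixes M :: "('x, 'v) model_data"
  assumes model: "model M"
begin

abbreviation base where "base \<equiv> space M"

lemma chart_open:
  assumes "(U, \<phi>) \<in> charts M" "openin base W" shows "openin (Cn (cdim M)) (\<phi> ` (U \<inter> W))"
proof -
  have U: "openin base U" "openin (Cn (cdim M)) (\<phi> ` U)"
    "homeomorphic_map (subtopology base U) (subtopology (Cn (cdim M)) (\<phi> ` U)) \<phi>"
    using model assms(1) unfolding model_def complex_manifold_def by auto
  have "openin (subtopology base U) (U \<inter> W)" using assms(2) by (metis inf_commute openin_subtopology_Int)
  hence "openin (subtopology (Cn (cdim M)) (\<phi> ` U)) (\<phi> ` (U \<inter> W))"
    using homeomorphic_imp_open_map[OF U(3)] unfolding open_map_def by blast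
  thus ?thesis using U(2) openin_trans_full by blast
qed

lemma hol_open: "holomorphic_fun M W f \<Longrightarrow> openin base W"
  by (simp add: holomorphic_fun_def)

lemma hol_add: "holomorphic_fun M W f \<Longrightarrow> holomorphic_fun M W g \<Longrightarrow> holomorphic_fun M W (\<lambda>x. f x + g x)"
  unfolding holomorphic_fun_def by (auto intro!: holomorphic_Cn_add)

lemma hol_mult: "holomorphic_fun M W f \<Longrightarrow> holomorphic_fun M W g \<Longrightarrow> holomorphic_fun M W (\<lambda>x. f x * g x)"
  unfolding holomorphic_fun_def by (auto intro!: holomorphic_Cn_mult)

lemma hol_const: "openin base W \<Longrightarrow> holomorphic_fun M W (\<lambda>x. c)"
  unfolding holomorphic_fun_def using chart_open by (auto intro!: holomorphic_Cn_const)

lemma hol_uminus: "holomorphic_fun M W f \<Longrightarrow> holomorphic_fun M W (\<lambda>x. - f x)"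
  using hol_mult[OF hol_const[OF hol_open], of W f f "-1"] by simp

lemma hol_sum:
  "openin base W \<Longrightarrow> (\<And>a. a \<in> A \<Longrightarrow> holomorphic_fun M W (f a)) \<Longrightarrow> holomorphic_fun M W (\<lambda>x. \<Sum>a\<in>A. f a x)"
  by (induction A rule: infinite_finite_induct) (auto intro: hol_add hol_const)

lemma hol_subset:
  assumes f: "holomorphic_fun M W f" and W': "openin base W'" "W' \<subseteq> W" shows "holomorphic_fun M W' f"
  unfolding holomorphic_fun_def
proof (intro conjI ballI W'(1), clarify)
  fix U \<phi> assume c: "(U, \<phi>) \<in> charts M"
  have hol: "holomorphic_Cn (cdim M) (\<phi> ` (U \<inter> W)) (\<lambda>z. f (inv_into U \<phi> z))"
    using bspec[OF conjunct2[OF f[unfolded holomorphic_fun_def]] c] unfolding split_conv .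
  have "\<phi> ` (U \<inter> W') \<subseteq> \<phi> ` (U \<inter> W)" using W' by blast
  from holomorphic_Cn_subset[OF hol chart_open[OF c W'(1)] this]
  show "holomorphic_Cn (cdim M) (\<phi> ` (U \<inter> W')) (\<lambda>z. f (inv_into U \<phi> z))" .
qed

subsection \<open>Frames\<close>

lemma bundle_data:
  shows "\<forall>x\<in>topspace base. module cfield (fibre M x)"
    and "(\<Union>(U, e)\<in>frames M. U) = topspace base"
    and "\<forall>(U, e)\<in>frames M. openin base U \<and>
       (\<forall>x\<in>U. (\<forall>i<rank M. e i x \<in> carrier (fibre M x)) \<and>
          (\<forall>v\<in>carrier (fibre M x). \<exists>!c. c \<in> {..<rank M} \<rightarrow>\<^sub>E UNIV \<and>
             v = (\<Oplus>\<^bsub>fibre M x\<^esub>i\<in>{..<rank M}. c i \<odot>\<^bsub>fibre M x\<^esub> e i x)))"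
    and "\<forall>(U, e)\<in>frames M. \<forall>(V, e')\<in>frames M. \<exists>g.
       (\<forall>k<rank M. \<forall>i<rank M. holomorphic_fun M (U \<inter> V) (g k i)) \<and>
       (\<forall>x\<in>U \<inter> V. \<forall>i<rank M.
          e' i x = (\<Oplus>\<^bsub>fibre M x\<^esub>k\<in>{..<rank M}. g k i x \<odot>\<^bsub>fibre M x\<^esub> e k x))"
  using model unfolding model_def holomorphic_bundle_def by - (elim conjE, assumption)+

lemma fibre_ext: "x \<in> topspace base \<Longrightarrow> ext_fibre (fibre M x)"
  using bundle_data(1) by (intro ext_fibre.intro) simp

lemma frame_open: "(U, e) \<in> frames M \<Longrightarrow> openin base U"
  using bspec[OF bundle_data(3), of "(U, e)"] by simp

lemma frame_carrier: "(U, e) \<in> frames M \<Longrightarrow> x \<in> U \<Longrightarrow> i < rank M \<Longrightarrow> e i x \<in> carrier (fibre M x)"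
  using bspec[OF bundle_data(3), of "(U, e)"] by simp

lemma frame_cover: "x \<in> topspace base \<Longrightarrow> \<exists>U e. (U, e) \<in> frames M \<and> x \<in> U"
  unfolding bundle_data(2)[symmetric] by auto

lemma frame_change:
  assumes "(U, e) \<in> frames M" "(V, e') \<in> frames M"
  obtains g where "\<forall>k<rank M. \<forall>i<rank M. holomorphic_fun M (U \<inter> V) (g k i)"
    "\<forall>x\<in>U \<inter> V. \<forall>i<rank M. e' i x = (\<Oplus>\<^bsub>fibre M x\<^esub>k\<in>{..<rank M}. g k i x \<odot>\<^bsub>fibre M x\<^esub> e k x)"
proof -
  have "\<forall>(V, e')\<in>frames M. \<exists>g.
       (\<forall>k<rank M. \<forall>i<rank M. holomorphic_fun M (U \<inter> V) (g k i)) \<and>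
       (\<forall>x\<in>U \<inter> V. \<forall>i<rank M.
          e' i x = (\<Oplus>\<^bsub>fibre M x\<^esub>k\<in>{..<rank M}. g k i x \<odot>\<^bsub>fibre M x\<^esub> e k x))"
    using bspec[OF bundle_data(4) assms(1)] by simp
  from bspec[OF this assms(2)] obtain g where "(\<forall>k<rank M. \<forall>i<rank M. holomorphic_fun M (U \<inter> V) (g k i)) \<and>
       (\<forall>x\<in>U \<inter> V. \<forall>i<rank M. e' i x = (\<Oplus>\<^bsub>fibre M x\<^esub>k\<in>{..<rank M}. g k i x \<odot>\<^bsub>fibre M x\<^esub> e k x))"
    unfolding split_conv by (elim exE)
  thus ?thesis by (elim conjE) (rule that)
qed

definition frame_expr :: "(nat \<Rightarrow> 'x \<Rightarrow> 'v) \<Rightarrow> 'x \<Rightarrow> (nat set \<Rightarrow> complex) \<Rightarrow> ('v gen_word \<Rightarrow>\<^sub>0 complex) set"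
  where "frame_expr e x f = ext_class (fibre M x) (expr (rank M) (\<lambda>i. e i x) f)"

abbreviation S where "S \<equiv> ext_sheaf M"

lemma Ball_frames: "(\<forall>(V, e)\<in>A. Q V e) \<longleftrightarrow> (\<forall>V e. (V, e) \<in> A \<longrightarrow> Q V e)"
  by auto

lemma sec_iff:
  "s \<in> carrier (S W) \<longleftrightarrow> s \<in> extensional W \<and> (\<forall>V e. (V, e) \<in> frames M \<longrightarrow> (\<exists>f.
     (\<forall>J\<in>Pow {..<rank M}. holomorphic_fun M (W \<inter> V) (f J)) \<and> (\<forall>x\<in>W \<inter> V. s x = frame_expr e x (\<lambda>J. f J x))))"
  unfolding ext_sheaf_def frame_expr_def expr_def ext_monom_def Ball_frames by simp

lemma S_simps:
  "monoid.mult (S W) = (\<lambda>s t. \<lambda>x\<in>W. s x \<otimes>\<^bsub>ext_alg (fibre M x)\<^esub> t x)"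
  "\<one>\<^bsub>S W\<^esub> = (\<lambda>x\<in>W. \<one>\<^bsub>ext_alg (fibre M x)\<^esub>)"
  "\<zero>\<^bsub>S W\<^esub> = (\<lambda>x\<in>W. \<zero>\<^bsub>ext_alg (fibre M x)\<^esub>)"
  "add (S W) = (\<lambda>s t. \<lambda>x\<in>W. s x \<oplus>\<^bsub>ext_alg (fibre M x)\<^esub> t x)"
  by (simp_all add: ext_sheaf_def)

lemma secI:
  assumes "s \<in> extensional W" "\<And>V e. (V, e) \<in> frames M \<Longrightarrow> \<exists>f.
     (\<forall>J\<in>Pow {..<rank M}. holomorphic_fun M (W \<inter> V) (f J)) \<and> (\<forall>x\<in>W \<inter> V. s x = frame_expr e x (\<lambda>J. f J x))"
  shows "s \<in> carrier (S W)"
  using assms unfolding sec_iff by blast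

lemma secE:
  assumes "s \<in> carrier (S W)" "(V, e) \<in> frames M"
  obtains f where "\<And>J. J \<in> Pow {..<rank M} \<Longrightarrow> holomorphic_fun M (W \<inter> V) (f J)"
    "\<And>x. x \<in> W \<Longrightarrow> x \<in> V \<Longrightarrow> s x = frame_expr e x (\<lambda>J. f J x)"
  using assms unfolding sec_iff by (metis Int_iff)

lemma sec_extensional: "s \<in> carrier (S W) \<Longrightarrow> s \<in> extensional W"
  by (simp add: sec_iff)

lemma frame_expr_closed:
  assumes "(V, e) \<in> frames M" "x \<in> V" shows "frame_expr e x f \<in> carrier (ext_alg (fibre M x))"
proof -
  have "x \<in> topspace base" using assms frame_open openin_subset by blast
  then interpret ext_fibre "fibre M x" by (rule fibre_ext)
  show ?thesis unfolding frame_expr_def using frame_carrier[OF assms] by (intro cls_closed R_expr) auto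
qed

lemma frame_expr_add:
  assumes "(V, e) \<in> frames M" "x \<in> V"
  shows "frame_expr e x f \<oplus>\<^bsub>ext_alg (fibre M x)\<^esub> frame_expr e x g = frame_expr e x (\<lambda>J. f J + g J)"
proof -
  have "x \<in> topspace base" using assms frame_open openin_subset by blast
  then interpret ext_fibre "fibre M x" by (rule fibre_ext)
  have R: "expr (rank M) (\<lambda>i. e i x) h \<in> carrier R" for h using frame_carrier[OF assms] by (intro R_expr) auto
  show ?thesis unfolding frame_expr_def using R by (simp add: cls_add expr_add)
qed

lemma frame_expr_uminus:
  assumes "(V, e) \<in> frames M" "x \<in> V"
  shows "\<ominus>\<^bsub>ext_alg (fibre M x)\<^esub> frame_expr e x f = frame_expr e x (\<lambda>J. - f J)"
proof -
  have "x \<in> topspace base" using assms frame_open openin_subset by blast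
  then interpret ext_fibre "fibre M x" by (rule fibre_ext)
  have R: "expr (rank M) (\<lambda>i. e i x) h \<in> carrier R" for h using frame_carrier[OF assms] by (intro R_expr) auto
  show ?thesis unfolding frame_expr_def using R by (simp add: cls_uminus expr_uminus)
qed

lemma frame_expr_mult:
  assumes "(V, e) \<in> frames M" "x \<in> V"
  shows "frame_expr e x f \<otimes>\<^bsub>ext_alg (fibre M x)\<^esub> frame_expr e x g = frame_expr e x (prod_coeff (rank M) f g)"
proof -
  have "x \<in> topspace base" using assms frame_open openin_subset by blast
  then interpret ext_fibre "fibre M x" by (rule fibre_ext)
  show ?thesis unfolding frame_expr_def using frame_carrier[OF assms] by (intro cls_expr_mult) auto
qed

lemma frame_expr_zero:
  assumes "(V, e) \<in> frames M" "x \<in> V" shows "\<zero>\<^bsub>ext_alg (fibre M x)\<^esub> = frame_expr e x (\<lambda>J. 0)"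
proof -
  have "x \<in> topspace base" using assms frame_open openin_subset by blast
  then interpret ext_fibre "fibre M x" by (rule fibre_ext)
  show ?thesis unfolding frame_expr_def by (simp add: expr_zero cls_zero)
qed

lemma frame_expr_scalar:
  assumes "(V, e) \<in> frames M" "x \<in> V"
  shows "ext_class (fibre M x) (scalar c) = frame_expr e x (\<lambda>J. if J = {} then c else 0)"
  unfolding frame_expr_def using expr_delta[of "{}" "rank M" "\<lambda>i. e i x" c]
  by (simp add: ext_monom_def zero_gen_word_def)

lemma frame_expr_monom:
  assumes "L \<in> Pow {..<rank M}"
  shows "ext_class (fibre M x) (ext_monom (\<lambda>i. e i x) (sorted_list_of_set L) c) = frame_expr e x (\<lambda>J. if J = L then c else 0)"
  unfolding frame_expr_def using expr_delta[OF assms, of "\<lambda>i. e i x" c] by simp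

lemma frame_expr_proj:
  assumes "(V, e) \<in> frames M" "x \<in> V"
  shows "ext_fibre.proj_part (fibre M x) D (frame_expr e x f) = frame_expr e x (\<lambda>J. if card J \<in> D then f J else 0)"
proof -
  have "x \<in> topspace base" using assms frame_open openin_subset by blast
  then interpret ext_fibre "fibre M x" by (rule fibre_ext)
  have R: "expr (rank M) (\<lambda>i. e i x) h \<in> carrier R" for h using frame_carrier[OF assms] by (intro R_expr) auto
  show ?thesis unfolding frame_expr_def using R by (simp add: proj_part_cls deg_part_expr)
qed

lemma frame_expr_part:
  assumes "(V, e) \<in> frames M" "x \<in> V" "frame_expr e x f \<in> ext_part (fibre M x) D"
  shows "frame_expr e x f = frame_expr e x (\<lambda>J. if card J \<in> D then f J else 0)"
proof -
  have "x \<in> topspace base" using assms frame_open openin_subset by blast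
  then interpret ext_fibre "fibre M x" by (rule fibre_ext)
  have R: "expr (rank M) (\<lambda>i. e i x) h \<in> carrier R" for h using frame_carrier[OF assms(1,2)] by (intro R_expr) auto
  show ?thesis using assms(3) R[of f] unfolding frame_expr_def by (simp add: ext_part_iff deg_part_expr)
qed

subsection \<open>Rings of sections\<close>

lemma sec_at:
  assumes W: "openin base W" and s: "s \<in> carrier (S W)" "x \<in> W"
  shows "s x \<in> carrier (ext_alg (fibre M x))"
proof -
  have "x \<in> topspace base" using assms openin_subset by blast
  then obtain V e where V: "(V, e) \<in> frames M" "x \<in> V" using frame_cover by blast
  obtain f where "\<And>x. x \<in> W \<Longrightarrow> x \<in> V \<Longrightarrow> s x = frame_expr e x (\<lambda>J. f J x)"
    using secE[OF s(1) V(1)] by metis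
  thus ?thesis using frame_expr_closed[OF V] V s by simp
qed

lemma sec_eqI:
  "s \<in> carrier (S W) \<Longrightarrow> t \<in> carrier (S W) \<Longrightarrow> (\<And>x. x \<in> W \<Longrightarrow> s x = t x) \<Longrightarrow> s = t"
  using sec_extensional by (intro extensionalityI[of _ W]) auto

lemma sec_add:
  assumes s: "s \<in> carrier (S W)" and t: "t \<in> carrier (S W)" shows "s \<oplus>\<^bsub>S W\<^esub> t \<in> carrier (S W)"
proof (rule secI)
  fix V e assume V: "(V, e) \<in> frames M"
  obtain f where f: "\<And>J. J \<in> Pow {..<rank M} \<Longrightarrow> holomorphic_fun M (W \<inter> V) (f J)"
    "\<And>x. x \<in> W \<Longrightarrow> x \<in> V \<Longrightarrow> s x = frame_expr e x (\<lambda>J. f J x)" using secE[OF s V] by metis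
  obtain g where g: "\<And>J. J \<in> Pow {..<rank M} \<Longrightarrow> holomorphic_fun M (W \<inter> V) (g J)"
    "\<And>x. x \<in> W \<Longrightarrow> x \<in> V \<Longrightarrow> t x = frame_expr e x (\<lambda>J. g J x)" using secE[OF t V] by metis
  show "\<exists>f. (\<forall>J\<in>Pow {..<rank M}. holomorphic_fun M (W \<inter> V) (f J)) \<and> (\<forall>x\<in>W \<inter> V. (s \<oplus>\<^bsub>S W\<^esub> t) x = frame_expr e x (\<lambda>J. f J x))"
    using f g frame_expr_add[OF V] by (intro exI[of _ "\<lambda>J x. f J x + g J x"]) (auto simp: S_simps intro!: hol_add)
qed (simp add: S_simps)

lemma sec_mult:
  assumes s: "s \<in> carrier (S W)" and t: "t \<in> carrier (S W)" and W: "openin base W" shows "s \<otimes>\<^bsub>S W\<^esub> t \<in> carrier (S W)"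
proof (rule secI)
  fix V e assume V: "(V, e) \<in> frames M"
  obtain f where f: "\<And>J. J \<in> Pow {..<rank M} \<Longrightarrow> holomorphic_fun M (W \<inter> V) (f J)"
    "\<And>x. x \<in> W \<Longrightarrow> x \<in> V \<Longrightarrow> s x = frame_expr e x (\<lambda>J. f J x)" using secE[OF s V] by metis
  obtain g where g: "\<And>J. J \<in> Pow {..<rank M} \<Longrightarrow> holomorphic_fun M (W \<inter> V) (g J)"
    "\<And>x. x \<in> W \<Longrightarrow> x \<in> V \<Longrightarrow> t x = frame_expr e x (\<lambda>J. g J x)" using secE[OF t V] by metis
  have WV: "openin base (W \<inter> V)" using W frame_open[OF V] by auto
  have "holomorphic_fun M (W \<inter> V) (\<lambda>x. prod_coeff (rank M) (\<lambda>J. f J x) (\<lambda>J. g J x) L)" for L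
    unfolding prod_coeff_def
  proof (intro hol_sum WV)
    fix J K assume JK: "J \<in> Pow {..<rank M}" "K \<in> Pow {..<rank M}"
    show "holomorphic_fun M (W \<inter> V) (\<lambda>x. if J \<union> K = L then word_sign (sorted_list_of_set J @ sorted_list_of_set K) * (f J x * g K x) else 0)"
      using f(1)[OF JK(1)] g(1)[OF JK(2)] by (cases "J \<union> K = L") (auto intro!: hol_mult hol_const WV)
  qed
  thus "\<exists>f. (\<forall>J\<in>Pow {..<rank M}. holomorphic_fun M (W \<inter> V) (f J)) \<and> (\<forall>x\<in>W \<inter> V. (s \<otimes>\<^bsub>S W\<^esub> t) x = frame_expr e x (\<lambda>J. f J x))"
    using f g frame_expr_mult[OF V] by (intro exI[of _ "\<lambda>L x. prod_coeff (rank M) (\<lambda>J. f J x) (\<lambda>J. g J x) L"]) (auto simp: S_simps)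
qed (simp add: S_simps)

definition neg :: "'x set \<Rightarrow> ('x, 'v) ext_section \<Rightarrow> ('x, 'v) ext_section"
  where "neg W s = (\<lambda>x\<in>W. \<ominus>\<^bsub>ext_alg (fibre M x)\<^esub> s x)"

lemma sec_neg: assumes s: "s \<in> carrier (S W)" shows "neg W s \<in> carrier (S W)"
proof (rule secI)
  fix V e assume V: "(V, e) \<in> frames M"
  obtain f where f: "\<And>J. J \<in> Pow {..<rank M} \<Longrightarrow> holomorphic_fun M (W \<inter> V) (f J)"
    "\<And>x. x \<in> W \<Longrightarrow> x \<in> V \<Longrightarrow> s x = frame_expr e x (\<lambda>J. f J x)" using secE[OF s V] by metis
  show "\<exists>f. (\<forall>J\<in>Pow {..<rank M}. holomorphic_fun M (W \<inter> V) (f J)) \<and> (\<forall>x\<in>W \<inter> V. neg W s x = frame_expr e x (\<lambda>J. f J x))"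
    using f frame_expr_uminus[OF V] by (intro exI[of _ "\<lambda>J x. - f J x"]) (auto simp: neg_def intro!: hol_uminus)
qed (simp add: neg_def)

lemma sec_scalar_fun:
  assumes h: "holomorphic_fun M W h" shows "(\<lambda>x\<in>W. ext_class (fibre M x) (scalar (h x))) \<in> carrier (S W)"
proof (rule secI)
  fix V e assume V: "(V, e) \<in> frames M"
  have WV: "openin base (W \<inter> V)" using hol_open[OF h] frame_open[OF V] by auto
  have "holomorphic_fun M (W \<inter> V) (\<lambda>x. if J = {} then h x else 0)" for J :: "nat set"
    using hol_subset[OF h WV] hol_const[OF WV] by (cases "J = {}") auto
  thus "\<exists>f. (\<forall>J\<in>Pow {..<rank M}. holomorphic_fun M (W \<inter> V) (f J)) \<and>
      (\<forall>x\<in>W \<inter> V. (\<lambda>x\<in>W. ext_class (fibre M x) (scalar (h x))) x = frame_expr e x (\<lambda>J. f J x))"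
    using frame_expr_scalar[OF V] by (intro exI[of _ "\<lambda>J x. if J = {} then h x else 0"]) auto
qed simp

lemma sec_zero: "openin base W \<Longrightarrow> \<zero>\<^bsub>S W\<^esub> \<in> carrier (S W)"
proof (rule secI)
  fix V e assume W: "openin base W" and V: "(V, e) \<in> frames M"
  have "openin base (W \<inter> V)" using W frame_open[OF V] by auto
  thus "\<exists>f. (\<forall>J\<in>Pow {..<rank M}. holomorphic_fun M (W \<inter> V) (f J)) \<and> (\<forall>x\<in>W \<inter> V. \<zero>\<^bsub>S W\<^esub> x = frame_expr e x (\<lambda>J. f J x))"
    using frame_expr_zero[OF V] by (intro exI[of _ "\<lambda>J x. 0"]) (auto simp: S_simps intro: hol_const)
qed (simp add: S_simps)

lemma const_section: "openin base W \<Longrightarrow> const_section M W c \<in> carrier (S W)"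
  unfolding const_section_def by (rule sec_scalar_fun[OF hol_const])

lemma sec_one: assumes W: "openin base W" shows "\<one>\<^bsub>S W\<^esub> \<in> carrier (S W)"
proof -
  have "\<one>\<^bsub>ext_alg (fibre M x)\<^esub> = ext_class (fibre M x) (scalar 1)" if "x \<in> W" for x
  proof -
    have "x \<in> topspace base" using that W openin_subset by blast
    then interpret ext_fibre "fibre M x" by (rule fibre_ext)
    show ?thesis by (simp add: cls_one)
  qed
  hence "\<one>\<^bsub>S W\<^esub> = const_section M W 1" unfolding S_simps const_section_def by (intro restrict_ext) auto
  thus ?thesis using const_section[OF W] by simp
qed

lemma fibre_ring: "openin base W \<Longrightarrow> x \<in> W \<Longrightarrow> ring (ext_alg (fibre M x))"
proof -
  assume "openin base W" "x \<in> W"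
  then interpret ext_fibre "fibre M x" using openin_subset fibre_ext by blast
  show ?thesis by (rule E.ring_axioms)
qed

lemma neg_add:
  assumes W: "openin base W" and s: "s \<in> carrier (S W)" shows "neg W s \<oplus>\<^bsub>S W\<^esub> s = \<zero>\<^bsub>S W\<^esub>"
proof (rule sec_eqI[OF sec_add[OF sec_neg[OF s] s] sec_zero[OF W]])
  fix x assume x: "x \<in> W"
  interpret E: ring "ext_alg (fibre M x)" by (rule fibre_ring[OF W x])
  show "(neg W s \<oplus>\<^bsub>S W\<^esub> s) x = \<zero>\<^bsub>S W\<^esub> x" using x sec_at[OF W s x] by (simp add: S_simps neg_def E.l_neg)
qed

text \<open>The operations are pointwise, so the ring axioms hold because they hold in the fibres; the closure
  properties express that sums and products have holomorphic coefficients in every frame.\<close>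

lemma ring_S: assumes W: "openin base W" shows "ring (S W)"
proof -
  have rE: "ring (ext_alg (fibre M x))" if "x \<in> W" for x by (rule fibre_ring[OF W that])
  have at: "s x \<in> carrier (ext_alg (fibre M x))" if "s \<in> carrier (S W)" "x \<in> W" for s x by (rule sec_at[OF W that])
  show ?thesis
  proof (rule ringI)
    show "abelian_group (S W)"
    proof (rule abelian_groupI)
      fix s assume s: "s \<in> carrier (S W)"
      show "\<exists>t\<in>carrier (S W). t \<oplus>\<^bsub>S W\<^esub> s = \<zero>\<^bsub>S W\<^esub>"
      proof
        show "neg W s \<in> carrier (S W)" by (rule sec_neg[OF s])
        show "neg W s \<oplus>\<^bsub>S W\<^esub> s = \<zero>\<^bsub>S W\<^esub>"
          by (rule neg_add[OF W s])
      qed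
      show "\<zero>\<^bsub>S W\<^esub> \<oplus>\<^bsub>S W\<^esub> s = s"
      proof (rule sec_eqI[OF sec_add[OF sec_zero[OF W] s] s])
        fix x assume x: "x \<in> W"
        interpret E: ring "ext_alg (fibre M x)" by (rule rE[OF x])
        show "(\<zero>\<^bsub>S W\<^esub> \<oplus>\<^bsub>S W\<^esub> s) x = s x" using x at[OF s x] by (simp add: S_simps)
      qed
    next
      fix s t assume s: "s \<in> carrier (S W)" and t: "t \<in> carrier (S W)"
      show "s \<oplus>\<^bsub>S W\<^esub> t = t \<oplus>\<^bsub>S W\<^esub> s"
      proof (rule sec_eqI)
        fix x assume x: "x \<in> W"
        interpret E: ring "ext_alg (fibre M x)" by (rule rE[OF x])
        show "(s \<oplus>\<^bsub>S W\<^esub> t) x = (t \<oplus>\<^bsub>S W\<^esub> s) x" using x at[OF s x] at[OF t x] by (simp add: S_simps E.a_comm)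
      qed (use s t  sec_add sec_mult W in simp_all)
      fix u assume u: "u \<in> carrier (S W)"
      show "s \<oplus>\<^bsub>S W\<^esub> t \<oplus>\<^bsub>S W\<^esub> u = s \<oplus>\<^bsub>S W\<^esub> (t \<oplus>\<^bsub>S W\<^esub> u)"
      proof (rule sec_eqI)
        fix x assume x: "x \<in> W"
        interpret E: ring "ext_alg (fibre M x)" by (rule rE[OF x])
        show "(s \<oplus>\<^bsub>S W\<^esub> t \<oplus>\<^bsub>S W\<^esub> u) x = (s \<oplus>\<^bsub>S W\<^esub> (t \<oplus>\<^bsub>S W\<^esub> u)) x" using x at[OF s x] at[OF t x] at[OF u x] by (simp add: S_simps E.a_assoc)
      qed (use s t u sec_add sec_mult W in simp_all)
    qed (use sec_add sec_zero[OF W] in auto)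
    show "monoid (S W)"
    proof (rule monoidI)
      fix s assume s: "s \<in> carrier (S W)"
      show "\<one>\<^bsub>S W\<^esub> \<otimes>\<^bsub>S W\<^esub> s = s" "s \<otimes>\<^bsub>S W\<^esub> \<one>\<^bsub>S W\<^esub> = s"
      proof (rule_tac [!] sec_eqI)
        fix x assume x: "x \<in> W"
        interpret E: ring "ext_alg (fibre M x)" by (rule rE[OF x])
        show "(\<one>\<^bsub>S W\<^esub> \<otimes>\<^bsub>S W\<^esub> s) x = s x" "(s \<otimes>\<^bsub>S W\<^esub> \<one>\<^bsub>S W\<^esub>) x = s x" using x at[OF s x] by (simp_all add: S_simps)
      qed (use s sec_mult sec_one W in auto)
    next
      fix s t u assume s: "s \<in> carrier (S W)" and t: "t \<in> carrier (S W)" and u: "u \<in> carrier (S W)"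
      show "s \<otimes>\<^bsub>S W\<^esub> t \<otimes>\<^bsub>S W\<^esub> u = s \<otimes>\<^bsub>S W\<^esub> (t \<otimes>\<^bsub>S W\<^esub> u)"
      proof (rule sec_eqI)
        fix x assume x: "x \<in> W"
        interpret E: ring "ext_alg (fibre M x)" by (rule rE[OF x])
        show "(s \<otimes>\<^bsub>S W\<^esub> t \<otimes>\<^bsub>S W\<^esub> u) x = (s \<otimes>\<^bsub>S W\<^esub> (t \<otimes>\<^bsub>S W\<^esub> u)) x" using x at[OF s x] at[OF t x] at[OF u x] by (simp add: S_simps E.m_assoc)
      qed (use s t u sec_add sec_mult W in simp_all)
    qed (use sec_mult sec_one W in auto)
    fix s t u assume s: "s \<in> carrier (S W)" and t: "t \<in> carrier (S W)" and u: "u \<in> carrier (S W)"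
    show "(s \<oplus>\<^bsub>S W\<^esub> t) \<otimes>\<^bsub>S W\<^esub> u = s \<otimes>\<^bsub>S W\<^esub> u \<oplus>\<^bsub>S W\<^esub> t \<otimes>\<^bsub>S W\<^esub> u"
      proof (rule sec_eqI)
        fix x assume x: "x \<in> W"
        interpret E: ring "ext_alg (fibre M x)" by (rule rE[OF x])
        show "((s \<oplus>\<^bsub>S W\<^esub> t) \<otimes>\<^bsub>S W\<^esub> u) x = (s \<otimes>\<^bsub>S W\<^esub> u \<oplus>\<^bsub>S W\<^esub> t \<otimes>\<^bsub>S W\<^esub> u) x" using x at[OF s x] at[OF t x] at[OF u x] by (simp add: S_simps E.l_distr)
      qed (use s t u sec_add sec_mult W in simp_all)
    show "u \<otimes>\<^bsub>S W\<^esub> (s \<oplus>\<^bsub>S W\<^esub> t) = u \<otimes>\<^bsub>S W\<^esub> s \<oplus>\<^bsub>S W\<^esub> u \<otimes>\<^bsub>S W\<^esub> t"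
      proof (rule sec_eqI)
        fix x assume x: "x \<in> W"
        interpret E: ring "ext_alg (fibre M x)" by (rule rE[OF x])
        show "(u \<otimes>\<^bsub>S W\<^esub> (s \<oplus>\<^bsub>S W\<^esub> t)) x = (u \<otimes>\<^bsub>S W\<^esub> s \<oplus>\<^bsub>S W\<^esub> u \<otimes>\<^bsub>S W\<^esub> t) x" using x at[OF s x] at[OF t x] at[OF u x] by (simp add: S_simps E.r_distr)
      qed (use s t u sec_add sec_mult W in simp_all)
  qed
qed

lemma neg_eq: "openin base W \<Longrightarrow> s \<in> carrier (S W) \<Longrightarrow> \<ominus>\<^bsub>S W\<^esub> s = neg W s"
proof -
  assume W: "openin base W" and s: "s \<in> carrier (S W)"
  interpret S: ring "S W" by (rule ring_S[OF W])
  show ?thesis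
  proof (rule S.minus_equality[OF _ s sec_neg[OF s]])
    show "neg W s \<oplus>\<^bsub>S W\<^esub> s = \<zero>\<^bsub>S W\<^esub>" by (rule neg_add[OF W s])
  qed
qed

lemma S_minus_at:
  "openin base W \<Longrightarrow> s \<in> carrier (S W) \<Longrightarrow> t \<in> carrier (S W) \<Longrightarrow> x \<in> W \<Longrightarrow>
    (s \<ominus>\<^bsub>S W\<^esub> t) x = s x \<ominus>\<^bsub>ext_alg (fibre M x)\<^esub> t x"
  by (simp add: a_minus_def neg_eq) (simp add: S_simps neg_def)

lemma sec_restrict:
  assumes s: "s \<in> carrier (S W)" and W': "openin base W'" "W' \<subseteq> W" shows "restrict s W' \<in> carrier (S W')"
proof (rule secI)
  fix V e assume V: "(V, e) \<in> frames M"
  obtain f where f: "\<And>J. J \<in> Pow {..<rank M} \<Longrightarrow> holomorphic_fun M (W \<inter> V) (f J)"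
    "\<And>x. x \<in> W \<Longrightarrow> x \<in> V \<Longrightarrow> s x = frame_expr e x (\<lambda>J. f J x)" using secE[OF s V] by metis
  have WV: "openin base (W' \<inter> V)" "W' \<inter> V \<subseteq> W \<inter> V" using W' frame_open[OF V] by auto
  show "\<exists>f. (\<forall>J\<in>Pow {..<rank M}. holomorphic_fun M (W' \<inter> V) (f J)) \<and> (\<forall>x\<in>W' \<inter> V. restrict s W' x = frame_expr e x (\<lambda>J. f J x))"
    using hol_subset[OF f(1) WV] f(2) W'(2) by (intro exI[of _ f]) auto
qed simp

subsection \<open>The grading of the sheaf\<close>

abbreviation P where "P \<equiv> ext_sheaf_part M"
abbreviation J where "J \<equiv> J_sheaf M"

lemma part_iff: "s \<in> P D W \<longleftrightarrow> s \<in> carrier (S W) \<and> (\<forall>x\<in>W. s x \<in> ext_part (fibre M x) D)"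
  by (simp add: ext_sheaf_part_def)

lemma J_eq: "J k = P {k..}"
  by (simp add: J_sheaf_def)

lemma part_closed: "s \<in> P D W \<Longrightarrow> s \<in> carrier (S W)"
  by (simp add: part_iff)

lemma J_closed: "s \<in> J k W \<Longrightarrow> s \<in> carrier (S W)"
  by (simp add: J_eq part_closed)

lemma J_zero_eq: assumes "openin base W" shows "J 0 W = carrier (S W)"
proof -
  have "s x \<in> ext_part (fibre M x) {0..}" if "s \<in> carrier (S W)" "x \<in> W" for s x
  proof -
    interpret ext_fibre "fibre M x" using that assms openin_subset fibre_ext by blast
    show ?thesis using ext_part_UNIV sec_at[OF assms that] by simp
  qed
  thus ?thesis by (auto simp: J_eq part_iff)
qed

lemma part_add:
  assumes W: "openin base W" and s: "s \<in> P D W" and t: "t \<in> P D W" shows "s \<oplus>\<^bsub>S W\<^esub> t \<in> P D W"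
proof -
  have "s x \<oplus>\<^bsub>ext_alg (fibre M x)\<^esub> t x \<in> ext_part (fibre M x) D" if x: "x \<in> W" for x
  proof -
    interpret ext_fibre "fibre M x" using x W openin_subset fibre_ext by blast
    show ?thesis using s t x by (intro ext_part_add) (auto simp: part_iff)
  qed
  thus ?thesis using s t sec_add by (auto simp: part_iff S_simps)
qed

lemma part_minus:
  assumes W: "openin base W" and s: "s \<in> P D W" and t: "t \<in> P D W" shows "s \<ominus>\<^bsub>S W\<^esub> t \<in> P D W"
proof -
  interpret S: ring "S W" by (rule ring_S[OF W])
  have "(s \<ominus>\<^bsub>S W\<^esub> t) x \<in> ext_part (fibre M x) D" if x: "x \<in> W" for x
  proof -
    interpret ext_fibre "fibre M x" using x W openin_subset fibre_ext by blast
    show ?thesis using s t x S_minus_at[OF W part_closed[OF s] part_closed[OF t] x]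
      by (auto simp: part_iff intro: ext_part_minus)
  qed
  moreover have "s \<ominus>\<^bsub>S W\<^esub> t \<in> carrier (S W)" using part_closed[OF s] part_closed[OF t] by simp
  ultimately show ?thesis by (simp add: part_iff)
qed

lemma part_zero: assumes W: "openin base W" shows "\<zero>\<^bsub>S W\<^esub> \<in> P D W"
proof -
  have "\<zero>\<^bsub>ext_alg (fibre M x)\<^esub> \<in> ext_part (fibre M x) D" if x: "x \<in> W" for x
  proof -
    interpret ext_fibre "fibre M x" using x W openin_subset fibre_ext by blast
    show ?thesis by (rule ext_part_zero)
  qed
  thus ?thesis using sec_zero[OF W] by (auto simp: part_iff S_simps)
qed

lemma part_uminus:
  assumes W: "openin base W" and s: "s \<in> P D W" shows "\<ominus>\<^bsub>S W\<^esub> s \<in> P D W"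
proof -
  interpret S: ring "S W" by (rule ring_S[OF W])
  have "\<zero>\<^bsub>S W\<^esub> \<ominus>\<^bsub>S W\<^esub> s = \<ominus>\<^bsub>S W\<^esub> s" using part_closed[OF s] by (simp add: a_minus_def)
  thus ?thesis using part_minus[OF W part_zero[OF W] s] by simp
qed

lemma part_mono:
  assumes W: "openin base W" and D: "D \<subseteq> D'" shows "P D W \<subseteq> P D' W"
proof
  fix s assume s: "s \<in> P D W"
  have "s x \<in> ext_part (fibre M x) D'" if x: "x \<in> W" for x
  proof -
    interpret ext_fibre "fibre M x" using x W openin_subset fibre_ext by blast
    show ?thesis using s x ext_part_mono[OF D] by (auto simp: part_iff)
  qed
  thus "s \<in> P D' W" using s by (simp add: part_iff)
qed

lemma J_mono: "openin base W \<Longrightarrow> k \<le> l \<Longrightarrow> s \<in> J l W \<Longrightarrow> s \<in> J k W"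
  unfolding J_eq using part_mono[of W "{l..}" "{k..}"] by auto

lemma J_mult:
  assumes W: "openin base W" and s: "s \<in> J k W" and t: "t \<in> J l W" shows "s \<otimes>\<^bsub>S W\<^esub> t \<in> J (k + l) W"
proof -
  have "s x \<otimes>\<^bsub>ext_alg (fibre M x)\<^esub> t x \<in> ext_part (fibre M x) {k + l..}" if x: "x \<in> W" for x
  proof -
    interpret ext_fibre "fibre M x" using x W openin_subset fibre_ext by blast
    show ?thesis using s t x by (intro ext_part_mult) (auto simp: part_iff J_eq)
  qed
  thus ?thesis using sec_mult[OF J_closed[OF s] J_closed[OF t] W] by (auto simp: part_iff J_eq S_simps)
qed

lemma part_restrict: "s \<in> P D W \<Longrightarrow> openin base W' \<Longrightarrow> W' \<subseteq> W \<Longrightarrow> restrict s W' \<in> P D W'"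
  using sec_restrict by (auto simp: part_iff)

lemma part_disjoint:
  assumes W: "openin base W" and s: "s \<in> P D W" "s \<in> P D' W" and D: "D \<inter> D' = {}" shows "s = \<zero>\<^bsub>S W\<^esub>"
proof (rule sec_eqI[OF part_closed[OF s(1)] sec_zero[OF W]])
  fix x assume x: "x \<in> W"
  interpret ext_fibre "fibre M x" using x W openin_subset fibre_ext by blast
  show "s x = \<zero>\<^bsub>S W\<^esub> x" using s x ext_part_disjoint[OF _ _ D, of "s x"] by (auto simp: part_iff S_simps)
qed

text \<open>In every frame the projection to a set of degrees selects some of the coefficients, so it maps sections
  to sections.\<close>

lemma part_decompose:
  assumes W: "openin base W" and s: "s \<in> carrier (S W)"
  obtains t u where "t \<in> P D W" "u \<in> P (- D) W" "s = t \<oplus>\<^bsub>S W\<^esub> u"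
proof -
  define pr where "pr D = (\<lambda>x\<in>W. ext_fibre.proj_part (fibre M x) D (s x))" for D
  have pr: "pr D \<in> P D W" for D
  proof -
    have "pr D \<in> carrier (S W)"
    proof (rule secI)
      fix V e assume V: "(V, e) \<in> frames M"
      obtain f where f: "\<And>J. J \<in> Pow {..<rank M} \<Longrightarrow> holomorphic_fun M (W \<inter> V) (f J)"
        "\<And>x. x \<in> W \<Longrightarrow> x \<in> V \<Longrightarrow> s x = frame_expr e x (\<lambda>J. f J x)" using secE[OF s V] by metis
      have WV: "openin base (W \<inter> V)" using W frame_open[OF V] by auto
      have "holomorphic_fun M (W \<inter> V) (\<lambda>x. if card K \<in> D then f K x else 0)" if "K \<in> Pow {..<rank M}" for K
        using f(1)[OF that] hol_const[OF WV] by (cases "card K \<in> D") auto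
      thus "\<exists>f. (\<forall>J\<in>Pow {..<rank M}. holomorphic_fun M (W \<inter> V) (f J)) \<and> (\<forall>x\<in>W \<inter> V. pr D x = frame_expr e x (\<lambda>J. f J x))"
        using f(2) frame_expr_proj[OF V] by (intro exI[of _ "\<lambda>K x. if card K \<in> D then f K x else 0"]) (auto simp: pr_def)
    qed (simp add: pr_def)
    moreover have "pr D x \<in> ext_part (fibre M x) D" if x: "x \<in> W" for x
    proof -
      interpret ext_fibre "fibre M x" using x W openin_subset fibre_ext by blast
      show ?thesis using x proj_part_in[OF sec_at[OF W s x]] by (simp add: pr_def)
    qed
    ultimately show ?thesis by (simp add: part_iff)
  qed
  have "s = pr D \<oplus>\<^bsub>S W\<^esub> pr (- D)"
  proof (rule sec_eqI[OF s sec_add[OF part_closed[OF pr] part_closed[OF pr]]])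
    fix x assume x: "x \<in> W"
    interpret ext_fibre "fibre M x" using x W openin_subset fibre_ext by blast
    show "s x = (pr D \<oplus>\<^bsub>S W\<^esub> pr (- D)) x" using x proj_part_compl[OF sec_at[OF W s x], of D] by (simp add: pr_def S_simps)
  qed
  with pr that show ?thesis by blast
qed

subsection \<open>Local generation by the frame\<close>

text \<open>In another frame the coefficients of a frame vector are entries of the transition matrix, which are holomorphic.\<close>

lemma frame_section:
  assumes V: "(V, e) \<in> frames M" and i: "i < rank M" and W: "openin base W" "W \<subseteq> V"
  shows "(\<lambda>x\<in>W. ext_class (fibre M x) (gen (e i x))) \<in> J 1 W"
proof -
  have "(\<lambda>x\<in>W. ext_class (fibre M x) (gen (e i x))) \<in> carrier (S W)"
  proof (rule secI)
    fix V' e' assume V': "(V', e') \<in> frames M"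
    obtain g where g0: "\<forall>k<rank M. \<forall>i<rank M. holomorphic_fun M (V' \<inter> V) (g k i)"
      "\<forall>x\<in>V' \<inter> V. \<forall>i<rank M. e i x = (\<Oplus>\<^bsub>fibre M x\<^esub>k\<in>{..<rank M}. g k i x \<odot>\<^bsub>fibre M x\<^esub> e' k x)"
      by (rule frame_change[OF V' V])
    note g = g0[rule_format]
    have WV: "openin base (W \<inter> V')" "W \<inter> V' \<subseteq> V' \<inter> V" using W frame_open[OF V'] by auto
    have hol: "holomorphic_fun M (W \<inter> V') (\<lambda>x. \<Sum>k<rank M. if K = {k} then g k i x else 0)" for K
    proof (intro hol_sum WV(1))
      fix k assume "k \<in> {..<rank M}"
      thus "holomorphic_fun M (W \<inter> V') (\<lambda>x. if K = {k} then g k i x else 0)"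
        using hol_subset[OF g(1)[OF _ i] WV, of k] hol_const[OF WV(1)] by (cases "K = {k}") auto
    qed
    have "ext_class (fibre M x) (gen (e i x)) = frame_expr e' x (\<lambda>K. \<Sum>k<rank M. if K = {k} then g k i x else 0)"
      if "x \<in> W \<inter> V'" for x
    proof -
      interpret ext_fibre "fibre M x" using that W openin_subset fibre_ext by blast
      have x: "x \<in> V' \<inter> V" using that WV by blast
      show ?thesis unfolding frame_expr_def g(2)[OF x i]
        using frame_carrier[OF V'] x by (intro cls_gen_expr) auto
    qed
    with hol show "\<exists>f. (\<forall>J\<in>Pow {..<rank M}. holomorphic_fun M (W \<inter> V') (f J)) \<and>
      (\<forall>x\<in>W \<inter> V'. (\<lambda>x\<in>W. ext_class (fibre M x) (gen (e i x))) x = frame_expr e' x (\<lambda>J. f J x))"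
      by (intro exI[of _ "\<lambda>K x. \<Sum>k<rank M. if K = {k} then g k i x else 0"]) auto
  qed simp
  moreover have "ext_class (fibre M x) (gen (e i x)) \<in> ext_part (fibre M x) {1..}" if x: "x \<in> W" for x
  proof -
    interpret ext_fibre "fibre M x" using that W openin_subset fibre_ext by blast
    have "e i x \<in> carrier (fibre M x)" using frame_carrier[OF V] x W i by blast
    hence "gen (e i x) \<in> carrier R" by (intro R_single) simp
    from ext_partI[OF this, of "{1..}"] show ?thesis by (simp add: deg_part_single)
  qed
  ultimately show ?thesis by (simp add: J_eq part_iff)
qed

text \<open>The indices need not increase, so that a product of frame vectors can be built up one factor at a time.\<close>

definition monom_section :: "'x set \<Rightarrow> (nat \<Rightarrow> 'x \<Rightarrow> 'v) \<Rightarrow> nat list \<Rightarrow> ('x \<Rightarrow> complex) \<Rightarrow> ('x, 'v) ext_section"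
  where "monom_section W e L f = (\<lambda>x\<in>W. ext_class (fibre M x) (ext_monom (\<lambda>i. e i x) L (f x)))"

lemma monom_section_snoc:
  assumes V: "(V, e) \<in> frames M" and L: "set (L @ [i]) \<subseteq> {..<rank M}" and W: "openin base W" "W \<subseteq> V"
  shows "monom_section W e (L @ [i]) f = monom_section W e L f \<otimes>\<^bsub>S W\<^esub> (\<lambda>x\<in>W. ext_class (fibre M x) (gen (e i x)))"
  unfolding monom_section_def S_simps
proof (rule restrict_ext)
  fix x assume x: "x \<in> W"
  interpret ext_fibre "fibre M x" using x W openin_subset fibre_ext by blast
  have e: "(\<lambda>i. e i x) ` set (L @ [i]) \<subseteq> carrier (fibre M x)" using frame_carrier[OF V] x W L by auto
  have "ext_monom (\<lambda>i. e i x) (L @ [i]) (f x) = ext_monom (\<lambda>i. e i x) L (f x) * gen (e i x)"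
    by (simp add: ext_monom_def mult_single plus_gen_word_def)
  moreover have "ext_monom (\<lambda>i. e i x) L (f x) \<in> carrier R" "gen (e i x) \<in> carrier R"
    using e by (auto intro!: R_ext_monom R_single)
  ultimately show "cls (ext_monom (\<lambda>i. e i x) (L @ [i]) (f x)) =
      (\<lambda>x\<in>W. ext_class (fibre M x) (ext_monom (\<lambda>i. e i x) L (f x))) x \<otimes>\<^bsub>E\<^esub> (\<lambda>x\<in>W. ext_class (fibre M x) (gen (e i x))) x"
    using x by (simp add: cls_mult)
qed

text \<open>Sections of \<open>J\<^sup>k\<close> over a small open set are sums of products of a function and at least \<open>k\<close> frame
  vectors, so an additive property of sections can be tested on such products.\<close>

lemma J_induct:
  assumes V: "(V, e) \<in> frames M" and W: "openin base W" "W \<subseteq> V" and s: "s \<in> J k W"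
    and zero: "Q \<zero>\<^bsub>S W\<^esub>"
    and add: "\<And>s t. s \<in> carrier (S W) \<Longrightarrow> t \<in> carrier (S W) \<Longrightarrow> Q s \<Longrightarrow> Q t \<Longrightarrow> Q (s \<oplus>\<^bsub>S W\<^esub> t)"
    and mono: "\<And>L f. set L \<subseteq> {..<rank M} \<Longrightarrow> k \<le> length L \<Longrightarrow> holomorphic_fun M W f \<Longrightarrow>
      monom_section W e L f \<in> carrier (S W) \<and> Q (monom_section W e L f)"
  shows "Q s"
proof -
  obtain f where f: "\<And>K. K \<in> Pow {..<rank M} \<Longrightarrow> holomorphic_fun M (W \<inter> V) (f K)"
    "\<And>x. x \<in> W \<Longrightarrow> x \<in> V \<Longrightarrow> s x = frame_expr e x (\<lambda>K. f K x)" using secE[OF J_closed[OF s] V] by metis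
  have WV: "W \<inter> V = W" using W by blast
  define part where "part A = (\<lambda>x\<in>W. frame_expr e x (\<lambda>K. if K \<in> A then f K x else 0))" for A
  have "part A \<in> carrier (S W) \<and> Q (part A)" if "finite A" "A \<subseteq> {K \<in> Pow {..<rank M}. k \<le> card K}" for A
    using that
  proof (induction A rule: finite_induct)
    case empty
    have "part {} = \<zero>\<^bsub>S W\<^esub>" unfolding part_def S_simps using frame_expr_zero[OF V] W by (intro restrict_ext) auto
    thus ?case using zero sec_zero[OF W(1)] by simp
  next
    case (insert K A)
    let ?m = "monom_section W e (sorted_list_of_set K) (f K)"
    have K: "K \<in> Pow {..<rank M}" "k \<le> card K" "finite K" using insert.prems finite_Pow_index by auto
    have m: "?m \<in> carrier (S W) \<and> Q ?m"
      using K f(1)[OF K(1)] WV by (intro mono) auto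
    have "part (insert K A) = ?m \<oplus>\<^bsub>S W\<^esub> part A"
      unfolding part_def monom_section_def S_simps
    proof (rule restrict_ext)
      fix x assume x: "x \<in> W"
      hence xV: "x \<in> V" using W by blast
      have "(\<lambda>L. if L \<in> insert K A then f L x else 0) = (\<lambda>L. (if L = K then f K x else 0) + (if L \<in> A then f L x else 0))"
        using insert.hyps by (auto simp: fun_eq_iff)
      thus "frame_expr e x (\<lambda>L. if L \<in> insert K A then f L x else 0) =
         (\<lambda>x\<in>W. ext_class (fibre M x) (ext_monom (\<lambda>i. e i x) (sorted_list_of_set K) (f K x))) x \<oplus>\<^bsub>ext_alg (fibre M x)\<^esub>
         (\<lambda>x\<in>W. frame_expr e x (\<lambda>K. if K \<in> A then f K x else 0)) x"
        using x by (simp add: frame_expr_monom[OF K(1)] frame_expr_add[OF V xV])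
    qed
    thus ?case using m insert add sec_add by auto
  qed
  moreover have "finite {K \<in> Pow {..<rank M}. k \<le> card K}" by simp
  moreover have "s = part {K \<in> Pow {..<rank M}. k \<le> card K}"
  proof (rule extensionalityI[of _ W])
    fix x assume x: "x \<in> W"
    hence xV: "x \<in> V" using W by blast
    have "frame_expr e x (\<lambda>K. f K x) \<in> ext_part (fibre M x) {k..}" using s x f(2)[OF x xV] unfolding J_eq part_iff by metis
    from frame_expr_part[OF V xV this]
    have "s x = frame_expr e x (\<lambda>K. if card K \<in> {k..} then f K x else 0)" using f(2)[OF x xV] by simp
    also have "\<dots> = frame_expr e x (\<lambda>K. if K \<in> {K \<in> Pow {..<rank M}. k \<le> card K} then f K x else 0)"
      unfolding frame_expr_def expr_def by (intro arg_cong[of _ _ "ext_class (fibre M x)"] sum.cong) auto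
    finally show "s x = part {K \<in> Pow {..<rank M}. k \<le> card K} x" using x by (simp add: part_def)
  qed (use sec_extensional[OF J_closed[OF s]] in \<open>auto simp: part_def\<close>)
  ultimately show ?thesis by auto
qed

end

section \<open>Unipotent automorphisms\<close>

lemma (in ring) add_minus_cancel_left:
  "a \<in> carrier R \<Longrightarrow> b \<in> carrier R \<Longrightarrow> (a \<oplus> b) \<ominus> a = b"
  by (simp add: a_minus_def a_comm[of a b] a_assoc r_neg)

lemma (in ring) commutator_differences:
  assumes "p \<in> carrier R" "q \<in> carrier R" "x \<in> carrier R" "y \<in> carrier R" "t \<in> carrier R"
  shows "((p \<ominus> x) \<ominus> (y \<ominus> t)) \<ominus> ((q \<ominus> y) \<ominus> (x \<ominus> t)) = p \<ominus> q"
proof -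
  define z where "z = x \<oplus> (y \<ominus> t)"
  have z: "z \<in> carrier R" using assms by (simp add: z_def)
  have "(p \<ominus> x) \<ominus> (y \<ominus> t) = p \<ominus> z" "(q \<ominus> y) \<ominus> (x \<ominus> t) = q \<ominus> z"
    using assms by (simp_all add: z_def a_minus_def minus_add a_ac)
  moreover have "(p \<ominus> z) \<ominus> (q \<ominus> z) = p \<ominus> q"
  proof -
    have "(p \<ominus> z) \<ominus> (q \<ominus> z) = p \<oplus> (\<ominus> z \<oplus> (z \<oplus> \<ominus> q))"
      using assms z by (simp add: a_minus_def minus_add a_assoc a_comm[of "\<ominus> q" z])
    then show ?thesis using assms z by (simp add: r_neg1 a_minus_def)
  qed
  ultimately show ?thesis by simp
qed

context complex_model
begin

abbreviation opens where "opens U \<equiv> opens_in base U"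
abbreviation Aut where "Aut U \<equiv> sec (aut_sheaf M) U"
abbreviation G where "G k U \<equiv> carrier (sec (G_sheaf M k) U)"

lemma opens_iff: "W \<in> opens U \<longleftrightarrow> openin base W \<and> W \<subseteq> U"
  by (simp add: opens_in_def)

text \<open>The conditions on an automorphism over a single open set; they are separated from the compatibility
  with restrictions in order to treat composites and inverses one open set at a time.\<close>

definition component :: "'x set \<Rightarrow> (('x, 'v) ext_section \<Rightarrow> ('x, 'v) ext_section) \<Rightarrow> bool"
  where "component W h \<longleftrightarrow> h \<in> extensional (carrier (S W)) \<and> h \<in> ring_iso (S W) (S W) \<and>
    (\<forall>c. h (const_section M W c) = const_section M W c) \<and>
    h ` P {j. even j} W \<subseteq> P {j. even j} W \<and> h ` P {j. odd j} W \<subseteq> P {j. odd j} W"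

lemma Aut_iff:
  "\<alpha> \<in> carrier (Aut U) \<longleftrightarrow> \<alpha> \<in> extensional (opens U) \<and> (\<forall>W\<in>opens U. component W (\<alpha> W)) \<and>
    (\<forall>W\<in>opens U. \<forall>W'\<in>opens W. \<forall>s\<in>carrier (S W). \<alpha> W' (restrict s W') = restrict (\<alpha> W s) W')"
  by (simp add: aut_sheaf_def component_def)

lemma Aut_mult: "\<alpha> \<otimes>\<^bsub>Aut U\<^esub> \<beta> = (\<lambda>W\<in>opens U. compose (carrier (S W)) (\<alpha> W) (\<beta> W))"
  by (simp add: aut_sheaf_def)

lemma Aut_one: "\<one>\<^bsub>Aut U\<^esub> = (\<lambda>W\<in>opens U. \<lambda>s\<in>carrier (S W). s)"
  by (simp add: aut_sheaf_def)

lemma component_hom: "component W h \<Longrightarrow> h \<in> ring_hom (S W) (S W)"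
  by (simp add: component_def ring_iso_def)

lemma component_bij: "component W h \<Longrightarrow> bij_betw h (carrier (S W)) (carrier (S W))"
  by (simp add: component_def ring_iso_def)

lemma component_closed: "component W h \<Longrightarrow> s \<in> carrier (S W) \<Longrightarrow> h s \<in> carrier (S W)"
  using ring_hom_closed[OF component_hom] .

lemma component_minus:
  assumes W: "openin base W" and h: "component W h" and s: "s \<in> carrier (S W)" "t \<in> carrier (S W)"
  shows "h (s \<ominus>\<^bsub>S W\<^esub> t) = h s \<ominus>\<^bsub>S W\<^esub> h t"
proof -
  interpret h: ring_hom_ring "S W" "S W" h
    using ring_S[OF W] component_hom[OF h] by (intro ring_hom_ringI2)
  show ?thesis using s by (simp add: a_minus_def)
qed

lemma component_id: "openin base W \<Longrightarrow> component W (\<lambda>s\<in>carrier (S W). s)"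
proof -
  assume W: "openin base W"
  interpret S: ring "S W" by (rule ring_S[OF W])
  have "(\<lambda>s\<in>carrier (S W). s) \<in> ring_iso (S W) (S W)"
    by (rule S.ring_iso_restrict[OF ring_iso_set_refl]) simp
  thus ?thesis using const_section[OF W] part_closed by (auto simp: component_def)
qed

lemma component_compose:
  assumes W: "openin base W" and h: "component W h" and k: "component W k"
  shows "component W (compose (carrier (S W)) h k)"
proof -
  interpret S: ring "S W" by (rule ring_S[OF W])
  have "compose (carrier (S W)) h k \<in> ring_iso (S W) (S W)"
    by (rule S.ring_iso_restrict[OF ring_iso_set_trans[of k _ _ h]])
      (use h k in \<open>auto simp: component_def compose_def\<close>)
  thus ?thesis using h k const_section[OF W] part_closed
    by (auto simp: component_def compose_eq) (metis compose_eq image_subset_iff part_closed)+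
qed

text \<open>That the inverse preserves the parity needs an argument: decompose \<open>k s\<close> for \<open>s\<close> of one parity as \<open>t + u\<close> with
  \<open>u\<close> of the other parity. Then \<open>h u = s - h t\<close> has both parities, so it is zero, and \<open>u = 0\<close>.\<close>

lemma component_inverse:
  assumes W: "openin base W" and h: "component W h"
  defines "k \<equiv> \<lambda>s\<in>carrier (S W). inv_into (carrier (S W)) h s"
  shows "component W k" "\<And>s. s \<in> carrier (S W) \<Longrightarrow> h (k s) = s" "\<And>s. s \<in> carrier (S W) \<Longrightarrow> k (h s) = s"
proof -
  interpret S: ring "S W" by (rule ring_S[OF W])
  have bij: "bij_betw h (carrier (S W)) (carrier (S W))" by (rule component_bij[OF h])
  have inj: "inj_on h (carrier (S W))" using bij by (simp add: bij_betw_def)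
  show hk: "h (k s) = s" if "s \<in> carrier (S W)" for s
    using that bij by (simp add: k_def bij_betw_inv_into_right)
  show kh: "k (h s) = s" if "s \<in> carrier (S W)" for s
    using that bij component_closed[OF h] by (simp add: k_def bij_betw_inv_into_left)
  have iso: "k \<in> ring_iso (S W) (S W)"
    by (rule S.ring_iso_restrict[OF ring_iso_set_sym[OF S.ring_axioms, of h]])
      (use h in \<open>auto simp: component_def k_def\<close>)
  have kc: "k s \<in> carrier (S W)" if "s \<in> carrier (S W)" for s
    using ring_iso_memE(1)[OF iso that] .
  have const: "k (const_section M W c) = const_section M W c" for c
    using kh[OF const_section[OF W, of c]] h by (simp add: component_def)
  have part: "k s \<in> P D W"
    if s: "s \<in> P D W" and D: "h ` P D W \<subseteq> P D W" "h ` P (- D) W \<subseteq> P (- D) W" for s D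
  proof -
    have sc: "s \<in> carrier (S W)" by (rule part_closed[OF s])
    obtain t u where tu: "t \<in> P D W" "u \<in> P (- D) W" "k s = t \<oplus>\<^bsub>S W\<^esub> u"
      by (rule part_decompose[OF W kc[OF sc]])
    note tc = part_closed[OF tu(1)] and uc = part_closed[OF tu(2)]
    have ht: "h t \<in> P D W" and hu: "h u \<in> P (- D) W" using tu D by auto
    have "s = h t \<oplus>\<^bsub>S W\<^esub> h u" using hk[OF sc] tu(3) ring_hom_add[OF component_hom[OF h] tc uc] by simp
    hence "h u = s \<ominus>\<^bsub>S W\<^esub> h t"
      using part_closed[OF ht] part_closed[OF hu] by (simp add: S.add_minus_cancel_left)
    hence "h u \<in> P D W" using part_minus[OF W s ht] by simp
    hence "h u = \<zero>\<^bsub>S W\<^esub>" using part_disjoint[OF W _ hu] by blast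
    also have "\<zero>\<^bsub>S W\<^esub> = h \<zero>\<^bsub>S W\<^esub>" using ring_hom_zero[OF component_hom[OF h] S.ring_axioms S.ring_axioms] by simp
    finally have "u = \<zero>\<^bsub>S W\<^esub>" using inj uc S.zero_closed by (auto dest: inj_onD)
    thus ?thesis using tu tc by simp
  qed
  have even: "- {j::nat. even j} = {j. odd j}" "- {j::nat. odd j} = {j. even j}" by auto
  have he: "h ` P {j. even j} W \<subseteq> P {j. even j} W" "h ` P {j. odd j} W \<subseteq> P {j. odd j} W"
    using h by (auto simp: component_def)
  show "component W k"
    unfolding component_def
  proof (intro conjI allI)
    show "k \<in> extensional (carrier (S W))" by (simp add: k_def)
    show "k ` P {j. even j} W \<subseteq> P {j. even j} W" using part[of _ "{j. even j}"] he even by auto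
    show "k ` P {j. odd j} W \<subseteq> P {j. odd j} W" using part[of _ "{j. odd j}"] he even by auto
  qed (use iso const in auto)
qed

lemma Aut_component: "\<alpha> \<in> carrier (Aut U) \<Longrightarrow> openin base W \<Longrightarrow> W \<subseteq> U \<Longrightarrow> component W (\<alpha> W)"
  by (simp add: Aut_iff opens_iff)

lemma Aut_restrict:
  "\<alpha> \<in> carrier (Aut U) \<Longrightarrow> openin base W \<Longrightarrow> W \<subseteq> U \<Longrightarrow> openin base W' \<Longrightarrow> W' \<subseteq> W \<Longrightarrow> s \<in> carrier (S W) \<Longrightarrow>
    \<alpha> W' (restrict s W') = restrict (\<alpha> W s) W'"
  by (simp add: Aut_iff opens_iff)

lemma Aut_closed:
  "\<alpha> \<in> carrier (Aut U) \<Longrightarrow> openin base W \<Longrightarrow> W \<subseteq> U \<Longrightarrow> s \<in> carrier (S W) \<Longrightarrow> \<alpha> W s \<in> carrier (S W)"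
  using component_closed[OF Aut_component] .

lemma AutI:
  assumes "\<alpha> \<in> extensional (opens U)" "\<And>W. openin base W \<Longrightarrow> W \<subseteq> U \<Longrightarrow> component W (\<alpha> W)"
    "\<And>W W' s. openin base W \<Longrightarrow> W \<subseteq> U \<Longrightarrow> openin base W' \<Longrightarrow> W' \<subseteq> W \<Longrightarrow> s \<in> carrier (S W) \<Longrightarrow>
      \<alpha> W' (restrict s W') = restrict (\<alpha> W s) W'"
  shows "\<alpha> \<in> carrier (Aut U)"
  using assms by (simp add: Aut_iff opens_iff)

lemma Aut_eqI:
  assumes "\<alpha> \<in> carrier (Aut U)" "\<beta> \<in> carrier (Aut U)"
    "\<And>W s. openin base W \<Longrightarrow> W \<subseteq> U \<Longrightarrow> s \<in> carrier (S W) \<Longrightarrow> \<alpha> W s = \<beta> W s"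
  shows "\<alpha> = \<beta>"
proof (rule extensionalityI[of _ "opens U"])
  show "\<alpha> \<in> extensional (opens U)" "\<beta> \<in> extensional (opens U)" using assms by (auto simp: Aut_iff)
  fix W assume W: "W \<in> opens U"
  show "\<alpha> W = \<beta> W"
  proof (rule extensionalityI[of _ "carrier (S W)"])
    show "\<alpha> W \<in> extensional (carrier (S W))" "\<beta> W \<in> extensional (carrier (S W))"
      using assms(1,2) W by (auto simp: Aut_iff component_def)
  qed (use assms(3) W in \<open>auto simp: opens_iff\<close>)
qed

lemma Aut_mult_at: "openin base W \<Longrightarrow> W \<subseteq> U \<Longrightarrow> s \<in> carrier (S W) \<Longrightarrow> (\<alpha> \<otimes>\<^bsub>Aut U\<^esub> \<beta>) W s = \<alpha> W (\<beta> W s)"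
  by (simp add: Aut_mult opens_iff compose_eq)

lemma Aut_one_at: "openin base W \<Longrightarrow> W \<subseteq> U \<Longrightarrow> s \<in> carrier (S W) \<Longrightarrow> \<one>\<^bsub>Aut U\<^esub> W s = s"
  by (simp add: Aut_one opens_iff)

lemma group_Aut: "group (Aut U)"
proof (rule groupI)
  show one: "\<one>\<^bsub>Aut U\<^esub> \<in> carrier (Aut U)"
    using sec_restrict by (intro AutI) (auto simp: Aut_one opens_iff component_id)
  fix \<alpha> assume a: "\<alpha> \<in> carrier (Aut U)"
  have mult: "\<alpha> \<otimes>\<^bsub>Aut U\<^esub> \<beta> \<in> carrier (Aut U)" if a: "\<alpha> \<in> carrier (Aut U)" and b: "\<beta> \<in> carrier (Aut U)" for \<alpha> \<beta>
  proof (rule AutI)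
    show "\<alpha> \<otimes>\<^bsub>Aut U\<^esub> \<beta> \<in> extensional (opens U)" by (simp add: Aut_mult)
    fix W assume W: "openin base W" "W \<subseteq> U"
    show "component W ((\<alpha> \<otimes>\<^bsub>Aut U\<^esub> \<beta>) W)"
      using W component_compose[OF W(1) Aut_component[OF a W] Aut_component[OF b W]] by (simp add: Aut_mult opens_iff)
    fix W' s assume W': "openin base W'" "W' \<subseteq> W" and s: "s \<in> carrier (S W)"
    have W'U: "W' \<subseteq> U" using W W' by blast
    show "(\<alpha> \<otimes>\<^bsub>Aut U\<^esub> \<beta>) W' (restrict s W') = restrict ((\<alpha> \<otimes>\<^bsub>Aut U\<^esub> \<beta>) W s) W'"
      by (simp only: Aut_mult_at[OF W s] Aut_mult_at[OF W'(1) W'U sec_restrict[OF s W']]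
          Aut_restrict[OF b W W' s] Aut_restrict[OF a W W' Aut_closed[OF b W s]])
  qed
  show "\<one>\<^bsub>Aut U\<^esub> \<otimes>\<^bsub>Aut U\<^esub> \<alpha> = \<alpha>"
    by (rule Aut_eqI[OF mult[OF one a] a]) (simp add: Aut_mult_at Aut_one_at Aut_closed[OF a])
  define \<beta> where "\<beta> = (\<lambda>W\<in>opens U. \<lambda>s\<in>carrier (S W). inv_into (carrier (S W)) (\<alpha> W) s)"
  have inv: "component W (\<beta> W)" "\<And>s. s \<in> carrier (S W) \<Longrightarrow> \<alpha> W (\<beta> W s) = s" "\<And>s. s \<in> carrier (S W) \<Longrightarrow> \<beta> W (\<alpha> W s) = s"
    if "openin base W" "W \<subseteq> U" for W
    using component_inverse[OF that(1) Aut_component[OF a that]] that by (auto simp: \<beta>_def opens_iff)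
  have b: "\<beta> \<in> carrier (Aut U)"
  proof (rule AutI)
    show "\<beta> \<in> extensional (opens U)" by (simp add: \<beta>_def)
    fix W assume W: "openin base W" "W \<subseteq> U"
    show "component W (\<beta> W)" by (rule inv(1)[OF W])
    fix W' s assume W': "openin base W'" "W' \<subseteq> W" and s: "s \<in> carrier (S W)"
    have W'U: "W' \<subseteq> U" using W W' by blast
    have bs: "\<beta> W s \<in> carrier (S W)" by (rule component_closed[OF inv(1)[OF W] s])
    have "\<alpha> W' (restrict (\<beta> W s) W') = restrict s W'"
      using Aut_restrict[OF a W W' bs] inv(2)[OF W s] by simp
    thus "\<beta> W' (restrict s W') = restrict (\<beta> W s) W'"
      using inv(3)[OF W'(1) W'U sec_restrict[OF bs W']] by simp
  qed
  have "\<beta> \<otimes>\<^bsub>Aut U\<^esub> \<alpha> = \<one>\<^bsub>Aut U\<^esub>"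
    by (rule Aut_eqI[OF mult[OF b a] one]) (simp add: Aut_mult_at Aut_one_at inv)
  with b show "\<exists>\<beta>\<in>carrier (Aut U). \<beta> \<otimes>\<^bsub>Aut U\<^esub> \<alpha> = \<one>\<^bsub>Aut U\<^esub>" by blast
  fix \<beta> assume b: "\<beta> \<in> carrier (Aut U)"
  show "\<alpha> \<otimes>\<^bsub>Aut U\<^esub> \<beta> \<in> carrier (Aut U)" by (rule mult[OF a b])
  fix \<gamma> assume c: "\<gamma> \<in> carrier (Aut U)"
  show "\<alpha> \<otimes>\<^bsub>Aut U\<^esub> \<beta> \<otimes>\<^bsub>Aut U\<^esub> \<gamma> = \<alpha> \<otimes>\<^bsub>Aut U\<^esub> (\<beta> \<otimes>\<^bsub>Aut U\<^esub> \<gamma>)"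
    by (rule Aut_eqI[OF mult[OF mult[OF a b] c] mult[OF a mult[OF b c]]])
      (simp add: Aut_mult_at Aut_closed[OF c] Aut_closed[OF b])
qed

lemma Aut_inv_at:
  assumes a: "\<alpha> \<in> carrier (Aut U)" and W: "openin base W" "W \<subseteq> U" and s: "s \<in> carrier (S W)"
  shows "\<alpha> W ((inv\<^bsub>Aut U\<^esub> \<alpha>) W s) = s" "(inv\<^bsub>Aut U\<^esub> \<alpha>) W s \<in> carrier (S W)"
proof -
  interpret A: group "Aut U" by (rule group_Aut)
  have "(\<alpha> \<otimes>\<^bsub>Aut U\<^esub> inv\<^bsub>Aut U\<^esub> \<alpha>) W s = s" using a Aut_one_at[OF W s] by simp
  thus "\<alpha> W ((inv\<^bsub>Aut U\<^esub> \<alpha>) W s) = s" by (simp add: Aut_mult_at[OF W s])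
  show "(inv\<^bsub>Aut U\<^esub> \<alpha>) W s \<in> carrier (S W)" using Aut_closed[OF A.inv_closed[OF a] W s] .
qed

subsection \<open>The filtration of the automorphisms\<close>

lemma G_iff:
  "\<alpha> \<in> G k U \<longleftrightarrow> \<alpha> \<in> carrier (Aut U) \<and>
    (\<forall>W s. openin base W \<longrightarrow> W \<subseteq> U \<longrightarrow> s \<in> carrier (S W) \<longrightarrow> \<alpha> W s \<ominus>\<^bsub>S W\<^esub> s \<in> J k W)"
  by (auto simp: G_sheaf_def opens_iff)

lemma G_Aut: "\<alpha> \<in> G k U \<Longrightarrow> \<alpha> \<in> carrier (Aut U)"
  by (simp add: G_iff)

lemma G_at: "\<alpha> \<in> G k U \<Longrightarrow> openin base W \<Longrightarrow> W \<subseteq> U \<Longrightarrow> s \<in> carrier (S W) \<Longrightarrow> \<alpha> W s \<ominus>\<^bsub>S W\<^esub> s \<in> J k W"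
  by (simp add: G_iff)

lemma G_mono: "k \<le> l \<Longrightarrow> G l U \<subseteq> G k U"
  unfolding G_iff using J_mono by (auto simp: G_iff)

text \<open>An automorphism that is the identity modulo \<open>J\<^sup>j\<close> moves a product of \<open>k\<close> sections of \<open>J\<close> by
  elements of \<open>J\<^bsup>j+k-1\<^esup>\<close>, because in each term of the difference at least one factor is replaced by an element of \<open>J\<^sup>j\<close>.
  In the induction this is \<open>\<alpha>(xy) - xy = \<alpha>x (\<alpha>y - y) + (\<alpha>x - x) y\<close>.\<close>

lemma G_monom:
  assumes a: "\<alpha> \<in> G j U" and j: "1 \<le> j" and V: "(V, e) \<in> frames M" and W: "openin base W" "W \<subseteq> V" "W \<subseteq> U"
    and L: "set L \<subseteq> {..<rank M}" and f: "holomorphic_fun M W f"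
  shows "monom_section W e L f \<in> J (length L) W \<and>
    \<alpha> W (monom_section W e L f) \<ominus>\<^bsub>S W\<^esub> monom_section W e L f \<in> J (j + length L - 1) W"
  using L
proof (induction L rule: rev_induct)
  case Nil
  have "monom_section W e [] f = (\<lambda>x\<in>W. ext_class (fibre M x) (scalar (f x)))"
    by (simp add: monom_section_def ext_monom_def zero_gen_word_def)
  hence s: "monom_section W e [] f \<in> carrier (S W)" using sec_scalar_fun[OF f] by simp
  show ?case using s J_zero_eq[OF W(1)] J_mono[OF W(1) _ G_at[OF a W(1,3) s], of "j - 1"] by simp
next
  case (snoc i L)
  interpret S: ring "S W" by (rule ring_S[OF W(1)])
  define x where "x = monom_section W e L f"
  define y where "y = (\<lambda>x\<in>W. ext_class (fibre M x) (gen (e i x)))"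
  have hom: "\<alpha> W \<in> ring_hom (S W) (S W)" by (rule component_hom[OF Aut_component[OF G_Aut[OF a] W(1,3)]])
  have x: "x \<in> J (length L) W" "\<alpha> W x \<ominus>\<^bsub>S W\<^esub> x \<in> J (j + length L - 1) W"
    using snoc by (auto simp: x_def)
  have y: "y \<in> J 1 W" unfolding y_def using snoc.prems by (intro frame_section[OF V _ W(1,2)]) auto
  have xy: "monom_section W e (L @ [i]) f = x \<otimes>\<^bsub>S W\<^esub> y"
    unfolding x_def y_def by (rule monom_section_snoc[OF V snoc.prems W(1,2)])
  note xc = J_closed[OF x(1)] and yc = J_closed[OF y]
  have axc: "\<alpha> W x \<in> carrier (S W)" "\<alpha> W y \<in> carrier (S W)" using ring_hom_closed[OF hom] xc yc by auto
  have ay: "\<alpha> W y \<ominus>\<^bsub>S W\<^esub> y \<in> J j W" by (rule G_at[OF a W(1,3) yc])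
  have "\<alpha> W x \<ominus>\<^bsub>S W\<^esub> x \<in> J (length L) W" using j by (intro J_mono[OF W(1) _ x(2)]) simp
  hence "(\<alpha> W x \<ominus>\<^bsub>S W\<^esub> x) \<oplus>\<^bsub>S W\<^esub> x \<in> J (length L) W" using x(1) part_add[OF W(1)] by (simp add: J_eq)
  moreover have "(\<alpha> W x \<ominus>\<^bsub>S W\<^esub> x) \<oplus>\<^bsub>S W\<^esub> x = \<alpha> W x" using axc xc by (simp add: a_minus_def S.a_assoc S.l_neg)
  ultimately have ax: "\<alpha> W x \<in> J (length L) W" by simp
  have "\<alpha> W (x \<otimes>\<^bsub>S W\<^esub> y) \<ominus>\<^bsub>S W\<^esub> (x \<otimes>\<^bsub>S W\<^esub> y) =
     \<alpha> W x \<otimes>\<^bsub>S W\<^esub> (\<alpha> W y \<ominus>\<^bsub>S W\<^esub> y) \<oplus>\<^bsub>S W\<^esub> (\<alpha> W x \<ominus>\<^bsub>S W\<^esub> x) \<otimes>\<^bsub>S W\<^esub> y"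
    using ring_hom_mult[OF hom xc yc] axc xc yc
    by (simp add: a_minus_def S.r_distr S.l_distr S.r_minus S.l_minus S.a_assoc S.r_neg1 S.r_neg2)
  moreover have "\<alpha> W x \<otimes>\<^bsub>S W\<^esub> (\<alpha> W y \<ominus>\<^bsub>S W\<^esub> y) \<in> J (j + length (L @ [i]) - 1) W"
    using J_mult[OF W(1) ax ay] by (simp add: add.commute)
  moreover have "(\<alpha> W x \<ominus>\<^bsub>S W\<^esub> x) \<otimes>\<^bsub>S W\<^esub> y \<in> J (j + length (L @ [i]) - 1) W"
    using J_mult[OF W(1) x(2) y] j by simp
  moreover have "x \<otimes>\<^bsub>S W\<^esub> y \<in> J (length (L @ [i])) W" using J_mult[OF W(1) x(1) y] by simp
  ultimately show ?case unfolding xy using part_add[OF W(1)] by (simp add: J_eq)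
qed

text \<open>Membership in \<open>J\<^bsup>j+k-1\<^esup>\<close> is a condition at each point, so it can be checked over the domains of frames, where \<open>J\<^sup>k\<close>
  is spanned by the products of \<open>G_monom\<close>.\<close>

lemma G_J:
  assumes a: "\<alpha> \<in> G j U" and j: "1 \<le> j" and W: "openin base W" "W \<subseteq> U" and s: "s \<in> J k W"
  shows "\<alpha> W s \<ominus>\<^bsub>S W\<^esub> s \<in> J (j + k - 1) W"
proof -
  interpret S: ring "S W" by (rule ring_S[OF W(1)])
  have sc: "s \<in> carrier (S W)" by (rule J_closed[OF s])
  have asc: "\<alpha> W s \<in> carrier (S W)" by (rule Aut_closed[OF G_Aut[OF a] W sc])
  have "(\<alpha> W s \<ominus>\<^bsub>S W\<^esub> s) x \<in> ext_part (fibre M x) {j + k - 1..}" if x: "x \<in> W" for x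
  proof -
    obtain V e where V: "(V, e) \<in> frames M" "x \<in> V" using frame_cover x W openin_subset by blast
    define W' where "W' = W \<inter> V"
    have W': "openin base W'" "W' \<subseteq> V" "W' \<subseteq> W" "W' \<subseteq> U" "x \<in> W'" using W V frame_open[OF V(1)] x by (auto simp: W'_def)
    interpret S': ring "S W'" by (rule ring_S[OF W'(1)])
    have c: "component W' (\<alpha> W')" by (rule Aut_component[OF G_Aut[OF a] W'(1,4)])
    have hom: "\<alpha> W' \<in> ring_hom (S W') (S W')" by (rule component_hom[OF c])
    define t where "t = restrict s W'"
    have t: "t \<in> J k W'" unfolding t_def J_eq using part_restrict[OF _ W'(1,3)] s by (simp add: J_eq)
    have "\<alpha> W' t \<ominus>\<^bsub>S W'\<^esub> t \<in> J (j + k - 1) W'"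
    proof (rule J_induct[OF V(1) W'(1,2) t])
      have "\<alpha> W' \<zero>\<^bsub>S W'\<^esub> = \<zero>\<^bsub>S W'\<^esub>" using ring_hom_zero[OF hom S'.ring_axioms S'.ring_axioms] .
      thus "\<alpha> W' \<zero>\<^bsub>S W'\<^esub> \<ominus>\<^bsub>S W'\<^esub> \<zero>\<^bsub>S W'\<^esub> \<in> J (j + k - 1) W'"
        using part_zero[OF W'(1)] by (simp add: a_minus_def J_eq)
    next
      fix u v assume u: "u \<in> carrier (S W')" and v: "v \<in> carrier (S W')"
        and "\<alpha> W' u \<ominus>\<^bsub>S W'\<^esub> u \<in> J (j + k - 1) W'" "\<alpha> W' v \<ominus>\<^bsub>S W'\<^esub> v \<in> J (j + k - 1) W'"
      hence "(\<alpha> W' u \<ominus>\<^bsub>S W'\<^esub> u) \<oplus>\<^bsub>S W'\<^esub> (\<alpha> W' v \<ominus>\<^bsub>S W'\<^esub> v) \<in> J (j + k - 1) W'"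
        using part_add[OF W'(1)] by (simp add: J_eq)
      moreover have "\<alpha> W' (u \<oplus>\<^bsub>S W'\<^esub> v) \<ominus>\<^bsub>S W'\<^esub> (u \<oplus>\<^bsub>S W'\<^esub> v) = (\<alpha> W' u \<ominus>\<^bsub>S W'\<^esub> u) \<oplus>\<^bsub>S W'\<^esub> (\<alpha> W' v \<ominus>\<^bsub>S W'\<^esub> v)"
        using ring_hom_add[OF hom u v] ring_hom_closed[OF hom u] ring_hom_closed[OF hom v] u v
        by (simp add: a_minus_def S'.minus_add S'.a_ac)
      ultimately show "\<alpha> W' (u \<oplus>\<^bsub>S W'\<^esub> v) \<ominus>\<^bsub>S W'\<^esub> (u \<oplus>\<^bsub>S W'\<^esub> v) \<in> J (j + k - 1) W'" by simp
    next
      fix L f assume L: "set L \<subseteq> {..<rank M}" "k \<le> length L" and f: "holomorphic_fun M W' f"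
      note m = G_monom[OF a j V(1) W'(1,2,4) L(1) f]
      show "monom_section W' e L f \<in> carrier (S W') \<and>
        \<alpha> W' (monom_section W' e L f) \<ominus>\<^bsub>S W'\<^esub> monom_section W' e L f \<in> J (j + k - 1) W'"
        using J_closed[OF conjunct1[OF m]] J_mono[OF W'(1) _ conjunct2[OF m], of "j + k - 1"] L(2) by simp
    qed
    hence "(\<alpha> W' t \<ominus>\<^bsub>S W'\<^esub> t) x \<in> ext_part (fibre M x) {j + k - 1..}" using W'(5) by (simp add: J_eq part_iff)
    moreover have "\<alpha> W' t = restrict (\<alpha> W s) W'" unfolding t_def by (rule Aut_restrict[OF G_Aut[OF a] W W'(1,3) sc])
    ultimately show ?thesis
      using S_minus_at[OF W'(1) Aut_closed[OF G_Aut[OF a] W'(1,4) J_closed[OF t]] J_closed[OF t] W'(5)]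
        S_minus_at[OF W(1) asc sc x] W'(5) by (simp add: t_def)
  qed
  moreover have "\<alpha> W s \<ominus>\<^bsub>S W\<^esub> s \<in> carrier (S W)" using sc asc by simp
  ultimately show ?thesis by (simp add: J_eq part_iff)
qed

lemma G_preserves_J:
  assumes a: "\<alpha> \<in> G j U" and j: "1 \<le> j" and W: "openin base W" "W \<subseteq> U" and s: "s \<in> J k W"
  shows "\<alpha> W s \<in> J k W"
proof -
  interpret S: ring "S W" by (rule ring_S[OF W(1)])
  have sc: "s \<in> carrier (S W)" by (rule J_closed[OF s])
  have asc: "\<alpha> W s \<in> carrier (S W)" by (rule Aut_closed[OF G_Aut[OF a] W sc])
  have "\<alpha> W s \<ominus>\<^bsub>S W\<^esub> s \<in> J k W" using j by (intro J_mono[OF W(1) _ G_J[OF a j W s]]) simp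
  hence "(\<alpha> W s \<ominus>\<^bsub>S W\<^esub> s) \<oplus>\<^bsub>S W\<^esub> s \<in> J k W" using s part_add[OF W(1)] by (simp add: J_eq)
  moreover have "(\<alpha> W s \<ominus>\<^bsub>S W\<^esub> s) \<oplus>\<^bsub>S W\<^esub> s = \<alpha> W s" using asc sc by (simp add: a_minus_def S.a_assoc S.l_neg)
  ultimately show ?thesis by simp
qed

lemma subgroup_G: "subgroup (G k U) (Aut U)"
proof -
  interpret A: group "Aut U" by (rule group_Aut)
  show ?thesis
  proof (rule A.subgroupI)
    show "G k U \<subseteq> carrier (Aut U)" using G_Aut by blast
    have "\<one>\<^bsub>Aut U\<^esub> \<in> G k U"
      unfolding G_iff
    proof (intro conjI allI impI)
      fix W s assume W: "openin base W" "W \<subseteq> U" and s: "s \<in> carrier (S W)"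
      interpret S: ring "S W" by (rule ring_S[OF W(1)])
      show "\<one>\<^bsub>Aut U\<^esub> W s \<ominus>\<^bsub>S W\<^esub> s \<in> J k W"
        using s part_zero[OF W(1)] by (simp add: Aut_one_at[OF W s] a_minus_def S.r_neg J_eq)
    qed simp
    thus "G k U \<noteq> {}" by blast
    fix \<alpha> assume a: "\<alpha> \<in> G k U"
    note aA = G_Aut[OF a]
    show "inv\<^bsub>Aut U\<^esub> \<alpha> \<in> G k U"
      unfolding G_iff
    proof (intro conjI allI impI)
      show "inv\<^bsub>Aut U\<^esub> \<alpha> \<in> carrier (Aut U)" using aA by simp
      fix W s assume W: "openin base W" "W \<subseteq> U" and s: "s \<in> carrier (S W)"
      interpret S: ring "S W" by (rule ring_S[OF W(1)])
      let ?t = "(inv\<^bsub>Aut U\<^esub> \<alpha>) W s"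
      note t = Aut_inv_at[OF aA W s]
      have "s \<ominus>\<^bsub>S W\<^esub> ?t \<in> J k W" using G_at[OF a W t(2)] t(1) by simp
      hence "\<ominus>\<^bsub>S W\<^esub> (s \<ominus>\<^bsub>S W\<^esub> ?t) \<in> J k W" using part_uminus[OF W(1)] by (simp add: J_eq)
      moreover have "\<ominus>\<^bsub>S W\<^esub> (s \<ominus>\<^bsub>S W\<^esub> ?t) = ?t \<ominus>\<^bsub>S W\<^esub> s" using s t(2) by (simp add: a_minus_def S.minus_add S.a_comm)
      ultimately show "?t \<ominus>\<^bsub>S W\<^esub> s \<in> J k W" by simp
    qed
    fix \<beta> assume b: "\<beta> \<in> G k U"
    show "\<alpha> \<otimes>\<^bsub>Aut U\<^esub> \<beta> \<in> G k U"
      unfolding G_iff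
    proof (intro conjI allI impI)
      show "\<alpha> \<otimes>\<^bsub>Aut U\<^esub> \<beta> \<in> carrier (Aut U)" using aA G_Aut[OF b] by simp
      fix W s assume W: "openin base W" "W \<subseteq> U" and s: "s \<in> carrier (S W)"
      interpret S: ring "S W" by (rule ring_S[OF W(1)])
      have bs: "\<beta> W s \<in> carrier (S W)" by (rule Aut_closed[OF G_Aut[OF b] W s])
      have abs: "\<alpha> W (\<beta> W s) \<in> carrier (S W)" by (rule Aut_closed[OF aA W bs])
      have "(\<alpha> W (\<beta> W s) \<ominus>\<^bsub>S W\<^esub> \<beta> W s) \<oplus>\<^bsub>S W\<^esub> (\<beta> W s \<ominus>\<^bsub>S W\<^esub> s) \<in> J k W"
        using part_add[OF W(1)] G_at[OF a W bs] G_at[OF b W s] by (simp add: J_eq)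
      moreover have "(\<alpha> W (\<beta> W s) \<ominus>\<^bsub>S W\<^esub> \<beta> W s) \<oplus>\<^bsub>S W\<^esub> (\<beta> W s \<ominus>\<^bsub>S W\<^esub> s) = \<alpha> W (\<beta> W s) \<ominus>\<^bsub>S W\<^esub> s"
        using s bs abs by (simp add: a_minus_def S.a_assoc S.r_neg1)
      ultimately show "(\<alpha> \<otimes>\<^bsub>Aut U\<^esub> \<beta>) W s \<ominus>\<^bsub>S W\<^esub> s \<in> J k W" by (simp add: Aut_mult_at[OF W s])
    qed
  qed
qed

text \<open>With \<open>t = \<alpha>\<inverse> s\<close> one has \<open>\<alpha>\<nu>\<alpha>\<inverse> s - s = \<alpha>(\<nu>t - t)\<close>, and \<open>\<alpha>\<close> maps \<open>J\<^sup>k\<close> to itself.\<close>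

lemma normal_G:
  assumes a: "\<alpha> \<in> G 2 U" and n: "\<nu> \<in> G k U" shows "\<alpha> \<otimes>\<^bsub>Aut U\<^esub> \<nu> \<otimes>\<^bsub>Aut U\<^esub> inv\<^bsub>Aut U\<^esub> \<alpha> \<in> G k U"
  unfolding G_iff
proof (intro conjI allI impI)
  interpret A: group "Aut U" by (rule group_Aut)
  note aA = G_Aut[OF a] and nA = G_Aut[OF n]
  show "\<alpha> \<otimes>\<^bsub>Aut U\<^esub> \<nu> \<otimes>\<^bsub>Aut U\<^esub> inv\<^bsub>Aut U\<^esub> \<alpha> \<in> carrier (Aut U)" using aA nA by simp
  fix W s assume W: "openin base W" "W \<subseteq> U" and s: "s \<in> carrier (S W)"
  define t where "t = (inv\<^bsub>Aut U\<^esub> \<alpha>) W s"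
  have t: "\<alpha> W t = s" "t \<in> carrier (S W)" unfolding t_def by (rule Aut_inv_at[OF aA W s])+
  have "\<alpha> W (\<nu> W t \<ominus>\<^bsub>S W\<^esub> t) \<in> J k W" by (rule G_preserves_J[OF a _ W G_at[OF n W t(2)]]) simp
  moreover have "\<alpha> W (\<nu> W t \<ominus>\<^bsub>S W\<^esub> t) = \<alpha> W (\<nu> W t) \<ominus>\<^bsub>S W\<^esub> s"
    using component_minus[OF W(1) Aut_component[OF aA W] Aut_closed[OF nA W t(2)] t(2)] t(1) by simp
  ultimately show "(\<alpha> \<otimes>\<^bsub>Aut U\<^esub> \<nu> \<otimes>\<^bsub>Aut U\<^esub> inv\<^bsub>Aut U\<^esub> \<alpha>) W s \<ominus>\<^bsub>S W\<^esub> s \<in> J k W"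
    using Aut_mult_at[OF W s] Aut_mult_at[OF W t(2)] by (simp add: t_def)
qed

text \<open>With \<open>a = \<alpha> - 1\<close> and \<open>b = \<beta> - 1\<close> one has \<open>\<alpha>\<beta> - \<beta>\<alpha> = ab - ba\<close>. Here \<open>b\<close> maps into \<open>J\<^sup>k\<close>, which \<open>a\<close> maps into
  \<open>J\<^bsup>j+k-1\<^esup>\<close> by \<open>G_J\<close>, and similarly for \<open>ba\<close>. The commutator at \<open>s\<close> is this difference at \<open>t = (\<beta>\<alpha>)\<inverse> s\<close>.\<close>

lemma commutator_in_G:
  assumes a: "\<alpha> \<in> G j U" and b: "\<beta> \<in> G k U" and jk: "1 \<le> j" "1 \<le> k"
  shows "\<alpha> \<otimes>\<^bsub>Aut U\<^esub> \<beta> \<otimes>\<^bsub>Aut U\<^esub> inv\<^bsub>Aut U\<^esub> (\<beta> \<otimes>\<^bsub>Aut U\<^esub> \<alpha>) \<in> G (j + k - 1) U"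
  unfolding G_iff
proof (intro conjI allI impI)
  interpret A: group "Aut U" by (rule group_Aut)
  note aA = G_Aut[OF a] and bA = G_Aut[OF b]
  have baA: "\<beta> \<otimes>\<^bsub>Aut U\<^esub> \<alpha> \<in> carrier (Aut U)" using aA bA by simp
  show "\<alpha> \<otimes>\<^bsub>Aut U\<^esub> \<beta> \<otimes>\<^bsub>Aut U\<^esub> inv\<^bsub>Aut U\<^esub> (\<beta> \<otimes>\<^bsub>Aut U\<^esub> \<alpha>) \<in> carrier (Aut U)" using aA bA by simp
  fix W s assume W: "openin base W" "W \<subseteq> U" and s: "s \<in> carrier (S W)"
  interpret S: ring "S W" by (rule ring_S[OF W(1)])
  define t where "t = (inv\<^bsub>Aut U\<^esub> (\<beta> \<otimes>\<^bsub>Aut U\<^esub> \<alpha>)) W s"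
  have t: "(\<beta> \<otimes>\<^bsub>Aut U\<^esub> \<alpha>) W t = s" "t \<in> carrier (S W)" unfolding t_def by (rule Aut_inv_at[OF baA W s])+
  have s_eq: "s = \<beta> W (\<alpha> W t)" using t(1) Aut_mult_at[OF W t(2)] by simp
  define d where "d = \<beta> W t \<ominus>\<^bsub>S W\<^esub> t"
  define c where "c = \<alpha> W t \<ominus>\<^bsub>S W\<^esub> t"
  have d: "d \<in> J k W" unfolding d_def by (rule G_at[OF b W t(2)])
  have c: "c \<in> J j W" unfolding c_def by (rule G_at[OF a W t(2)])
  have cl: "\<alpha> W t \<in> carrier (S W)" "\<beta> W t \<in> carrier (S W)" "\<alpha> W (\<beta> W t) \<in> carrier (S W)" "\<beta> W (\<alpha> W t) \<in> carrier (S W)"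
    using Aut_closed[OF aA W] Aut_closed[OF bA W] t(2) by auto
  have "\<alpha> W d \<ominus>\<^bsub>S W\<^esub> d \<in> J (j + k - 1) W" by (rule G_J[OF a jk(1) W d])
  moreover have "\<beta> W c \<ominus>\<^bsub>S W\<^esub> c \<in> J (j + k - 1) W" using G_J[OF b jk(2) W c] by (simp add: add.commute)
  ultimately have "(\<alpha> W d \<ominus>\<^bsub>S W\<^esub> d) \<ominus>\<^bsub>S W\<^esub> (\<beta> W c \<ominus>\<^bsub>S W\<^esub> c) \<in> J (j + k - 1) W"
    using part_minus[OF W(1)] by (simp add: J_eq)
  moreover have "\<alpha> W d = \<alpha> W (\<beta> W t) \<ominus>\<^bsub>S W\<^esub> \<alpha> W t" "\<beta> W c = \<beta> W (\<alpha> W t) \<ominus>\<^bsub>S W\<^esub> \<beta> W t"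
    unfolding d_def c_def using component_minus[OF W(1) Aut_component[OF aA W] cl(2) t(2)]
      component_minus[OF W(1) Aut_component[OF bA W] cl(1) t(2)] by auto
  moreover have "((\<alpha> W (\<beta> W t) \<ominus>\<^bsub>S W\<^esub> \<alpha> W t) \<ominus>\<^bsub>S W\<^esub> (\<beta> W t \<ominus>\<^bsub>S W\<^esub> t)) \<ominus>\<^bsub>S W\<^esub> ((\<beta> W (\<alpha> W t) \<ominus>\<^bsub>S W\<^esub> \<beta> W t) \<ominus>\<^bsub>S W\<^esub> (\<alpha> W t \<ominus>\<^bsub>S W\<^esub> t))
     = \<alpha> W (\<beta> W t) \<ominus>\<^bsub>S W\<^esub> \<beta> W (\<alpha> W t)"
    by (rule S.commutator_differences[OF cl(3,4,1,2) t(2)])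
  ultimately have "\<alpha> W (\<beta> W t) \<ominus>\<^bsub>S W\<^esub> s \<in> J (j + k - 1) W" unfolding d_def[symmetric] c_def[symmetric] s_eq by simp
  thus "(\<alpha> \<otimes>\<^bsub>Aut U\<^esub> \<beta> \<otimes>\<^bsub>Aut U\<^esub> inv\<^bsub>Aut U\<^esub> (\<beta> \<otimes>\<^bsub>Aut U\<^esub> \<alpha>)) W s \<ominus>\<^bsub>S W\<^esub> s \<in> J (j + k - 1) W"
    using Aut_mult_at[OF W s] Aut_mult_at[OF W t(2)] by (simp add: t_def)
qed

subsection \<open>The tower of sheaves\<close>

lemma sec_G: "sec (G_sheaf M k) U = (Aut U)\<lparr>carrier := G k U\<rparr>"
  by (simp add: G_sheaf_def)

lemma mult_G: "monoid.mult (sec (G_sheaf M k) U) = monoid.mult (Aut U)"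
  by (simp add: G_sheaf_def)

lemma group_G: "group (sec (G_sheaf M k) U)"
  by (subst sec_G) (rule subgroup.subgroup_is_group[OF subgroup_G group_Aut])

lemma inv_G: "\<alpha> \<in> G k U \<Longrightarrow> inv\<^bsub>sec (G_sheaf M k) U\<^esub> \<alpha> = inv\<^bsub>Aut U\<^esub> \<alpha>"
  by (subst sec_G) (rule group.m_inv_consistent[OF group_Aut subgroup_G])

lemma rest_G: "rest (G_sheaf M k) V \<alpha> = restrict \<alpha> (opens V)"
  by (simp add: G_sheaf_def aut_sheaf_def)

lemma restrict_Aut:
  assumes a: "\<alpha> \<in> carrier (Aut U)" and V: "V \<subseteq> U" shows "restrict \<alpha> (opens V) \<in> carrier (Aut V)"
proof (rule AutI)
  fix W assume W: "openin base W" "W \<subseteq> V"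
  hence WU: "W \<subseteq> U" using V by blast
  show "component W (restrict \<alpha> (opens V) W)" using W Aut_component[OF a W(1) WU] by (simp add: opens_iff)
  fix W' s assume W': "openin base W'" "W' \<subseteq> W" and s: "s \<in> carrier (S W)"
  thus "restrict \<alpha> (opens V) W' (restrict s W') = restrict (restrict \<alpha> (opens V) W s) W'"
    using W Aut_restrict[OF a W(1) WU W' s] by (auto simp: opens_iff)
qed simp

lemma restrict_G:
  assumes a: "\<alpha> \<in> G k U" and V: "V \<subseteq> U" shows "restrict \<alpha> (opens V) \<in> G k V"
  unfolding G_iff
proof (intro conjI allI impI restrict_Aut[OF G_Aut[OF a] V])
  fix W s assume "openin base W" "W \<subseteq> V" "s \<in> carrier (S W)"
  thus "restrict \<alpha> (opens V) W s \<ominus>\<^bsub>S W\<^esub> s \<in> J k W" using G_at[OF a, of W s] V by (auto simp: opens_iff)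
qed

lemma presheaf_G: "presheaf base (G_sheaf M k)"
proof (rule presheaf.intro)
  fix U assume U: "openin base U"
  show "group (sec (G_sheaf M k) U)" by (rule group_G)
  {
    fix V assume V: "openin base V" "V \<subseteq> U"
    have "restrict (\<alpha> \<otimes>\<^bsub>Aut U\<^esub> \<beta>) (opens V) = restrict \<alpha> (opens V) \<otimes>\<^bsub>Aut V\<^esub> restrict \<beta> (opens V)" for \<alpha> \<beta>
      unfolding Aut_mult using V(2) by (intro extensionalityI[of _ "opens V"]) (auto simp: opens_iff)
    thus "rest (G_sheaf M k) V \<in> hom (sec (G_sheaf M k) U) (sec (G_sheaf M k) V)"
      using restrict_G[OF _ V(2)] by (auto simp: hom_def rest_G mult_G)
  }
  fix \<alpha> assume a: "\<alpha> \<in> G k U"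
  show "rest (G_sheaf M k) U \<alpha> = \<alpha>"
    using G_Aut[OF a] by (simp add: rest_G Aut_iff extensional_restrict)
  fix V W :: "'x set" assume "W \<subseteq> V"
  thus "rest (G_sheaf M k) W (rest (G_sheaf M k) V \<alpha>) = rest (G_sheaf M k) W \<alpha>"
    unfolding rest_G by (intro extensionalityI[of _ "opens W"]) (auto simp: opens_iff)
qed

lemma local_G:
  assumes a: "\<alpha> \<in> carrier (Aut U)"
    and loc: "\<And>x. x \<in> U \<Longrightarrow> \<exists>W. openin base W \<and> x \<in> W \<and> W \<subseteq> U \<and> restrict \<alpha> (opens W) \<in> G k W"
  shows "\<alpha> \<in> G k U"
  unfolding G_iff
proof (intro conjI allI impI a)
  fix W s assume W: "openin base W" "W \<subseteq> U" and s: "s \<in> carrier (S W)"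
  interpret S: ring "S W" by (rule ring_S[OF W(1)])
  have as: "\<alpha> W s \<in> carrier (S W)" by (rule Aut_closed[OF a W s])
  have "(\<alpha> W s \<ominus>\<^bsub>S W\<^esub> s) x \<in> ext_part (fibre M x) {k..}" if x: "x \<in> W" for x
  proof -
    obtain Y where Y: "openin base Y" "x \<in> Y" "Y \<subseteq> U" "restrict \<alpha> (opens Y) \<in> G k Y" using loc x W by blast
    define W' where "W' = W \<inter> Y"
    have W': "openin base W'" "W' \<subseteq> W" "W' \<subseteq> Y" "W' \<subseteq> U" "x \<in> W'" using W Y x by (auto simp: W'_def)
    note s' = sec_restrict[OF s W'(1,2)]
    have "\<alpha> W' (restrict s W') \<ominus>\<^bsub>S W'\<^esub> restrict s W' \<in> J k W'"
      using G_at[OF Y(4) W'(1,3) s'] W'(1,3) by (simp add: opens_iff)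
    hence "(\<alpha> W' (restrict s W') \<ominus>\<^bsub>S W'\<^esub> restrict s W') x \<in> ext_part (fibre M x) {k..}" using W'(5) by (simp add: J_eq part_iff)
    moreover have "\<alpha> W' (restrict s W') = restrict (\<alpha> W s) W'" by (rule Aut_restrict[OF a W W'(1,2) s])
    ultimately show ?thesis
      using S_minus_at[OF W'(1) Aut_closed[OF a W'(1,4) s'] s' W'(5)] S_minus_at[OF W(1) as s x] W'(5) by simp
  qed
  moreover have "\<alpha> W s \<ominus>\<^bsub>S W\<^esub> s \<in> carrier (S W)" using s as by simp
  ultimately show "\<alpha> W s \<ominus>\<^bsub>S W\<^esub> s \<in> J k W" by (simp add: J_eq part_iff)
qed

lemma normal_subsheaf_G:
  assumes k: "2 \<le> k" shows "normal_subsheaf base (G_sheaf M 2) (G_sheaf M k)"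
proof (intro normal_subsheaf.intro normal_subsheaf_axioms.intro)
  show "presheaf base (G_sheaf M 2)" by (rule presheaf_G)
  show "rest (G_sheaf M k) = rest (G_sheaf M 2)" by (simp add: G_sheaf_def)
  fix U
  show "sec (G_sheaf M k) U = sec (G_sheaf M 2) U\<lparr>carrier := G k U\<rparr>" by (simp add: G_sheaf_def)
  {
    assume "openin base U"
    interpret A: group "Aut U" by (rule group_Aut)
    interpret G2: group "sec (G_sheaf M 2) U" by (rule group_G)
    have "subgroup (G k U) (sec (G_sheaf M 2) U)"
      using A.subgroup_incl[OF subgroup_G subgroup_G G_mono[OF k]] by (simp only: sec_G[symmetric])
    moreover have "\<alpha> \<otimes>\<^bsub>sec (G_sheaf M 2) U\<^esub> \<nu> \<otimes>\<^bsub>sec (G_sheaf M 2) U\<^esub> inv\<^bsub>sec (G_sheaf M 2) U\<^esub> \<alpha> \<in> G k U"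
      if "\<alpha> \<in> G 2 U" "\<nu> \<in> G k U" for \<alpha> \<nu>
      unfolding mult_G inv_G[OF that(1)] by (rule normal_G[OF that])
    ultimately show "G k U \<lhd> sec (G_sheaf M 2) U" by (rule G2.normal_invI)
  }
  fix \<alpha>
  show "rest (G_sheaf M 2) V \<alpha> \<in> G k V" if "\<alpha> \<in> G k U" "openin base U" "openin base V" "V \<subseteq> U" for V
    using restrict_G[OF that(1,4)] by (simp add: rest_G)
  show "\<alpha> \<in> G k U" if a: "\<alpha> \<in> G 2 U" "openin base U"
    and loc: "\<And>x. x \<in> U \<Longrightarrow> \<exists>W. openin base W \<and> x \<in> W \<and> W \<subseteq> U \<and> rest (G_sheaf M 2) W \<alpha> \<in> G k W"
    by (rule local_G[OF G_Aut[OF a(1)] loc[unfolded rest_G]])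
qed

text \<open>For \<open>j \<ge> 2\<close> the commutator estimate gives \<open>[G\<^sub>j, G\<^sub>k] \<subseteq> G\<^bsub>k+1\<^esub>\<close>, which is the centrality in the tower.\<close>

theorem obstruction_tower_G: "obstruction_tower M"
proof (rule obstruction_tower.intro)
  fix j k :: nat assume "2 \<le> k"
  thus "normal_subsheaf base (G_sheaf M 2) (G_sheaf M k)" by (rule normal_subsheaf_G)
next
  fix j k :: nat and U assume "j \<le> k"
  thus "G k U \<subseteq> G j U" by (rule G_mono)
next
  fix j k :: nat and U \<alpha> \<beta> assume j: "2 \<le> j" "j \<le> k" and a: "\<alpha> \<in> G j U" and b: "\<beta> \<in> G k U"
  have a2: "\<alpha> \<in> G 2 U" "\<beta> \<in> G 2 U" using G_mono[of 2 j U] G_mono[of 2 k U] a b j by auto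
  interpret G2: group "sec (G_sheaf M 2) U" by (rule group_G)
  have "inv\<^bsub>sec (G_sheaf M 2) U\<^esub> (\<beta> \<otimes>\<^bsub>Aut U\<^esub> \<alpha>) = inv\<^bsub>Aut U\<^esub> (\<beta> \<otimes>\<^bsub>Aut U\<^esub> \<alpha>)"
    using G2.m_closed[OF a2(2,1)] by (intro inv_G) (simp add: mult_G)
  moreover have "\<alpha> \<otimes>\<^bsub>Aut U\<^esub> \<beta> \<otimes>\<^bsub>Aut U\<^esub> inv\<^bsub>Aut U\<^esub> (\<beta> \<otimes>\<^bsub>Aut U\<^esub> \<alpha>) \<in> G (k + 1) U"
  proof -
    have "G (j + k - 1) U \<subseteq> G (k + 1) U" using j by (intro G_mono) simp
    moreover have "1 \<le> j" "1 \<le> k" using j by simp_all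
    ultimately show ?thesis by (rule subsetD[OF _ commutator_in_G[OF a b]])
  qed
  ultimately show "\<alpha> \<otimes>\<^bsub>sec (G_sheaf M 2) U\<^esub> \<beta> \<otimes>\<^bsub>sec (G_sheaf M 2) U\<^esub> inv\<^bsub>sec (G_sheaf M 2) U\<^esub> (\<beta> \<otimes>\<^bsub>sec (G_sheaf M 2) U\<^esub> \<alpha>)
    \<in> G (k + 1) U" by (simp only: mult_G)
qed

end

theorem theorem5p16:
  fixes M :: "('x, 'v) model_data"
    and \<theta> :: "int \<Rightarrow> ('x, ('x, 'v) quot_section) cochain1 set"
  assumes "model M"
    and "carrier (obs_cohomology1 M) = {\<one>\<^bsub>obs_cohomology1 M\<^esub>}"
    and "\<theta> \<in> carrier (obs_space M)" and "homogeneous M \<theta>"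
  shows "(\<exists>j z. supermanifold_atlas M j z \<and> obstruction M j z = \<theta>)
           \<longleftrightarrow> boundary M \<theta> = \<one>\<^bsub>obs_space2 M\<^esub>"
proof -
  interpret complex_model M using assms(1) by (rule complex_model.intro)
  show ?thesis using assms(2-4) by (rule obstruction_tower.obstruction_iff_boundary_one[OF obstruction_tower_G])
qed

end
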